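(* Let $\boldsymbol\mu=(k_0,1^n)$ be a (possibly not Eve) composition of $k_0+n$, i.e. $k_0\geq 0$ followed by $n$ ones. Then $$\Lambda_{\boldsymbol\mu}=\bigcup_{a\in\mathrm{supp}(k_0)}\{a-n,a-n+2,\dots,a+n\}\cap\mathbb N_0$$ and, for $m\in\Lambda_{\boldsymbol\mu}$, $$\dim\Delta_{\boldsymbol\mu}(m)=\sum_{a\in\mathrm{supp}(k_0)}\binom{n}{(n+a-m)/2}-\binom{n}{(n-a-m-2)/2},$$ the sum being over both terms, with binomial coefficients $\binom{n}{j}$ taken to be $0$ unless $j$ is an integer with $0\le j\le n$.
   Context: Base ring. $K$ is an integral domain with a distinguished element $\delta$. Quantum numbers are $[0]=0$, $[1]=1$, $[n+1]=\delta[n]-[n-1]$. $\ell\ge 2$ is the least positive integer with $[\ell]=0$ in $K$ ($\ell=\infty$ if there is none), and $p$ is the characteristic of $K$ ($p=\infty$ in characteristic zero). Dimensions of $K$-modules mean ranks. $\mathbb N_0=\{0,1,2,\dots\}$. Digits. $p^{(0)}=1$, $p^{(i)}=\ell p^{i-1}$ for $i\ge1$. Each integer $N\ge 1$ is uniquely $N=\sum_{i=0}^{j}N_ip^{(i)}$ with $0\le N_0<\ell$, $0\le N_i<p$ for $i>0$, $N_j\ne0$. For $n\ge0$ with $n+1=\sum_{i=0}^{j}n_ip^{(i)}$ in this form, $\mathrm{supp}(n)=\{n_jp^{(j)}\pm n_{j-1}p^{(j-1)}\pm\cdots\pm n_0p^{(0)}-1\}$. $n$ is Eve if $n+1$ has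 exactly one nonzero digit; a composition is Eve if all its parts are. Temperley-Lieb category. Objects $\underline n$, $n\ge0$; morphisms $\underline n\to\underline m$ are linear combinations of planar (crossingless) pairings ("diagrams") of $n$ source and $m$ target points. $xy$ denotes concatenation with $x$ on the left, closed loops being replaced by $\delta$; $\otimes$ is juxtaposition (first factor on top); $\iota$ is reflection exchanging source and target. $\mathrm{TL}_n=\mathrm{End}(\underline n)$. The through degree of a diagram is its number of source-to-target strands; a diagram $\underline n\to\underline m$ is monic if it has through degree $m$. Idempotents. Over $\mathbb Q(X)$ (loop value $X$), $\mathrm{JW}_n$ is the Jones-Wenzl idempotent: the unique nonzero idempotent in $\mathrm{TL}_n$ killed by all simple cups and caps. Let $n+1=\sum_{i=0}^jn_ip^{(i)}$, let $S\subseteq\{0,\dots,j-1\}$ consist of indices of nonzero digits, and $m=n-2\sum_{i\in S}n_ip^{(i)}$ (such $m$ run over $\mathrm{supp}(n)$ bijectively). Put $\tilde d_j=\mathrm{JW}_{n_jp^{(j)}-1}$ and, for $i=j-1,\dots,0$, with $c=n_ip^{(i)}$ and $\underline{w}$ the target of $\tilde d_{i+1}$: $\tilde d_i=(\tilde d_{i+1}\otimes \mathrm{id}_c)\,\mathrm{JW}_{w+c}$ if $i\notin S$, and $\tilde d_i=(\tilde d_{i+1}\otimes\mathrm{id}_c)(\mathrm{id}_{w-c}\otimes \mathrm{cap}_c)\mathrm{JW}_{w-c}$ if $i\in S$, where $\mathrm{cap}_c:\underline{2c}\to\underline0$ is $c$ nested arcs. Set $\overline d_n^m=\tilde d_0:\underline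 n\to\underline m$, $\overline u_n^m=\iota\overline d_n^m$, and define $\lambda_n^m\in\mathbb Q(X)$ by $\overline u_n^m\overline d_n^m=(\lambda_n^m)^{-1}\mathrm{JW}_m$. It is known that all coefficients of $\sum_{m\in\mathrm{supp}(n)}\lambda_n^m\overline d_n^m\overline u_n^m$ lie in $\mathbb Z[X]_{\mathfrak p}$, $\mathfrak p=\ker(\mathbb Z[X]\to K, X\mapsto\delta)$; its specialisation at $X=\delta$ is the $(\ell,p)$-Jones-Wenzl idempotent $e^{n}$ (assumed to have coefficients in $K$; automatic if $K$ is a field). Algebra and cell modules. For a composition $\boldsymbol\mu=(\mu_1,\dots,\mu_r)$ of $N$ (tuple of non-negative integers with sum $N$): $e^{\boldsymbol\mu}=e^{\mu_1}\otimes\cdots\otimes e^{\mu_r}$, $\mathrm{TL}_{\boldsymbol\mu}=e^{\boldsymbol\mu}\,\mathrm{TL}_N\,e^{\boldsymbol\mu}$. $\Delta_N(m)$ is the left $\mathrm{TL}_N$-module with basis the monic diagrams $\underline N\to\underline m$, acted on by concatenation modulo morphisms of through degree $<m$. $\Delta_{\boldsymbol\mu}(m)=e^{\boldsymbol\mu}\Delta_N(m)$ is the cell module of $\mathrm{TL}_{\boldsymbol\mu}$; $\Lambda_{\boldsymbol\mu}=\{m:\Delta_{\boldsymbol\mu}(m)\ne0\}$. *)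

theory Defs
  imports
    "HOL-Library.Poly_Mapping"
    "HOL-Library.Disjoint_Sets"
    "HOL-Library.Extended_Nat"
    "HOL-Computational_Algebra.Computational_Algebra"
begin

subsection \<open>Quantum numbers and digits\<close>

fun qnum :: "'a::idom \<Rightarrow> nat \<Rightarrow> 'a" where
  "qnum \<delta> 0 = 0"
| "qnum \<delta> (Suc 0) = 1"
| "qnum \<delta> (Suc (Suc n)) = \<delta> * qnum \<delta> (Suc n) - qnum \<delta> n"

text \<open>The infimum of the empty set is \<open>\<infinity>\<close>; since \<open>[1] = 1 \<noteq> 0\<close>, the value is always at least 2.\<close>

definition ell :: "'a::idom \<Rightarrow> enat" where
  "ell \<delta> = (INF n \<in> {n. 1 \<le> n \<and> qnum \<delta> n = 0}. enat n)"

definition pchar :: "'a::idom itself \<Rightarrow> enat" where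
  "pchar _ = (if CHAR('a) = 0 then \<infinity> else enat CHAR('a))"

definition ppow :: "'a::idom \<Rightarrow> nat \<Rightarrow> enat" where
  "ppow \<delta> i = (if i = 0 then 1 else ell \<delta> * pchar TYPE('a) ^ (i - 1))"

text \<open>Least significant digit first.  In \<^typ>\<open>enat\<close> we have \<open>0 * \<infinity> = 0\<close> and
  \<open>k * \<infinity> = \<infinity>\<close> for \<open>k \<noteq> 0\<close>, so infinite place values can only carry the digit 0, and
  (the last digit being nonzero) every place value that occurs in the list is finite.\<close>

definition digits :: "'a::idom \<Rightarrow> nat \<Rightarrow> nat list" where
  "digits \<delta> N = (THE ds. ds \<noteq> [] \<and> last ds \<noteq> 0
     \<and> (\<forall>i<length ds. enat (ds ! i) < (if i = 0 then ell \<delta> else pchar TYPE('a)))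
     \<and> enat N = (\<Sum>i<length ds. enat (ds ! i) * ppow \<delta> i))"

text \<open>With \<open>n + 1 = (\<Sum>i\<le>j. n\<^sub>i p\<^bsup>(i)\<^esup>)\<close>: \<open>top_index \<delta> n\<close> is \<open>j\<close> and \<open>digit_term \<delta> n i\<close> is
  \<open>n\<^sub>i p\<^bsup>(i)\<^esup>\<close>.\<close>

definition top_index :: "'a::idom \<Rightarrow> nat \<Rightarrow> nat" where
  "top_index \<delta> n = length (digits \<delta> (n + 1)) - 1"

definition digit_term :: "'a::idom \<Rightarrow> nat \<Rightarrow> nat \<Rightarrow> nat" where
  "digit_term \<delta> n i = digits \<delta> (n + 1) ! i * the_enat (ppow \<delta> i)"

definition supp :: "'a::idom \<Rightarrow> nat \<Rightarrow> int set" where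
  "supp \<delta> n =
    {int (digit_term \<delta> n (top_index \<delta> n))
       + (\<Sum>i<top_index \<delta> n. s i * int (digit_term \<delta> n i)) - 1 | s.
     \<forall>i<top_index \<delta> n. s i \<in> {1, - 1}}"

subsection \<open>Planar diagrams\<close>

text \<open>\<open>Inl i\<close> is the \<open>i\<close>-th source point and \<open>Inr j\<close> the \<open>j\<close>-th target point, both numbered
  from the top starting at 0.  A diagram is the set of its strands, each strand being the
  two-element set of its end points.\<close>

type_synonym diagram = "(nat + nat) set set"

text \<open>Position on the boundary of the rectangle: down the source side, then up the target side.\<close>

fun boundary_pos :: "nat \<Rightarrow> nat \<Rightarrow> nat + nat \<Rightarrow> nat" where
  "boundary_pos n m (Inl i) = i"
| "boundary_pos n m (Inr j) = n + (m - 1 - j)"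

definition diagrams :: "nat \<Rightarrow> nat \<Rightarrow> diagram set" where
  "diagrams n m = {D. partition_on ({..<n} <+> {..<m}) D \<and> (\<forall>B\<in>D. card B = 2) \<and>
     \<not> (\<exists>a b c d. {a, b} \<in> D \<and> {c, d} \<in> D \<and>
          boundary_pos n m a < boundary_pos n m c \<and>
          boundary_pos n m c < boundary_pos n m b \<and>
          boundary_pos n m b < boundary_pos n m d)}"

definition through_degree :: "diagram \<Rightarrow> nat" where
  "through_degree D = card {B \<in> D. \<exists>i j. B = {Inl i, Inr j}}"

definition monic_diagrams :: "nat \<Rightarrow> nat \<Rightarrow> diagram set" where
  "monic_diagrams n m = {D \<in> diagrams n m. through_degree D = m}"

text \<open>Gluing \<open>D\<close> (left) and \<open>E\<close> (right): sources of \<open>D\<close> become \<open>Inl i\<close>, the identified middle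
  points \<open>Inr (Inl k)\<close>, and targets of \<open>E\<close> become \<open>Inr (Inr j)\<close>.  The components that meet the
  outer points are the strands of the concatenation, the remaining ones are closed loops.\<close>

definition glue_edges :: "diagram \<Rightarrow> diagram \<Rightarrow> (nat + nat + nat) set set" where
  "glue_edges D E = (`) (map_sum id Inl) ` D \<union> (`) Inr ` E"

definition glue_components :: "diagram \<Rightarrow> diagram \<Rightarrow> (nat + nat + nat) set set" where
  "glue_components D E =
     \<Union> (glue_edges D E) // {(a, b). \<exists>B \<in> glue_edges D E. a \<in> B \<and> b \<in> B}\<^sup>*"

definition outer_part :: "(nat + nat + nat) set \<Rightarrow> (nat + nat) set" where
  "outer_part C = map_sum id Inr -` C"

definition diag_comp :: "diagram \<Rightarrow> diagram \<Rightarrow> diagram" where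
  "diag_comp D E = outer_part ` glue_components D E - {{}}"

definition diag_loops :: "diagram \<Rightarrow> diagram \<Rightarrow> nat" where
  "diag_loops D E = card {C \<in> glue_components D E. outer_part C = {}}"

text \<open>The second factor is moved below the source and target points of the first one.\<close>

definition diag_tensor :: "diagram \<Rightarrow> diagram \<Rightarrow> diagram" where
  "diag_tensor D E =
     D \<union> (`) (map_sum ((+) (card (Inl -` \<Union> D))) ((+) (card (Inr -` \<Union> D)))) ` E"

definition diag_flip :: "diagram \<Rightarrow> diagram" where
  "diag_flip D = (`) (case_sum Inr Inl) ` D"

definition diag_id :: "nat \<Rightarrow> diagram" where
  "diag_id n = {{Inl i, Inr i} | i. i < n}"

definition diag_cap :: "nat \<Rightarrow> diagram" where
  "diag_cap c = {{Inl i, Inl (2 * c - 1 - i)} | i. i < c}"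

subsection \<open>The Temperley-Lieb category\<close>

type_synonym 'a morphism = "diagram \<Rightarrow>\<^sub>0 'a"

definition tl_hom :: "nat \<Rightarrow> nat \<Rightarrow> 'a::idom morphism set" where
  "tl_hom n m = {x. Poly_Mapping.keys x \<subseteq> diagrams n m}"

definition tl_scale :: "'a::idom \<Rightarrow> 'a morphism \<Rightarrow> 'a morphism" where
  "tl_scale c x = Poly_Mapping.map ((*) c) x"

definition tl_comp :: "'a::idom \<Rightarrow> 'a morphism \<Rightarrow> 'a morphism \<Rightarrow> 'a morphism" where
  "tl_comp \<delta> x y = (\<Sum>D\<in>Poly_Mapping.keys x. \<Sum>E\<in>Poly_Mapping.keys y.
     Poly_Mapping.single (diag_comp D E)
       (Poly_Mapping.lookup x D * Poly_Mapping.lookup y E * \<delta> ^ diag_loops D E))"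

definition tl_tensor :: "'a::idom morphism \<Rightarrow> 'a morphism \<Rightarrow> 'a morphism" where
  "tl_tensor x y = (\<Sum>D\<in>Poly_Mapping.keys x. \<Sum>E\<in>Poly_Mapping.keys y.
     Poly_Mapping.single (diag_tensor D E) (Poly_Mapping.lookup x D * Poly_Mapping.lookup y E))"

definition tl_flip :: "'a::idom morphism \<Rightarrow> 'a morphism" where
  "tl_flip x = (\<Sum>D\<in>Poly_Mapping.keys x.
     Poly_Mapping.single (diag_flip D) (Poly_Mapping.lookup x D))"

definition tl_id :: "nat \<Rightarrow> 'a::idom morphism" where
  "tl_id n = Poly_Mapping.single (diag_id n) 1"

definition tl_cap :: "nat \<Rightarrow> 'a::idom morphism" where
  "tl_cap c = Poly_Mapping.single (diag_cap c) 1"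

definition simple_cap :: "nat \<Rightarrow> nat \<Rightarrow> 'a::idom morphism" where
  "simple_cap n i = tl_tensor (tl_tensor (tl_id i) (tl_cap 1)) (tl_id (n - 2 - i))"

definition simple_cup :: "nat \<Rightarrow> nat \<Rightarrow> 'a::idom morphism" where
  "simple_cup n i = tl_flip (simple_cap n i)"

lemma tl_scale_lookup: "Poly_Mapping.lookup (tl_scale c x) D = c * Poly_Mapping.lookup x D"
  by (simp add: tl_scale_def Poly_Mapping.map.rep_eq when_def)

lemma module_tl_scale: "module (tl_scale :: 'a::idom \<Rightarrow> 'a morphism \<Rightarrow> 'a morphism)"
  by unfold_locales
    (auto intro!: poly_mapping_eqI simp: tl_scale_lookup lookup_add algebra_simps)

subsection \<open>Jones-Wenzl idempotents\<close>

text \<open>\<open>\<rat>(X)\<close> is realised as the fraction field of \<open>\<int>[X]\<close>.\<close>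

type_synonym ratfun = "int poly fract"

definition loopX :: ratfun where
  "loopX = Fract [:0, 1:] 1"

definition is_JW :: "nat \<Rightarrow> ratfun morphism \<Rightarrow> bool" where
  "is_JW n x \<longleftrightarrow> x \<in> tl_hom n n \<and> x \<noteq> 0 \<and> tl_comp loopX x x = x \<and>
     (\<forall>i. i + 2 \<le> n \<longrightarrow>
        tl_comp loopX x (simple_cap n i) = 0 \<and> tl_comp loopX (simple_cup n i) x = 0)"

definition JW :: "nat \<Rightarrow> ratfun morphism" where
  "JW n = (THE x. is_JW n x)"

text \<open>\<open>down_step c j S k\<close> is the partial morphism obtained after processing the digits
  \<open>j, \<dots>, j - k\<close> (with digit terms \<open>c i = n\<^sub>i p\<^bsup>(i)\<^esup>\<close>), paired with its target \<open>w\<close>.\<close>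

primrec down_step :: "(nat \<Rightarrow> nat) \<Rightarrow> nat \<Rightarrow> nat set \<Rightarrow> nat \<Rightarrow> nat \<times> ratfun morphism" where
  "down_step c j S 0 = (c j - 1, JW (c j - 1))"
| "down_step c j S (Suc k) =
    (let (w, d) = down_step c j S k; i = j - Suc k; x = tl_tensor d (tl_id (c i)) in
     if i \<in> S then
       (w - c i,
        tl_comp loopX (tl_comp loopX x (tl_tensor (tl_id (w - c i)) (tl_cap (c i)))) (JW (w - c i)))
     else (w + c i, tl_comp loopX x (JW (w + c i))))"

definition down_set :: "'a::idom \<Rightarrow> nat \<Rightarrow> nat \<Rightarrow> nat set" where
  "down_set \<delta> n m = (THE S. S \<subseteq> {i. i < top_index \<delta> n \<and> digits \<delta> (n + 1) ! i \<noteq> 0} \<and>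
     int m = int n - 2 * (\<Sum>i\<in>S. int (digit_term \<delta> n i)))"

definition dbar :: "'a::idom \<Rightarrow> nat \<Rightarrow> nat \<Rightarrow> ratfun morphism" where
  "dbar \<delta> n m =
     snd (down_step (digit_term \<delta> n) (top_index \<delta> n) (down_set \<delta> n m) (top_index \<delta> n))"

definition ubar :: "'a::idom \<Rightarrow> nat \<Rightarrow> nat \<Rightarrow> ratfun morphism" where
  "ubar \<delta> n m = tl_flip (dbar \<delta> n m)"

definition lam :: "'a::idom \<Rightarrow> nat \<Rightarrow> nat \<Rightarrow> ratfun" where
  "lam \<delta> n m = (THE c. c \<noteq> 0 \<and>
     tl_comp loopX (ubar \<delta> n m) (dbar \<delta> n m) = tl_scale (inverse c) (JW m))"

definition generic_ljw :: "'a::idom \<Rightarrow> nat \<Rightarrow> ratfun morphism" where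
  "generic_ljw \<delta> n = (\<Sum>m | int m \<in> supp \<delta> n.
     tl_scale (lam \<delta> n m) (tl_comp loopX (dbar \<delta> n m) (ubar \<delta> n m)))"

definition eval_int_poly :: "'a::idom \<Rightarrow> int poly \<Rightarrow> 'a" where
  "eval_int_poly \<delta> f = poly (map_poly of_int f) \<delta>"

text \<open>\<open>q\<close> lies in the localisation of \<open>\<int>[X]\<close> at the kernel of \<open>X \<mapsto> \<delta>\<close>, and its value at
  \<open>X = \<delta>\<close>, a priori an element of the fraction field of \<open>K\<close>, is the element \<open>a\<close> of \<open>K\<close>.\<close>

definition specialises_to :: "'a::idom \<Rightarrow> ratfun \<Rightarrow> 'a \<Rightarrow> bool" where
  "specialises_to \<delta> q a \<longleftrightarrow> (\<exists>f g. q = Fract f g \<and> eval_int_poly \<delta> g \<noteq> 0 \<and>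
     eval_int_poly \<delta> f = a * eval_int_poly \<delta> g)"

definition is_ljw :: "'a::idom \<Rightarrow> nat \<Rightarrow> 'a morphism \<Rightarrow> bool" where
  "is_ljw \<delta> n x \<longleftrightarrow>
     (\<forall>D. specialises_to \<delta> (Poly_Mapping.lookup (generic_ljw \<delta> n) D) (Poly_Mapping.lookup x D))"

text \<open>The standing assumption that the \<open>(\<ell>,p)\<close>-Jones-Wenzl idempotent has coefficients in \<open>K\<close>.\<close>

definition ljw_defined :: "'a::idom \<Rightarrow> nat \<Rightarrow> bool" where
  "ljw_defined \<delta> n \<longleftrightarrow> (\<exists>x. is_ljw \<delta> n x)"

definition ljw :: "'a::idom \<Rightarrow> nat \<Rightarrow> 'a morphism" where
  "ljw \<delta> n = (THE x. is_ljw \<delta> n x)"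

definition ljw_tensor :: "'a::idom \<Rightarrow> nat list \<Rightarrow> 'a morphism" where
  "ljw_tensor \<delta> \<mu> = foldr (\<lambda>k x. tl_tensor (ljw \<delta> k) x) \<mu> (tl_id 0)"

subsection \<open>Cell modules\<close>

definition cell_full :: "nat \<Rightarrow> nat \<Rightarrow> 'a::idom morphism set" where
  "cell_full N m = {v. Poly_Mapping.keys v \<subseteq> monic_diagrams N m}"

text \<open>Concatenation modulo smaller through degree: in the basis of monic diagrams, the
  diagrams of through degree less than \<open>m\<close> are dropped.\<close>

definition cell_act :: "'a::idom \<Rightarrow> nat \<Rightarrow> 'a morphism \<Rightarrow> 'a morphism \<Rightarrow> 'a morphism" where
  "cell_act \<delta> m x v = (\<Sum>D | D \<in> Poly_Mapping.keys (tl_comp \<delta> x v) \<and> through_degree D = m.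
     Poly_Mapping.single D (Poly_Mapping.lookup (tl_comp \<delta> x v) D))"

definition cell_module :: "'a::idom \<Rightarrow> nat list \<Rightarrow> nat \<Rightarrow> 'a morphism set" where
  "cell_module \<delta> \<mu> m = cell_act \<delta> m (ljw_tensor \<delta> \<mu>) ` cell_full (sum_list \<mu>) m"

definition cell_index :: "'a::idom \<Rightarrow> nat list \<Rightarrow> nat set" where
  "cell_index \<delta> \<mu> = {m. cell_module \<delta> \<mu> m \<noteq> {0}}"

text \<open>The rank of a submodule of a finite free module over a domain is the maximal number of
  linearly independent elements (cell modules need not be free over \<open>K\<close>).\<close>

definition tl_rank :: "'a::idom morphism set \<Rightarrow> nat" where
  "tl_rank V = (GREATEST r. \<exists>B. B \<subseteq> V \<and> finite B \<and> card B = r \<and> \<not> module.dependent tl_scale B)"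

definition binom :: "nat \<Rightarrow> rat \<Rightarrow> nat" where
  "binom n q = (if q \<in> \<int> \<and> 0 \<le> q \<and> q \<le> of_nat n then n choose nat \<lfloor>q\<rfloor> else 0)"

end

theory Submission
  imports Defs
begin

text \<open>Over the generic field \<open>\<rat>(X)\<close> the idempotent \<open>e\<^sup>k\<close> is a sum of orthogonal idempotents
  \<open>\<lambda>\<^sub>a d\<^sub>a u\<^sub>a\<close>, one for each \<open>a\<close> in the support of \<open>k\<close>, and \<open>u\<^sub>a d\<^sub>a\<close> is a nonzero multiple of
  \<open>JW\<^sub>a\<close>.  Hence the image of \<open>e\<^sup>k \<otimes> id\<^sub>n\<close> on the generic cell module has a basis of elements
  \<open>(d\<^sub>a \<otimes> id\<^sub>n) D\<close>, where \<open>D\<close> runs over the monic diagrams without an arc among the first \<open>a\<close>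
  source points.  These are counted by lattice paths in the half-line, hence by the reflection
  principle.  Ranks of matrices over a local domain do not increase under reduction to the residue
  field; as the generic ranks of an idempotent and of its complement add up to the size of the
  matrix, both ranks are preserved by the specialisation \<open>X \<mapsto> \<delta>\<close>.\<close>

text \<open>The summands of \<open>generic_ljw\<close> and the scalars \<open>lam\<close> may have
  poles at X = \<delta>, so the generic basis itself cannot be specialised; only the whole sum, and
  hence only its rank, can be followed to \<delta>. Semicontinuity alone bounds that rank from
  above. The matching lower bound is the remark that rank A + rank (1 - A) is at least the size of
  any square matrix A, applied to the specialised matrix. The second obstacle is topological.
  Concatenation is given by connected components of a graph, with no isotopy to appeal to.
  Identities of diagrams and loop numbers are therefore tested on colourings of the points, and
  planarity of a composite is obtained by splitting a diagram into single caps and cups, each of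
  which inserts or contracts two neighbouring boundary points. Since \<open>K\<close> is only a
  domain, ranks are computed in its fraction field, which also supplies the inverses needed for
  elimination.\<close>

section \<open>Diagrams as set partitions and their two-colourings\<close>

definition pdiag :: "nat \<Rightarrow> nat \<Rightarrow> diagram \<Rightarrow> bool" where
  "pdiag n m D \<longleftrightarrow> partition_on ({..<n} <+> {..<m}) D"

text \<open>Two-colourings of the points that are constant on blocks; \<open>s\<close> and
  \<open>t\<close> hold the points of one colour on either side. The colour calculus asks neither
  for blocks of size two nor for planarity; both enter only with \<open>diagrams\<close>.\<close>

definition sat :: "diagram \<Rightarrow> nat set \<Rightarrow> nat set \<Rightarrow> bool" where
  "sat D s t \<longleftrightarrow> (\<forall>B\<in>D. \<forall>x\<in>B. \<forall>y\<in>B. x \<in> s <+> t \<longrightarrow> y \<in> s <+> t)"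

lemma in_Plus_iff [simp]: "Inl a \<in> A <+> B \<longleftrightarrow> a \<in> A" "Inr b \<in> A <+> B \<longleftrightarrow> b \<in> B"
  by auto

lemma pdiag_sub: "pdiag n m D \<Longrightarrow> B \<in> D \<Longrightarrow> B \<subseteq> {..<n} <+> {..<m}"
  unfolding pdiag_def partition_on_def by blast

lemma pdiag_cover: "pdiag n m D \<Longrightarrow> x \<in> {..<n} <+> {..<m} \<Longrightarrow> \<exists>B\<in>D. x \<in> B"
  unfolding pdiag_def partition_on_def by blast

lemma pdiag_unique: "pdiag n m D \<Longrightarrow> B \<in> D \<Longrightarrow> C \<in> D \<Longrightarrow> x \<in> B \<Longrightarrow> x \<in> C \<Longrightarrow> B = C"
  unfolding pdiag_def partition_on_def disjoint_def by (metis disjoint_iff)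

lemma pdiag_nonempty: "pdiag n m D \<Longrightarrow> B \<in> D \<Longrightarrow> \<exists>x. x \<in> B"
  by (auto simp: pdiag_def partition_on_def)

lemma sat_restrict:
  assumes "pdiag n m D"
  shows "sat D (s \<inter> {..<n}) (t \<inter> {..<m}) \<longleftrightarrow> sat D s t"
proof -
  have "x \<in> (s \<inter> {..<n}) <+> (t \<inter> {..<m}) \<longleftrightarrow> x \<in> s <+> t" if "B \<in> D" "x \<in> B" for B x
    using pdiag_sub[OF assms that(1)] that(2) by (cases x) auto
  then show ?thesis unfolding sat_def by metis
qed

lemma sat_empty [simp]: "sat D {} {}"
  by (auto simp: sat_def)

text \<open>The block \<open>B\<close>, read as the set of points of one colour, is saturated for
  \<open>D\<close>, hence for \<open>E\<close>, so it swallows the \<open>E\<close>-block of each of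
  its points.\<close>

lemma sat_block_le:
  assumes D: "pdiag n m D" and E: "pdiag n m E"
    and le: "\<And>s t. s \<subseteq> {..<n} \<Longrightarrow> t \<subseteq> {..<m} \<Longrightarrow> sat D s t \<Longrightarrow> sat E s t"
    and B: "B \<in> D" "x \<in> B" and C: "C \<in> E" "x \<in> C"
  shows "C \<subseteq> B"
proof -
  have Bsub: "B \<subseteq> {..<n} <+> {..<m}" by (rule pdiag_sub[OF D B(1)])
  have Beq: "Inl -` B <+> Inr -` B = B"
    by (auto simp: Plus_def image_iff) (metis obj_sumE)
  have "sat D (Inl -` B) (Inr -` B)"
    unfolding sat_def Beq using pdiag_unique[OF D] B by metis
  moreover have "Inl -` B \<subseteq> {..<n}" "Inr -` B \<subseteq> {..<m}" using Bsub by auto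
  ultimately have "sat E (Inl -` B) (Inr -` B)" by (intro le)
  then show ?thesis unfolding sat_def Beq using B C by blast
qed

text \<open>Blocks are the minimal nonempty saturated sets, so the colourings determine the
  partition. This is the criterion by which diagrams are compared below.\<close>

lemma sat_inject:
  assumes D: "pdiag n m D" and E: "pdiag n m E"
    and eq: "\<And>s t. s \<subseteq> {..<n} \<Longrightarrow> t \<subseteq> {..<m} \<Longrightarrow> sat D s t \<longleftrightarrow> sat E s t"
  shows "D = E"
proof -
  have *: "D \<subseteq> E" if D: "pdiag n m D" and E: "pdiag n m E"
    and eq: "\<And>s t. s \<subseteq> {..<n} \<Longrightarrow> t \<subseteq> {..<m} \<Longrightarrow> sat D s t \<longleftrightarrow> sat E s t" for D E
  proof
    fix B assume B: "B \<in> D"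
    obtain x where x: "x \<in> B" using pdiag_nonempty[OF D B] by blast
    obtain C where C: "C \<in> E" "x \<in> C"
      using pdiag_cover[OF E] pdiag_sub[OF D B] x by blast
    have "C \<subseteq> B" using sat_block_le[OF D E _ B x C] eq by blast
    moreover have "B \<subseteq> C" using sat_block_le[OF E D _ C B x] eq by blast
    ultimately show "B \<in> E" using C by simp
  qed
  show ?thesis using *[OF D E eq] *[OF E D] eq by blast
qed

subsection \<open>Gluing\<close>

definition glue_pts :: "nat \<Rightarrow> nat \<Rightarrow> nat \<Rightarrow> (nat + nat + nat) set" where
  "glue_pts n m k = {..<n} <+> ({..<m} <+> {..<k})"

lemma glue_edges_union:
  assumes "pdiag n m D" "pdiag m k E"
  shows "\<Union> (glue_edges D E) = glue_pts n m k"
proof -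
  have D: "\<Union>D = {..<n} <+> {..<m}" and E: "\<Union>E = {..<m} <+> {..<k}"
    using assms by (auto simp: pdiag_def partition_on_def)
  have "\<Union> (glue_edges D E) = map_sum id Inl ` \<Union>D \<union> Inr ` \<Union>E"
    by (auto simp: glue_edges_def)
  also have "\<dots> = glue_pts n m k"
    unfolding D E glue_pts_def by (auto simp: Plus_def image_Un image_image)
  finally show ?thesis .
qed

text \<open>Closure under single edges passes to chains of edges, so the colourings of the glued
  graph are exactly the colourings of its components.\<close>

lemma glue_partition:
  assumes "pdiag n m D" "pdiag m k E"
  shows "partition_on (glue_pts n m k) (glue_components D E)"
    and "(\<forall>B\<in>glue_edges D E. \<forall>a\<in>B. \<forall>b\<in>B. a \<in> U \<longrightarrow> b \<in> U) \<longleftrightarrow>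
         (\<forall>C\<in>glue_components D E. \<forall>a\<in>C. \<forall>b\<in>C. a \<in> U \<longrightarrow> b \<in> U)"
proof -
  define V where "V = glue_pts n m k"
  define r where "r = {(a, b). \<exists>B \<in> glue_edges D E. a \<in> B \<and> b \<in> B}"
  have V: "\<Union> (glue_edges D E) = V" using glue_edges_union[OF assms] V_def by simp
  have rV: "r \<subseteq> V \<times> V" using V by (auto simp: r_def)
  have rV': "y \<in> V" if "(x, y) \<in> r\<^sup>*" "x \<in> V" for x y
    using that by (induction rule: rtrancl_induct) (use rV in auto)
  have symr: "sym r" by (auto simp: r_def sym_def)
  then have symr': "sym (r\<^sup>*)" by (rule sym_rtrancl)
  \<comment> \<open>\<open>r\<^sup>*\<close> is reflexive on the whole type; cut down to
    \<open>V\<close> it is an equivalence relation there with the same classes.\<close>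
  define r' where "r' = r\<^sup>* \<inter> V \<times> V"
  have "equiv V r'"
    unfolding r'_def
    by (rule equivI) (use symr' in \<open>auto simp: refl_on_def sym_def trans_def intro: rtrancl_trans\<close>)
  have eq: "glue_components D E = V // r'"
    unfolding glue_components_def V r_def[symmetric] quotient_def r'_def
    using rV' by (auto simp: Image_def)
  show "partition_on (glue_pts n m k) (glue_components D E)"
    unfolding V_def[symmetric] eq by (rule partition_on_quotient) fact
  have mem: "C \<in> glue_components D E \<longleftrightarrow> (\<exists>x\<in>V. C = r\<^sup>* `` {x})" for C
    unfolding glue_components_def V r_def[symmetric] quotient_def by auto
  show "(\<forall>B\<in>glue_edges D E. \<forall>a\<in>B. \<forall>b\<in>B. a \<in> U \<longrightarrow> b \<in> U) \<longleftrightarrow>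
         (\<forall>C\<in>glue_components D E. \<forall>a\<in>C. \<forall>b\<in>C. a \<in> U \<longrightarrow> b \<in> U)" (is "?L \<longleftrightarrow> ?R")
  proof
    assume L: ?L
    then have step: "b \<in> U" if "(a, b) \<in> r" "a \<in> U" for a b
      using that by (auto simp: r_def)
    have steps: "b \<in> U" if "(a, b) \<in> r\<^sup>*" "a \<in> U" for a b
      using that by (induction rule: rtrancl_induct) (use step in auto)
    show ?R
    proof (intro ballI impI)
      fix C a b assume C: "C \<in> glue_components D E" "a \<in> C" "b \<in> C" "a \<in> U"
      then obtain x where "C = r\<^sup>* `` {x}" by (auto simp: mem)
      then have "(x, a) \<in> r\<^sup>*" "(x, b) \<in> r\<^sup>*" using C by auto
      then have "(a, b) \<in> r\<^sup>*" using symr' by (meson rtrancl_trans symE)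
      then show "b \<in> U" using steps C by blast
    qed
  next
    assume R: ?R
    show ?L
    proof (intro ballI impI)
      fix B a b assume B: "B \<in> glue_edges D E" "a \<in> B" "b \<in> B" "a \<in> U"
      then have ab: "(a, b) \<in> r" by (auto simp: r_def)
      then have "r\<^sup>* `` {a} \<in> glue_components D E" using rV by (auto simp: mem)
      moreover have "a \<in> r\<^sup>* `` {a}" "b \<in> r\<^sup>* `` {a}" using ab by auto
      ultimately show "b \<in> U" using R B(4) by blast
    qed
  qed
qed

lemma glue_sat:
  assumes "pdiag n m D" "pdiag m k E"
  shows "sat D s t \<and> sat E t u \<longleftrightarrow> (\<forall>C\<in>glue_components D E. \<forall>a\<in>C. \<forall>b\<in>C.
            a \<in> s <+> (t <+> u) \<longrightarrow> b \<in> s <+> (t <+> u))"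
proof -
  have 1: "map_sum id Inl x \<in> s <+> (t <+> u) \<longleftrightarrow> x \<in> s <+> t" for x :: "nat + nat"
    by (cases x) auto
  have "sat D s t \<and> sat E t u \<longleftrightarrow> (\<forall>B\<in>glue_edges D E. \<forall>a\<in>B. \<forall>b\<in>B.
            a \<in> s <+> (t <+> u) \<longrightarrow> b \<in> s <+> (t <+> u))"
    unfolding glue_edges_def ball_Un sat_def by (simp add: 1)
  then show ?thesis using glue_partition(2)[OF assms] by simp
qed

lemma pdiag_comp:
  assumes "pdiag n m D" "pdiag m k E"
  shows "pdiag n k (diag_comp D E)"
proof -
  have "map_sum id Inr x \<in> glue_pts n m k \<longleftrightarrow> x \<in> {..<n} <+> {..<k}" for x
    by (cases x) (simp_all add: glue_pts_def)
  then have "map_sum id Inr -` glue_pts n m k = {..<n} <+> {..<k}" by blast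
  moreover have "diag_comp D E = (-`) (map_sum id Inr) ` glue_components D E - {{}}"
    by (simp add: diag_comp_def outer_part_def image_def)
  ultimately show ?thesis
    using partition_on_vimage[OF glue_partition(1)[OF assms], of "map_sum id Inr"]
    by (simp add: pdiag_def)
qed

lemma sat_compI:
  assumes D: "pdiag n m D" and E: "pdiag m k E" and "sat D s t" "sat E t u"
  shows "sat (diag_comp D E) s u"
proof -
  have 1: "map_sum id Inr x \<in> s <+> (t <+> u) \<longleftrightarrow> x \<in> s <+> u" for x :: "nat + nat"
    by (cases x) auto
  have *: "\<forall>C\<in>glue_components D E. \<forall>a\<in>C. \<forall>b\<in>C. a \<in> s <+> (t <+> u) \<longrightarrow> b \<in> s <+> (t <+> u)"
    by (rule glue_sat[OF D E, THEN iffD1]) (simp add: assms(3,4))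
  show ?thesis unfolding sat_def
  proof (intro ballI impI)
    fix B x y assume B: "B \<in> diag_comp D E" "x \<in> B" "y \<in> B" "x \<in> s <+> u"
    then obtain C where C: "C \<in> glue_components D E" "B = outer_part C"
      by (auto simp: diag_comp_def)
    then have "map_sum id Inr x \<in> C" "map_sum id Inr y \<in> C"
      using B by (auto simp: outer_part_def)
    then show "y \<in> s <+> u" using * C(1) B(4) 1 by metis
  qed
qed

text \<open>Labelling the points by two colours, constantly along strands, is a faithful functor to
  nonnegative integer matrices for loop value 2.  This turns the topological identities between
  diagrams into identities between relations on sets of labels.\<close>

lemma card_sat_comp:
  assumes D: "pdiag n m D" and E: "pdiag m k E" and s: "s \<subseteq> {..<n}" and u: "u \<subseteq> {..<k}"
  shows "card {t. t \<subseteq> {..<m} \<and> sat D s t \<and> sat E t u} =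
         (if sat (diag_comp D E) s u then 2 ^ diag_loops D E else 0)"
proof (cases "sat (diag_comp D E) s u")
  case False
  then have "{t. t \<subseteq> {..<m} \<and> sat D s t \<and> sat E t u} = {}"
    using sat_compI[OF D E] by blast
  then show ?thesis using False by simp
next
  case True
  define P where "P = glue_components D E"
  define V where "V = glue_pts n m k"
  \<comment> \<open>\<open>Lp\<close> holds the closed loops. A component that meets the outer
    boundary has its colour forced by \<open>s\<close> and \<open>u\<close>, and \<open>Q\<close>
    collects those forced into the first colour. \<open>W T\<close> is the coloured region once the
    loops in \<open>T\<close> are coloured too; \<open>g\<close> and \<open>h\<close> translate
    between sets of loops and middle colourings.\<close>
  define Lp where "Lp = {C \<in> P. outer_part C = {}}"
  define Q where "Q = {C \<in> P. outer_part C \<noteq> {} \<and> outer_part C \<subseteq> s <+> u}"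
  define W where "W T = \<Union>T \<union> \<Union>Q" for T
  define g where "g T = {j. Inr (Inl j) \<in> W T}" for T
  define h where "h t = {C \<in> Lp. C \<subseteq> s <+> (t <+> u)}" for t
  have part: "partition_on V P" unfolding P_def V_def by (rule glue_partition(1)[OF D E])
  then have UP: "\<Union>P = V" and disj: "\<And>C C' x. C \<in> P \<Longrightarrow> C' \<in> P \<Longrightarrow> x \<in> C \<Longrightarrow> x \<in> C' \<Longrightarrow> C = C'"
    and ne: "\<And>C. C \<in> P \<Longrightarrow> C \<noteq> {}"
    by (auto simp: partition_on_def disjoint_def)
  have "finite V" by (auto simp: V_def glue_pts_def)
  then have "finite P" using part finite_elements by blast
  then have finL: "finite Lp" by (simp add: Lp_def)
  have outer: "x \<in> outer_part C \<longleftrightarrow> map_sum id Inr x \<in> C" for x C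
    by (simp add: outer_part_def)
  have sat': "sat D s t \<and> sat E t u \<longleftrightarrow> (\<forall>C\<in>P. \<forall>a\<in>C. \<forall>b\<in>C.
            a \<in> s <+> (t <+> u) \<longrightarrow> b \<in> s <+> (t <+> u))" for t
    unfolding P_def by (rule glue_sat[OF D E])
  have mid_or_outer: "(\<exists>j. a = Inr (Inl j)) \<or> (\<exists>x. a = map_sum id Inr x)" for a :: "nat + nat + nat"
    by (metis id_apply map_sum.simps old.sum.exhaust)
  \<comment> \<open>\<open>g T\<close> records only the middle colours; on the outer points
    \<open>W T\<close> agrees with \<open>s\<close> and \<open>u\<close>, because \<open>Q\<close>
    contains exactly the components through coloured outer points.\<close>
  have Wg: "s <+> (g T <+> u) = W T" if T: "T \<subseteq> Lp" for T
  proof (rule set_eqI)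
    fix a :: "nat + nat + nat"
    from mid_or_outer[of a] show "a \<in> s <+> (g T <+> u) \<longleftrightarrow> a \<in> W T"
    proof
      assume "\<exists>j. a = Inr (Inl j)"
      then show ?thesis by (auto simp: g_def)
    next
      assume "\<exists>x. a = map_sum id Inr x"
      then obtain x where x: "a = map_sum id Inr x" by blast
      have "a \<in> s <+> (g T <+> u) \<longleftrightarrow> x \<in> s <+> u" unfolding x by (cases x) auto
      also have "\<dots> \<longleftrightarrow> a \<in> W T"
      proof
        assume xs: "x \<in> s <+> u"
        then have "a \<in> V" using s u by (auto simp: x V_def glue_pts_def)
        then obtain C where C: "C \<in> P" "a \<in> C" using UP by blast
        then have xC: "x \<in> outer_part C" by (simp add: outer x)
        then have "outer_part C \<in> diag_comp D E" using C by (auto simp: diag_comp_def P_def)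
        then have "outer_part C \<subseteq> s <+> u" using True xC xs unfolding sat_def by blast
        then show "a \<in> W T" using C xC by (auto simp: W_def Q_def)
      next
        assume "a \<in> W T"
        then consider C where "C \<in> T" "a \<in> C" | C where "C \<in> Q" "a \<in> C" by (auto simp: W_def)
        then show "x \<in> s <+> u"
        proof cases
          case 1
          then show ?thesis using T outer[of x C] x by (auto simp: Lp_def)
        next
          case 2
          then show ?thesis using outer[of x C] x by (auto simp: Q_def)
        qed
      qed
      finally show ?thesis .
    qed
  qed
  have WP: "W T \<subseteq> V" "\<forall>C\<in>P. \<forall>a\<in>C. \<forall>b\<in>C. a \<in> W T \<longrightarrow> b \<in> W T" if "T \<subseteq> Lp" for T
  proof -
    have sub: "T \<union> Q \<subseteq> P" using that by (auto simp: Lp_def Q_def)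
    then show "W T \<subseteq> V" using UP by (auto simp: W_def)
    show "\<forall>C\<in>P. \<forall>a\<in>C. \<forall>b\<in>C. a \<in> W T \<longrightarrow> b \<in> W T"
    proof (intro ballI impI)
      fix C a b assume C: "C \<in> P" "a \<in> C" "b \<in> C" "a \<in> W T"
      then obtain C' where C': "C' \<in> T \<union> Q" "a \<in> C'" by (auto simp: W_def)
      then have "C = C'" using disj[of C C' a] C sub by blast
      then show "b \<in> W T" using C C' by (auto simp: W_def)
    qed
  qed
  have "bij_betw g (Pow Lp) {t. t \<subseteq> {..<m} \<and> sat D s t \<and> sat E t u}"
  proof (rule bij_betw_byWitness[where f' = h])
    show "\<forall>T\<in>Pow Lp. h (g T) = T"
    proof
      fix T assume "T \<in> Pow Lp"
      then have T: "T \<subseteq> Lp" by simp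
      show "h (g T) = T"
      proof
        show "T \<subseteq> h (g T)" using T by (auto simp: h_def Wg[OF T] W_def)
        show "h (g T) \<subseteq> T"
        proof
          fix C assume "C \<in> h (g T)"
          then have C: "C \<in> Lp" "C \<subseteq> W T" by (auto simp: h_def Wg[OF T])
          then have CP: "C \<in> P" "outer_part C = {}" by (auto simp: Lp_def)
          obtain a where a: "a \<in> C" using ne[OF CP(1)] by blast
          then obtain C' where C': "C' \<in> T \<union> Q" "a \<in> C'" using C by (auto simp: W_def)
          then have "C' \<in> P" using T by (auto simp: Lp_def Q_def)
          then have "C = C'" using disj CP a C' by blast
          then show "C \<in> T" using C' CP by (auto simp: Q_def)
        qed
      qed
    qed
    show "\<forall>t\<in>{t. t \<subseteq> {..<m} \<and> sat D s t \<and> sat E t u}. g (h t) = t"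
    proof
      fix t assume t': "t \<in> {t. t \<subseteq> {..<m} \<and> sat D s t \<and> sat E t u}"
      then have t: "t \<subseteq> {..<m}" by simp
      have st: "\<forall>C\<in>P. \<forall>a\<in>C. \<forall>b\<in>C. a \<in> s <+> (t <+> u) \<longrightarrow> b \<in> s <+> (t <+> u)"
        by (rule sat'[THEN iffD1]) (use t' in simp)
      have hL: "h t \<subseteq> Lp" by (auto simp: h_def)
      show "g (h t) = t"
      proof (rule set_eqI)
        fix j
        have "j \<in> g (h t) \<longleftrightarrow> Inr (Inl j) \<in> W (h t)" by (simp add: g_def)
        also have "\<dots> \<longleftrightarrow> j \<in> t"
        proof
          assume "Inr (Inl j) \<in> W (h t)"
          then consider C where "C \<in> h t" "Inr (Inl j) \<in> C" | C where "C \<in> Q" "Inr (Inl j) \<in> C"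
            by (auto simp: W_def)
          then show "j \<in> t"
          proof cases
            case 1
            then show ?thesis by (auto simp: h_def)
          next
            case 2
            then obtain x where x: "x \<in> outer_part C" "x \<in> s <+> u" "C \<in> P" by (auto simp: Q_def)
            then have "map_sum id Inr x \<in> C" "map_sum id Inr x \<in> s <+> (t <+> u)"
              by (auto simp: outer)
            from st[rule_format, OF x(3) this(1) 2(2) this(2)]
            have "Inr (Inl j) \<in> s <+> (t <+> u)" .
            then show ?thesis by simp
          qed
        next
          assume j: "j \<in> t"
          then have "Inr (Inl j) \<in> V" using t by (auto simp: V_def glue_pts_def)
          then obtain C where C: "C \<in> P" "Inr (Inl j) \<in> C" using UP by blast
          have "Inr (Inl j) \<in> s <+> (t <+> u)" using j by simp
          then have sub: "C \<subseteq> s <+> (t <+> u)" 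
            by (intro subsetI) (rule st[rule_format, OF C])
          have o: "outer_part C \<subseteq> s <+> u"
          proof
            fix x assume "x \<in> outer_part C"
            then have "map_sum id Inr x \<in> s <+> (t <+> u)" using sub by (auto simp: outer)
            then show "x \<in> s <+> u" by (cases x) auto
          qed
          show "Inr (Inl j) \<in> W (h t)"
          proof (cases "outer_part C = {}")
            case True
            then have "C \<in> h t" using C sub by (auto simp: h_def Lp_def)
            then show ?thesis using C by (auto simp: W_def)
          next
            case False
            then show ?thesis using C o by (auto simp: W_def Q_def)
          qed
        qed
        finally show "j \<in> g (h t) \<longleftrightarrow> j \<in> t" .
      qed
    qed
    show "g ` Pow Lp \<subseteq> {t. t \<subseteq> {..<m} \<and> sat D s t \<and> sat E t u}"
    proof
      fix t assume "t \<in> g ` Pow Lp"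
      then obtain T where T: "T \<subseteq> Lp" "t = g T" by auto
      have "t \<subseteq> {..<m}" using WP(1)[OF T(1)] by (auto simp: T g_def V_def glue_pts_def)
      moreover have "sat D s t \<and> sat E t u"
        by (rule sat'[THEN iffD2]) (unfold T(2) Wg[OF T(1)], rule WP(2)[OF T(1)])
      ultimately show "t \<in> {t. t \<subseteq> {..<m} \<and> sat D s t \<and> sat E t u}" by simp
    qed
    show "h ` {t. t \<subseteq> {..<m} \<and> sat D s t \<and> sat E t u} \<subseteq> Pow Lp"
      by (auto simp: h_def)
  qed
  then have "card {t. t \<subseteq> {..<m} \<and> sat D s t \<and> sat E t u} = card (Pow Lp)"
    by (simp add: bij_betw_same_card)
  also have "\<dots> = 2 ^ diag_loops D E"
    using finL by (simp add: card_Pow Lp_def P_def diag_loops_def)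
  finally show ?thesis using True by simp
qed

text \<open>The number of middle colourings is zero or a power of two, so testing it for zero shows
  that diagrams compose as relations between colourings.\<close>

lemma sat_comp_iff:
  assumes "pdiag n m D" "pdiag m k E" "s \<subseteq> {..<n}" "u \<subseteq> {..<k}"
  shows "sat (diag_comp D E) s u \<longleftrightarrow> (\<exists>t\<subseteq>{..<m}. sat D s t \<and> sat E t u)"
proof
  assume "sat (diag_comp D E) s u"
  then have "card {t. t \<subseteq> {..<m} \<and> sat D s t \<and> sat E t u} \<noteq> 0"
    using card_sat_comp[OF assms] by simp
  then have "{t. t \<subseteq> {..<m} \<and> sat D s t \<and> sat E t u} \<noteq> {}" by (metis card.empty)
  then show "\<exists>t\<subseteq>{..<m}. sat D s t \<and> sat E t u" by blast
qed (use sat_compI[OF assms(1,2)] in blast)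

lemma diag_comp_eqI:
  assumes "pdiag n m D" "pdiag m k E" "pdiag n k F"
    and "\<And>s u. s \<subseteq> {..<n} \<Longrightarrow> u \<subseteq> {..<k} \<Longrightarrow>
      sat F s u \<longleftrightarrow> (\<exists>t\<subseteq>{..<m}. sat D s t \<and> sat E t u)"
  shows "diag_comp D E = F"
  by (rule sat_inject[OF pdiag_comp[OF assms(1,2)] assms(3)])
    (simp add: sat_comp_iff[OF assms(1,2)] assms(4))

text \<open>With both outer sides uncoloured only the closed loops are free to choose a colour;
  their number is thus the exponent of two.\<close>

lemma card_loops:
  assumes "pdiag n m D" "pdiag m k E"
  shows "card {t. t \<subseteq> {..<m} \<and> sat D {} t \<and> sat E t {}} = 2 ^ diag_loops D E"
  using card_sat_comp[OF assms, of "{}" "{}"] by simp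

lemma diag_loops_0I:
  assumes "pdiag n m D" "pdiag m k E"
    and "\<And>t. t \<subseteq> {..<m} \<Longrightarrow> sat D {} t \<Longrightarrow> sat E t {} \<Longrightarrow> t = {}"
  shows "diag_loops D E = 0"
proof -
  have "{t. t \<subseteq> {..<m} \<and> sat D {} t \<and> sat E t {}} = {{}}" using assms(3) by auto
  then have "(2::nat) ^ diag_loops D E = 1" using card_loops[OF assms(1,2)] by simp
  then show ?thesis by simp
qed

lemma diag_comp_assoc:
  assumes D: "pdiag n m D" and E: "pdiag m k E" and F: "pdiag k l F"
  shows "diag_comp (diag_comp D E) F = diag_comp D (diag_comp E F)"
proof (rule diag_comp_eqI[OF pdiag_comp[OF D E] F pdiag_comp[OF D pdiag_comp[OF E F]]])
  fix s u :: "nat set" assume s: "s \<subseteq> {..<n}" and u: "u \<subseteq> {..<l}"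
  have "sat (diag_comp D (diag_comp E F)) s u \<longleftrightarrow>
      (\<exists>t\<subseteq>{..<m}. sat D s t \<and> (\<exists>v\<subseteq>{..<k}. sat E t v \<and> sat F v u))"
    using sat_comp_iff[OF D pdiag_comp[OF E F] s u] sat_comp_iff[OF E F _ u] by metis
  moreover have "(\<exists>t\<subseteq>{..<k}. sat (diag_comp D E) s t \<and> sat F t u) \<longleftrightarrow>
      (\<exists>v\<subseteq>{..<k}. (\<exists>t\<subseteq>{..<m}. sat D s t \<and> sat E t v) \<and> sat F v u)"
    using sat_comp_iff[OF D E s] by metis
  ultimately show "sat (diag_comp D (diag_comp E F)) s u \<longleftrightarrow>
      (\<exists>t\<subseteq>{..<k}. sat (diag_comp D E) s t \<and> sat F t u)"
    by blast
qed

text \<open>Both sides are the exponent of two in the number of colourings of the two middle layers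
  with uncoloured outer sides, summed over the layers in the two possible orders.\<close>

lemma diag_loops_assoc:
  assumes D: "pdiag n m D" and E: "pdiag m k E" and F: "pdiag k l F"
  shows "diag_loops D E + diag_loops (diag_comp D E) F =
         diag_loops E F + diag_loops D (diag_comp E F)"
proof -
  let ?A = "Pow {..<m}" and ?B = "Pow {..<k}"
  define X where "X t v = (if sat D {} t \<and> sat E t v \<and> sat F v {} then 1 else 0 :: nat)" for t v
  have sum_card: "(\<Sum>t\<in>Pow {..<q}. if P t then 1 else 0) = card {t. t \<subseteq> {..<q} \<and> P t}"
    for P :: "nat set \<Rightarrow> bool" and q
    by (simp add: sum.If_cases Int_def Pow_def)
  have "(\<Sum>v\<in>?B. \<Sum>t\<in>?A. X t v) = (\<Sum>v\<in>?B. (if sat F v {} then 1 else 0) *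
      (\<Sum>t\<in>?A. if sat D {} t \<and> sat E t v then 1 else 0))"
    unfolding sum_distrib_left by (intro sum.cong refl) (auto simp: X_def)
  also have "\<dots> = (\<Sum>v\<in>?B. (if sat F v {} then 1 else 0) *
      (if sat (diag_comp D E) {} v then 2 ^ diag_loops D E else 0))"
    by (intro sum.cong refl) (simp add: sum_card card_sat_comp[OF D E])
  also have "\<dots> = 2 ^ diag_loops D E *
      (\<Sum>v\<in>?B. if sat (diag_comp D E) {} v \<and> sat F v {} then 1 else 0)"
    unfolding sum_distrib_left by (intro sum.cong refl) auto
  also have "\<dots> = 2 ^ (diag_loops D E + diag_loops (diag_comp D E) F)"
    by (simp add: sum_card card_loops[OF pdiag_comp[OF D E] F] power_add)
  finally have 1: "(\<Sum>v\<in>?B. \<Sum>t\<in>?A. X t v) =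
    2 ^ (diag_loops D E + diag_loops (diag_comp D E) F)" .
  have "(\<Sum>t\<in>?A. \<Sum>v\<in>?B. X t v) = (\<Sum>t\<in>?A. (if sat D {} t then 1 else 0) *
      (\<Sum>v\<in>?B. if sat E t v \<and> sat F v {} then 1 else 0))"
    unfolding sum_distrib_left by (intro sum.cong refl) (auto simp: X_def)
  also have "\<dots> = (\<Sum>t\<in>?A. (if sat D {} t then 1 else 0) *
      (if sat (diag_comp E F) t {} then 2 ^ diag_loops E F else 0))"
    by (intro sum.cong refl) (simp add: sum_card card_sat_comp[OF E F])
  also have "\<dots> = 2 ^ diag_loops E F *
      (\<Sum>t\<in>?A. if sat D {} t \<and> sat (diag_comp E F) t {} then 1 else 0)"
    unfolding sum_distrib_left by (intro sum.cong refl) auto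
  also have "\<dots> = 2 ^ (diag_loops E F + diag_loops D (diag_comp E F))"
    by (simp add: sum_card card_loops[OF D pdiag_comp[OF E F]] power_add)
  finally have "(2::nat) ^ (diag_loops D E + diag_loops (diag_comp D E) F) =
      2 ^ (diag_loops E F + diag_loops D (diag_comp E F))"
    using 1 by (simp add: sum.swap[of _ ?A])
  then show ?thesis by simp
qed

subsection \<open>Identities, tensor products and reflections\<close>

lemma partition_on_disjoint_Un:
  assumes "partition_on A P" "partition_on B Q" "A \<inter> B = {}"
  shows "partition_on (A \<union> B) (P \<union> Q)"
proof (rule partition_onI)
  show "\<Union> (P \<union> Q) = A \<union> B" "{} \<notin> P \<union> Q" for p
    using assms by (auto simp: partition_on_def)
  fix p q assume pq: "p \<in> P \<union> Q" "q \<in> P \<union> Q" "p \<noteq> q"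
  have "p \<subseteq> A" if "p \<in> P" for p using that assms(1) by (auto simp: partition_on_def)
  moreover have "p \<subseteq> B" if "p \<in> Q" for p using that assms(2) by (auto simp: partition_on_def)
  moreover have "disjnt p q" if "p \<in> P" "q \<in> P" "p \<noteq> q" for p q
    using that assms(1) by (auto simp: partition_on_def pairwise_def disjoint_def disjnt_def)
  moreover have "disjnt p q" if "p \<in> Q" "q \<in> Q" "p \<noteq> q" for p q
    using that assms(2) by (auto simp: partition_on_def pairwise_def disjoint_def disjnt_def)
  ultimately show "disjnt p q" using pq assms(3)
    by (metis Un_iff disjnt_def disjnt_subset1 disjnt_subset2 disjnt_sym)
qed

lemma pdiag_id [intro, simp]: "pdiag n n (diag_id n)"
  unfolding pdiag_def
proof (rule partition_onI)
  show "\<Union> (diag_id n) = {..<n} <+> {..<n}" unfolding diag_id_def Plus_def by blast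
qed (auto simp: diag_id_def disjnt_def)

lemma sat_id: "sat (diag_id n) s t \<longleftrightarrow> s \<inter> {..<n} = t \<inter> {..<n}"
proof -
  have "sat (diag_id n) s t \<longleftrightarrow> (\<forall>i<n. i \<in> s \<longleftrightarrow> i \<in> t)"
    unfolding sat_def diag_id_def setcompr_eq_image by (auto simp only: ball_simps in_Plus_iff mem_Collect_eq insert_iff empty_iff)
  then show ?thesis unfolding set_eq_iff Int_iff lessThan_iff by blast
qed

lemma pdiag_cap: "pdiag (2 * c) 0 (diag_cap c)"
  unfolding pdiag_def
proof (rule partition_onI)
  show "\<Union> (diag_cap c) = {..<2 * c} <+> {..<0}"
  proof (rule set_eqI)
    fix x :: "nat + nat"
    show "x \<in> \<Union> (diag_cap c) \<longleftrightarrow> x \<in> {..<2 * c} <+> {..<0}"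
    proof (cases x)
      case (Inl i)
      show ?thesis
      proof
        assume "x \<in> {..<2 * c} <+> {..<0}"
        then have i: "i < 2 * c" using Inl by simp
        show "x \<in> \<Union> (diag_cap c)"
        proof (cases "i < c")
          case True
          then show ?thesis using Inl by (auto simp: diag_cap_def)
        next
          case False
          then have "2 * c - 1 - (2 * c - 1 - i) = i" "2 * c - 1 - i < c" using i by auto
          then have "{Inl (2 * c - 1 - i), Inl i} \<in> diag_cap c"
            unfolding diag_cap_def by (metis (mono_tags, lifting) mem_Collect_eq)
          then show ?thesis using Inl by auto
        qed
      qed (auto simp: diag_cap_def)
    qed (auto simp: diag_cap_def)
  qed
qed (auto simp: diag_cap_def disjnt_def)

lemma sat_cap: "sat (diag_cap c) s t \<longleftrightarrow> (\<forall>i<c. i \<in> s \<longleftrightarrow> 2 * c - 1 - i \<in> s)"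
  unfolding sat_def diag_cap_def setcompr_eq_image by (auto simp only: ball_simps in_Plus_iff mem_Collect_eq insert_iff empty_iff)

lemma pdiag_cap1 [simp]: "pdiag 2 0 (diag_cap 1)" "pdiag 2 0 (diag_cap (Suc 0))"
  using pdiag_cap[of 1] by simp_all

lemma diag_tensor_eq:
  assumes "pdiag n m D"
  shows "diag_tensor D E = D \<union> (`) (map_sum ((+) n) ((+) m)) ` E"
proof -
  have "\<Union>D = {..<n} <+> {..<m}" using assms by (auto simp: pdiag_def partition_on_def)
  then have "Inl -` \<Union>D = {..<n}" "Inr -` \<Union>D = {..<m}" by auto
  then show ?thesis by (simp add: diag_tensor_def)
qed

lemma inj_map_sum_add: "inj (map_sum ((+) (n::nat)) ((+) (m::nat)))"
  by (rule sum.inj_map) auto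

lemma pdiag_tensor [intro]:
  assumes D: "pdiag n m D" and E: "pdiag n' m' E"
  shows "pdiag (n + n') (m + m') (diag_tensor D E)"
proof -
  let ?f = "map_sum ((+) n) ((+) m)"
  have "partition_on (?f ` ({..<n'} <+> {..<m'})) ((`) ?f ` E)"
  proof -
    have "partition_on (?f ` ({..<n'} <+> {..<m'})) ((`) ?f ` E - {{}})"
      using E inj_map_sum_add unfolding pdiag_def
      by (intro partition_on_inj_image) (auto intro: inj_on_subset)
    moreover have "{} \<notin> (`) ?f ` E" using E by (auto simp: pdiag_def partition_on_def)
    ultimately show ?thesis by simp
  qed
  then have "partition_on (({..<n} <+> {..<m}) \<union> ?f ` ({..<n'} <+> {..<m'})) (D \<union> (`) ?f ` E)"
    using D unfolding pdiag_def by (intro partition_on_disjoint_Un) auto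
  moreover have "({..<n} <+> {..<m}) \<union> ?f ` ({..<n'} <+> {..<m'}) = {..<n + n'} <+> {..<m + m'}"
    (is "?A = ?B")
  proof (rule set_eqI)
    fix x :: "nat + nat"
    have *: "j < a + b \<longleftrightarrow> j < a \<or> (\<exists>i<b. j = a + i)" for j a b :: nat
      by (metis add_lessD1 le_Suc_ex nat_add_left_cancel_less not_le trans_less_add1)
    show "x \<in> ?A \<longleftrightarrow> x \<in> ?B"
    proof (cases x)
      case (Inl j)
      have "x \<in> ?f ` ({..<n'} <+> {..<m'}) \<longleftrightarrow> (\<exists>i<n'. j = n + i)"
        unfolding Inl Plus_def image_Un by (auto simp: image_iff)
      then show ?thesis using *[of j n n'] by (simp add: Inl)
    next
      case (Inr j)
      have "x \<in> ?f ` ({..<n'} <+> {..<m'}) \<longleftrightarrow> (\<exists>i<m'. j = m + i)"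
        unfolding Inr Plus_def image_Un by (auto simp: image_iff)
      then show ?thesis using *[of j m m'] by (simp add: Inr)
    qed
  qed
  ultimately show ?thesis by (simp add: pdiag_def diag_tensor_eq[OF D])
qed

lemma sat_image:
  "sat ((`) f ` E) s t \<longleftrightarrow> (\<forall>B\<in>E. \<forall>x\<in>B. \<forall>y\<in>B. f x \<in> s <+> t \<longrightarrow> f y \<in> s <+> t)"
proof
  assume L: "sat ((`) f ` E) s t"
  show "\<forall>B\<in>E. \<forall>x\<in>B. \<forall>y\<in>B. f x \<in> s <+> t \<longrightarrow> f y \<in> s <+> t"
  proof (intro ballI impI)
    fix B x y assume "B \<in> E" "x \<in> B" "y \<in> B" and fx: "f x \<in> s <+> t"
    then have "f ` B \<in> (`) f ` E" "f x \<in> f ` B" "f y \<in> f ` B" by simp_all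
    then show "f y \<in> s <+> t" using L fx unfolding sat_def by metis
  qed
next
  assume R: "\<forall>B\<in>E. \<forall>x\<in>B. \<forall>y\<in>B. f x \<in> s <+> t \<longrightarrow> f y \<in> s <+> t"
  show "sat ((`) f ` E) s t" unfolding sat_def
  proof (intro ballI impI)
    fix B x y assume "B \<in> (`) f ` E" "x \<in> B" "y \<in> B" "x \<in> s <+> t"
    then obtain C x' y' where "C \<in> E" "x' \<in> C" "y' \<in> C" "f x' = x" "f y' = y" by blast
    then show "y \<in> s <+> t" using R \<open>x \<in> s <+> t\<close> by metis
  qed
qed

lemma sat_tensor:
  assumes "pdiag n m D"
  shows "sat (diag_tensor D E) s t \<longleftrightarrow> sat D s t \<and> sat E ((+) n -` s) ((+) m -` t)"
proof -
  have "map_sum ((+) n) ((+) m) x \<in> s <+> t \<longleftrightarrow> x \<in> ((+) n -` s) <+> ((+) m -` t)" for x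
    by (cases x) auto
  then have "sat ((`) (map_sum ((+) n) ((+) m)) ` E) s t \<longleftrightarrow> sat E ((+) n -` s) ((+) m -` t)"
    unfolding sat_image sat_def by simp
  moreover have "sat (D \<union> F) s t \<longleftrightarrow> sat D s t \<and> sat F s t" for F
    unfolding sat_def ball_Un by simp
  ultimately show ?thesis by (simp add: diag_tensor_eq[OF assms])
qed

lemma pdiag_flip [intro]:
  assumes "pdiag n m D"
  shows "pdiag m n (diag_flip D)"
proof -
  let ?f = "case_sum Inr Inl :: nat + nat \<Rightarrow> nat + nat"
  have inj: "inj ?f" by (auto simp: inj_def split: sum.splits)
  have "partition_on (?f ` ({..<n} <+> {..<m})) ((`) ?f ` D - {{}})"
    using assms inj unfolding pdiag_def
    by (intro partition_on_inj_image) (auto intro: inj_on_subset)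
  moreover have "{} \<notin> (`) ?f ` D" using assms by (auto simp: pdiag_def partition_on_def)
  moreover have "?f ` ({..<n} <+> {..<m}) = {..<m} <+> {..<n}"
    unfolding Plus_def image_Un image_image by auto
  ultimately show ?thesis by (simp add: pdiag_def diag_flip_def)
qed

lemma sat_flip [simp]: "sat (diag_flip D) s t \<longleftrightarrow> sat D t s"
proof -
  have "case_sum Inr Inl x \<in> s <+> t \<longleftrightarrow> x \<in> t <+> s" for x :: "nat + nat"
    by (cases x) auto
  then show ?thesis unfolding diag_flip_def sat_image by (simp add: sat_def)
qed

lemma diag_flip_flip [simp]: "diag_flip (diag_flip D) = D"
proof -
  have "case_sum Inr Inl (case_sum Inr Inl x) = x" for x :: "nat + nat" by (cases x) auto
  then show ?thesis by (simp add: diag_flip_def image_image)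
qed

lemma diag_comp_id_left:
  assumes "pdiag n m D"
  shows "diag_comp (diag_id n) D = D" "diag_loops (diag_id n) D = 0"
proof -
  show "diag_comp (diag_id n) D = D"
  proof (rule diag_comp_eqI[OF pdiag_id assms assms])
    fix s u :: "nat set" assume "s \<subseteq> {..<n}"
    then show "sat D s u \<longleftrightarrow> (\<exists>t\<subseteq>{..<n}. sat (diag_id n) s t \<and> sat D t u)"
      unfolding sat_id by (metis Int_absorb2)
  qed
  show "diag_loops (diag_id n) D = 0"
    by (rule diag_loops_0I[OF pdiag_id assms]) (auto simp: sat_id)
qed

lemma diag_comp_id_right:
  assumes "pdiag n m D"
  shows "diag_comp D (diag_id m) = D" "diag_loops D (diag_id m) = 0"
proof -
  show "diag_comp D (diag_id m) = D"
  proof (rule diag_comp_eqI[OF assms pdiag_id assms])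
    fix s u :: "nat set" assume "u \<subseteq> {..<m}"
    then show "sat D s u \<longleftrightarrow> (\<exists>t\<subseteq>{..<m}. sat D s t \<and> sat (diag_id m) t u)"
      unfolding sat_id by (metis Int_absorb2)
  qed
  show "diag_loops D (diag_id m) = 0"
    by (rule diag_loops_0I[OF assms pdiag_id]) (auto simp: sat_id)
qed

lemma diag_flip_comp:
  assumes D: "pdiag n m D" and E: "pdiag m k E"
  shows "diag_flip (diag_comp D E) = diag_comp (diag_flip E) (diag_flip D)"
    and "diag_loops (diag_flip E) (diag_flip D) = diag_loops D E"
proof -
  show "diag_flip (diag_comp D E) = diag_comp (diag_flip E) (diag_flip D)"
    by (rule diag_comp_eqI[OF pdiag_flip[OF E] pdiag_flip[OF D] pdiag_flip[OF pdiag_comp[OF D E]],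
          symmetric])
      (simp add: sat_comp_iff[OF D E], blast)
  have "(2::nat) ^ diag_loops (diag_flip E) (diag_flip D) = 2 ^ diag_loops D E"
    unfolding card_loops[OF pdiag_flip[OF E] pdiag_flip[OF D], symmetric]
      card_loops[OF D E, symmetric] by (intro arg_cong[of _ _ card]) auto
  then show "diag_loops (diag_flip E) (diag_flip D) = diag_loops D E" by simp
qed

lemma diag_flip_id [simp]: "diag_flip (diag_id n) = diag_id n"
  by (rule sat_inject[OF pdiag_flip[OF pdiag_id] pdiag_id]) (auto simp: sat_id)

lemma diag_flip_tensor:
  assumes D: "pdiag n m D" and E: "pdiag n' m' E"
  shows "diag_flip (diag_tensor D E) = diag_tensor (diag_flip D) (diag_flip E)"
  by (rule sat_inject[OF pdiag_flip[OF pdiag_tensor[OF D E]]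
        pdiag_tensor[OF pdiag_flip[OF D] pdiag_flip[OF E]]])
    (simp add: sat_tensor[OF D] sat_tensor[OF pdiag_flip[OF D]])

lemma diag_tensor_assoc:
  assumes D: "pdiag n m D" and E: "pdiag n' m' E" and F: "pdiag n'' m'' F"
  shows "diag_tensor (diag_tensor D E) F = diag_tensor D (diag_tensor E F)"
proof -
  have "pdiag (n + n' + n'') (m + m' + m'') (diag_tensor D (diag_tensor E F))"
    using pdiag_tensor[OF D pdiag_tensor[OF E F]] by (simp add: add.assoc)
  moreover have "(+) (a + b) -` s = (+) b -` ((+) a -` s)" for a b :: nat and s
    by (auto simp: add.assoc)
  ultimately show ?thesis
    by (intro sat_inject[OF pdiag_tensor[OF pdiag_tensor[OF D E] F]])
      (simp_all add: sat_tensor[OF pdiag_tensor[OF D E]] sat_tensor[OF D] sat_tensor[OF E])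
qed

lemma diag_tensor_id: "diag_tensor (diag_id n) (diag_id m) = diag_id (n + m)"
proof (rule sat_inject[OF pdiag_tensor[OF pdiag_id pdiag_id] pdiag_id])
  fix s t :: "nat set"
  have "i \<in> s \<longleftrightarrow> i \<in> t" if *: "s \<inter> {..<n} = t \<inter> {..<n}"
    "(+) n -` s \<inter> {..<m} = (+) n -` t \<inter> {..<m}" and i: "i < n + m" for i
  proof (cases "i < n")
    case True
    then show ?thesis using *(1) by auto
  next
    case False
    then have "i = n + (i - n)" "i - n < m" using i by auto
    then show ?thesis using *(2) by (metis Int_iff lessThan_iff vimage_eq)
  qed
  moreover have "(\<forall>i<n+m. i \<in> s \<longleftrightarrow> i \<in> t) \<longleftrightarrow> s \<inter> {..<n+m} = t \<inter> {..<n+m}" by auto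
  moreover have "s \<inter> {..<n} = t \<inter> {..<n} \<and> (+) n -` s \<inter> {..<m} = (+) n -` t \<inter> {..<m}"
    if "\<forall>i<n+m. i \<in> s \<longleftrightarrow> i \<in> t" using that by auto
  ultimately have "s \<inter> {..<n} = t \<inter> {..<n} \<and> (+) n -` s \<inter> {..<m} = (+) n -` t \<inter> {..<m} \<longleftrightarrow>
    s \<inter> {..<n+m} = t \<inter> {..<n+m}" by metis
  then show "sat (diag_tensor (diag_id n) (diag_id m)) s t \<longleftrightarrow> sat (diag_id (n + m)) s t"
    unfolding sat_tensor[OF pdiag_id] sat_id .
qed

lemma diag_id_0: "diag_id 0 = {}"
  by (simp add: diag_id_def)

lemma diag_tensor_id_0_right: "diag_tensor D (diag_id 0) = D"
  by (simp add: diag_tensor_def diag_id_0)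

lemma diag_tensor_id_0_left: "diag_tensor (diag_id 0) D = D"
proof -
  have "map_sum ((+) (0::nat)) ((+) (0::nat)) = id" by (rule ext) (case_tac x, auto)
  then show ?thesis by (simp add: diag_tensor_def diag_id_0)
qed

section \<open>The interchange law\<close>

text \<open>The colouring of the middle points of a tensor product assembled from one colouring for
  each factor. Through \<open>join_bij\<close> the counts of colourings multiply, so loop numbers
  add.\<close>

definition join :: "nat \<Rightarrow> nat set \<times> nat set \<Rightarrow> nat set" where
  "join m = (\<lambda>(t1, t2). t1 \<union> (+) m ` t2)"

lemma join_restrict:
  "t1 \<subseteq> {..<m} \<Longrightarrow> join m (t1, t2) \<inter> {..<m} = t1"
  "t1 \<subseteq> {..<m} \<Longrightarrow> (+) m -` join m (t1, t2) = t2"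
proof -
  assume t1: "t1 \<subseteq> {..<m}"
  have ge: "\<not> m + j < m" for j by simp
  show "join m (t1, t2) \<inter> {..<m} = t1"
    unfolding join_def prod.case using t1 ge by blast
  have "m + j \<notin> t1" for j using t1 ge by blast
  then show "(+) m -` join m (t1, t2) = t2"
    unfolding join_def prod.case by (auto simp: image_iff)
qed

lemma join_bij: "bij_betw (join m) (Pow {..<m} \<times> Pow {..<m'}) (Pow {..<m + m'})"
proof (rule bij_betw_byWitness[where f' = "\<lambda>t. (t \<inter> {..<m}, (+) m -` t)"])
  show "\<forall>t\<in>Pow {..<m + m'}. join m (t \<inter> {..<m}, (+) m -` t) = t"
  proof
    fix t assume "t \<in> Pow {..<m + m'}"
    have "j \<in> (+) m ` ((+) m -` t) \<longleftrightarrow> j \<in> t \<and> \<not> j < m" for j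
      by (auto simp: image_iff) (metis le_Suc_ex not_le)
    then show "join m (t \<inter> {..<m}, (+) m -` t) = t" unfolding join_def set_eq_iff prod.case Un_iff Int_iff lessThan_iff by blast
  qed
  show "\<forall>a\<in>Pow {..<m} \<times> Pow {..<m'}. (join m a \<inter> {..<m}, (+) m -` join m a) = a"
    by (auto simp: join_restrict)
  show "join m ` (Pow {..<m} \<times> Pow {..<m'}) \<subseteq> Pow {..<m + m'}"
    unfolding join_def by (force simp: subset_iff)
qed auto

lemma diag_tensor_comp:
  assumes D: "pdiag n m D" "pdiag m k D'" and E: "pdiag n' m' E" "pdiag m' k' E'"
  shows "diag_comp (diag_tensor D E) (diag_tensor D' E') =
      diag_tensor (diag_comp D D') (diag_comp E E')"
    and "diag_loops (diag_tensor D E) (diag_tensor D' E') = diag_loops D D' + diag_loops E E'"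
proof -
  have *: "sat (diag_tensor D E) s (join m (t1, t2)) \<and> sat (diag_tensor D' E') (join m (t1, t2)) u
     \<longleftrightarrow> (sat D (s \<inter> {..<n}) t1 \<and> sat D' t1 (u \<inter> {..<k})) \<and>
        (sat E ((+) n -` s) t2 \<and> sat E' t2 ((+) k -` u))"
    if t: "t1 \<subseteq> {..<m}" for s u t1 t2
  proof -
    have "sat D s (join m (t1, t2)) \<longleftrightarrow> sat D (s \<inter> {..<n}) t1"
      using sat_restrict[OF D(1), of s "join m (t1, t2)"] by (simp add: join_restrict t)
    moreover have "sat D' (join m (t1, t2)) u \<longleftrightarrow> sat D' t1 (u \<inter> {..<k})"
      using sat_restrict[OF D(2), of "join m (t1, t2)" u] by (simp add: join_restrict t)
    ultimately show ?thesis by (auto simp: sat_tensor[OF D(1)] sat_tensor[OF D(2)] join_restrict t)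
  qed
  \<comment> \<open>Middle colourings of the tensor product are pairs of middle colourings of the
    factors. Nonemptiness of these sets gives the first claim, their cardinality the second.\<close>
  have set_eq: "{t. t \<subseteq> {..<m + m'} \<and> sat (diag_tensor D E) s t \<and> sat (diag_tensor D' E') t u}
     = join m ` ({t. t \<subseteq> {..<m} \<and> sat D (s \<inter> {..<n}) t \<and> sat D' t (u \<inter> {..<k})} \<times>
        {t. t \<subseteq> {..<m'} \<and> sat E ((+) n -` s) t \<and> sat E' t ((+) k -` u)})" (is "?L = join m ` ?R") for s u
  proof (rule set_eqI)
    fix t
    show "t \<in> ?L \<longleftrightarrow> t \<in> join m ` ?R"
    proof
      assume t: "t \<in> ?L"
      then have "t \<in> join m ` (Pow {..<m} \<times> Pow {..<m'})"
        using bij_betw_imp_surj_on[OF join_bij[of m m']] by simp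
      then obtain t1 t2 where t': "t1 \<subseteq> {..<m}" "t2 \<subseteq> {..<m'}" "t = join m (t1, t2)"
        unfolding image_iff by blast
      then have "(t1, t2) \<in> ?R" using t *[OF t'(1), of s t2 u] by simp
      then show "t \<in> join m ` ?R" unfolding t'(3) by (rule imageI)
    next
      assume "t \<in> join m ` ?R"
      then obtain t1 t2 where t: "(t1, t2) \<in> ?R" "t = join m (t1, t2)" unfolding image_iff by blast
      then have "(t1, t2) \<in> Pow {..<m} \<times> Pow {..<m'}" by simp
      then have "t \<in> Pow {..<m + m'}" unfolding t(2)
        using bij_betw_imp_surj_on[OF join_bij[of m m']] by blast
      moreover have "t1 \<subseteq> {..<m}" using t(1) by simp
      ultimately show "t \<in> ?L" using t *[of t1 s t2 u] by simp
    qed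
  qed
  show "diag_comp (diag_tensor D E) (diag_tensor D' E') =
      diag_tensor (diag_comp D D') (diag_comp E E')"
  proof (rule diag_comp_eqI[OF pdiag_tensor[OF D(1) E(1)] pdiag_tensor[OF D(2) E(2)]
        pdiag_tensor[OF pdiag_comp[OF D] pdiag_comp[OF E]]])
    fix s u assume s: "s \<subseteq> {..<n + n'}" and u: "u \<subseteq> {..<k + k'}"
    have "(\<exists>t\<subseteq>{..<m + m'}. sat (diag_tensor D E) s t \<and> sat (diag_tensor D' E') t u) \<longleftrightarrow>
       (\<exists>t\<subseteq>{..<m}. sat D (s \<inter> {..<n}) t \<and> sat D' t (u \<inter> {..<k})) \<and>
       (\<exists>t\<subseteq>{..<m'}. sat E ((+) n -` s) t \<and> sat E' t ((+) k -` u))"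
    proof -
      have "(\<exists>t\<subseteq>{..<m + m'}. sat (diag_tensor D E) s t \<and> sat (diag_tensor D' E') t u) \<longleftrightarrow>
        {t. t \<subseteq> {..<m + m'} \<and> sat (diag_tensor D E) s t \<and> sat (diag_tensor D' E') t u} \<noteq> {}"
        by blast
      also note set_eq[of s u]
      finally show ?thesis unfolding image_is_empty by (simp only: Times_empty) blast
    qed
    also have "\<dots> \<longleftrightarrow> sat (diag_comp D D') (s \<inter> {..<n}) (u \<inter> {..<k}) \<and>
        sat (diag_comp E E') ((+) n -` s) ((+) k -` u)"
      by (subst sat_comp_iff[OF D], simp, simp, subst sat_comp_iff[OF E])
        (use s u in \<open>auto simp: subset_iff\<close>)
    also have "\<dots> \<longleftrightarrow> sat (diag_tensor (diag_comp D D') (diag_comp E E')) s u"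
      by (simp add: sat_tensor[OF pdiag_comp[OF D]] sat_restrict[OF pdiag_comp[OF D]])
    finally show "sat (diag_tensor (diag_comp D D') (diag_comp E E')) s u \<longleftrightarrow>
      (\<exists>t\<subseteq>{..<m + m'}. sat (diag_tensor D E) s t \<and> sat (diag_tensor D' E') t u)" by simp
  qed
  have inj: "inj_on (join m) ({t. t \<subseteq> {..<m} \<and> sat D {} t \<and> sat D' t {}} \<times>
        {t. t \<subseteq> {..<m'} \<and> sat E {} t \<and> sat E' t {}})"
    by (rule inj_on_subset[OF bij_betw_imp_inj_on[OF join_bij[of m m']]]) auto
  have "(2::nat) ^ diag_loops (diag_tensor D E) (diag_tensor D' E') =
     2 ^ (diag_loops D D' + diag_loops E E')"
    unfolding power_add card_loops[OF D, symmetric] card_loops[OF E, symmetric]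
      card_loops[OF pdiag_tensor[OF D(1) E(1)] pdiag_tensor[OF D(2) E(2)], symmetric]
      set_eq by (simp add: card_image[OF inj] card_cartesian_product)
  then show "diag_loops (diag_tensor D E) (diag_tensor D' E') = diag_loops D D' + diag_loops E E'"
    by simp
qed

subsection \<open>Caps\<close>

definition capd :: "nat \<Rightarrow> nat \<Rightarrow> diagram" where
  "capd n i = diag_tensor (diag_tensor (diag_id i) (diag_cap 1)) (diag_id (n - 2 - i))"

abbreviation cupd :: "nat \<Rightarrow> nat \<Rightarrow> diagram" where
  "cupd n i \<equiv> diag_flip (capd n i)"

text \<open>The increasing map that leaves a gap at \<open>i\<close> and \<open>Suc i\<close>, the
  two feet of a cap.\<close>

definition skip :: "nat \<Rightarrow> nat \<Rightarrow> nat" where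
  "skip i j = (if j < i then j else j + 2)"

lemma pdiag_capd:
  assumes "i \<le> n"
  shows "pdiag (n + 2) n (capd (n + 2) i)"
proof -
  have "i + 2 + (n + 2 - 2 - i) = n + 2" "i + 0 + (n + 2 - 2 - i) = n" using assms by auto
  then show ?thesis
    using pdiag_tensor[OF pdiag_tensor[OF pdiag_id pdiag_cap1(1)] pdiag_id, of i "n + 2 - 2 - i"]
    unfolding capd_def by metis
qed

lemma skip_vimage_sub: "i \<le> n \<Longrightarrow> s \<subseteq> {..<n + 2} \<Longrightarrow> skip i -` s \<subseteq> {..<n}"
proof
  fix j assume "i \<le> n" "s \<subseteq> {..<n + 2}" "j \<in> skip i -` s"
  then have "skip i j < n + 2" "i \<le> n" by auto
  then show "j \<in> {..<n}" by (simp add: skip_def split: if_splits)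
qed

lemma sat_capd:
  assumes i: "i \<le> n"
  shows "sat (capd (n + 2) i) s t \<longleftrightarrow>
    (i \<in> s \<longleftrightarrow> Suc i \<in> s) \<and> (\<forall>j<n. j \<in> t \<longleftrightarrow> skip i j \<in> s)"
proof -
  have "sat (capd (n + 2) i) s t \<longleftrightarrow> (s \<inter> {..<i} = t \<inter> {..<i}) \<and> (i \<in> s \<longleftrightarrow> Suc i \<in> s) \<and>
     (+) (i + 2) -` s \<inter> {..<n - i} = (+) i -` t \<inter> {..<n - i}"
    unfolding capd_def sat_tensor[OF pdiag_tensor[OF pdiag_id pdiag_cap1(1)]]
      sat_tensor[OF pdiag_id] sat_id sat_cap by simp
  also have "s \<inter> {..<i} = t \<inter> {..<i} \<longleftrightarrow> (\<forall>j<i. j \<in> t \<longleftrightarrow> skip i j \<in> s)"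
    by (auto simp: skip_def)
  also have "(+) (i + 2) -` s \<inter> {..<n - i} = (+) i -` t \<inter> {..<n - i} \<longleftrightarrow>
      (\<forall>j. i \<le> j \<and> j < n \<longrightarrow> (j \<in> t \<longleftrightarrow> skip i j \<in> s))" (is "?L \<longleftrightarrow> ?R")
  proof
    assume L: ?L
    show ?R
    proof (intro allI impI)
      fix j assume j: "i \<le> j \<and> j < n"
      then have "j - i \<in> {..<n - i}" by auto
      then have "j - i \<in> (+) (i + 2) -` s \<longleftrightarrow> j - i \<in> (+) i -` t" using L by blast
      then show "j \<in> t \<longleftrightarrow> skip i j \<in> s" using j by (simp add: skip_def)
    qed
  next
    assume R: ?R
    show ?L
    proof (rule set_eqI)
      fix j
      show "j \<in> (+) (i + 2) -` s \<inter> {..<n - i} \<longleftrightarrow> j \<in> (+) i -` t \<inter> {..<n - i}"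
        using R[rule_format, of "i + j"] by (auto simp: skip_def add_ac)
    qed
  qed
  finally have *: "sat (capd (n + 2) i) s t \<longleftrightarrow> (\<forall>j<i. j \<in> t \<longleftrightarrow> skip i j \<in> s) \<and>
     (i \<in> s \<longleftrightarrow> Suc i \<in> s) \<and> (\<forall>j. i \<le> j \<and> j < n \<longrightarrow> (j \<in> t \<longleftrightarrow> skip i j \<in> s))" .
  have "(\<forall>j<n. P j) \<longleftrightarrow> (\<forall>j<i. P j) \<and> (\<forall>j. i \<le> j \<and> j < n \<longrightarrow> P j)" for P
    using i by (meson less_le_trans not_le_imp_less)
  from this[of "\<lambda>j. j \<in> t \<longleftrightarrow> skip i j \<in> s"] show ?thesis unfolding * by argo
qed

lemma sat_capd_iff:
  assumes "i \<le> n" "s \<subseteq> {..<n + 2}" "t \<subseteq> {..<n}"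
  shows "sat (capd (n + 2) i) s t \<longleftrightarrow> (i \<in> s \<longleftrightarrow> Suc i \<in> s) \<and> t = skip i -` s"
proof -
  have "j < n" if "j \<in> t \<or> j \<in> skip i -` s" for j
    using that assms(3) skip_vimage_sub[OF assms(1,2)] by blast
  then have "(\<forall>j<n. j \<in> t \<longleftrightarrow> skip i j \<in> s) \<longleftrightarrow> t = skip i -` s"
    unfolding set_eq_iff vimage_eq by metis
  then show ?thesis unfolding sat_capd[OF assms(1)] by (simp only:)
qed

text \<open>The innermost of the nested arcs, joining \<open>c\<close> and \<open>Suc c\<close>, is
  peeled off first. In this order \<open>JW_partial_trace\<close> closes its strands.\<close>

lemma diag_cap_Suc:
  "diag_comp (diag_tensor (diag_tensor (diag_id c) (diag_cap 1)) (diag_id c)) (diag_cap c) =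
     diag_cap (Suc c)" (is "diag_comp ?A _ = _")
  "diag_loops (diag_tensor (diag_tensor (diag_id c) (diag_cap 1)) (diag_id c)) (diag_cap c) = 0"
proof -
  have A: "capd (2 * c + 2) c = ?A" by (simp add: capd_def)
  have pA: "pdiag (2 * c + 2) (2 * c) ?A" using pdiag_capd[of c "2 * c"] A by simp
  have pS: "pdiag (2 * c + 2) 0 (diag_cap (Suc c))" using pdiag_cap[of "Suc c"] by simp
  have satA: "sat ?A s t \<longleftrightarrow> (c \<in> s \<longleftrightarrow> Suc c \<in> s) \<and> t = skip c -` s"
    if "s \<subseteq> {..<2 * c + 2}" "t \<subseteq> {..<2 * c}" for s t
    using sat_capd_iff[of c "2 * c" s t] that A by simp
  show "diag_comp ?A (diag_cap c) = diag_cap (Suc c)"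
  proof (rule diag_comp_eqI[OF pA pdiag_cap pS])
    fix s u :: "nat set" assume s: "s \<subseteq> {..<2 * c + 2}"
    have sub: "skip c -` s \<subseteq> {..<2 * c}" using skip_vimage_sub[OF _ s, of c] by simp
    have "sat (diag_cap (Suc c)) s u \<longleftrightarrow>
      (c \<in> s \<longleftrightarrow> Suc c \<in> s) \<and> (\<forall>i<c. i \<in> s \<longleftrightarrow> 2 * Suc c - 1 - i \<in> s)"
      unfolding sat_cap by (auto simp: less_Suc_eq)
    also have "\<dots> \<longleftrightarrow> (c \<in> s \<longleftrightarrow> Suc c \<in> s) \<and> sat (diag_cap c) (skip c -` s) u"
    proof -
      have "skip c i = i \<and> skip c (2 * c - 1 - i) = 2 * Suc c - 1 - i" if "i < c" for i
        using that by (auto simp: skip_def)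
      then show ?thesis by (simp add: sat_cap)
    qed
    also have "\<dots> \<longleftrightarrow> (\<exists>t\<subseteq>{..<2 * c}. sat ?A s t \<and> sat (diag_cap c) t u)"
      using satA[OF s] sub by metis
    finally show "sat (diag_cap (Suc c)) s u \<longleftrightarrow>
      (\<exists>t\<subseteq>{..<2 * c}. sat ?A s t \<and> sat (diag_cap c) t u)" .
  qed
  show "diag_loops ?A (diag_cap c) = 0"
  proof (rule diag_loops_0I[OF pA pdiag_cap])
    fix t :: "nat set" assume "t \<subseteq> {..<2 * c}" "sat ?A {} t"
    then show "t = {}" using satA[of "{}" t] by blast
  qed
qed

lemma sat_cap_1: "sat (diag_cap 1) s t \<longleftrightarrow> (0 \<in> s \<longleftrightarrow> 1 \<in> s)"
  by (simp add: sat_cap)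

text \<open>A circle has the two colourings \<open>{}\<close> and \<open>{0, 1}\<close>, and 2 is
  the first power of 2.\<close>

lemma cup_cap_loop:
  "diag_comp (diag_flip (diag_cap 1)) (diag_cap 1) = diag_id 0"
  "diag_loops (diag_flip (diag_cap 1)) (diag_cap 1) = 1"
proof -
  have "sat (diag_flip (diag_cap 1)) s {} \<and> sat (diag_cap 1) {} u" for s u
    unfolding sat_flip sat_cap_1 by simp
  then show "diag_comp (diag_flip (diag_cap 1)) (diag_cap 1) = diag_id 0"
    by (intro diag_comp_eqI[OF pdiag_flip[OF pdiag_cap1(1)] pdiag_cap1(1) pdiag_id])
      (unfold sat_id, blast)
  have "{t. t \<subseteq> {..<2} \<and> sat (diag_flip (diag_cap 1)) {} t \<and> sat (diag_cap 1) t {}}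
      = {t. t \<subseteq> {0, 1} \<and> (0 \<in> t \<longleftrightarrow> 1 \<in> t)}"
    unfolding sat_flip sat_cap_1 by (auto simp: less_2_cases_iff)
  also have "\<dots> = {{}, {0, 1}}" by blast
  finally have "(2::nat) ^ diag_loops (diag_flip (diag_cap 1)) (diag_cap 1) = card {{}, {0, 1::nat}}"
    using card_loops[OF pdiag_flip[OF pdiag_cap1(1)] pdiag_cap1(1)] by simp
  also have "\<dots> = 2 ^ 1" by simp
  finally show "diag_loops (diag_flip (diag_cap 1)) (diag_cap 1) = 1" by (metis one_less_numeral_iff power_inject_exp semiring_norm(76))
qed

text \<open>Straightening a bent strand becomes a finite check on the colours of the three middle
  points.\<close>

lemma zigzag:
  "diag_comp (diag_tensor (diag_id 1) (diag_flip (diag_cap 1)))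
     (diag_tensor (diag_cap 1) (diag_id 1)) = diag_id 1" (is "diag_comp ?A ?B = _")
  "diag_loops (diag_tensor (diag_id 1) (diag_flip (diag_cap 1)))
     (diag_tensor (diag_cap 1) (diag_id 1)) = 0"
proof -
  have A: "pdiag 1 3 ?A" using pdiag_tensor[OF pdiag_id pdiag_flip[OF pdiag_cap1(1)], of 1]
    by (simp add: numeral_3_eq_3 numeral_2_eq_2)
  have B: "pdiag 3 1 ?B" using pdiag_tensor[OF pdiag_cap1(1) pdiag_id, of 1]
    by (simp add: numeral_3_eq_3 numeral_2_eq_2)
  have lt1: "s \<inter> {..<1} = t \<inter> {..<1} \<longleftrightarrow> (0 \<in> s \<longleftrightarrow> 0 \<in> t)" for s t :: "nat set" by auto
  have sA: "sat ?A s t \<longleftrightarrow> (0 \<in> s \<longleftrightarrow> 0 \<in> t) \<and> (1 \<in> t \<longleftrightarrow> 2 \<in> t)" for s t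
    unfolding sat_tensor[OF pdiag_id] sat_id sat_flip sat_cap_1 lt1 by (simp add: numeral_2_eq_2)
  have sB: "sat ?B s t \<longleftrightarrow> (0 \<in> t \<longleftrightarrow> 2 \<in> s) \<and> (0 \<in> s \<longleftrightarrow> 1 \<in> s)" for s t
    unfolding sat_tensor[OF pdiag_cap1(1)] sat_id sat_flip sat_cap_1 lt1 by auto
  show "diag_comp ?A ?B = diag_id 1"
  proof (rule diag_comp_eqI[OF A B pdiag_id])
    fix s u :: "nat set"
    show "sat (diag_id 1) s u \<longleftrightarrow> (\<exists>t\<subseteq>{..<3}. sat ?A s t \<and> sat ?B t u)"
    proof
      assume "sat (diag_id 1) s u"
      then have "sat ?A s (if 0 \<in> s then {0, 1, 2} else {}) \<and> sat ?B (if 0 \<in> s then {0, 1, 2} else {}) u"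
        unfolding sA sB sat_id lt1 by simp
      moreover have "(if 0 \<in> s then {0, 1, 2} else {}) \<subseteq> {..<3::nat}" by auto
      ultimately show "\<exists>t\<subseteq>{..<3}. sat ?A s t \<and> sat ?B t u" by blast
    qed (unfold sA sB sat_id lt1, blast)
  qed
  show "diag_loops ?A ?B = 0"
  proof (rule diag_loops_0I[OF A B])
    fix t :: "nat set" assume t: "t \<subseteq> {..<3}" "sat ?A {} t" "sat ?B t {}"
    then have "0 \<notin> t" "1 \<notin> t" "2 \<notin> t" unfolding sA sB by auto
    moreover have "{..<3} = {0, 1, 2::nat}" by auto
    ultimately show "t = {}" using t(1) by auto
  qed
qed

subsection \<open>Noncrossing matchings\<close>

text \<open>The position function is a parameter so that one theory covers diagrams, with
  \<open>boundary_pos\<close>, and matchings of points on a line, with \<open>id\<close>.\<close>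

definition ncmatch :: "('p \<Rightarrow> nat) \<Rightarrow> 'p set \<Rightarrow> 'p set set \<Rightarrow> bool" where
  "ncmatch f A M \<longleftrightarrow> partition_on A M \<and> (\<forall>B\<in>M. card B = 2) \<and>
     \<not> (\<exists>a b c d. {a, b} \<in> M \<and> {c, d} \<in> M \<and> f a < f c \<and> f c < f b \<and> f b < f d)"

lemma diagrams_eq: "D \<in> diagrams n m \<longleftrightarrow> ncmatch (boundary_pos n m) ({..<n} <+> {..<m}) D"
  by (simp add: diagrams_def ncmatch_def)

lemma ncmatch_noncrossing:
  "ncmatch f A M \<Longrightarrow> {a, b} \<in> M \<Longrightarrow> {c, d} \<in> M \<Longrightarrow> \<not> (f a < f c \<and> f c < f b \<and> f b < f d)"
  unfolding ncmatch_def by blast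

lemma ncmatch_strand:
  assumes "ncmatch f A M" "B \<in> M" "x \<in> B"
  obtains y where "B = {x, y}" "x \<noteq> y" "x \<in> A" "y \<in> A"
proof -
  have "card B = 2" using assms unfolding ncmatch_def by blast
  then obtain u v where uv: "B = {u, v}" "u \<noteq> v" by (meson card_2_iff)
  have "B \<subseteq> A" using assms unfolding ncmatch_def partition_on_def by blast
  then show ?thesis using uv assms(3) that by fastforce
qed

lemma ncmatch_nonempty: "ncmatch f A M \<Longrightarrow> B \<in> M \<Longrightarrow> \<exists>x. x \<in> B"
  unfolding ncmatch_def partition_on_def by (metis ex_in_conv)

lemma ncmatch_sub: "ncmatch f A M \<Longrightarrow> B \<in> M \<Longrightarrow> B \<subseteq> A"
  unfolding ncmatch_def partition_on_def by blast

lemma ncmatch_cover: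
  assumes "ncmatch f A M" "x \<in> A"
  obtains y where "{x, y} \<in> M" "x \<noteq> y" "y \<in> A"
proof -
  obtain B where "B \<in> M" "x \<in> B" using assms unfolding ncmatch_def partition_on_def by blast
  then show ?thesis using ncmatch_strand[OF assms(1)] that by metis
qed

lemma ncmatch_unique:
  assumes "ncmatch f A M" "B \<in> M" "C \<in> M" "x \<in> B" "x \<in> C"
  shows "B = C"
  using assms unfolding ncmatch_def partition_on_def disjoint_def by (metis disjoint_iff)

lemma ncmatch_partner_unique:
  assumes "ncmatch f A M" "{x, y} \<in> M" "{x, z} \<in> M"
  shows "y = z"
  using ncmatch_unique[OF assms, of x] ncmatch_strand[OF assms(1,2), of x]
  by (metis doubleton_eq_iff insertI1)

lemma ncmatchI:
  assumes "\<And>B. B \<in> M \<Longrightarrow> \<exists>x y. B = {x, y} \<and> x \<noteq> y \<and> x \<in> A \<and> y \<in> A"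
    and "\<And>x. x \<in> A \<Longrightarrow> \<exists>B\<in>M. x \<in> B"
    and "\<And>B C x. B \<in> M \<Longrightarrow> C \<in> M \<Longrightarrow> x \<in> B \<Longrightarrow> x \<in> C \<Longrightarrow> B = C"
    and "\<And>a b c d. {a, b} \<in> M \<Longrightarrow> {c, d} \<in> M \<Longrightarrow> f a < f c \<Longrightarrow> f c < f b \<Longrightarrow> f b < f d \<Longrightarrow> False"
  shows "ncmatch f A M"
  unfolding ncmatch_def
proof (intro conjI)
  show "partition_on A M"
  proof (rule partition_onI)
    show "\<Union>M = A"
    proof
      show "\<Union>M \<subseteq> A" using assms(1) by fastforce
      show "A \<subseteq> \<Union>M" using assms(2) by blast
    qed
    show "{} \<notin> M" using assms(1) by blast
    fix p q assume "p \<in> M" "q \<in> M" "p \<noteq> q"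
    then show "disjnt p q" using assms(3) unfolding disjnt_def by blast
  qed
  show "\<forall>B\<in>M. card B = 2" using assms(1) by (metis card_2_iff)
  show "\<not> (\<exists>a b c d. {a, b} \<in> M \<and> {c, d} \<in> M \<and> f a < f c \<and> f c < f b \<and> f b < f d)"
    using assms(4) by blast
qed

lemma skip_less_iff: "skip i x < skip i y \<longleftrightarrow> x < y"
  by (auto simp: skip_def)

lemma skip_not_pair: "skip i x \<noteq> i" "skip i x \<noteq> Suc i"
  by (auto simp: skip_def)

text \<open>The arc from \<open>z\<close> to \<open>w\<close> ends at neither \<open>p\<close> nor
  \<open>Suc p\<close>, so these two neighbours lie on the same side of it. Noncrossing puts
  \<open>a\<close> on the side of \<open>p\<close> and \<open>b\<close> on the side of
  \<open>Suc p\<close>; hence the fused arc from \<open>a\<close> to \<open>b\<close> stays on one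
  side as well.\<close>

lemma crossing_arith:
  fixes a b z w p :: nat
  assumes a: "\<not> (a < z \<and> z < p \<and> p < w)" "\<not> (p < z \<and> z < a \<and> a < w)"
    "\<not> (z < a \<and> a < w \<and> w < p)" "\<not> (z < p \<and> p < w \<and> w < a)"
    and b: "\<not> (b < z \<and> z < Suc p \<and> Suc p < w)" "\<not> (Suc p < z \<and> z < b \<and> b < w)"
    "\<not> (z < b \<and> b < w \<and> w < Suc p)" "\<not> (z < Suc p \<and> Suc p < w \<and> w < b)"
    and zw: "z \<noteq> p" "z \<noteq> Suc p" "w \<noteq> p" "w \<noteq> Suc p"
  shows "\<not> (a < z \<and> z < b \<and> b < w)" "\<not> (b < z \<and> z < a \<and> a < w)"
    "\<not> (z < a \<and> a < w \<and> w < b)" "\<not> (z < b \<and> b < w \<and> w < a)"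
proof -
  consider "Suc p < z" "p < z" | "z < p" "z < Suc p" "p < w" "Suc p < w"
    | "z < p" "w < p" "z < Suc p" "w < Suc p"
    using zw by linarith
  note cases = this
  show "\<not> (a < z \<and> z < b \<and> b < w)" by (cases rule: cases) (use a b in auto)
  show "\<not> (b < z \<and> z < a \<and> a < w)" by (cases rule: cases) (use a b in auto)
  show "\<not> (z < a \<and> a < w \<and> w < b)" by (cases rule: cases) (use a b in auto)
  show "\<not> (z < b \<and> b < w \<and> w < a)" by (cases rule: cases) (use a b in auto)
qed

text \<open>Inserting and contracting a pair of adjacent points \<open>P\<close>, \<open>Q\<close>: the map \<open>\<sigma>\<close> embeds the
  remaining points.\<close>

locale adjacent_pair =
  fixes f' :: "'p \<Rightarrow> nat" and A' :: "'p set" and f :: "'p \<Rightarrow> nat" and A :: "'p set"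
    and \<sigma> :: "'p \<Rightarrow> 'p" and P Q :: 'p and p :: nat
  assumes inj: "inj \<sigma>" and A: "\<And>x. \<sigma> x \<in> A \<longleftrightarrow> x \<in> A'"
    and range: "A - {P, Q} \<subseteq> range \<sigma>" and PQ: "P \<notin> range \<sigma>" "Q \<notin> range \<sigma>" "P \<noteq> Q" "P \<in> A" "Q \<in> A"
    and fP: "f P = p" and fQ: "f Q = Suc p"
    and f: "\<And>x. x \<in> A' \<Longrightarrow> f (\<sigma> x) = skip p (f' x)"
begin

definition ins :: "'p set set \<Rightarrow> 'p set set" where
  "ins M = insert {P, Q} ((`) \<sigma> ` M)"

text \<open>The effect of gluing an arc onto \<open>P\<close> and \<open>Q\<close>: the strands
  ending there fuse into one. If \<open>{P, Q}\<close> is itself a strand, the leftover is empty and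
  is discarded, which is where a closed loop disappears.\<close>

definition contr :: "'p set set \<Rightarrow> 'p set set" where
  "contr M = (-`) \<sigma> ` ({B \<in> M. P \<notin> B \<and> Q \<notin> B} \<union> ({\<Union>{B \<in> M. P \<in> B \<or> Q \<in> B} - {P, Q}} - {{}}))"

lemma in_A: "x \<in> A \<Longrightarrow> x \<noteq> P \<Longrightarrow> x \<noteq> Q \<Longrightarrow> \<exists>y\<in>A'. x = \<sigma> y"
  using range A by blast

lemma ncmatch_ins:
  assumes M: "ncmatch f' A' M"
  shows "ncmatch f A (ins M)"
proof (rule ncmatchI)
  fix B assume "B \<in> ins M"
  then consider "B = {P, Q}" | C where "C \<in> M" "B = \<sigma> ` C" by (auto simp: ins_def)
  then show "\<exists>x y. B = {x, y} \<and> x \<noteq> y \<and> x \<in> A \<and> y \<in> A"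
  proof cases
    case 1
    then show ?thesis using PQ by blast
  next
    case 2
    then obtain x where "x \<in> C" using ncmatch_nonempty[OF M] by blast
    then obtain y where "C = {x, y}" "x \<noteq> y" "x \<in> A'" "y \<in> A'"
      using ncmatch_strand[OF M 2(1)] by metis
    then have "B = {\<sigma> x, \<sigma> y} \<and> \<sigma> x \<noteq> \<sigma> y \<and> \<sigma> x \<in> A \<and> \<sigma> y \<in> A"
      using 2 A inj by (auto simp: inj_def)
    then show ?thesis by blast
  qed
next
  fix x assume x: "x \<in> A"
  show "\<exists>B\<in>ins M. x \<in> B"
  proof (cases "x = P \<or> x = Q")
    case True
    then show ?thesis by (auto simp: ins_def)
  next
    case False
    then obtain y where y: "y \<in> A'" "x = \<sigma> y" using in_A x by blast
    obtain z where "{y, z} \<in> M" using ncmatch_cover[OF M y(1)] by blast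
    then have "\<sigma> ` {y, z} \<in> ins M" unfolding ins_def by (intro insertI2 imageI)
    moreover have "x \<in> \<sigma> ` {y, z}" using y by simp
    ultimately show ?thesis by (rule rev_bexI)
  qed
next
  fix B C x assume "B \<in> ins M" "C \<in> ins M" "x \<in> B" "x \<in> C"
  moreover have "B' = C'" if st: "B' \<in> M" "C' \<in> M" "x \<in> \<sigma> ` B'" "x \<in> \<sigma> ` C'" for B' C'
  proof -
    obtain u where u: "x = \<sigma> u" "u \<in> B'" using st(3) by blast
    then have "u \<in> C'" using st(4) inj by (simp add: inj_image_mem_iff)
    then show ?thesis using ncmatch_unique[OF M st(1,2)] u(2) by blast
  qed
  moreover have "B' = {P, Q} \<or> (\<exists>B''\<in>M. B' = \<sigma> ` B'' \<and> P \<notin> B' \<and> Q \<notin> B')" if "B' \<in> ins M" for B'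
    using that PQ(1,2) unfolding ins_def by blast
  ultimately show "B = C" by (metis empty_iff insert_iff)
next
  fix a b c d
  assume *: "{a, b} \<in> ins M" "{c, d} \<in> ins M" "f a < f c" "f c < f b" "f b < f d"
  have ab: "\<exists>a' b'. a = \<sigma> a' \<and> b = \<sigma> b' \<and> {a', b'} \<in> M" if st: "{a, b} \<in> ins M" "{a, b} \<noteq> {P, Q}" for a b
  proof -
    obtain C where C: "C \<in> M" "{a, b} = \<sigma> ` C" using st unfolding ins_def by blast
    then obtain a' b' where "a' \<in> C" "b' \<in> C" "a = \<sigma> a'" "b = \<sigma> b'" by (metis imageE insert_iff)
    moreover have "C = {a', b'}"
    proof -
      have "x = a' \<or> x = b'" if "x \<in> C" for x
      proof -
        have "\<sigma> x \<in> {a, b}" using C that by auto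
        then show ?thesis using calculation inj by (auto simp: inj_def)
      qed
      then show ?thesis using calculation by blast
    qed
    ultimately show ?thesis using C by blast
  qed
  \<comment> \<open>A strand crossing \<open>{P, Q}\<close> would need an end at a position strictly
    between \<open>p\<close> and \<open>Suc p\<close>; the same holds for \<open>{c, d}\<close>
    below.\<close>
  have "{a, b} \<noteq> {P, Q}" using * fP fQ by (auto simp: doubleton_eq_iff)
  then obtain a' b' where 1: "a = \<sigma> a'" "b = \<sigma> b'" "{a', b'} \<in> M" using ab *(1) by blast
  then have A1: "a' \<in> A'" "b' \<in> A'" using ncmatch_sub[OF M] by blast+
  have "{c, d} \<noteq> {P, Q}"
    using * fP fQ f[OF A1(1)] f[OF A1(2)] 1 skip_not_pair[of p "f' b'"]
    by (auto simp: doubleton_eq_iff)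
  then obtain c' d' where 2: "c = \<sigma> c'" "d = \<sigma> d'" "{c', d'} \<in> M" using ab *(2) by blast
  then have A2: "c' \<in> A'" "d' \<in> A'" using ncmatch_sub[OF M] by blast+
  show False
    using ncmatch_noncrossing[OF M 1(3) 2(3)] *(3-5) A1 A2 by (simp add: 1 2 f skip_less_iff)
qed

lemma contr_cases:
  assumes M: "ncmatch f A M"
  obtains "{P, Q} \<in> M" "contr M = (-`) \<sigma> ` (M - {{P, Q}})"
  | a b where "{P, \<sigma> a} \<in> M" "{Q, \<sigma> b} \<in> M" "a \<in> A'" "b \<in> A'" "a \<noteq> b"
    "contr M = insert {a, b} ((-`) \<sigma> ` (M - {{P, \<sigma> a}, {Q, \<sigma> b}}))"
proof -
  obtain x where x: "{P, x} \<in> M" "P \<noteq> x" "x \<in> A" using ncmatch_cover[OF M PQ(4)] by blast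
  obtain y where y: "{Q, y} \<in> M" "Q \<noteq> y" "y \<in> A" using ncmatch_cover[OF M PQ(5)] by blast
  have P: "P \<in> B \<longleftrightarrow> B = {P, x}" if "B \<in> M" for B
    using ncmatch_unique[OF M that x(1), of P] by blast
  have Q: "Q \<in> B \<longleftrightarrow> B = {Q, y}" if "B \<in> M" for B
    using ncmatch_unique[OF M that y(1), of Q] by blast
  have 1: "{B \<in> M. P \<notin> B \<and> Q \<notin> B} = M - {{P, x}, {Q, y}}" using P Q by blast
  have 2: "{B \<in> M. P \<in> B \<or> Q \<in> B} = {{P, x}, {Q, y}}" using P Q x y by blast
  show ?thesis
  proof (cases "x = Q")
    case True
    then have "{Q, y} = {P, x}" using P[OF y(1)] Q[OF x(1)] by blast
    then have "y = P" using True PQ by (metis doubleton_eq_iff)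
    then have PQe: "{Q, y} = {P, Q}" "{P, x} = {P, Q}" using True by auto
    have "contr M = (-`) \<sigma> ` (M - {{P, Q}})"
      unfolding contr_def 1 2 PQe by (intro arg_cong[of _ _ "(`) ((-`) \<sigma>)"]) auto
    then show ?thesis using that(1) x True by simp
  next
    case False
    then have yP: "y \<noteq> P" using Q[OF x(1)] P[OF y(1)] y x(2) by blast
    obtain a where a: "x = \<sigma> a" "a \<in> A'" using in_A x False by blast
    obtain b where b: "y = \<sigma> b" "b \<in> A'" using in_A y yP by blast
    have xy: "x \<noteq> y"
    proof
      assume "x = y"
      then have "{P, x} = {Q, y}" using ncmatch_unique[OF M x(1) y(1), of x] by blast
      then show False using PQ(3) False by blast
    qed
    then have ab: "a \<noteq> b" using a b by auto
    have "\<Union>{{P, x}, {Q, y}} - {P, Q} = {x, y}" using False yP x(2) y(2) by blast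
    moreover have "\<sigma> -` {x, y} = {a, b}" using a b inj by (auto simp: inj_def)
    ultimately have "contr M = insert {a, b} ((-`) \<sigma> ` (M - {{P, x}, {Q, y}}))"
      unfolding contr_def 1 2 by auto
    then show ?thesis using that(2)[of a b] x y a b ab by blast
  qed
qed

lemma vimage_strand: "\<sigma> -` {\<sigma> x, \<sigma> y} = {x, y}"
  using inj by (auto simp: inj_def)

lemma vimage_block:
  assumes M: "ncmatch f A M" and B: "B \<in> M" "P \<notin> B" "Q \<notin> B"
  obtains x y where "B = {\<sigma> x, \<sigma> y}" "\<sigma> -` B = {x, y}" "x \<noteq> y" "x \<in> A'" "y \<in> A'"
proof -
  obtain u where "u \<in> B" using ncmatch_nonempty[OF M B(1)] by blast
  then obtain v where uv: "B = {u, v}" "u \<noteq> v" "u \<in> A" "v \<in> A"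
    using ncmatch_strand[OF M B(1)] by metis
  obtain x where x: "u = \<sigma> x" "x \<in> A'" using in_A uv B by blast
  obtain y where y: "v = \<sigma> y" "y \<in> A'" using in_A uv B by blast
  show ?thesis using that[of x y] uv x y vimage_strand by blast
qed

lemma ncmatch_contr:
  assumes M: "ncmatch f A M"
  shows "ncmatch f' A' (contr M)"
  using M
proof (cases rule: contr_cases)
  case 1
  have PQ_notin: "P \<notin> B \<and> Q \<notin> B" if "B \<in> M - {{P, Q}}" for B
    using ncmatch_unique[OF M 1(1), of B] that by blast
  have strand: "{\<sigma> x, \<sigma> y} \<in> M" "x \<in> A'" "y \<in> A'" if st: "{x, y} \<in> contr M" for x y
  proof -
    obtain B where B: "B \<in> M - {{P, Q}}" "{x, y} = \<sigma> -` B" using st unfolding 1(2) by blast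
    then obtain u v where uv: "B = {\<sigma> u, \<sigma> v}" "\<sigma> -` B = {u, v}" "u \<in> A'" "v \<in> A'"
      using vimage_block[OF M] PQ_notin by (metis DiffD1)
    then have "{\<sigma> x, \<sigma> y} = B" using B(2) by (metis doubleton_eq_iff)
    then show "{\<sigma> x, \<sigma> y} \<in> M" using B(1) by simp
    have "x \<in> {u, v}" "y \<in> {u, v}" using B(2) uv(2) by blast+
    then show "x \<in> A'" "y \<in> A'" using uv(3,4) by blast+
  qed
  show ?thesis
  proof (rule ncmatchI)
    fix B assume "B \<in> contr M"
    then obtain C where "C \<in> M - {{P, Q}}" "B = \<sigma> -` C" using 1(2) by auto
    then show "\<exists>x y. B = {x, y} \<and> x \<noteq> y \<and> x \<in> A' \<and> y \<in> A'"
      using vimage_block[OF M] PQ_notin by (metis DiffD1)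
  next
    fix x assume "x \<in> A'"
    then have sx: "\<sigma> x \<in> A" using A by simp
    obtain B where B: "B \<in> M" "\<sigma> x \<in> B" using ncmatch_cover[OF M sx] by blast
    then have "B \<noteq> {P, Q}" using PQ by auto
    then have "\<sigma> -` B \<in> contr M" unfolding 1(2) using B(1) by (intro imageI) simp
    then show "\<exists>B\<in>contr M. x \<in> B" using B(2) by (intro bexI[of _ "\<sigma> -` B"]) simp_all
  next
    fix B C x assume *: "B \<in> contr M" "C \<in> contr M" "x \<in> B" "x \<in> C"
    then obtain B' C' where "B' \<in> M" "C' \<in> M" "B = \<sigma> -` B'" "C = \<sigma> -` C'" unfolding 1(2) by blast
    then show "B = C" using * ncmatch_unique[OF M, of B' C' "\<sigma> x"] by auto
  next
    fix a b c d
    assume "{a, b} \<in> contr M" "{c, d} \<in> contr M" "f' a < f' c" "f' c < f' b" "f' b < f' d"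
    then show False
      using ncmatch_noncrossing[OF M strand(1) strand(1), of a b c d] strand(2,3)
      by (simp add: f skip_less_iff)
  qed
next
  case (2 a b)
  have BC: "B' = {a, b} \<or> (\<exists>C\<in>M - {{P, \<sigma> a}, {Q, \<sigma> b}}. B' = \<sigma> -` C)"
    if "B' \<in> contr M" for B' using that by (simp only: 2(6) insert_iff image_iff)
  have PQ_notin: "P \<notin> B \<and> Q \<notin> B \<and> \<sigma> a \<notin> B \<and> \<sigma> b \<notin> B"
    if "B \<in> M - {{P, \<sigma> a}, {Q, \<sigma> b}}" for B
    using ncmatch_unique[OF M 2(1), of B] ncmatch_unique[OF M 2(2), of B] that by blast
  have strand: "({\<sigma> x, \<sigma> y} \<in> M \<or> {x, y} = {a, b}) \<and> x \<in> A' \<and> y \<in> A'"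
    if st: "{x, y} \<in> contr M" for x y
  proof (cases "{x, y} = {a, b}")
    case True
    then show ?thesis using 2(3,4) by (metis doubleton_eq_iff)
  next
    case False
    then obtain B where B: "B \<in> M - {{P, \<sigma> a}, {Q, \<sigma> b}}" "{x, y} = \<sigma> -` B" using BC[OF st] False by blast
    then obtain u v where uv: "B = {\<sigma> u, \<sigma> v}" "\<sigma> -` B = {u, v}" "u \<in> A'" "v \<in> A'"
      using vimage_block[OF M] PQ_notin by (metis DiffD1)
    then have "{\<sigma> x, \<sigma> y} = B" using B(2) by (metis doubleton_eq_iff)
    then have "{\<sigma> x, \<sigma> y} \<in> M" using B(1) by simp
    moreover have "x \<in> {u, v}" "y \<in> {u, v}" using B(2) uv(2) by blast+
    ultimately show ?thesis using uv(3,4) by blast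
  qed
  show ?thesis
  proof (rule ncmatchI)
    fix B assume "B \<in> contr M"
    from BC[OF this] show "\<exists>x y. B = {x, y} \<and> x \<noteq> y \<and> x \<in> A' \<and> y \<in> A'"
    proof (elim disjE bexE)
      assume "B = {a, b}"
      then show ?thesis using 2(3-5) by (intro exI[of _ a] exI[of _ b]) simp
    next
      fix C assume C: "C \<in> M - {{P, \<sigma> a}, {Q, \<sigma> b}}" "B = \<sigma> -` C"
      then have "C \<in> M" "P \<notin> C" "Q \<notin> C" using PQ_notin by simp_all
      then obtain x y where "\<sigma> -` C = {x, y}" "x \<noteq> y" "x \<in> A'" "y \<in> A'"
        by (rule vimage_block[OF M])
      then show ?thesis using C(2) by (intro exI[of _ x] exI[of _ y]) simp
    qed
  next
    fix x assume "x \<in> A'"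
    then have sx: "\<sigma> x \<in> A" using A by simp
    obtain B where B: "B \<in> M" "\<sigma> x \<in> B" using ncmatch_cover[OF M sx] by blast
    show "\<exists>B\<in>contr M. x \<in> B"
    proof (cases "B = {P, \<sigma> a} \<or> B = {Q, \<sigma> b}")
      case True
      then have "\<sigma> x = \<sigma> a \<or> \<sigma> x = \<sigma> b" using B(2) PQ by auto
      then have "x \<in> {a, b}" using inj by (auto simp: inj_def)
      then show ?thesis unfolding 2(6) by (intro bexI[of _ "{a, b}"]) simp_all
    next
      case False
      then have "\<sigma> -` B \<in> contr M" unfolding 2(6) using B(1) by (intro insertI2 imageI) simp
      then show ?thesis using B(2) by (intro bexI[of _ "\<sigma> -` B"]) simp_all
    qed
  next
    fix B C x assume *: "B \<in> contr M" "C \<in> contr M" "x \<in> B" "x \<in> C"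
    have ab: "x \<notin> {a, b}" if "B' \<in> M - {{P, \<sigma> a}, {Q, \<sigma> b}}" "x \<in> \<sigma> -` B'" for B'
      using PQ_notin[OF that(1)] that(2) by auto
    have "B = {a, b} \<longleftrightarrow> C = {a, b}" using *(3,4) ab BC[OF *(1)] BC[OF *(2)] by metis
    moreover have "B = C" if ne: "B \<noteq> {a, b}" "C \<noteq> {a, b}"
    proof -
      obtain B' C' where "B' \<in> M" "C' \<in> M" "B = \<sigma> -` B'" "C = \<sigma> -` C'"
        using BC[OF *(1)] BC[OF *(2)] ne by blast
      then show "B = C" using * ncmatch_unique[OF M, of B' C' "\<sigma> x"] by auto
    qed
    ultimately show "B = C" by blast
  next
    fix x y z w
    assume *: "{x, y} \<in> contr M" "{z, w} \<in> contr M" "f' x < f' z" "f' z < f' y" "f' y < f' w"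
    have fs: "f (\<sigma> x) < f (\<sigma> z)" "f (\<sigma> z) < f (\<sigma> y)" "f (\<sigma> y) < f (\<sigma> w)"
      using *(3-5) strand[OF *(1)] strand[OF *(2)] by (simp_all add: f skip_less_iff)
    have np: "f (\<sigma> u) \<noteq> p" "f (\<sigma> u) \<noteq> Suc p" if "u \<in> A'" for u
      using that skip_not_pair by (simp_all add: f)
    \<comment> \<open>The fused strand \<open>{a, b}\<close> is the only new one. It comes from
      strands at the neighbouring positions \<open>p\<close> and \<open>Suc p\<close>, the situation
      of \<open>crossing_arith\<close>.\<close>
    have key: "\<not> (f (\<sigma> a) < f (\<sigma> z) \<and> f (\<sigma> z) < f (\<sigma> b) \<and> f (\<sigma> b) < f (\<sigma> w))"
        "\<not> (f (\<sigma> b) < f (\<sigma> z) \<and> f (\<sigma> z) < f (\<sigma> a) \<and> f (\<sigma> a) < f (\<sigma> w))"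
        "\<not> (f (\<sigma> z) < f (\<sigma> a) \<and> f (\<sigma> a) < f (\<sigma> w) \<and> f (\<sigma> w) < f (\<sigma> b))"
        "\<not> (f (\<sigma> z) < f (\<sigma> b) \<and> f (\<sigma> b) < f (\<sigma> w) \<and> f (\<sigma> w) < f (\<sigma> a))"
      if zw: "{\<sigma> z, \<sigma> w} \<in> M" "z \<in> A'" "w \<in> A'" for z w
    proof -
      have aP: "{\<sigma> a, P} \<in> M" and bQ: "{\<sigma> b, Q} \<in> M"
        using 2(1,2) by (simp_all add: insert_commute)
      note nc = ncmatch_noncrossing[OF M]
      show "\<not> (f (\<sigma> a) < f (\<sigma> z) \<and> f (\<sigma> z) < f (\<sigma> b) \<and> f (\<sigma> b) < f (\<sigma> w))"
        "\<not> (f (\<sigma> b) < f (\<sigma> z) \<and> f (\<sigma> z) < f (\<sigma> a) \<and> f (\<sigma> a) < f (\<sigma> w))"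
        "\<not> (f (\<sigma> z) < f (\<sigma> a) \<and> f (\<sigma> a) < f (\<sigma> w) \<and> f (\<sigma> w) < f (\<sigma> b))"
        "\<not> (f (\<sigma> z) < f (\<sigma> b) \<and> f (\<sigma> b) < f (\<sigma> w) \<and> f (\<sigma> w) < f (\<sigma> a))"
        using crossing_arith[of "f (\<sigma> a)" "f (\<sigma> z)" p "f (\<sigma> w)" "f (\<sigma> b)"]
          nc[OF aP zw(1)] nc[OF 2(1) zw(1)] nc[OF zw(1) aP] nc[OF zw(1) 2(1)]
          nc[OF bQ zw(1)] nc[OF 2(2) zw(1)] nc[OF zw(1) bQ] nc[OF zw(1) 2(2)]
          np[OF zw(2)] np[OF zw(3)]
        unfolding fP fQ by simp_all
    qed
    show False
    proof (cases "{x, y} = {a, b}")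
      case True
      show ?thesis
      proof (cases "{z, w} = {a, b}")
        case True
        then have "{x, y} = {z, w}" using \<open>{x, y} = {a, b}\<close> by simp
        then show ?thesis using fs by (auto simp: doubleton_eq_iff)
      next
        case False
        then have "{\<sigma> z, \<sigma> w} \<in> M" "z \<in> A'" "w \<in> A'" using strand[OF *(2)] by simp_all
        from key(1,2)[OF this] True fs show ?thesis by (auto simp: doubleton_eq_iff)
      qed
    next
      case False
      then have xy: "{\<sigma> x, \<sigma> y} \<in> M" "x \<in> A'" "y \<in> A'" using strand[OF *(1)] by auto
      show ?thesis
      proof (cases "{z, w} = {a, b}")
        case True
        from key(3,4)[OF xy] True fs show ?thesis by (auto simp: doubleton_eq_iff)
      next
        case False
        then have "{\<sigma> z, \<sigma> w} \<in> M" using strand[OF *(2)] by auto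
        then show ?thesis using ncmatch_noncrossing[OF M xy(1)] fs by blast
      qed
    qed
  qed
qed

text \<open>The counterpart of \<open>sat\<close> for an abstract type of points;
  \<open>closed_sat\<close> identifies the two.\<close>

definition closed :: "'p set set \<Rightarrow> 'p set \<Rightarrow> bool" where
  "closed M S \<longleftrightarrow> (\<forall>B\<in>M. \<forall>x\<in>B. \<forall>y\<in>B. x \<in> S \<longrightarrow> y \<in> S)"

lemma closed_ins: "closed (ins M) S \<longleftrightarrow> (P \<in> S \<longleftrightarrow> Q \<in> S) \<and> closed M (\<sigma> -` S)"
  unfolding closed_def ins_def by auto

text \<open>A colouring survives contraction iff \<open>P\<close> and \<open>Q\<close> can be given
  one common colour compatible with it. This has the shape of \<open>sat_comp_iff\<close> for a cup,
  which is how contraction is recognised as a composition.\<close>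

lemma closed_contr:
  assumes M: "ncmatch f A M" and S: "S \<subseteq> A'"
  shows "closed (contr M) S \<longleftrightarrow> (\<exists>T\<subseteq>A. (P \<in> T \<longleftrightarrow> Q \<in> T) \<and> \<sigma> -` T = S \<and> closed M T)"
proof
  assume "\<exists>T\<subseteq>A. (P \<in> T \<longleftrightarrow> Q \<in> T) \<and> \<sigma> -` T = S \<and> closed M T"
  then obtain T where T: "P \<in> T \<longleftrightarrow> Q \<in> T" "\<sigma> -` T = S" "closed M T" by blast
  have *: "\<sigma> y \<in> T" if "B \<in> M" "\<sigma> x \<in> B" "\<sigma> y \<in> B" "\<sigma> x \<in> T" for B x y
    using that T(3) unfolding closed_def by blast
  from M show "closed (contr M) S"
  proof (cases rule: contr_cases)
    case 1
    show ?thesis unfolding closed_def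
    proof (intro ballI impI)
      fix B x y assume B: "B \<in> contr M" "x \<in> B" "y \<in> B" "x \<in> S"
      then obtain C where "C \<in> M" "B = \<sigma> -` C" unfolding 1(2) by blast
      then have "\<sigma> y \<in> T" using *[of C x y] B unfolding T(2)[symmetric] by simp
      then show "y \<in> S" unfolding T(2)[symmetric] by simp
    qed
  next
    case (2 a b)
    have "P \<in> T \<longleftrightarrow> \<sigma> a \<in> T" using T(3) 2(1) unfolding closed_def by (metis insertCI)
    moreover have "Q \<in> T \<longleftrightarrow> \<sigma> b \<in> T" using T(3) 2(2) unfolding closed_def by (metis insertCI)
    ultimately have "\<sigma> a \<in> T \<longleftrightarrow> \<sigma> b \<in> T" using T(1) by simp
    note ab = this
    show ?thesis unfolding closed_def
    proof (intro ballI impI)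
      fix B x y assume B: "B \<in> contr M" "x \<in> B" "y \<in> B" "x \<in> S"
      then have "B = {a, b} \<or> (\<exists>C\<in>M - {{P, \<sigma> a}, {Q, \<sigma> b}}. B = \<sigma> -` C)"
        by (simp only: 2(6) insert_iff image_iff)
      then show "y \<in> S"
      proof (elim disjE bexE)
        assume "B = {a, b}"
        then have "x = a \<or> x = b" "y = a \<or> y = b" using B(2,3) by simp_all
        moreover have "\<sigma> x \<in> T" using B(4) unfolding T(2)[symmetric] by simp
        ultimately have "\<sigma> y \<in> T" using ab by metis
        then show ?thesis unfolding T(2)[symmetric] by simp
      next
        fix C assume "C \<in> M - {{P, \<sigma> a}, {Q, \<sigma> b}}" "B = \<sigma> -` C"
        then have "\<sigma> y \<in> T" using *[of C x y] B unfolding T(2)[symmetric] by simp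
        then show ?thesis unfolding T(2)[symmetric] by simp
      qed
    qed
  qed
next
  assume cl: "closed (contr M) S"
  from M show "\<exists>T\<subseteq>A. (P \<in> T \<longleftrightarrow> Q \<in> T) \<and> \<sigma> -` T = S \<and> closed M T"
  proof (cases rule: contr_cases)
    case 1
    \<comment> \<open>\<open>P\<close> and \<open>Q\<close> form a closed loop here, so either
      colour would do; they are left uncoloured.\<close>
    let ?T = "\<sigma> ` S"
    have "?T \<subseteq> A" using S A by auto
    moreover have "P \<notin> ?T" "Q \<notin> ?T" using PQ by auto
    moreover have "\<sigma> -` ?T = S" using inj by (simp add: inj_vimage_image_eq)
    moreover have "closed M ?T" unfolding closed_def
    proof (intro ballI impI)
      fix B x y assume B: "B \<in> M" "x \<in> B" "y \<in> B" "x \<in> ?T"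
      then have ne: "B \<noteq> {P, Q}" using PQ by auto
      then have "P \<notin> B" "Q \<notin> B" using ncmatch_unique[OF M B(1) 1(1)] by blast+
      then obtain u v where uv: "B = {\<sigma> u, \<sigma> v}" "\<sigma> -` B = {u, v}" by (rule vimage_block[OF M B(1)])
      have "\<sigma> -` B \<in> contr M" unfolding 1(2) using B(1) ne by (intro imageI) simp
      then have "u \<in> S \<longleftrightarrow> v \<in> S" 
        using cl[unfolded closed_def, rule_format, of "{u, v}"] unfolding uv(2) by (metis insertCI)
      moreover have "\<sigma> w \<in> ?T \<longleftrightarrow> w \<in> S" for w using inj by (rule inj_image_mem_iff)
      moreover have "x = \<sigma> u \<or> x = \<sigma> v" "y = \<sigma> u \<or> y = \<sigma> v" using B(2,3) uv(1) by auto
      ultimately show "y \<in> ?T" using B(4) by metis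
    qed
    ultimately show ?thesis by (intro exI[of _ ?T] conjI) simp_all
  next
    case (2 a b)
    \<comment> \<open>The strands force \<open>P\<close> to the colour of \<open>a\<close> and
      \<open>Q\<close> to that of \<open>b\<close>; these agree because \<open>{a, b}\<close> is a
      strand of the contraction.\<close>
    let ?T = "\<sigma> ` S \<union> (if a \<in> S then {P, Q} else {})"
    have T\<sigma>: "\<sigma> w \<in> ?T \<longleftrightarrow> w \<in> S" for w using inj PQ(1,2) by (auto simp: inj_image_mem_iff)
    have TPQ: "P \<in> ?T \<longleftrightarrow> a \<in> S" "Q \<in> ?T \<longleftrightarrow> a \<in> S" using PQ(1,2) by auto
    have "?T \<subseteq> A" using S A PQ(4,5) by auto
    moreover have "\<sigma> -` ?T = S" using T\<sigma> by blast
    moreover have "closed M ?T" unfolding closed_def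
    proof (intro ballI impI)
      have "{a, b} \<in> contr M" unfolding 2(6) by simp
      then have ab: "a \<in> S \<longleftrightarrow> b \<in> S"
        using cl[unfolded closed_def, rule_format, of "{a, b}"] by (metis insertCI)
      fix B x y assume B: "B \<in> M" "x \<in> B" "y \<in> B" "x \<in> ?T"
      show "y \<in> ?T"
      proof (cases "P \<in> B \<or> Q \<in> B")
        case True
        then have "B = {P, \<sigma> a} \<or> B = {Q, \<sigma> b}"
          using ncmatch_unique[OF M B(1) 2(1), of P] ncmatch_unique[OF M B(1) 2(2), of Q] by blast
        then show ?thesis
        proof
          assume "B = {P, \<sigma> a}"
          then have "x = P \<or> x = \<sigma> a" "y = P \<or> y = \<sigma> a" using B(2,3) by auto
          then show ?thesis using T\<sigma>[of a] TPQ B(4) by metis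
        next
          assume "B = {Q, \<sigma> b}"
          then have "x = Q \<or> x = \<sigma> b" "y = Q \<or> y = \<sigma> b" using B(2,3) by auto
          then show ?thesis using T\<sigma>[of b] TPQ B(4) ab by metis
        qed
      next
        case False
        then have "P \<notin> B" "Q \<notin> B" by simp_all
        then obtain u v where uv: "B = {\<sigma> u, \<sigma> v}" "\<sigma> -` B = {u, v}" by (rule vimage_block[OF M B(1)])
        have "B \<noteq> {P, \<sigma> a}" "B \<noteq> {Q, \<sigma> b}" using False by auto
        then have "\<sigma> -` B \<in> contr M" unfolding 2(6) using B(1) by (intro insertI2 imageI) simp
        then have "u \<in> S \<longleftrightarrow> v \<in> S" 
        using cl[unfolded closed_def, rule_format, of "{u, v}"] unfolding uv(2) by (metis insertCI)
        moreover have "x = \<sigma> u \<or> x = \<sigma> v" "y = \<sigma> u \<or> y = \<sigma> v" using B(2,3) uv(1) by auto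
        ultimately show ?thesis using B(4) T\<sigma> by metis
      qed
    qed
    ultimately show ?thesis using TPQ by (intro exI[of _ ?T] conjI) simp_all
  qed
qed

lemma ins_contr:
  assumes M: "ncmatch f A M" and PQM: "{P, Q} \<in> M"
  shows "ins (contr M) = M"
proof -
  have PQ_notin: "P \<notin> B \<and> Q \<notin> B" if "B \<in> M - {{P, Q}}" for B
    using ncmatch_unique[OF M PQM, of B] that by blast
  from M have c: "contr M = (-`) \<sigma> ` (M - {{P, Q}})"
  proof (cases rule: contr_cases)
    case (2 a b)
    have "{P, \<sigma> a} = {P, Q}" using ncmatch_unique[OF M 2(1) PQM, of P] by blast
    then show ?thesis using PQ by (metis doubleton_eq_iff rangeI)
  qed simp
  have "\<sigma> ` (\<sigma> -` B) = B" if "B \<in> M - {{P, Q}}" for B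
  proof -
    have BM: "B \<in> M" and n: "P \<notin> B" "Q \<notin> B" using PQ_notin[OF that] that by auto
    show ?thesis by (rule vimage_block[OF M BM n]) auto
  qed
  then have "(`) \<sigma> ` contr M = M - {{P, Q}}" unfolding c image_image by simp
  then show ?thesis using PQM by (auto simp: ins_def)
qed

end

subsection \<open>Planar diagrams form a category\<close>

lemma pdiag_diagrams: "D \<in> diagrams n m \<Longrightarrow> pdiag n m D"
  by (simp add: diagrams_def pdiag_def)

lemma diagramsI:
  assumes "pdiag n m D" "\<And>B. B \<in> D \<Longrightarrow> card B = 2"
    and "\<And>a b c d. {a, b} \<in> D \<Longrightarrow> {c, d} \<in> D \<Longrightarrow> boundary_pos n m a < boundary_pos n m c \<Longrightarrow>
          boundary_pos n m c < boundary_pos n m b \<Longrightarrow> boundary_pos n m b < boundary_pos n m d \<Longrightarrow> False"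
  shows "D \<in> diagrams n m"
  using assms unfolding diagrams_def pdiag_def by blast

lemma diagrams_noncrossing:
  assumes "D \<in> diagrams n m" "{a, b} \<in> D" "{c, d} \<in> D"
  shows "\<not> (boundary_pos n m a < boundary_pos n m c \<and>
          boundary_pos n m c < boundary_pos n m b \<and> boundary_pos n m b < boundary_pos n m d)"
  using assms unfolding diagrams_def by blast

lemma diagrams_card: "D \<in> diagrams n m \<Longrightarrow> B \<in> D \<Longrightarrow> card B = 2"
  unfolding diagrams_def by blast

lemma finite_diagrams: "finite (diagrams n m)"
proof -
  have "diagrams n m \<subseteq> Pow (Pow ({..<n} <+> {..<m}))"
    by (rule subsetI) (use pdiag_diagrams pdiag_sub in blast)
  then show ?thesis by (rule finite_subset) simp
qed

lemma boundary_pos_bij: "bij_betw (boundary_pos n m) ({..<n} <+> {..<m}) {..<n + m}"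
proof (rule bij_betw_byWitness[where f' = "\<lambda>p. if p < n then Inl p else Inr (n + m - 1 - p)"])
  show "\<forall>x\<in>{..<n} <+> {..<m}. (if boundary_pos n m x < n then Inl (boundary_pos n m x)
      else Inr (n + m - 1 - boundary_pos n m x)) = x"
  proof
    fix x assume "x \<in> {..<n} <+> {..<m}"
    then show "(if boundary_pos n m x < n then Inl (boundary_pos n m x)
      else Inr (n + m - 1 - boundary_pos n m x)) = x" by (cases x) auto
  qed
qed auto

text \<open>In boundary order the targets come after all sources, so the gap at \<open>i\<close>
  moves every target position up by two, just as \<open>skip i\<close> does.\<close>

lemma boundary_pos_adjacent:
  fixes i n m :: nat
  assumes "i \<le> n"
  shows "adjacent_pair (boundary_pos n m) ({..<n} <+> {..<m}) (boundary_pos (n + 2) m)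
    ({..<n + 2} <+> {..<m}) (map_sum (skip i) id) (Inl i) (Inl (Suc i)) i"
proof
  show "inj (map_sum (skip i) (id :: nat \<Rightarrow> nat))"
    by (rule sum.inj_map) (auto simp: inj_def skip_def split: if_splits)
  show "map_sum (skip i) id x \<in> {..<n + 2} <+> {..<m} \<longleftrightarrow> x \<in> {..<n} <+> {..<m}" for x
    using assms by (cases x) (auto simp: skip_def)
  show "({..<n + 2} <+> {..<m}) - {Inl i, Inl (Suc i)} \<subseteq> range (map_sum (skip i) id)"
  proof
    fix x :: "nat + nat" assume x: "x \<in> ({..<n + 2} <+> {..<m}) - {Inl i, Inl (Suc i)}"
    show "x \<in> range (map_sum (skip i) id)"
    proof (cases x)
      case (Inl j)
      then have "skip i (if j < i then j else j - 2) = j" using x by (auto simp: skip_def)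
      then have "map_sum (skip i) id (Inl (if j < i then j else j - 2)) = x" by (simp add: Inl)
      then show ?thesis by (metis rangeI)
    next
      case (Inr j)
      then have "map_sum (skip i) id (Inr j) = x" by simp
      then show ?thesis by (metis rangeI)
    qed
  qed
  have "map_sum (skip i) id x \<noteq> Inl i \<and> map_sum (skip i) id x \<noteq> Inl (Suc i)" for x :: "nat + nat"
    by (cases x) (simp_all add: skip_not_pair)
  then show "Inl i \<notin> range (map_sum (skip i) (id :: nat \<Rightarrow> nat))"
    "Inl (Suc i) \<notin> range (map_sum (skip i) (id :: nat \<Rightarrow> nat))" by (metis imageE)+
  show "boundary_pos (n + 2) m (map_sum (skip i) id x) = skip i (boundary_pos n m x)"
    if "x \<in> {..<n} <+> {..<m}" for x
    using assms by (cases x) (auto simp: skip_def)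
qed (use assms in auto)

lemma closed_sat:
  assumes "i \<le> (n::nat)"
  shows "adjacent_pair.closed D (s <+> t) \<longleftrightarrow> sat D s t"
proof -
  interpret adjacent_pair "boundary_pos n 0" "{..<n} <+> {..<0}" "boundary_pos (n + 2) 0"
    "{..<n + 2} <+> {..<0}" "map_sum (skip i) id" "Inl i" "Inl (Suc i)" i
    by (rule boundary_pos_adjacent[OF assms])
  show ?thesis by (simp only: closed_def sat_def)
qed

lemma vimage_skip_Plus: "map_sum (skip i) id -` (s <+> t) = (skip i -` s) <+> t"
proof (rule set_eqI)
  show "x \<in> map_sum (skip i) id -` (s <+> t) \<longleftrightarrow> x \<in> (skip i -` s) <+> t" for x
    by (cases x) simp_all
qed

text \<open>Composition with a single cup is contraction at two neighbouring points, hence stays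
  planar. Together with \<open>cap_comp_eq_ins\<close> this is the only place where planarity of a
  composite is checked by hand.\<close>

lemma cup_comp_eq_contr:
  assumes D: "D \<in> diagrams (n + 2) m" and i: "i \<le> n"
  shows "diag_comp (cupd (n + 2) i) D =
    adjacent_pair.contr (map_sum (skip i) id) (Inl i) (Inl (Suc i)) D"
    and "diag_comp (cupd (n + 2) i) D \<in> diagrams n m"
proof -
  interpret adjacent_pair "boundary_pos n m" "{..<n} <+> {..<m}" "boundary_pos (n + 2) m"
    "{..<n + 2} <+> {..<m}" "map_sum (skip i) id" "Inl i" "Inl (Suc i)" i
    by (rule boundary_pos_adjacent[OF i])
  have M: "ncmatch (boundary_pos (n + 2) m) ({..<n + 2} <+> {..<m}) D" using D by (simp only: diagrams_eq)
  have C: "contr D \<in> diagrams n m" unfolding diagrams_eq by (rule ncmatch_contr[OF M])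
  show eq: "diag_comp (cupd (n + 2) i) D = contr D"
  proof (rule diag_comp_eqI[OF pdiag_flip[OF pdiag_capd[OF i]] pdiag_diagrams[OF D] pdiag_diagrams[OF C]])
    fix s u :: "nat set" assume s: "s \<subseteq> {..<n}" and u: "u \<subseteq> {..<m}"
    have "sat (contr D) s u \<longleftrightarrow> (\<exists>T\<subseteq>{..<n + 2} <+> {..<m}. (Inl i \<in> T \<longleftrightarrow> Inl (Suc i) \<in> T) \<and>
        map_sum (skip i) id -` T = s <+> u \<and> closed D T)"
      unfolding closed_sat[OF i, symmetric] using s u by (intro closed_contr[OF M]) auto
    also have "\<dots> \<longleftrightarrow> (\<exists>t\<subseteq>{..<n + 2}. sat (cupd (n + 2) i) s t \<and> sat D t u)" (is "?L \<longleftrightarrow> ?R")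
    proof
      assume ?L
      then obtain T where T: "T \<subseteq> {..<n + 2} <+> {..<m}" "Inl i \<in> T \<longleftrightarrow> Inl (Suc i) \<in> T"
        "map_sum (skip i) id -` T = s <+> u" "closed D T" by blast
      define t where "t = Inl -` T"
      have mem: "x \<in> T \<longleftrightarrow> x \<in> t <+> Inr -` T" for x by (cases x) (simp_all add: t_def)
      then have Teq: "T = t <+> Inr -` T" by blast
      have "Inr -` T = u"
      proof (rule set_eqI)
        fix j
        have "j \<in> Inr -` T \<longleftrightarrow> Inr j \<in> map_sum (skip i) id -` T" by simp
        then show "j \<in> Inr -` T \<longleftrightarrow> j \<in> u" unfolding T(3) by simp
      qed
      then have Teq: "T = t <+> u" using Teq by simp
      have "s <+> u = (skip i -` t) <+> u" using T(3) unfolding Teq vimage_skip_Plus by simp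
      then have "s = skip i -` t" by (metis (no_types, lifting) in_Plus_iff(1) subsetI subset_antisym)
      moreover have tsub: "t \<subseteq> {..<n + 2}" using T(1) by (auto simp: t_def)
      moreover have "i \<in> t \<longleftrightarrow> Suc i \<in> t" using T(2) by (simp add: t_def)
      moreover have "sat D t u" using T(4) unfolding Teq closed_sat[OF i] .
      ultimately have "sat (cupd (n + 2) i) s t \<and> sat D t u"
        unfolding sat_flip using sat_capd_iff[OF i tsub s] by simp
      then show ?R using tsub by blast
    next
      assume ?R
      then obtain t where t: "t \<subseteq> {..<n + 2}" "sat (capd (n + 2) i) t s" "sat D t u"
        unfolding sat_flip by blast
      have "(i \<in> t \<longleftrightarrow> Suc i \<in> t) \<and> s = skip i -` t" using sat_capd_iff[OF i t(1) s] t(2) by simp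
      then show ?L using t(1,3) u
        by (intro exI[of _ "t <+> u"] conjI) (auto simp: vimage_skip_Plus closed_sat[OF i])
    qed
    finally show "sat (contr D) s u \<longleftrightarrow> (\<exists>t\<subseteq>{..<n + 2}. sat (cupd (n + 2) i) s t \<and> sat D t u)" .
  qed
  show "diag_comp (cupd (n + 2) i) D \<in> diagrams n m" unfolding eq by (rule C)
qed

lemma cap_comp_eq_ins:
  assumes D: "D \<in> diagrams n m" and i: "i \<le> n"
  shows "diag_comp (capd (n + 2) i) D =
    adjacent_pair.ins (map_sum (skip i) id) (Inl i) (Inl (Suc i)) D"
    and "diag_comp (capd (n + 2) i) D \<in> diagrams (n + 2) m"
    and "diag_loops (capd (n + 2) i) D = 0"
proof -
  interpret adjacent_pair "boundary_pos n m" "{..<n} <+> {..<m}" "boundary_pos (n + 2) m"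
    "{..<n + 2} <+> {..<m}" "map_sum (skip i) id" "Inl i" "Inl (Suc i)" i
    by (rule boundary_pos_adjacent[OF i])
  have M: "ncmatch (boundary_pos n m) ({..<n} <+> {..<m}) D" using D by (simp only: diagrams_eq)
  have C: "ins D \<in> diagrams (n + 2) m" unfolding diagrams_eq by (rule ncmatch_ins[OF M])
  show eq: "diag_comp (capd (n + 2) i) D = ins D"
  proof (rule diag_comp_eqI[OF pdiag_capd[OF i] pdiag_diagrams[OF D] pdiag_diagrams[OF C]])
    fix s u :: "nat set" assume s: "s \<subseteq> {..<n + 2}"
    have "sat (ins D) s u \<longleftrightarrow> (i \<in> s \<longleftrightarrow> Suc i \<in> s) \<and> sat D (skip i -` s) u"
      unfolding closed_sat[OF i, symmetric] closed_ins vimage_skip_Plus by simp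
    then show "sat (ins D) s u \<longleftrightarrow> (\<exists>t\<subseteq>{..<n}. sat (capd (n + 2) i) s t \<and> sat D t u)"
      using sat_capd_iff[OF i s] skip_vimage_sub[OF i s] by metis
  qed
  show "diag_comp (capd (n + 2) i) D \<in> diagrams (n + 2) m" unfolding eq by (rule C)
  show "diag_loops (capd (n + 2) i) D = 0"
  proof (rule diag_loops_0I[OF pdiag_capd[OF i] pdiag_diagrams[OF D]])
    fix t assume "t \<subseteq> {..<n}" "sat (capd (n + 2) i) {} t"
    then show "t = {}" using sat_capd_iff[OF i, of "{}" t] by simp
  qed
qed

lemma cap_cup_comp:
  assumes D: "D \<in> diagrams (n + 2) m" and i: "i \<le> n" and st: "{Inl i, Inl (Suc i)} \<in> D"
  shows "diag_comp (capd (n + 2) i) (diag_comp (cupd (n + 2) i) D) = D"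
proof -
  interpret adjacent_pair "boundary_pos n m" "{..<n} <+> {..<m}" "boundary_pos (n + 2) m"
    "{..<n + 2} <+> {..<m}" "map_sum (skip i) id" "Inl i" "Inl (Suc i)" i
    by (rule boundary_pos_adjacent[OF i])
  have M: "ncmatch (boundary_pos (n + 2) m) ({..<n + 2} <+> {..<m}) D" using D by (simp only: diagrams_eq)
  show ?thesis
    unfolding cap_comp_eq_ins(1)[OF cup_comp_eq_contr(2)[OF D i] i]
    unfolding cup_comp_eq_contr(1)[OF D i]
    by (rule ins_contr[OF M st])
qed

section \<open>Innermost arcs, factorisation into caps and cups, closure under composition\<close>

text \<open>Descent to an innermost strand: if \<open>y\<close> is not next to \<open>x\<close>, the
  point following \<open>x\<close> must be matched strictly inside the strand, since otherwise its
  strand would cross that of \<open>x\<close> and \<open>y\<close>. Surjectivity onto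
  \<open>{..<L}\<close> guarantees that this point exists.\<close>

lemma ncmatch_adjacent_strand:
  assumes M: "ncmatch f A M" and bij: "bij_betw f A {..<L}"
    and xy: "{x, y} \<in> M" "f x < f y"
  shows "\<exists>u v. {u, v} \<in> M \<and> f v = Suc (f u) \<and> f x \<le> f u \<and> f v \<le> f y"
  using xy
proof (induction "f y - f x" arbitrary: x y rule: less_induct)
  case less
  show ?case
  proof (cases "f y = Suc (f x)")
    case True
    then show ?thesis using less.prems by blast
  next
    case False
    have xA: "x \<in> A" and yA: "y \<in> A" using ncmatch_sub[OF M less.prems(1)] by auto
    have "f y < L" using bij yA by (auto simp: bij_betw_def)
    then have "Suc (f x) \<in> f ` A" using False less.prems(2) bij by (simp add: bij_betw_def)
    then obtain z where z: "z \<in> A" "f z = Suc (f x)" by (metis imageE)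
    obtain w where w: "{z, w} \<in> M" "z \<noteq> w" "w \<in> A" using ncmatch_cover[OF M z(1)] by blast
    have zxy: "z \<noteq> x" "z \<noteq> y" using z False by auto
    have "w \<noteq> x"
    proof
      assume "w = x"
      then have "{x, z} \<in> M" using w(1) by (simp add: insert_commute)
      then show False using ncmatch_partner_unique[OF M less.prems(1)] zxy by blast
    qed
    moreover have "w \<noteq> y"
    proof
      assume "w = y"
      then have "{y, z} \<in> M" "{y, x} \<in> M" using w(1) less.prems(1) by (simp_all add: insert_commute)
      then show False using ncmatch_partner_unique[OF M] zxy by blast
    qed
    moreover have "f u = f v \<longleftrightarrow> u = v" if "u \<in> A" "v \<in> A" for u v
      using bij that by (auto simp: bij_betw_def inj_on_def)
    ultimately have neq: "f w \<noteq> f x" "f w \<noteq> f y" "f w \<noteq> f z" using w xA yA z(1) by metis+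
    have "\<not> f y < f w" using ncmatch_noncrossing[OF M less.prems(1) w(1)] z False less.prems(2) by auto
    moreover have "{w, z} \<in> M" using w(1) by (simp add: insert_commute)
    then have "\<not> f w < f x"
      using ncmatch_noncrossing[OF M _ less.prems(1), of w z] z False less.prems(2) by auto
    ultimately have "f z < f w" "f w < f y" using neq z by auto
    then have "\<exists>u v. {u, v} \<in> M \<and> f v = Suc (f u) \<and> f z \<le> f u \<and> f v \<le> f w"
      using less.hyps[OF _ w(1)] z by simp
    then show ?thesis using z \<open>f w < f y\<close> by (metis Suc_leD le_trans less_imp_le_nat)
  qed
qed

definition capped :: "nat \<Rightarrow> diagram \<Rightarrow> bool" where
  "capped a D \<longleftrightarrow> (\<exists>i j. i < a \<and> j < a \<and> i \<noteq> j \<and> {Inl i, Inl j} \<in> D)"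

definition cupped :: "diagram \<Rightarrow> bool" where
  "cupped D \<longleftrightarrow> (\<exists>i j. i \<noteq> j \<and> {Inr i, Inr j} \<in> D)"

lemma capped_adjacent:
  assumes D: "D \<in> diagrams n m" and a: "a \<le> n" and cap: "capped a D"
  obtains i where "Suc i < a" "{Inl i, Inl (Suc i)} \<in> D"
proof -
  have M: "ncmatch (boundary_pos n m) ({..<n} <+> {..<m}) D" using D by (simp only: diagrams_eq)
  obtain i j where ij: "i < j" "j < a" "{Inl i, Inl j} \<in> D"
    using cap unfolding capped_def by (metis insert_commute linorder_neqE_nat)
  then obtain u v where uv: "{u, v} \<in> D" "boundary_pos n m v = Suc (boundary_pos n m u)"
     "boundary_pos n m v \<le> j"
    using ncmatch_adjacent_strand[OF M boundary_pos_bij ij(3)] by auto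
  then have *: "boundary_pos n m u < n" "boundary_pos n m v < n" using ij a by auto
  obtain k where k: "u = Inl k" using *(1) by (cases u) auto
  obtain l where l: "v = Inl l" using *(2) by (cases v) auto
  show ?thesis using that[of k] uv ij k l by simp
qed

lemma strict_mono_bij_id:
  assumes bij: "bij_betw g {..<n::nat} {..<m}" and mono: "\<And>i j. i < j \<Longrightarrow> j < n \<Longrightarrow> g i < (g j :: nat)"
    and i: "i < n"
  shows "g i = i" "n = m"
proof -
  show nm: "n = m" using bij_betw_same_card[OF bij] by simp
  have lower: "k \<le> g k" if "k < n" for k
    using that
  proof (induction k)
    case (Suc k)
    then show ?case using mono[of k "Suc k"] by simp
  qed simp
  have upper: "g k + (n - 1 - k) \<le> n - 1" if "k < n" for k
    using that
  proof (induction "n - 1 - k" arbitrary: k)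
    case 0
    have "g k < m" using bij 0(2) by (auto simp: bij_betw_def)
    then show ?case using 0 nm by simp
  next
    case (Suc d)
    then have k: "Suc k < n" by simp
    have "g (Suc k) + (n - 1 - Suc k) \<le> n - 1" by (rule Suc.hyps(1)) (use Suc.hyps(2) k in auto)
    moreover have "g k < g (Suc k)" using mono[of k "Suc k"] k by simp
    ultimately show ?case using k by linarith
  qed
  show "g i = i" using lower[OF i] upper[OF i] i by simp
qed

text \<open>Without arcs every strand runs from one side to the other, and noncrossing makes the
  resulting bijection increasing, hence the identity.\<close>

lemma uncapped_uncupped_id:
  assumes D: "D \<in> diagrams n m" and cap: "\<not> capped n D" and cup: "\<not> cupped D"
  shows "n = m" "D = diag_id n"
proof -
  have M: "ncmatch (boundary_pos n m) ({..<n} <+> {..<m}) D" using D by (simp only: diagrams_eq)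
  have ex: "\<exists>j<m. {Inl i, Inr j} \<in> D" if i: "i < n" for i
  proof -
    obtain y where y: "{Inl i, y} \<in> D" "Inl i \<noteq> y" "y \<in> {..<n} <+> {..<m}"
      using ncmatch_cover[OF M, of "Inl i"] i by auto
    then show ?thesis using cap i unfolding capped_def by (cases y) auto
  qed
  then obtain g where g: "\<And>i. i < n \<Longrightarrow> g i < m \<and> {Inl i, Inr (g i)} \<in> D" by metis
  have ex': "\<exists>i<n. {Inl i, Inr j} \<in> D" if j: "j < m" for j
  proof -
    obtain y where y: "{Inr j, y} \<in> D" "Inr j \<noteq> y" "y \<in> {..<n} <+> {..<m}"
      using ncmatch_cover[OF M, of "Inr j"] j by auto
    show ?thesis
    proof (cases y)
      case (Inl i)
      then show ?thesis using y by (intro exI[of _ i]) (simp add: insert_commute)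
    next
      case (Inr i)
      then show ?thesis using cup y unfolding cupped_def by blast
    qed
  qed
  have bij: "bij_betw g {..<n} {..<m}"
    unfolding bij_betw_def
  proof
    show "inj_on g {..<n}"
    proof (rule inj_onI)
      fix i j assume ij: "i \<in> {..<n}" "j \<in> {..<n}" "g i = g j"
      then have "{Inr (g i), Inl i} \<in> D" "{Inr (g i), Inl j} \<in> D"
        using g[of i] g[of j] by (auto simp: insert_commute)
      then have "Inl i = (Inl j :: nat + nat)" by (rule ncmatch_partner_unique[OF M])
      then show "i = j" by simp
    qed
    show "g ` {..<n} = {..<m}"
    proof
      show "g ` {..<n} \<subseteq> {..<m}" using g by auto
      show "{..<m} \<subseteq> g ` {..<n}"
      proof
        fix j assume "j \<in> {..<m}"
        then obtain i where i: "i < n" "{Inl i, Inr j} \<in> D" using ex' by auto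
        then have "Inr j = (Inr (g i) :: nat + nat)"
          using g[of i] ncmatch_partner_unique[OF M i(2)] by blast
        then show "j \<in> g ` {..<n}" using i by auto
      qed
    qed
  qed
  \<comment> \<open>\<open>boundary_pos\<close> runs backwards along the targets, so
    \<open>g j < g i\<close> would put the four ends into crossing order.\<close>
  have mono: "g i < g j" if ij: "i < j" "j < n" for i j
  proof (rule ccontr)
    assume "\<not> g i < g j"
    moreover have "g i \<noteq> g j" using bij ij by (auto simp: bij_betw_def inj_on_def)
    ultimately have lt: "g j < g i" by simp
    have gi: "g i < m" "{Inl i, Inr (g i)} \<in> D" and gj: "g j < m" "{Inl j, Inr (g j)} \<in> D"
      using g[of i] g[of j] ij by auto
    show False using diagrams_noncrossing[OF D gi(2) gj(2)] ij lt gi(1) gj(1) by (simp, arith)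
  qed
  show nm: "n = m" using bij_betw_same_card[OF bij] by simp
  have gid: "g i = i" if "i < n" for i using strict_mono_bij_id(1)[OF bij mono that] by simp
  show "D = diag_id n"
  proof
    show "diag_id n \<subseteq> D" unfolding diag_id_def using g gid by auto
    show "D \<subseteq> diag_id n"
    proof
      fix B assume B: "B \<in> D"
      have Bs: "B \<subseteq> {..<n} <+> {..<m}" using ncmatch_sub[OF M B] .
      obtain x where x: "x \<in> B" using ncmatch_nonempty[OF M B] by blast
      obtain i where i: "i < n" "x = Inl i \<or> x = Inr i"
        using x Bs nm by (cases x) auto
      then have "{Inl i, Inr i} \<in> D" using g[of i] gid[of i] by simp
      moreover have "x \<in> {Inl i, Inr i}" using i by blast
      ultimately have "B = {Inl i, Inr i}" using ncmatch_unique[OF M B _ x] by blast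
      then show "B \<in> diag_id n" using i by (auto simp: diag_id_def)
    qed
  qed
qed

lemma diag_flip_mem: "{a, b} \<in> diag_flip D \<longleftrightarrow> {case_sum Inr Inl a, case_sum Inr Inl b} \<in> D"
proof -
  let ?f = "case_sum Inr Inl :: nat + nat \<Rightarrow> nat + nat"
  have f: "?f (?f x) = x" for x by (cases x) auto
  have 1: "{?f a, ?f b} \<in> D" if ab: "{a, b} \<in> diag_flip D" for a b D
  proof -
    obtain B where B: "B \<in> D" "{a, b} = ?f ` B" using ab unfolding diag_flip_def by blast
    have "?f ` {a, b} = B" unfolding B(2) image_image f by simp
    then have "{?f a, ?f b} = B" by (simp only: image_insert image_empty)
    then show ?thesis using B(1) by (simp only:)
  qed
  have "{a, b} \<in> diag_flip D" if ab: "{?f a, ?f b} \<in> D"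
    using 1[of "?f a" "?f b" "diag_flip D"] that f by simp
  then show ?thesis using 1 by blast
qed

lemma diag_flip_diagrams:
  assumes D: "D \<in> diagrams n m"
  shows "diag_flip D \<in> diagrams m n"
proof (rule diagramsI[OF pdiag_flip[OF pdiag_diagrams[OF D]]])
  let ?f = "case_sum Inr Inl :: nat + nat \<Rightarrow> nat + nat"
  fix B assume "B \<in> diag_flip D"
  then obtain C where "C \<in> D" "B = ?f ` C" by (auto simp: diag_flip_def)
  moreover have "inj_on ?f C" by (auto simp: inj_on_def split: sum.splits)
  ultimately show "card B = 2" using diagrams_card[OF D] by (simp add: card_image)
next
  let ?f = "case_sum Inr Inl :: nat + nat \<Rightarrow> nat + nat"
  fix a b c d
  assume *: "{a, b} \<in> diag_flip D" "{c, d} \<in> diag_flip D"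
    "boundary_pos m n a < boundary_pos m n c" "boundary_pos m n c < boundary_pos m n b"
    "boundary_pos m n b < boundary_pos m n d"
  \<comment> \<open>Reflection reverses the boundary order; so a crossing turns into a crossing once
    the ends of both strands are read in the opposite order.\<close>
  have pos: "boundary_pos n m (?f x) + boundary_pos m n x = n + m - 1"
    if "x \<in> {..<m} <+> {..<n}" for x using that by (cases x) auto
  have "a \<in> {..<m} <+> {..<n}" "b \<in> {..<m} <+> {..<n}" "c \<in> {..<m} <+> {..<n}" "d \<in> {..<m} <+> {..<n}"
    using pdiag_sub[OF pdiag_flip[OF pdiag_diagrams[OF D]]] *(1,2) by blast+
  note p = this[THEN pos]
  have "{?f d, ?f c} \<in> D" "{?f b, ?f a} \<in> D" using *(1,2) unfolding diag_flip_mem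
    by (simp_all add: insert_commute)
  from diagrams_noncrossing[OF D this] show False using *(3-5) p by linarith
qed

lemma capd_2: "i + 2 \<le> (n::nat) \<Longrightarrow> \<exists>k. n = k + 2 \<and> i \<le> k \<and> n - 2 = k"
  by (intro exI[of _ "n - 2"]) auto

text \<open>An arc encloses an innermost one, which splits off as a simple cap on the left; the
  remaining factor is \<open>D\<close> contracted there. This turns the killing of simple caps into
  the killing of all capped diagrams.\<close>

lemma capped_factor:
  assumes D: "D \<in> diagrams n m" and a: "a \<le> n" and cap: "capped a D"
  obtains i D' where "i + 2 \<le> a" "D' \<in> diagrams (n - 2) m" "D = diag_comp (capd n i) D'"
    "diag_loops (capd n i) D' = 0"
proof -
  obtain i where i: "Suc i < a" "{Inl i, Inl (Suc i)} \<in> D" by (rule capped_adjacent[OF assms])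
  then obtain k where k: "n = k + 2" "i \<le> k" using capd_2[of i n] a by auto
  have D': "D \<in> diagrams (k + 2) m" using D k by simp
  show ?thesis
  proof (rule that[of i "diag_comp (cupd n i) D"])
    show "i + 2 \<le> a" using i by simp
    show "diag_comp (cupd n i) D \<in> diagrams (n - 2) m"
      using cup_comp_eq_contr(2)[OF D' k(2)] k(1) by simp
    show "D = diag_comp (capd n i) (diag_comp (cupd n i) D)"
      using cap_cup_comp[OF D' k(2) i(2)] k(1) by simp
    show "diag_loops (capd n i) (diag_comp (cupd n i) D) = 0"
      using cap_comp_eq_ins(3)[OF cup_comp_eq_contr(2)[OF D' k(2)] k(2)] k(1) by simp
  qed
qed

lemma cupped_flip:
  assumes "D \<in> diagrams n m"
  shows "cupped D \<longleftrightarrow> capped m (diag_flip D)"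
proof -
  have "i < m" "j < m" if "{Inr i, Inr j} \<in> D" for i j
    using pdiag_sub[OF pdiag_diagrams[OF assms] that] by auto
  then show ?thesis unfolding capped_def cupped_def diag_flip_mem by fastforce
qed

lemma pdiag_capd':
  assumes "i + 2 \<le> n"
  shows "pdiag n (n - 2) (capd n i)"
proof -
  obtain k where "n = k + 2" "i \<le> k" "n - 2 = k" using capd_2[OF assms] by blast
  then show ?thesis using pdiag_capd[of i k] by metis
qed

lemma cupped_factor:
  assumes D: "D \<in> diagrams n m" and cup: "cupped D"
  obtains i D' where "i + 2 \<le> m" "D' \<in> diagrams n (m - 2)" "D = diag_comp D' (cupd m i)"
    "diag_loops D' (cupd m i) = 0"
proof -
  obtain i D' where i: "i + 2 \<le> m" and D': "D' \<in> diagrams (m - 2) n"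
    and eq: "diag_flip D = diag_comp (capd m i) D'" and loops: "diag_loops (capd m i) D' = 0"
    using cup capped_factor[OF diag_flip_diagrams[OF D] order_refl] unfolding cupped_flip[OF D] by metis
  note pc = pdiag_capd'[OF i] and pD = pdiag_diagrams[OF D']
  show ?thesis
  proof (rule that[OF i diag_flip_diagrams[OF D']])
    show "D = diag_comp (diag_flip D') (cupd m i)"
      using arg_cong[OF eq, of diag_flip] diag_flip_comp(1)[OF pc pD] by simp
    show "diag_loops (diag_flip D') (cupd m i) = 0"
      using diag_flip_comp(2)[OF pc pD] loops by simp
  qed
qed

lemma diag_id_diagrams: "diag_id n \<in> diagrams n n"
proof (rule diagramsI[OF pdiag_id])
  show "card B = 2" if "B \<in> diag_id n" for B using that by (auto simp: diag_id_def)
  fix a b c d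
  assume *: "{a, b} \<in> diag_id n" "{c, d} \<in> diag_id n"
    "boundary_pos n n a < boundary_pos n n c" "boundary_pos n n c < boundary_pos n n b"
    "boundary_pos n n b < boundary_pos n n d"
  have st: "\<exists>i<n. a = Inl i \<and> b = Inr i \<or> a = Inr i \<and> b = Inl i" if "{a, b} \<in> diag_id n"
    for a b :: "nat + nat" using that by (auto simp: diag_id_def doubleton_eq_iff)
  from st[OF *(1)] st[OF *(2)] *(3-5) show False by (elim exE conjE disjE) auto
qed

lemma diag_cap_diagrams: "diag_cap c \<in> diagrams (2 * c) 0"
proof (rule diagramsI[OF pdiag_cap])
  show "card B = 2" if "B \<in> diag_cap c" for B using that by (auto simp: diag_cap_def)
  fix a b c' d
  assume *: "{a, b} \<in> diag_cap c" "{c', d} \<in> diag_cap c"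
    "boundary_pos (2 * c) 0 a < boundary_pos (2 * c) 0 c'"
    "boundary_pos (2 * c) 0 c' < boundary_pos (2 * c) 0 b"
    "boundary_pos (2 * c) 0 b < boundary_pos (2 * c) 0 d"
  have st: "\<exists>i<c. a = Inl i \<and> b = Inl (2 * c - 1 - i) \<or> a = Inl (2 * c - 1 - i) \<and> b = Inl i"
    if "{a, b} \<in> diag_cap c" for a b :: "nat + nat"
    using that by (auto simp: diag_cap_def doubleton_eq_iff)
  from st[OF *(1)] st[OF *(2)] *(3-5) show False by (elim exE conjE disjE) auto
qed

lemma diag_tensor_diagrams:
  assumes D: "D \<in> diagrams n m" and E: "E \<in> diagrams n' m'"
  shows "diag_tensor D E \<in> diagrams (n + n') (m + m')"
proof (rule diagramsI[OF pdiag_tensor[OF pdiag_diagrams[OF D] pdiag_diagrams[OF E]]])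
  note eq = diag_tensor_eq[OF pdiag_diagrams[OF D], of E]
  let ?f = "map_sum ((+) n) ((+) m)"
  fix B assume "B \<in> diag_tensor D E"
  then consider "B \<in> D" | C where "C \<in> E" "B = ?f ` C" unfolding eq by blast
  then show "card B = 2"
  proof cases
    case 2
    then show ?thesis using diagrams_card[OF E] inj_map_sum_add
      by (metis card_image inj_on_subset subset_UNIV)
  qed (rule diagrams_card[OF D])
next
  note eq = diag_tensor_eq[OF pdiag_diagrams[OF D], of E]
  let ?f = "map_sum ((+) n) ((+) m)"
  let ?p = "boundary_pos (n + n') (m + m')"
  \<comment> \<open>The boundary points of \<open>E\<close> form an interval of positions, inserted
    between the sources and the targets of \<open>D\<close>.\<close>
  have posD: "?p x = (if boundary_pos n m x < n then boundary_pos n m x else boundary_pos n m x + n' + m')"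
    if "x \<in> {..<n} <+> {..<m}" for x using that by (cases x) auto
  have posE: "?p (?f x) = n + boundary_pos n' m' x \<and> boundary_pos n' m' x < n' + m'"
    if "x \<in> {..<n'} <+> {..<m'}" for x using that by (cases x) auto
  have st: "{a, b} \<in> D \<and> ?p a = (if boundary_pos n m a < n then boundary_pos n m a else boundary_pos n m a + n' + m')
      \<and> ?p b = (if boundary_pos n m b < n then boundary_pos n m b else boundary_pos n m b + n' + m') \<or>
      (\<exists>a' b'. {a', b'} \<in> E \<and> ?p a = n + boundary_pos n' m' a' \<and> ?p b = n + boundary_pos n' m' b'
        \<and> boundary_pos n' m' a' < n' + m' \<and> boundary_pos n' m' b' < n' + m')"
    if ab: "{a, b} \<in> diag_tensor D E" for a b
  proof (cases "{a, b} \<in> D")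
    case True
    then have "a \<in> {..<n} <+> {..<m}" "b \<in> {..<n} <+> {..<m}"
      using pdiag_sub[OF pdiag_diagrams[OF D] True] by auto
    then show ?thesis using True posD by blast
  next
    case False
    then obtain C where C: "C \<in> E" "{a, b} = ?f ` C" using ab unfolding eq by blast
    have "a \<in> ?f ` C" "b \<in> ?f ` C" using C(2) by blast+
    then obtain a' b' where a': "a' \<in> C" "a = ?f a'" and b': "b' \<in> C" "b = ?f b'" by blast
    have "?f ` C = ?f ` {a', b'}" using C(2) a' b' by simp
    then have "C = {a', b'}" using inj_map_sum_add by (simp only: inj_image_eq_iff)
    then have "{a', b'} \<in> E" using C(1) by simp
    moreover have "a' \<in> {..<n'} <+> {..<m'}" "b' \<in> {..<n'} <+> {..<m'}"
      using pdiag_sub[OF pdiag_diagrams[OF E] C(1)] a' b' by auto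
    ultimately show ?thesis using posE a'(2) b'(2) by blast
  qed
  fix a b c d
  assume *: "{a, b} \<in> diag_tensor D E" "{c, d} \<in> diag_tensor D E" "?p a < ?p c" "?p c < ?p b" "?p b < ?p d"
  from st[OF *(1)] st[OF *(2)] show False
  proof (elim disjE exE conjE)
    assume "{a, b} \<in> D" "{c, d} \<in> D"
      and p: "?p a = (if boundary_pos n m a < n then boundary_pos n m a else boundary_pos n m a + n' + m')"
      "?p b = (if boundary_pos n m b < n then boundary_pos n m b else boundary_pos n m b + n' + m')"
      "?p c = (if boundary_pos n m c < n then boundary_pos n m c else boundary_pos n m c + n' + m')"
      "?p d = (if boundary_pos n m d < n then boundary_pos n m d else boundary_pos n m d + n' + m')"
    then show False using diagrams_noncrossing[OF D, of a b c d] *(3-5) unfolding p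
      by (simp split: if_splits)
  next
    fix a' b' c' d' assume "{a', b'} \<in> E" "{c', d'} \<in> E"
      and p: "?p a = n + boundary_pos n' m' a'" "?p b = n + boundary_pos n' m' b'"
      "?p c = n + boundary_pos n' m' c'" "?p d = n + boundary_pos n' m' d'"
    then show False using diagrams_noncrossing[OF E, of a' b' c' d'] *(3-5) unfolding p by simp
  qed (use *(3-5) in \<open>simp split: if_splits\<close>)+
qed

lemma capd_diagrams:
  assumes "i + 2 \<le> n"
  shows "capd n i \<in> diagrams n (n - 2)"
proof -
  have "i + 2 * 1 + (n - 2 - i) = n" "i + 0 + (n - 2 - i) = n - 2" using assms by auto
  then show ?thesis
    using diag_tensor_diagrams[OF diag_tensor_diagrams[OF diag_id_diagrams diag_cap_diagrams[of 1]]
      diag_id_diagrams, of i "n - 2 - i"]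
    unfolding capd_def by (simp only:)
qed

text \<open>Peeling simple caps off the left of \<open>D\<close> and simple cups off its right ends
  at an identity, and composing with a single cap or cup is already known to be planar.\<close>

lemma diag_comp_diagrams:
  assumes "D \<in> diagrams n m" "E \<in> diagrams m k"
  shows "diag_comp D E \<in> diagrams n k"
  using assms
proof (induction "n + m" arbitrary: D n m E rule: less_induct)
  case less
  note D = less.prems(1) and E = less.prems(2)
  show ?case
  proof (cases "capped n D")
    case True
    then obtain i D' where i: "i + 2 \<le> n" "D' \<in> diagrams (n - 2) m" "D = diag_comp (capd n i) D'"
      by (rule capped_factor[OF D order_refl])
    then obtain k' where k: "n = k' + 2" "i \<le> k'" "n - 2 = k'" using capd_2 by blast
    have "diag_comp D' E \<in> diagrams (n - 2) k" using less.hyps[OF _ i(2) E] i(1) by simp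
    then have "diag_comp (capd n i) (diag_comp D' E) \<in> diagrams n k"
      using cap_comp_eq_ins(2)[of "diag_comp D' E" k' k i] k by simp
    then show ?thesis
      unfolding i(3) diag_comp_assoc[OF pdiag_capd'[OF i(1)] pdiag_diagrams[OF i(2)] pdiag_diagrams[OF E]] .
  next
    case ncap: False
    show ?thesis
    proof (cases "cupped D")
      case True
      then obtain i D' where i: "i + 2 \<le> m" "D' \<in> diagrams n (m - 2)" "D = diag_comp D' (cupd m i)"
        by (rule cupped_factor[OF D])
      then obtain k' where k: "m = k' + 2" "i \<le> k'" "m - 2 = k'" using capd_2 by blast
      have "diag_comp (cupd m i) E \<in> diagrams (m - 2) k"
        using cup_comp_eq_contr(2)[of E k' k i] E k by simp
      then have "diag_comp D' (diag_comp (cupd m i) E) \<in> diagrams n k"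
        using less.hyps[OF _ i(2)] i(1) by simp
      then show ?thesis
        unfolding i(3) diag_comp_assoc[OF pdiag_diagrams[OF i(2)] pdiag_flip[OF pdiag_capd'[OF i(1)]] pdiag_diagrams[OF E]] .
    next
      case False
      from uncapped_uncupped_id[OF D ncap this] show ?thesis
        using E diag_comp_id_left(1)[OF pdiag_diagrams[OF E]] by simp
    qed
  qed
qed

text \<open>The composite block of \<open>i\<close> is a colouring, so it extends over the middle
  points to a colouring saturated for \<open>E\<close>, which then has to contain the other end of
  the arc. Hence composition on the left cannot destroy arcs among the targets.\<close>

lemma diag_comp_right_strand:
  assumes D: "D \<in> diagrams n m" and E: "E \<in> diagrams m k" and st: "{Inr i, Inr j} \<in> E"
  shows "{Inr i, Inr j} \<in> diag_comp D E"
proof -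
  let ?F = "diag_comp D E"
  have F: "?F \<in> diagrams n k" by (rule diag_comp_diagrams[OF D E])
  note pF = pdiag_diagrams[OF F] and pD = pdiag_diagrams[OF D] and pE = pdiag_diagrams[OF E]
  have "Inr i \<in> {..<n} <+> {..<k}" using pdiag_sub[OF pE st] by auto
  then obtain B where B: "B \<in> ?F" "Inr i \<in> B" using pdiag_cover[OF pF] by blast
  have Bsub: "B \<subseteq> {..<n} <+> {..<k}" by (rule pdiag_sub[OF pF B(1)])
  define s u where "s = Inl -` B" and "u = Inr -` B"
  have "x \<in> B \<longleftrightarrow> x \<in> s <+> u" for x by (cases x) (simp_all add: s_def u_def)
  then have Beq: "B = s <+> u" by blast
  have sub: "s \<subseteq> {..<n}" "u \<subseteq> {..<k}" using Bsub unfolding Beq by auto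
  have "sat ?F s u" unfolding sat_def Beq[symmetric]
    using pdiag_unique[OF pF B(1)] by blast
  then obtain t where "sat E t u" using sat_comp_iff[OF pD pE sub] by blast
  moreover have "Inr i \<in> t <+> u" using B(2) Beq by simp
  ultimately have "Inr j \<in> t <+> u" using st unfolding sat_def by (metis insertCI)
  then have "Inr j \<in> B" unfolding Beq by simp
  have ij: "Inr i \<noteq> (Inr j :: nat + nat)" using diagrams_card[OF E st] by auto
  have "card B = 2" by (rule diagrams_card[OF F B(1)])
  then have "B = {Inr i, Inr j}" using B(2) \<open>Inr j \<in> B\<close> ij
    by (metis card_2_iff doubleton_eq_iff empty_iff insert_iff)
  then show ?thesis using B(1) by simp
qed

lemma cupped_comp:
  assumes "D \<in> diagrams n m" "E \<in> diagrams m k" "cupped E"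
  shows "cupped (diag_comp D E)"
  using assms diag_comp_right_strand unfolding cupped_def by metis

lemma capped_comp:
  assumes D: "D \<in> diagrams n m" and E: "E \<in> diagrams m k" and "capped a D"
  shows "capped a (diag_comp D E)"
proof -
  obtain i j where ij: "i < a" "j < a" "i \<noteq> j" "{Inl i, Inl j} \<in> D" using assms(3) unfolding capped_def by blast
  then have "{Inr i, Inr j} \<in> diag_flip D" by (simp add: diag_flip_mem)
  then have "{Inr i, Inr j} \<in> diag_flip (diag_comp D E)"
    unfolding diag_flip_comp(1)[OF pdiag_diagrams[OF D] pdiag_diagrams[OF E]]
    by (rule diag_comp_right_strand[OF diag_flip_diagrams[OF E] diag_flip_diagrams[OF D]])
  then show ?thesis using ij unfolding capped_def by (auto simp: diag_flip_mem)
qed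

lemma capped_tensor: "D \<in> diagrams n m \<Longrightarrow> capped a D \<Longrightarrow> capped a (diag_tensor D E)"
  unfolding capped_def diag_tensor_def by blast

text \<open>In a square diagram an arc on one side leaves too few points there to match all points
  of the other side, so arcs occur on both sides or on neither; without arcs the diagram is the
  identity.\<close>

lemma nonid_capped_cupped:
  assumes D: "D \<in> diagrams n n" and "D \<noteq> diag_id n"
  shows "capped n D" "cupped D"
proof -
  have M: "ncmatch (boundary_pos n n) ({..<n} <+> {..<n}) D" using D by (simp only: diagrams_eq)
  have *: "cupped D" if D: "D \<in> diagrams n n" and "capped n D" for D
  proof (rule ccontr)
    assume ncup: "\<not> cupped D"
    have M: "ncmatch (boundary_pos n n) ({..<n} <+> {..<n}) D" using D by (simp only: diagrams_eq)
    have "\<exists>i<n. {Inr j, Inl i} \<in> D" if j: "j < n" for j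
    proof -
      obtain y where y: "{Inr j, y} \<in> D" "Inr j \<noteq> y" "y \<in> {..<n} <+> {..<n}"
        using ncmatch_cover[OF M, of "Inr j"] j by auto
      then show ?thesis using ncup unfolding cupped_def by (cases y) auto
    qed
    then obtain h where h: "\<And>j. j < n \<Longrightarrow> h j < n \<and> {Inr j, Inl (h j)} \<in> D" by metis
    have "inj_on h {..<n}"
    proof (rule inj_onI)
      fix j j' assume jj: "j \<in> {..<n}" "j' \<in> {..<n}" "h j = h j'"
      then have "{Inl (h j), Inr j} \<in> D" "{Inl (h j), Inr j'} \<in> D"
        using h[of j] h[of j'] by (auto simp: insert_commute)
      then have "Inr j = (Inr j' :: nat + nat)" by (rule ncmatch_partner_unique[OF M])
      then show "j = j'" by simp
    qed
    moreover have "h ` {..<n} \<subseteq> {..<n}" using h by auto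
    ultimately have surj: "h ` {..<n} = {..<n}" by (simp add: endo_inj_surj)
    obtain i i' where ii: "i < n" "{Inl i, Inl i'} \<in> D" using \<open>capped n D\<close> unfolding capped_def by blast
    then obtain j where "j < n" "i = h j" using surj by (metis imageE lessThan_iff)
    then have "{Inl i, Inr j} \<in> D" using h[of j] by (simp add: insert_commute)
    then have "Inl i' = (Inr j :: nat + nat)" using ncmatch_partner_unique[OF M ii(2)] by blast
    then show False by simp
  qed
  have flip: "cupped D \<longleftrightarrow> capped n (diag_flip D)" "cupped (diag_flip D) \<longleftrightarrow> capped n D"
    using cupped_flip[OF D] cupped_flip[OF diag_flip_diagrams[OF D]] by simp_all
  have iff: "capped n D \<longleftrightarrow> cupped D"
    using *[OF D] *[OF diag_flip_diagrams[OF D]] flip by blast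
  have "capped n D \<or> cupped D" using uncapped_uncupped_id(2)[OF D] assms(2) by blast
  then show "capped n D" "cupped D" using iff by blast+
qed

lemma diff_capped_or_cupped:
  assumes "D \<in> diagrams n m" "n \<noteq> m"
  shows "capped n D \<or> cupped D"
  using uncapped_uncupped_id(1)[OF assms(1)] assms(2) by blast

subsection \<open>The linear category\<close>

text \<open>A common shape for composition, with \<open>w\<close> the loop factor, and for the
  tensor product, with \<open>w\<close> equal to 1, so that bilinearity is proved once.\<close>

definition bilin :: "(diagram \<Rightarrow> diagram \<Rightarrow> diagram) \<Rightarrow> (diagram \<Rightarrow> diagram \<Rightarrow> 'a) \<Rightarrow>
    'a::idom morphism \<Rightarrow> 'a morphism \<Rightarrow> 'a morphism" where
  "bilin h w x y = (\<Sum>D\<in>Poly_Mapping.keys x. \<Sum>E\<in>Poly_Mapping.keys y.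
     Poly_Mapping.single (h D E) (Poly_Mapping.lookup x D * Poly_Mapping.lookup y E * w D E))"

lemma tl_comp_bilin: "tl_comp \<delta> = bilin diag_comp (\<lambda>D E. \<delta> ^ diag_loops D E)"
  by (intro ext) (simp add: tl_comp_def bilin_def)

lemma tl_tensor_bilin: "tl_tensor = bilin diag_tensor (\<lambda>D E. 1)"
  by (intro ext) (simp add: tl_tensor_def bilin_def)

text \<open>Supports can shrink under addition by cancellation. Summing over a common finite
  superset makes the sums for \<open>x\<close>, \<open>x'\<close> and \<open>x + x'\<close>
  comparable term by term.\<close>

lemma bilin_over:
  assumes "finite A" "Poly_Mapping.keys x \<subseteq> A" "finite B" "Poly_Mapping.keys y \<subseteq> B"
  shows "bilin h w x y = (\<Sum>D\<in>A. \<Sum>E\<in>B.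
     Poly_Mapping.single (h D E) (Poly_Mapping.lookup x D * Poly_Mapping.lookup y E * w D E))"
proof -
  have "bilin h w x y = (\<Sum>D\<in>Poly_Mapping.keys x. \<Sum>E\<in>B.
     Poly_Mapping.single (h D E) (Poly_Mapping.lookup x D * Poly_Mapping.lookup y E * w D E))"
    unfolding bilin_def
    by (intro sum.cong refl sum.mono_neutral_left assms) (simp add: in_keys_iff)
  also have "\<dots> = (\<Sum>D\<in>A. \<Sum>E\<in>B.
     Poly_Mapping.single (h D E) (Poly_Mapping.lookup x D * Poly_Mapping.lookup y E * w D E))"
    by (intro sum.mono_neutral_left assms) (simp add: in_keys_iff)
  finally show ?thesis .
qed

lemma bilin_add_left: "bilin h w (x + x') y = bilin h w x y + bilin h w x' y"
proof -
  let ?A = "Poly_Mapping.keys x \<union> Poly_Mapping.keys x'" and ?B = "Poly_Mapping.keys y"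
  have A: "finite ?A" by simp
  note over = bilin_over[OF A _ finite_keys[of y] order_refl]
  have "bilin h w (x + x') y = (\<Sum>D\<in>?A. \<Sum>E\<in>?B.
     Poly_Mapping.single (h D E) (Poly_Mapping.lookup (x + x') D * Poly_Mapping.lookup y E * w D E))"
    by (rule over) (rule Poly_Mapping.keys_add)
  also have "\<dots> = bilin h w x y + bilin h w x' y"
    unfolding over[of x, OF Un_upper1] over[of x', OF Un_upper2] sum.distrib[symmetric]
    by (intro sum.cong refl) (simp add: lookup_add single_add algebra_simps)
  finally show ?thesis .
qed

lemma bilin_add_right: "bilin h w x (y + y') = bilin h w x y + bilin h w x y'"
proof -
  let ?A = "Poly_Mapping.keys x" and ?B = "Poly_Mapping.keys y \<union> Poly_Mapping.keys y'"
  have B: "finite ?B" by simp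
  note over = bilin_over[OF finite_keys[of x] order_refl B]
  have "bilin h w x (y + y') = (\<Sum>D\<in>?A. \<Sum>E\<in>?B.
     Poly_Mapping.single (h D E) (Poly_Mapping.lookup x D * Poly_Mapping.lookup (y + y') E * w D E))"
    by (rule over) (rule Poly_Mapping.keys_add)
  also have "\<dots> = bilin h w x y + bilin h w x y'"
    unfolding over[of y, OF Un_upper1] over[of y', OF Un_upper2] sum.distrib[symmetric]
    by (intro sum.cong refl) (simp add: lookup_add single_add algebra_simps)
  finally show ?thesis .
qed

lemma bilin_zero [simp]: "bilin h w 0 y = 0" "bilin h w x 0 = 0"
  by (simp_all add: bilin_def)

lemma bilin_single: "bilin h w (Poly_Mapping.single D a) (Poly_Mapping.single E b) =
    Poly_Mapping.single (h D E) (a * b * w D E)"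
  by (subst bilin_over[of "{D}" _ "{E}"]) auto

lemma tl_scale_add: "tl_scale c (x + y) = tl_scale c x + tl_scale c y"
  by (intro poly_mapping_eqI) (simp add: tl_scale_lookup lookup_add algebra_simps)

lemma tl_scale_left_add: "tl_scale (c + d) x = tl_scale c x + tl_scale d x"
  by (intro poly_mapping_eqI) (simp add: tl_scale_lookup lookup_add algebra_simps)

lemma tl_scale_left_diff: "tl_scale (c - d) x = tl_scale c x - tl_scale d x"
  by (intro poly_mapping_eqI) (simp add: tl_scale_lookup lookup_minus algebra_simps)

lemma tl_scale_zero [simp]: "tl_scale c 0 = 0" "tl_scale 0 x = 0"
  by (intro poly_mapping_eqI; simp add: tl_scale_lookup)+

lemma tl_scale_single: "tl_scale c (Poly_Mapping.single D a) = Poly_Mapping.single D (c * a)"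
  by (intro poly_mapping_eqI) (simp add: tl_scale_lookup lookup_single when_def)

lemma tl_scale_scale [simp]: "tl_scale c (tl_scale d x) = tl_scale (c * d) x"
  by (intro poly_mapping_eqI) (simp add: tl_scale_lookup algebra_simps)

lemma tl_scale_one [simp]: "tl_scale 1 x = x"
  by (intro poly_mapping_eqI) (simp add: tl_scale_lookup)

lemma tl_scale_eq_0_iff [simp]: "tl_scale c x = 0 \<longleftrightarrow> c = 0 \<or> x = 0"
proof -
  have "tl_scale c x = 0 \<longleftrightarrow> (\<forall>D. c * Poly_Mapping.lookup x D = 0)"
    by (metis lookup_zero poly_mapping_eqI tl_scale_lookup)
  also have "\<dots> \<longleftrightarrow> c = 0 \<or> x = 0" by (metis lookup_zero mult_eq_0_iff poly_mapping_eqI)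
  finally show ?thesis .
qed

lemma tl_scale_sum: "tl_scale c (sum f A) = (\<Sum>x\<in>A. tl_scale c (f x))"
  by (induction A rule: infinite_finite_induct) (simp_all add: tl_scale_add)

lemma morphism_expand:
  fixes x :: "'a::idom morphism"
  shows "x = (\<Sum>D\<in>Poly_Mapping.keys x. Poly_Mapping.single D (Poly_Mapping.lookup x D))"
proof (rule poly_mapping_eqI)
  fix D
  have "(\<Sum>E\<in>Poly_Mapping.keys x. Poly_Mapping.lookup (Poly_Mapping.single E (Poly_Mapping.lookup x E)) D) =
     (\<Sum>E\<in>Poly_Mapping.keys x. if E = D then Poly_Mapping.lookup x D else 0)"
    by (intro sum.cong refl) (simp add: lookup_single when_def)
  then show "Poly_Mapping.lookup x D = Poly_Mapping.lookup
     (\<Sum>E\<in>Poly_Mapping.keys x. Poly_Mapping.single E (Poly_Mapping.lookup x E)) D"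
    by (simp add: lookup_sum in_keys_iff)
qed

text \<open>Linear extension as an induction rule: identities between multilinear operations reduce
  to single diagrams.\<close>

lemma keys_induct [consumes 1, case_names zero single add]:
  fixes x :: "'a::idom morphism"
  assumes "Poly_Mapping.keys x \<subseteq> A"
    and "P 0" "\<And>D c. D \<in> A \<Longrightarrow> P (Poly_Mapping.single D c)" "\<And>x y. P x \<Longrightarrow> P y \<Longrightarrow> P (x + y)"
  shows "P x"
proof -
  have "P (\<Sum>D\<in>B. Poly_Mapping.single D (Poly_Mapping.lookup x D))" if "finite B" "B \<subseteq> A" for B
    using that by (induction B rule: finite_induct) (simp_all add: assms)
  then show ?thesis using morphism_expand[of x] assms(1) by (metis finite_keys)
qed

lemma tl_hom_induct [consumes 1, case_names zero single add]:
  assumes "x \<in> tl_hom n m"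
    and "P 0" "\<And>D c. D \<in> diagrams n m \<Longrightarrow> P (Poly_Mapping.single D c)" "\<And>x y. P x \<Longrightarrow> P y \<Longrightarrow> P (x + y)"
  shows "P x"
  using assms by (intro keys_induct[of x "diagrams n m" P]) (auto simp: tl_hom_def)

lemma bilin_scale: "bilin h w (tl_scale c x) y = tl_scale c (bilin h w x y)"
  "bilin h w x (tl_scale c y) = tl_scale c (bilin h w x y)"
proof -
  have k: "Poly_Mapping.keys (tl_scale c x) \<subseteq> Poly_Mapping.keys x" for x :: "'a morphism"
    by (auto simp: in_keys_iff tl_scale_lookup)
  show "bilin h w (tl_scale c x) y = tl_scale c (bilin h w x y)"
    unfolding bilin_over[OF finite_keys[of x] k finite_keys[of y] order_refl]
    by (simp add: bilin_def tl_scale_sum tl_scale_single tl_scale_lookup algebra_simps)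
  show "bilin h w x (tl_scale c y) = tl_scale c (bilin h w x y)"
    unfolding bilin_over[OF finite_keys[of x] order_refl finite_keys[of y] k]
    by (simp add: bilin_def tl_scale_sum tl_scale_single tl_scale_lookup algebra_simps)
qed

lemmas tl_comp_add_left = bilin_add_left[of diag_comp "\<lambda>D E. \<delta> ^ diag_loops D E" for \<delta>, folded tl_comp_bilin]
lemmas tl_comp_add_right = bilin_add_right[of diag_comp "\<lambda>D E. \<delta> ^ diag_loops D E" for \<delta>, folded tl_comp_bilin]
lemmas tl_comp_zero [simp] = bilin_zero[of diag_comp "\<lambda>D E. \<delta> ^ diag_loops D E" for \<delta>, folded tl_comp_bilin]
lemmas tl_comp_single = bilin_single[of diag_comp "\<lambda>D E. \<delta> ^ diag_loops D E" for \<delta>, folded tl_comp_bilin]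
lemmas tl_comp_scale = bilin_scale[of diag_comp "\<lambda>D E. \<delta> ^ diag_loops D E" for \<delta>, folded tl_comp_bilin]
lemmas tl_tensor_add_left = bilin_add_left[of diag_tensor "\<lambda>D E. 1", folded tl_tensor_bilin]
lemmas tl_tensor_add_right = bilin_add_right[of diag_tensor "\<lambda>D E. 1", folded tl_tensor_bilin]
lemmas tl_tensor_zero [simp] = bilin_zero[of diag_tensor "\<lambda>D E. 1", folded tl_tensor_bilin]
lemmas tl_tensor_single = bilin_single[of diag_tensor "\<lambda>D E. 1", folded tl_tensor_bilin, simplified]
lemmas tl_tensor_scale = bilin_scale[of diag_tensor "\<lambda>D E. 1", folded tl_tensor_bilin]

lemma tl_comp_sum_left: "tl_comp \<delta> (sum f A) y = (\<Sum>i\<in>A. tl_comp \<delta> (f i) y)"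
  by (induction A rule: infinite_finite_induct) (simp_all add: tl_comp_add_left)

lemma tl_comp_sum_right: "tl_comp \<delta> x (sum f A) = (\<Sum>i\<in>A. tl_comp \<delta> x (f i))"
  by (induction A rule: infinite_finite_induct) (simp_all add: tl_comp_add_right)

lemma tl_tensor_sum_left: "tl_tensor (sum f A) y = (\<Sum>i\<in>A. tl_tensor (f i) y)"
  by (induction A rule: infinite_finite_induct) (simp_all add: tl_tensor_add_left)

lemma tl_comp_diff_left: "tl_comp \<delta> (x - y) z = tl_comp \<delta> x z - tl_comp \<delta> y z"
  using tl_comp_add_left[of \<delta> "x - y" y z] by (simp add: algebra_simps)

lemma tl_comp_diff_right: "tl_comp \<delta> x (y - z) = tl_comp \<delta> x y - tl_comp \<delta> x z"
  using tl_comp_add_right[of \<delta> x "y - z" z] by (simp add: algebra_simps)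

lemma tl_tensor_diff_left: "tl_tensor (x - y) z = tl_tensor x z - tl_tensor y z"
  using tl_tensor_add_left[of "x - y" y z] by (simp add: algebra_simps)

lemma tl_flip_over:
  assumes "finite A" "Poly_Mapping.keys x \<subseteq> A"
  shows "tl_flip x = (\<Sum>D\<in>A. Poly_Mapping.single (diag_flip D) (Poly_Mapping.lookup x D))"
  unfolding tl_flip_def by (rule sum.mono_neutral_left[OF assms]) (simp add: in_keys_iff)

lemma tl_flip_add: "tl_flip (x + y) = tl_flip x + tl_flip y"
proof -
  let ?A = "Poly_Mapping.keys x \<union> Poly_Mapping.keys y"
  have A: "finite ?A" by simp
  show ?thesis
    unfolding tl_flip_over[OF A Poly_Mapping.keys_add] tl_flip_over[OF A Un_upper1]
      tl_flip_over[OF A Un_upper2] sum.distrib[symmetric]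
    by (intro sum.cong refl) (simp add: lookup_add single_add)
qed

lemma tl_flip_zero [simp]: "tl_flip 0 = 0"
  by (simp add: tl_flip_def)

lemma tl_flip_single: "tl_flip (Poly_Mapping.single D a) = Poly_Mapping.single (diag_flip D) a"
  by (subst tl_flip_over[of "{D}"]) auto

lemma tl_flip_scale: "tl_flip (tl_scale c x) = tl_scale c (tl_flip x)"
proof -
  have k: "Poly_Mapping.keys (tl_scale c x) \<subseteq> Poly_Mapping.keys x"
    by (auto simp: in_keys_iff tl_scale_lookup)
  show ?thesis unfolding tl_flip_over[OF finite_keys k]
    by (simp add: tl_flip_def tl_scale_sum tl_scale_single tl_scale_lookup)
qed

lemma tl_flip_diff: "tl_flip (x - y) = tl_flip x - tl_flip y"
  using tl_flip_add[of "x - y" y] by (simp add: algebra_simps)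

lemma tl_flip_flip [simp]: "tl_flip (tl_flip x) = x"
  by (rule keys_induct[of x UNIV]) (simp_all add: tl_flip_add tl_flip_single)

lemma tl_hom_zero [simp]: "0 \<in> tl_hom n m"
  by (simp add: tl_hom_def)

lemma tl_hom_single: "D \<in> diagrams n m \<Longrightarrow> Poly_Mapping.single D c \<in> tl_hom n m"
  by (simp add: tl_hom_def)

lemma tl_hom_add: "x \<in> tl_hom n m \<Longrightarrow> y \<in> tl_hom n m \<Longrightarrow> x + y \<in> tl_hom n m"
  using Poly_Mapping.keys_add[of x y] by (auto simp: tl_hom_def)

lemma tl_hom_scale: "x \<in> tl_hom n m \<Longrightarrow> tl_scale c x \<in> tl_hom n m"
  by (auto simp: tl_hom_def in_keys_iff tl_scale_lookup subset_iff)

lemma tl_hom_diff: "x \<in> tl_hom n m \<Longrightarrow> y \<in> tl_hom n m \<Longrightarrow> x - y \<in> tl_hom n m"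
  using keys_diff[of x y] by (auto simp: tl_hom_def)

lemma tl_hom_sum: "(\<And>i. i \<in> A \<Longrightarrow> f i \<in> tl_hom n m) \<Longrightarrow> sum f A \<in> tl_hom n m"
  by (induction A rule: infinite_finite_induct) (simp_all add: tl_hom_add)

lemma tl_hom_lookup: "x \<in> tl_hom n m \<Longrightarrow> D \<notin> diagrams n m \<Longrightarrow> Poly_Mapping.lookup x D = 0"
  by (auto simp: tl_hom_def in_keys_iff)

lemma tl_hom_comp: "x \<in> tl_hom n m \<Longrightarrow> y \<in> tl_hom m k \<Longrightarrow> tl_comp \<delta> x y \<in> tl_hom n k"
proof (induction x rule: tl_hom_induct)
  case (single D c)
  note D = single.hyps
  show ?case using \<open>y \<in> tl_hom m k\<close>
    by (induction y rule: tl_hom_induct)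
      (simp_all add: tl_comp_single tl_comp_add_right tl_hom_add tl_hom_single diag_comp_diagrams[OF D])
qed (simp_all add: tl_comp_add_left tl_hom_add)

lemma tl_hom_tensor: "x \<in> tl_hom n m \<Longrightarrow> y \<in> tl_hom n' m' \<Longrightarrow> tl_tensor x y \<in> tl_hom (n + n') (m + m')"
proof (induction x rule: tl_hom_induct)
  case (single D c)
  note D = single.hyps
  show ?case using \<open>y \<in> tl_hom n' m'\<close>
    by (induction y rule: tl_hom_induct)
      (simp_all add: tl_tensor_single tl_tensor_add_right tl_hom_add tl_hom_single diag_tensor_diagrams[OF D])
qed (simp_all add: tl_tensor_add_left tl_hom_add)

lemma tl_hom_flip: "x \<in> tl_hom n m \<Longrightarrow> tl_flip x \<in> tl_hom m n"
  by (induction x rule: tl_hom_induct)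
    (simp_all add: tl_flip_single tl_flip_add tl_hom_add tl_hom_single diag_flip_diagrams)

lemma tl_hom_id [simp]: "tl_id n \<in> tl_hom n n"
  by (simp add: tl_id_def tl_hom_single diag_id_diagrams)

lemma tl_hom_cap: "tl_cap c \<in> tl_hom (2 * c) 0"
  by (simp add: tl_cap_def tl_hom_single diag_cap_diagrams)

lemma tl_comp_assoc:
  assumes "x \<in> tl_hom n m" "y \<in> tl_hom m k" "z \<in> tl_hom k l"
  shows "tl_comp \<delta> (tl_comp \<delta> x y) z = tl_comp \<delta> x (tl_comp \<delta> y z)"
  using assms(1)
proof (induction x rule: tl_hom_induct)
  case (single D c)
  note D = pdiag_diagrams[OF single]
  from assms(2) show ?case
  proof (induction y rule: tl_hom_induct)
    case (single E d)
    note E = pdiag_diagrams[OF single]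
    from assms(3) show ?case
    proof (induction z rule: tl_hom_induct)
      case (single F e)
      note F = pdiag_diagrams[OF single]
      have "\<delta> ^ diag_loops D E * \<delta> ^ diag_loops (diag_comp D E) F =
        \<delta> ^ diag_loops E F * \<delta> ^ diag_loops D (diag_comp E F)"
        unfolding power_add[symmetric] diag_loops_assoc[OF D E F] ..
      then have "c * d * \<delta> ^ diag_loops D E * e * \<delta> ^ diag_loops (diag_comp D E) F =
        c * (d * e * \<delta> ^ diag_loops E F) * \<delta> ^ diag_loops D (diag_comp E F)"
        by (simp add: algebra_simps)
      then show ?case unfolding tl_comp_single diag_comp_assoc[OF D E F] by (simp only:)
    qed (simp_all add: tl_comp_add_right)
  qed (simp_all add: tl_comp_add_left tl_comp_add_right)
qed (simp_all add: tl_comp_add_left)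

lemma tl_comp_id_left [simp]: "x \<in> tl_hom n m \<Longrightarrow> tl_comp \<delta> (tl_id n) x = x"
  by (induction x rule: tl_hom_induct)
    (simp_all add: tl_comp_add_right tl_comp_single tl_id_def diag_comp_id_left[OF pdiag_diagrams])

lemma tl_comp_id_right [simp]: "x \<in> tl_hom n m \<Longrightarrow> tl_comp \<delta> x (tl_id m) = x"
  by (induction x rule: tl_hom_induct)
    (simp_all add: tl_comp_add_left tl_comp_single tl_id_def diag_comp_id_right[OF pdiag_diagrams])

lemma tl_tensor_comp:
  assumes "x \<in> tl_hom n m" "x' \<in> tl_hom m k" "y \<in> tl_hom n' m'" "y' \<in> tl_hom m' k'"
  shows "tl_comp \<delta> (tl_tensor x y) (tl_tensor x' y') = tl_tensor (tl_comp \<delta> x x') (tl_comp \<delta> y y')"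
  using assms(1)
proof (induction x rule: tl_hom_induct)
  case (single D a)
  note D = pdiag_diagrams[OF single]
  from assms(2) show ?case
  proof (induction x' rule: tl_hom_induct)
    case (single D' a')
    note D' = pdiag_diagrams[OF single]
    from assms(3) show ?case
    proof (induction y rule: tl_hom_induct)
      case (single E b)
      note E = pdiag_diagrams[OF single]
      from assms(4) show ?case
      proof (induction y' rule: tl_hom_induct)
        case (single E' b')
        note E' = pdiag_diagrams[OF single]
        show ?case
          unfolding tl_comp_single tl_tensor_single diag_tensor_comp[OF D D' E E'] power_add
          by (simp add: mult_ac)
      qed (simp_all add: tl_comp_add_right tl_tensor_add_right)
    qed (simp_all add: tl_comp_add_left tl_tensor_add_right)
  qed (simp_all add: tl_comp_add_right tl_tensor_add_left)
qed (simp_all add: tl_comp_add_left tl_tensor_add_left)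

lemma tl_tensor_assoc:
  assumes "x \<in> tl_hom n m" "y \<in> tl_hom n' m'" "z \<in> tl_hom n'' m''"
  shows "tl_tensor (tl_tensor x y) z = tl_tensor x (tl_tensor y z)"
  using assms(1)
proof (induction x rule: tl_hom_induct)
  case (single D c)
  note D = pdiag_diagrams[OF single]
  from assms(2) show ?case
  proof (induction y rule: tl_hom_induct)
    case (single E d)
    note E = pdiag_diagrams[OF single]
    from assms(3) show ?case
    proof (induction z rule: tl_hom_induct)
      case (single F e)
      note F = pdiag_diagrams[OF single]
      show ?case unfolding tl_tensor_single diag_tensor_assoc[OF D E F] by (simp add: mult.assoc)
    qed (simp_all add: tl_tensor_add_right)
  qed (simp_all add: tl_tensor_add_left tl_tensor_add_right)
qed (simp_all add: tl_tensor_add_left)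

lemma tl_tensor_id: "tl_tensor (tl_id n) (tl_id m) = tl_id (n + m)"
  by (simp add: tl_id_def tl_tensor_single diag_tensor_id)

lemma tl_tensor_id_0_right [simp]: "tl_tensor x (tl_id 0) = x"
  by (rule keys_induct[of x UNIV])
    (simp_all add: tl_tensor_add_left tl_tensor_single tl_id_def diag_tensor_id_0_right)

lemma tl_tensor_id_0_left [simp]: "tl_tensor (tl_id 0) x = x"
  by (rule keys_induct[of x UNIV])
    (simp_all add: tl_tensor_add_right tl_tensor_single tl_id_def diag_tensor_id_0_left)

lemma tl_flip_comp:
  assumes "x \<in> tl_hom n m" "y \<in> tl_hom m k"
  shows "tl_flip (tl_comp \<delta> x y) = tl_comp \<delta> (tl_flip y) (tl_flip x)"
  using assms(1)
proof (induction x rule: tl_hom_induct)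
  case (single D c)
  note D = pdiag_diagrams[OF single]
  from assms(2) show ?case
  proof (induction y rule: tl_hom_induct)
    case (single E d)
    note E = pdiag_diagrams[OF single]
    show ?case unfolding tl_comp_single tl_flip_single diag_flip_comp[OF D E]
      by (simp add: mult.commute)
  qed (simp_all add: tl_comp_add_right tl_comp_add_left tl_flip_add)
qed (simp_all add: tl_comp_add_left tl_comp_add_right tl_flip_add)

lemma tl_flip_tensor:
  assumes "x \<in> tl_hom n m" "y \<in> tl_hom n' m'"
  shows "tl_flip (tl_tensor x y) = tl_tensor (tl_flip x) (tl_flip y)"
  using assms(1)
proof (induction x rule: tl_hom_induct)
  case (single D c)
  note D = pdiag_diagrams[OF single]
  from assms(2) show ?case
  proof (induction y rule: tl_hom_induct)
    case (single E d)
    note E = pdiag_diagrams[OF single]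
    show ?case unfolding tl_tensor_single tl_flip_single diag_flip_tensor[OF D E] ..
  qed (simp_all add: tl_tensor_add_right tl_flip_add)
qed (simp_all add: tl_tensor_add_left tl_flip_add)

lemma tl_flip_id [simp]: "tl_flip (tl_id n) = tl_id n"
  by (simp add: tl_id_def tl_flip_single)

lemma simple_cap_eq: "simple_cap n i = Poly_Mapping.single (capd n i) 1"
  by (simp add: simple_cap_def capd_def tl_id_def tl_cap_def tl_tensor_single)

lemma tl_hom_simple_cap: "i + 2 \<le> n \<Longrightarrow> simple_cap n i \<in> tl_hom n (n - 2)"
  by (simp add: simple_cap_eq tl_hom_single capd_diagrams)

lemma tl_hom_simple_cup: "i + 2 \<le> n \<Longrightarrow> simple_cup n i \<in> tl_hom (n - 2) n"
  by (simp add: simple_cup_def tl_hom_flip tl_hom_simple_cap)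

lemma tl_cup_cap_loop:
  "tl_comp \<delta> (tl_flip (tl_cap 1)) (tl_cap 1) = tl_scale \<delta> (tl_id 0)"
  unfolding tl_cap_def tl_flip_single tl_comp_single cup_cap_loop
  by (simp add: tl_id_def tl_scale_single)

lemma tl_zigzag:
  "tl_comp \<delta> (tl_tensor (tl_id 1) (tl_flip (tl_cap 1))) (tl_tensor (tl_cap 1) (tl_id 1)) = tl_id 1"
  unfolding tl_cap_def tl_flip_single tl_id_def tl_tensor_single tl_comp_single zigzag by simp

lemma tl_cap_Suc:
  "tl_cap (Suc c) = tl_comp \<delta> (tl_tensor (tl_tensor (tl_id c) (tl_cap 1)) (tl_id c)) (tl_cap c)"
  unfolding tl_cap_def tl_id_def tl_tensor_single tl_comp_single diag_cap_Suc by simp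

subsection \<open>Jones-Wenzl idempotents\<close>

abbreviation comp_generic (infixl \<open>\<odot>\<close> 70) where "x \<odot> y \<equiv> tl_comp loopX x y"
abbreviation tensor_infix (infixl \<open>\<otimes>\<close> 75) where "x \<otimes> y \<equiv> tl_tensor x y"
abbreviation qn :: "nat \<Rightarrow> ratfun" where "qn \<equiv> qnum loopX"

lemma qnum_2: "qnum (2::int) n = int n"
  by (induction "2::int" n rule: qnum.induct) simp_all

lemma qnum_poly: "poly (qnum [:0, 1:] n) x = qnum (x::'a::idom) n"
  by (induction x n rule: qnum.induct) simp_all

lemma qnum_loopX: "qn n = Fract (qnum [:0, 1:] n) 1"
  by (induction loopX n rule: qnum.induct)
    (simp_all add: loopX_def Zero_fract_def One_fract_def)

text \<open>Setting X = 2 turns the n-th quantum number into n, so none with positive index vanishes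
  generically.\<close>

lemma qn_nonzero: "qn (Suc n) \<noteq> 0"
proof
  assume "qn (Suc n) = 0"
  then have "qnum [:0, 1::int:] (Suc n) = 0" by (simp add: qnum_loopX Zero_fract_def eq_fract)
  then have "qnum (2::int) (Suc n) = 0" using qnum_poly[of "Suc n" "2::int"] by simp
  then show False unfolding qnum_2 by simp
qed

lemma tl_comp_id_id [simp]: "tl_comp \<delta> (tl_id n) (tl_id n) = tl_id n"
  by (rule tl_comp_id_left[OF tl_hom_id])

lemma lookup_tl_id [simp]: "Poly_Mapping.lookup (tl_id n) (diag_id n) = 1"
  by (simp add: tl_id_def)

lemma lookup_tl_flip: "Poly_Mapping.lookup (tl_flip x) D = Poly_Mapping.lookup x (diag_flip D)"
proof (rule keys_induct[of x UNIV])
  have eq: "diag_flip E = D \<longleftrightarrow> E = diag_flip D" for E by (metis diag_flip_flip)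
  show "Poly_Mapping.lookup (tl_flip (Poly_Mapping.single E c)) D =
    Poly_Mapping.lookup (Poly_Mapping.single E c) (diag_flip D)" for E and c :: 'a
    unfolding tl_flip_single lookup_single eq ..
qed (simp_all add: tl_flip_add lookup_add)

lemma simple_cap_tensor:
  assumes "i + 2 \<le> a"
  shows "simple_cap (a + n) i = simple_cap a i \<otimes> tl_id n"
proof -
  have "simple_cap a i \<otimes> tl_id n = (tl_id i \<otimes> tl_cap 1) \<otimes> (tl_id (a - 2 - i) \<otimes> tl_id n)"
    unfolding simple_cap_def
    by (rule tl_tensor_assoc[OF tl_hom_tensor[OF tl_hom_id tl_hom_cap] tl_hom_id tl_hom_id])
  also have "\<dots> = simple_cap (a + n) i"
    using assms by (simp add: simple_cap_def tl_tensor_id)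
  finally show ?thesis ..
qed

lemma capped_factor_tl:
  assumes D: "D \<in> diagrams n m" and a: "a \<le> n" and cap: "capped a D"
  obtains i y where "i + 2 \<le> a" "y \<in> tl_hom (n - 2) m"
    "Poly_Mapping.single D c = tl_comp \<delta> (simple_cap n i) y"
proof -
  obtain i D' where i: "i + 2 \<le> a" "D' \<in> diagrams (n - 2) m" "D = diag_comp (capd n i) D'"
    "diag_loops (capd n i) D' = 0" by (rule capped_factor[OF assms])
  show ?thesis
  proof (rule that[OF i(1) tl_hom_single[OF i(2)]])
    show "Poly_Mapping.single D c = tl_comp \<delta> (simple_cap n i) (Poly_Mapping.single D' c)"
      unfolding simple_cap_eq tl_comp_single i(4) i(3)[symmetric] by simp
  qed
qed

text \<open>One-sided and rectangular, so that it applies not only to \<open>JW\<close> but also to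
  the partial morphisms \<open>dbar\<close>, which end in a Jones-Wenzl element.\<close>

definition kills_caps :: "nat \<Rightarrow> nat \<Rightarrow> ratfun morphism \<Rightarrow> bool" where
  "kills_caps k n x \<longleftrightarrow> x \<in> tl_hom k n \<and> (\<forall>i. i + 2 \<le> n \<longrightarrow> x \<odot> simple_cap n i = 0)"

lemma kills_capsD: "kills_caps k n x \<Longrightarrow> x \<in> tl_hom k n"
  "kills_caps k n x \<Longrightarrow> i + 2 \<le> n \<Longrightarrow> x \<odot> simple_cap n i = 0"
  by (simp_all add: kills_caps_def)

lemma kills_caps_comp:
  assumes "x \<in> tl_hom l k" "kills_caps k n y"
  shows "kills_caps l n (x \<odot> y)"
  unfolding kills_caps_def
proof (intro conjI allI impI)
  note y = kills_capsD(1)[OF assms(2)]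
  show "x \<odot> y \<in> tl_hom l n" by (rule tl_hom_comp[OF assms(1) y])
  fix i assume i: "i + 2 \<le> n"
  show "x \<odot> y \<odot> simple_cap n i = 0"
    unfolding tl_comp_assoc[OF assms(1) y tl_hom_simple_cap[OF i]] kills_capsD(2)[OF assms(2) i] by simp
qed

text \<open>A diagram with an arc among its first \<open>n\<close> sources factors through a simple
  cap on these sources, by \<open>capped_factor_tl\<close>.\<close>

lemma kills_caps_capped:
  assumes x: "kills_caps k n x" and D: "D \<in> diagrams (n + c) m" and cap: "capped n D"
  shows "(x \<otimes> tl_id c) \<odot> Poly_Mapping.single D e = 0"
proof -
  obtain i y where i: "i + 2 \<le> n" and y: "y \<in> tl_hom (n + c - 2) m"
    and eq: "Poly_Mapping.single D e = simple_cap (n + c) i \<odot> y"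
    by (rule capped_factor_tl[OF D _ cap]) auto
  note x' = kills_capsD[OF x]
  have i': "i + 2 \<le> n + c" using i by simp
  have "(x \<otimes> tl_id c) \<odot> Poly_Mapping.single D e = (x \<otimes> tl_id c) \<odot> simple_cap (n + c) i \<odot> y"
    unfolding eq by (rule tl_comp_assoc[OF tl_hom_tensor[OF x'(1) tl_hom_id] tl_hom_simple_cap[OF i'] y, symmetric])
  also have "(x \<otimes> tl_id c) \<odot> simple_cap (n + c) i = (x \<odot> simple_cap n i) \<otimes> (tl_id c \<odot> tl_id c)"
    unfolding simple_cap_tensor[OF i]
    by (rule tl_tensor_comp[OF x'(1) tl_hom_simple_cap[OF i] tl_hom_id tl_hom_id])
  also have "\<dots> = 0" using x'(2)[OF i] by simp
  finally show ?thesis by simp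
qed

text \<open>Every diagram on \<open>w\<close> strands other than the identity has a cap on its left
  side, so only the identity coefficient of \<open>y\<close> survives.\<close>

lemma kills_caps_absorb:
  assumes x: "kills_caps k (w + c) x" and y: "y \<in> tl_hom w w"
  shows "x \<odot> (y \<otimes> tl_id c) = tl_scale (Poly_Mapping.lookup y (diag_id w)) x"
  using y
proof (induction y rule: tl_hom_induct)
  case (single D e)
  note x' = kills_capsD[OF x]
  show ?case
  proof (cases "D = diag_id w")
    case True
    then have "Poly_Mapping.single D e = tl_scale e (tl_id w)"
      by (simp add: tl_id_def tl_scale_single)
    then show ?thesis using True x'(1) by (simp add: tl_tensor_scale tl_comp_scale tl_tensor_id tl_scale_lookup)
  next
    case False
    have "Poly_Mapping.single D e \<otimes> tl_id c = Poly_Mapping.single (diag_tensor D (diag_id c)) e"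
      by (simp add: tl_id_def tl_tensor_single)
    moreover have "capped (w + c) (diag_tensor D (diag_id c))"
      using capped_tensor[OF single nonid_capped_cupped(1)[OF single False]]
      unfolding capped_def by (meson trans_less_add1)
    moreover have "diag_tensor D (diag_id c) \<in> diagrams (w + c + 0) (w + c)"
      using diag_tensor_diagrams[OF single diag_id_diagrams] by simp
    ultimately have "x \<odot> (Poly_Mapping.single D e \<otimes> tl_id c) = 0"
      using kills_caps_capped[OF x, of _ 0 "w + c" e] by simp
    then show ?thesis using False by (simp add: lookup_single)
  qed
next
  case (add y z)
  then show ?case by (simp add: tl_tensor_add_left tl_comp_add_right lookup_add tl_scale_left_add)
qed (simp add: lookup_zero)

lemma is_JW_kills:
  assumes "is_JW n x"
  shows "kills_caps n n x" "kills_caps n n (tl_flip x)"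
proof -
  show "kills_caps n n x" using assms by (simp add: is_JW_def kills_caps_def)
  have x: "x \<in> tl_hom n n" using assms by (simp add: is_JW_def)
  have "tl_flip x \<odot> simple_cap n i = 0" if i: "i + 2 \<le> n" for i
  proof -
    have "simple_cup n i \<odot> x = 0" using assms i by (simp add: is_JW_def)
    then have "tl_flip (simple_cup n i \<odot> x) = 0" by simp
    then show ?thesis
      unfolding tl_flip_comp[OF tl_hom_simple_cup[OF i] x] by (simp add: simple_cup_def)
  qed
  then show "kills_caps n n (tl_flip x)" using x by (simp add: kills_caps_def tl_hom_flip)
qed

lemma is_JW_absorb:
  assumes "is_JW (w + c) x" and y: "y \<in> tl_hom w w"
  shows "x \<odot> (y \<otimes> tl_id c) = tl_scale (Poly_Mapping.lookup y (diag_id w)) x"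
    and "(y \<otimes> tl_id c) \<odot> x = tl_scale (Poly_Mapping.lookup y (diag_id w)) x"
proof -
  note k = is_JW_kills[OF assms(1)]
  show "x \<odot> (y \<otimes> tl_id c) = tl_scale (Poly_Mapping.lookup y (diag_id w)) x"
    by (rule kills_caps_absorb[OF k(1) y])
  have x: "x \<in> tl_hom (w + c) (w + c)" using kills_capsD(1)[OF k(1)] .
  have "tl_flip ((y \<otimes> tl_id c) \<odot> x) = tl_flip x \<odot> (tl_flip y \<otimes> tl_id c)"
    unfolding tl_flip_comp[OF tl_hom_tensor[OF y tl_hom_id] x] tl_flip_tensor[OF y tl_hom_id] by simp
  also have "\<dots> = tl_scale (Poly_Mapping.lookup y (diag_id w)) (tl_flip x)"
    using kills_caps_absorb[OF k(2) tl_hom_flip[OF y]] by (simp add: lookup_tl_flip)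
  finally show "(y \<otimes> tl_id c) \<odot> x = tl_scale (Poly_Mapping.lookup y (diag_id w)) x"
    using tl_flip_flip by (metis tl_flip_scale)
qed

text \<open>Absorption gives x \<odot> x = c x with c the identity coefficient, and \<open>x\<close>
  is a nonzero idempotent.\<close>

lemma is_JW_coeff:
  assumes "is_JW n x"
  shows "Poly_Mapping.lookup x (diag_id n) = 1"
proof -
  have x: "x \<in> tl_hom n n" "x \<noteq> 0" "x \<odot> x = x" using assms by (simp_all add: is_JW_def)
  have "x \<odot> x = tl_scale (Poly_Mapping.lookup x (diag_id n)) x"
    using is_JW_absorb(1)[of n 0 x x] assms x by simp
  then have "tl_scale (Poly_Mapping.lookup x (diag_id n) - 1) x = 0"
    using x(3) by (simp add: tl_scale_left_diff)
  then show ?thesis using x(2) by simp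
qed

lemma is_JW_absorb_JW:
  assumes "is_JW (w + c) x" "is_JW w y"
  shows "x \<odot> (y \<otimes> tl_id c) = x" "(y \<otimes> tl_id c) \<odot> x = x"
proof -
  have y: "y \<in> tl_hom w w" using assms(2) by (simp add: is_JW_def)
  show "x \<odot> (y \<otimes> tl_id c) = x" "(y \<otimes> tl_id c) \<odot> x = x"
    unfolding is_JW_absorb[OF assms(1) y] is_JW_coeff[OF assms(2)] by simp_all
qed

text \<open>The product x \<odot> y equals \<open>x\<close> when \<open>x\<close> absorbs
  \<open>y\<close>, and \<open>y\<close> when \<open>y\<close> absorbs \<open>x\<close>.\<close>

lemma is_JW_unique: "is_JW n x \<Longrightarrow> is_JW n y \<Longrightarrow> x = y"
  using is_JW_absorb_JW(1)[of n 0 x y] is_JW_absorb_JW(2)[of n 0 y x] by simp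

abbreviation last_cap :: "nat \<Rightarrow> ratfun morphism" where
  "last_cap k \<equiv> tl_id k \<otimes> tl_cap 1"

abbreviation last_cup :: "nat \<Rightarrow> ratfun morphism" where
  "last_cup k \<equiv> tl_id k \<otimes> tl_flip (tl_cap 1)"

lemma hom_last_cap: "last_cap k \<in> tl_hom (k + 2) k"
  using tl_hom_tensor[OF tl_hom_id tl_hom_cap[of 1], of k] by simp

lemma flip_last_cap: "tl_flip (last_cap k) = last_cup k"
  using tl_flip_tensor[OF tl_hom_id tl_hom_cap] by simp

lemma flip_last_cup: "tl_flip (last_cup k) = last_cap k"
  unfolding flip_last_cap[symmetric] by simp

lemma hom_cap_1: "tl_cap 1 \<in> tl_hom 2 0" "tl_flip (tl_cap 1) \<in> tl_hom 0 2"
  using tl_hom_cap[of 1] tl_hom_flip[OF tl_hom_cap[of 1]] by simp_all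

lemma hom_last_cup: "last_cup k \<in> tl_hom k (k + 2)"
  using tl_hom_flip[OF hom_last_cap] unfolding flip_last_cap .

lemma simple_cap_last: "simple_cap (k + 2) k = last_cap k"
  by (simp add: simple_cap_def)

text \<open>Wenzl's recursion. The coefficient is the inverse of the partial trace factor of the
  preceding element, so that the last cap is killed.\<close>

fun wenzl :: "nat \<Rightarrow> ratfun morphism" where
  "wenzl 0 = tl_id 0"
| "wenzl (Suc 0) = tl_id 1"
| "wenzl (Suc (Suc k)) = wenzl (Suc k) \<otimes> tl_id 1 - tl_scale (qn (Suc k) / qn (Suc (Suc k)))
     ((wenzl (Suc k) \<otimes> tl_id 1) \<odot> last_cap k \<odot> (last_cup k \<odot> (wenzl (Suc k) \<otimes> tl_id 1)))"

text \<open>Two consecutive levels are carried along because the step to level k + 2 uses the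
  partial trace from level k + 1 down to level k.\<close>

definition wenzl_good :: "nat \<Rightarrow> bool" where
  "wenzl_good k \<longleftrightarrow> is_JW k (wenzl k) \<and> tl_flip (wenzl k) = wenzl k \<and>
     is_JW (Suc k) (wenzl (Suc k)) \<and> tl_flip (wenzl (Suc k)) = wenzl (Suc k) \<and>
     last_cup k \<odot> (wenzl (Suc k) \<otimes> tl_id 1) \<odot> last_cap k =
       tl_scale (qn (Suc (Suc k)) / qn (Suc k)) (wenzl k)"

lemma is_JWI:
  assumes x: "x \<in> tl_hom n n" "x \<noteq> 0" "x \<odot> x = x" "tl_flip x = x"
    and cap: "\<And>i. i + 2 \<le> n \<Longrightarrow> x \<odot> simple_cap n i = 0"
  shows "is_JW n x"
proof -
  have "simple_cup n i \<odot> x = 0" if i: "i + 2 \<le> n" for i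
    using arg_cong[OF cap[OF i], of tl_flip]
    unfolding tl_flip_comp[OF x(1) tl_hom_simple_cap[OF i]] by (simp add: simple_cup_def x(4))
  then show ?thesis using assms by (simp add: is_JW_def)
qed

lemma tl_id_nonzero [simp]: "tl_id n \<noteq> (0 :: 'a::idom morphism)"
proof
  assume "tl_id n = (0 :: 'a morphism)"
  then have "Poly_Mapping.lookup (tl_id n :: 'a morphism) (diag_id n) = 0" by simp
  then show False by (simp add: tl_id_def)
qed

lemma wenzl_good_0: "wenzl_good 0"
proof -
  have "last_cup 0 \<odot> (wenzl (Suc 0) \<otimes> tl_id 1) \<odot> last_cap 0 =
     tl_flip (tl_cap 1) \<odot> tl_id 2 \<odot> tl_cap 1"
    by (simp add: tl_tensor_id numeral_2_eq_2)
  also have "\<dots> = tl_flip (tl_cap 1) \<odot> tl_cap 1"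
    unfolding tl_comp_id_right[OF hom_cap_1(2)] ..
  also have "\<dots> = tl_scale loopX (tl_id 0)" by (rule tl_cup_cap_loop)
  finally show ?thesis
    unfolding wenzl_good_def by (intro conjI is_JWI) simp_all
qed

lemma wenzl_good_Suc:
  assumes "wenzl_good k"
  shows "wenzl_good (Suc k)"
proof -
  define f0 f1 where "f0 = wenzl k" and "f1 = wenzl (Suc k)"
  define F where "F = f1 \<otimes> tl_id 1"
  define c where "c = qn (Suc k) / qn (Suc (Suc k))"
  define f where "f = F - tl_scale c (F \<odot> last_cap k \<odot> (last_cup k \<odot> F))"
  have f_eq: "wenzl (Suc (Suc k)) = f" by (simp add: f_def F_def c_def f1_def)
  have J0: "is_JW k f0" and J1: "is_JW (Suc k) f1" and flip1: "tl_flip f1 = f1"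
    and ptr: "last_cup k \<odot> F \<odot> last_cap k = tl_scale (inverse c) f0"
    using assms by (simp_all add: wenzl_good_def f0_def f1_def F_def c_def)
  have c: "c \<noteq> 0" using qn_nonzero[of k] qn_nonzero[of "Suc k"] by (simp add: c_def del: qnum.simps)
  have h0: "f0 \<in> tl_hom k k" and h1: "f1 \<in> tl_hom (Suc k) (Suc k)"
    and idem1: "f1 \<odot> f1 = f1" and nz1: "f1 \<noteq> 0"
    using J0 J1 by (simp_all add: is_JW_def)
  have hF: "F \<in> tl_hom (k + 2) (k + 2)" using tl_hom_tensor[OF h1 tl_hom_id[of 1]] by (simp add: F_def)
  note hA = hom_last_cap[of k] and hB = hom_last_cup[of k]
  have idemF: "F \<odot> F = F"
    unfolding F_def tl_tensor_comp[OF h1 h1 tl_hom_id tl_hom_id] idem1 by simp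
  have hFA: "F \<odot> last_cap k \<in> tl_hom (k + 2) k" by (rule tl_hom_comp[OF hF hA])
  have hBF: "last_cup k \<odot> F \<in> tl_hom k (k + 2)" by (rule tl_hom_comp[OF hB hF])
  have hf: "f \<in> tl_hom (k + 2) (k + 2)"
    unfolding f_def by (intro tl_hom_diff tl_hom_scale hF tl_hom_comp[OF hFA hBF])
  have flipF: "tl_flip F = F" unfolding F_def tl_flip_tensor[OF h1 tl_hom_id] flip1 by simp
  have flip_BF: "tl_flip (last_cup k \<odot> F) = F \<odot> last_cap k"
    unfolding tl_flip_comp[OF hB hF] flipF flip_last_cup ..
  then have flip_FA: "tl_flip (F \<odot> last_cap k) = last_cup k \<odot> F" by (metis tl_flip_flip)
  have flipf: "tl_flip f = f"
    unfolding f_def tl_flip_diff tl_flip_scale tl_flip_comp[OF hFA hBF] flip_BF flip_FA flipF ..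
  note hc = hom_cap_1(1) and hc' = hom_cap_1(2)
  \<comment> \<open>The last cap slides past \<open>f0\<close>, which acts on the first
    \<open>k\<close> strands and is absorbed by \<open>f1\<close>.\<close>
  have absorb: "F \<odot> last_cap k \<odot> f0 = F \<odot> last_cap k"
  proof -
    have "last_cap k \<odot> f0 = (tl_id k \<otimes> tl_cap 1) \<odot> (f0 \<otimes> tl_id 0)" by simp
    also have "\<dots> = (tl_id k \<odot> f0) \<otimes> (tl_cap 1 \<odot> tl_id 0)"
      by (rule tl_tensor_comp[OF tl_hom_id h0 tl_hom_cap tl_hom_id])
    also have "\<dots> = (f0 \<odot> tl_id k) \<otimes> (tl_id 2 \<odot> tl_cap 1)"
      unfolding tl_comp_id_left[OF h0] tl_comp_id_right[OF h0] tl_comp_id_right[OF hc]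
        tl_comp_id_left[OF hc] ..
    also have "\<dots> = (f0 \<otimes> tl_id 2) \<odot> last_cap k"
      by (rule tl_tensor_comp[OF h0 tl_hom_id tl_hom_id hc, symmetric])
    finally have 1: "last_cap k \<odot> f0 = (f0 \<otimes> tl_id 2) \<odot> last_cap k" .
    have h02: "f0 \<otimes> tl_id 2 \<in> tl_hom (k + 2) (k + 2)" by (rule tl_hom_tensor[OF h0 tl_hom_id])
    have h01: "f0 \<otimes> tl_id 1 \<in> tl_hom (Suc k) (Suc k)" using tl_hom_tensor[OF h0 tl_hom_id[of 1]] by simp
    have "f0 \<otimes> tl_id 2 = (f0 \<otimes> tl_id 1) \<otimes> tl_id 1"
      unfolding tl_tensor_assoc[OF h0 tl_hom_id tl_hom_id] tl_tensor_id by (simp add: numeral_2_eq_2)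
    then have "F \<odot> (f0 \<otimes> tl_id 2) = (f1 \<odot> (f0 \<otimes> tl_id 1)) \<otimes> (tl_id 1 \<odot> tl_id 1)"
      unfolding F_def using tl_tensor_comp[OF h1 h01 tl_hom_id[of 1] tl_hom_id] by simp
    also have "\<dots> = F" using is_JW_absorb_JW(1)[of k 1 f1 f0] J0 J1 by (simp add: F_def)
    finally have 2: "F \<odot> (f0 \<otimes> tl_id 2) = F" .
    have "F \<odot> last_cap k \<odot> f0 = F \<odot> (last_cap k \<odot> f0)" by (rule tl_comp_assoc[OF hF hA h0])
    also have "\<dots> = F \<odot> (f0 \<otimes> tl_id 2) \<odot> last_cap k"
      unfolding 1 by (rule tl_comp_assoc[OF hF h02 hA, symmetric])
    finally show ?thesis unfolding 2 .
  qed
  \<comment> \<open>By \<open>ptr\<close> closing the middle strand produces the factor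
    \<open>inverse c\<close>, which cancels the coefficient \<open>c\<close> in
    \<open>f\<close>.\<close>
  have fA: "f \<odot> last_cap k = 0"
  proof -
    have "F \<odot> last_cap k \<odot> (last_cup k \<odot> F) \<odot> last_cap k =
      F \<odot> last_cap k \<odot> (last_cup k \<odot> F \<odot> last_cap k)"
      by (rule tl_comp_assoc[OF hFA hBF hA])
    also have "\<dots> = tl_scale (inverse c) (F \<odot> last_cap k)"
      unfolding ptr tl_comp_scale absorb ..
    finally show ?thesis using c by (simp add: f_def tl_comp_diff_left tl_comp_scale)
  qed
  have BFF: "last_cup k \<odot> F \<odot> F = last_cup k \<odot> F"
    unfolding tl_comp_assoc[OF hB hF hF] idemF ..
  have fF: "f \<odot> F = f"
    unfolding f_def tl_comp_diff_left tl_comp_scale tl_comp_assoc[OF hFA hBF hF] BFF idemF ..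
  have ff: "f \<odot> f = f"
  proof -
    have "f \<odot> (F \<odot> last_cap k) = f \<odot> F \<odot> last_cap k" by (rule tl_comp_assoc[OF hf hF hA, symmetric])
    then have "f \<odot> (F \<odot> last_cap k) = 0" unfolding fF fA .
    then have "f \<odot> (F \<odot> last_cap k \<odot> (last_cup k \<odot> F)) = 0"
      unfolding tl_comp_assoc[OF hf hFA hBF, symmetric] by simp
    then have "f \<odot> f = f \<odot> F" by (subst (2) f_def) (simp add: tl_comp_diff_right tl_comp_scale)
    then show ?thesis using fF by simp
  qed
  \<comment> \<open>The cap at \<open>i = k\<close> is \<open>fA\<close>. All others lie on the
    first \<open>Suc k\<close> strands, where \<open>F\<close> already kills them, and
    \<open>f \<odot> F = f\<close>.\<close>
  have fcap: "f \<odot> simple_cap (k + 2) i = 0" if i: "i + 2 \<le> k + 2" for i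
  proof (cases "i = k")
    case True
    show ?thesis unfolding True simple_cap_last by (rule fA)
  next
    case False
    then have i': "i + 2 \<le> Suc k" using i by simp
    have "F \<odot> simple_cap (k + 2) i = (f1 \<odot> simple_cap (Suc k) i) \<otimes> (tl_id 1 \<odot> tl_id 1)"
      unfolding F_def tl_tensor_comp[OF h1 tl_hom_simple_cap[OF i'] tl_hom_id[of 1] tl_hom_id, symmetric]
        simple_cap_tensor[OF i', symmetric] by simp
    also have "\<dots> = 0" using J1 i' by (simp add: is_JW_def)
    finally have "f \<odot> (F \<odot> simple_cap (k + 2) i) = 0" by simp
    then show ?thesis unfolding tl_comp_assoc[OF hf hF tl_hom_simple_cap[OF i], symmetric] fF .
  qed
  let ?A = "last_cap (Suc k)" and ?B = "last_cup (Suc k)"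
  have hA': "?A \<in> tl_hom (k + 3) (Suc k)" and hB': "?B \<in> tl_hom (Suc k) (k + 3)"
    using hom_last_cap[of "Suc k"] hom_last_cup[of "Suc k"] by (simp_all add: numeral_3_eq_3)
  \<comment> \<open>In the first term of \<open>f\<close> the closed strand is a loop, with factor
    \<open>loopX\<close>; in the second it straightens by the zigzag and leaves \<open>f1\<close>.
    The factor \<open>loopX - c\<close> is the quotient of quantum numbers by their
    recursion.\<close>
  have ptr': "?B \<odot> (f \<otimes> tl_id 1) \<odot> ?A = tl_scale (qn (Suc (Suc (Suc k))) / qn (Suc (Suc k))) f1"
  proof -
    note T = tl_tensor_comp
    have hF1: "F \<otimes> tl_id 1 \<in> tl_hom (k + 3) (k + 3)" using tl_hom_tensor[OF hF tl_hom_id[of 1]] by (simp add: numeral_3_eq_3)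
    have F1: "F \<otimes> tl_id 1 = f1 \<otimes> tl_id 2"
      unfolding F_def tl_tensor_assoc[OF h1 tl_hom_id tl_hom_id] tl_tensor_id by (simp add: numeral_2_eq_2)
    have BF1: "?B \<odot> (F \<otimes> tl_id 1) = f1 \<otimes> tl_flip (tl_cap 1)"
      unfolding F1 T[OF tl_hom_id h1 hc' tl_hom_id] tl_comp_id_left[OF h1] tl_comp_id_right[OF hc'] ..
    have 1: "?B \<odot> (F \<otimes> tl_id 1) \<odot> ?A = tl_scale loopX f1"
      unfolding BF1 T[OF h1 tl_hom_id hc' hc] tl_cup_cap_loop tl_tensor_scale
        tl_comp_id_right[OF h1] by simp
    have BF1': "?B \<odot> (F \<otimes> tl_id 1) = f1 \<odot> ?B"
    proof -
      have "f1 \<odot> ?B = (f1 \<otimes> tl_id 0) \<odot> (tl_id (Suc k) \<otimes> tl_flip (tl_cap 1))" by simp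
      also have "\<dots> = f1 \<otimes> tl_flip (tl_cap 1)"
        unfolding T[OF h1 tl_hom_id tl_hom_id hc'] tl_comp_id_right[OF h1] tl_comp_id_left[OF hc'] ..
      finally show ?thesis unfolding BF1 ..
    qed
    have flipF1: "tl_flip (F \<otimes> tl_id 1) = F \<otimes> tl_id 1"
      unfolding tl_flip_tensor[OF hF tl_hom_id] flipF by simp
    note flipA = flip_last_cup[of "Suc k"]
    have F1A: "(F \<otimes> tl_id 1) \<odot> ?A = ?A \<odot> f1"
      using arg_cong[OF BF1', of tl_flip]
      unfolding tl_flip_comp[OF hB' hF1] tl_flip_comp[OF h1 hB'] flipF1 flipA flip1 .
    have hA1: "last_cap k \<otimes> tl_id 1 \<in> tl_hom (k + 3) (Suc k)"
      using tl_hom_tensor[OF hA tl_hom_id[of 1]] by (simp add: numeral_3_eq_3)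
    have hB1: "last_cup k \<otimes> tl_id 1 \<in> tl_hom (Suc k) (k + 3)"
      using tl_hom_tensor[OF hB tl_hom_id[of 1]] by (simp add: numeral_3_eq_3)
    have BA: "?B \<odot> (last_cap k \<otimes> tl_id 1) = tl_id (Suc k)"
    proof -
      have B: "?B = tl_id k \<otimes> (tl_id 1 \<otimes> tl_flip (tl_cap 1))"
        using tl_tensor_assoc[OF tl_hom_id[of k] tl_hom_id[of 1] hc'] by (simp add: tl_tensor_id)
      have A: "last_cap k \<otimes> tl_id 1 = tl_id k \<otimes> (tl_cap 1 \<otimes> tl_id 1)"
        by (rule tl_tensor_assoc[OF tl_hom_id hc tl_hom_id])
      have h1': "tl_id 1 \<otimes> tl_flip (tl_cap 1) \<in> tl_hom 1 3" "tl_cap 1 \<otimes> tl_id 1 \<in> tl_hom 3 1"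
        using tl_hom_tensor[OF tl_hom_id[of 1] hc'] tl_hom_tensor[OF hc tl_hom_id[of 1]]
        by (simp_all add: numeral_3_eq_3)
      show ?thesis unfolding B A T[OF tl_hom_id tl_hom_id h1'] tl_zigzag tl_comp_id_left[OF tl_hom_id]
          tl_tensor_id by simp
    qed
    have flipA1: "tl_flip (last_cap k \<otimes> tl_id 1) = last_cup k \<otimes> tl_id 1"
      unfolding tl_flip_tensor[OF hA tl_hom_id] flip_last_cap by simp
    have AB: "(last_cup k \<otimes> tl_id 1) \<odot> ?A = tl_id (Suc k)"
      using arg_cong[OF BA, of tl_flip] unfolding tl_flip_comp[OF hB' hA1] flipA flipA1 by simp
    have "(F \<odot> last_cap k \<odot> (last_cup k \<odot> F)) \<otimes> tl_id 1 =
        (F \<otimes> tl_id 1) \<odot> (last_cap k \<otimes> tl_id 1) \<odot> ((last_cup k \<otimes> tl_id 1) \<odot> (F \<otimes> tl_id 1))"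
      unfolding T[OF hF hA tl_hom_id tl_hom_id] T[OF hB hF tl_hom_id tl_hom_id]
        T[OF hFA hBF tl_hom_comp[OF tl_hom_id tl_hom_id] tl_hom_comp[OF tl_hom_id tl_hom_id]] by simp
    also have "?B \<odot> \<dots> \<odot> ?A = f1"
    proof -
      let ?P = "(F \<otimes> tl_id 1) \<odot> (last_cap k \<otimes> tl_id 1)"
      let ?Q = "(last_cup k \<otimes> tl_id 1) \<odot> (F \<otimes> tl_id 1)"
      have hP: "?P \<in> tl_hom (k + 3) (Suc k)" and hQ: "?Q \<in> tl_hom (Suc k) (k + 3)"
        by (rule tl_hom_comp[OF hF1 hA1], rule tl_hom_comp[OF hB1 hF1])
      have "?B \<odot> ?P = ?B \<odot> (F \<otimes> tl_id 1) \<odot> (last_cap k \<otimes> tl_id 1)"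
        by (rule tl_comp_assoc[OF hB' hF1 hA1, symmetric])
      also have "\<dots> = f1 \<odot> (?B \<odot> (last_cap k \<otimes> tl_id 1))"
        unfolding BF1' by (rule tl_comp_assoc[OF h1 hB' hA1])
      finally have BP: "?B \<odot> ?P = f1" unfolding BA tl_comp_id_right[OF h1] .
      have "?Q \<odot> ?A = (last_cup k \<otimes> tl_id 1) \<odot> ((F \<otimes> tl_id 1) \<odot> ?A)"
        by (rule tl_comp_assoc[OF hB1 hF1 hA'])
      also have "\<dots> = (last_cup k \<otimes> tl_id 1) \<odot> ?A \<odot> f1"
        unfolding F1A by (rule tl_comp_assoc[OF hB1 hA' h1, symmetric])
      finally have QA: "?Q \<odot> ?A = f1" unfolding AB tl_comp_id_left[OF h1] .
      show ?thesis
        unfolding tl_comp_assoc[OF hB' hP hQ, symmetric] BP tl_comp_assoc[OF h1 hQ hA'] QA idem1 ..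
    qed
    finally have 2: "?B \<odot> ((F \<odot> last_cap k \<odot> (last_cup k \<odot> F)) \<otimes> tl_id 1) \<odot> ?A = f1" .
    have "?B \<odot> (f \<otimes> tl_id 1) \<odot> ?A = tl_scale loopX f1 - tl_scale c f1"
      unfolding f_def tl_tensor_diff_left tl_tensor_scale tl_comp_diff_right tl_comp_diff_left
        tl_comp_scale 1 2 ..
    also have "\<dots> = tl_scale (loopX - c) f1" by (simp add: tl_scale_left_diff)
    also have "loopX - c = qn (Suc (Suc (Suc k))) / qn (Suc (Suc k))"
      using qn_nonzero[of "Suc k"] by (simp add: c_def field_simps)
    finally show ?thesis .
  qed
  \<comment> \<open>The partial trace of \<open>f\<close> is a nonzero multiple of
    \<open>f1\<close>.\<close>
  have "f \<noteq> 0"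
  proof
    assume "f = 0"
    then have "tl_scale (qn (Suc (Suc (Suc k))) / qn (Suc (Suc k))) f1 = 0" using ptr' by simp
    then show False using nz1 qn_nonzero by (simp del: qnum.simps)
  qed
  then have "is_JW (Suc (Suc k)) f" using hf ff flipf fcap by (intro is_JWI) simp_all
  then show ?thesis
    using J1 flip1 flipf ptr' unfolding wenzl_good_def f_eq f1_def by simp
qed

lemma wenzl_good: "wenzl_good k"
  by (induction k) (auto intro: wenzl_good_0 wenzl_good_Suc)

lemma JW_eq: "JW n = wenzl n"
  unfolding JW_def
proof (rule the_equality)
  show "is_JW n (wenzl n)" using wenzl_good[of n] by (simp add: wenzl_good_def)
  then show "x = wenzl n" if "is_JW n x" for x using is_JW_unique that by blast
qed

lemma is_JW_JW: "is_JW n (JW n)"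
  unfolding JW_eq using wenzl_good[of n] by (simp add: wenzl_good_def)

lemma flip_JW [simp]: "tl_flip (JW n) = JW n"
  unfolding JW_eq using wenzl_good[of n] by (simp add: wenzl_good_def)

lemma hom_JW: "JW n \<in> tl_hom n n" and JW_idem: "JW n \<odot> JW n = JW n" and JW_nonzero: "JW n \<noteq> 0"
  using is_JW_JW[of n] by (simp_all add: is_JW_def)

lemma JW_partial_trace_1:
  "last_cup k \<odot> (JW (Suc k) \<otimes> tl_id 1) \<odot> last_cap k = tl_scale (qn (Suc (Suc k)) / qn (Suc k)) (JW k)"
  unfolding JW_eq using wenzl_good[of k] by (simp only: wenzl_good_def)

text \<open>Closing the strands one at a time gives the factors [v+i+1]/[v+i] for i = c, ..., 1, and
  their product telescopes.\<close>

lemma JW_partial_trace: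
  "(tl_id v \<otimes> tl_flip (tl_cap c)) \<odot> (JW (v + c) \<otimes> tl_id c) \<odot> (tl_id v \<otimes> tl_cap c) =
     tl_scale (qn (Suc (v + c)) / qn (Suc v)) (JW v)"
proof (induction c)
  case 0
  have "diag_cap 0 = diag_id 0" by (simp add: diag_cap_def diag_id_0)
  then have "tl_cap 0 = (tl_id 0 :: ratfun morphism)" by (simp add: tl_cap_def tl_id_def)
  then show ?case using qn_nonzero[of v] hom_JW[of v] by simp
next
  case (Suc c)
  let ?w = "v + c"
  let ?C = "tl_id v \<otimes> tl_cap c" and ?A = "last_cap ?w \<otimes> tl_id c"
  let ?J = "JW (Suc ?w) \<otimes> tl_id 1"
  note hc = hom_cap_1(1)
  have hC: "?C \<in> tl_hom (?w + c) v"
    using tl_hom_tensor[OF tl_hom_id tl_hom_cap[of c], of v] by (simp add: mult_2 add.assoc)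
  have hA: "?A \<in> tl_hom (?w + 2 + c) (?w + c)" by (rule tl_hom_tensor[OF hom_last_cap tl_hom_id])
  have hcc: "tl_id c \<otimes> tl_cap 1 \<in> tl_hom (c + 2) c" using tl_hom_tensor[OF tl_hom_id hc, of c] by simp
  have hccc: "tl_id c \<otimes> tl_cap 1 \<otimes> tl_id c \<in> tl_hom (c + 2 + c) (2 * c)"
    using tl_hom_tensor[OF hcc tl_hom_id[of c]] by (simp add: mult_2)
  have cap: "tl_id v \<otimes> tl_cap (Suc c) = ?A \<odot> ?C"
  proof -
    have "tl_id v \<otimes> tl_cap (Suc c) =
        (tl_id v \<odot> tl_id v) \<otimes> ((tl_id c \<otimes> tl_cap 1 \<otimes> tl_id c) \<odot> tl_cap c)"
      unfolding tl_cap_Suc[where \<delta> = loopX, of c] by simp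
    also have "\<dots> = (tl_id v \<otimes> (tl_id c \<otimes> tl_cap 1 \<otimes> tl_id c)) \<odot> ?C"
      by (rule tl_tensor_comp[OF tl_hom_id tl_hom_id hccc tl_hom_cap, symmetric])
    also have "tl_id v \<otimes> (tl_id c \<otimes> tl_cap 1 \<otimes> tl_id c) = tl_id v \<otimes> (tl_id c \<otimes> tl_cap 1) \<otimes> tl_id c"
      by (rule tl_tensor_assoc[OF tl_hom_id hcc tl_hom_id, symmetric])
    also have "tl_id v \<otimes> (tl_id c \<otimes> tl_cap 1) = last_cap ?w"
      unfolding tl_tensor_assoc[OF tl_hom_id tl_hom_id hc, symmetric] tl_tensor_id ..
    finally show ?thesis .
  qed
  have hcap: "tl_cap c \<in> tl_hom (2 * c) 0" by (rule tl_hom_cap)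
  have cup: "tl_id v \<otimes> tl_flip (tl_cap (Suc c)) = tl_flip ?C \<odot> tl_flip ?A"
    using arg_cong[OF cap, of tl_flip]
    unfolding tl_flip_tensor[OF tl_hom_id tl_hom_cap] tl_flip_comp[OF hA hC] by simp
  have hJ: "?J \<in> tl_hom (?w + 2) (?w + 2)" using tl_hom_tensor[OF hom_JW tl_hom_id[of 1]] by simp
  have hJc: "?J \<otimes> tl_id c \<in> tl_hom (?w + 2 + c) (?w + 2 + c)" by (rule tl_hom_tensor[OF hJ tl_hom_id])
  have J: "JW (v + Suc c) \<otimes> tl_id (Suc c) = ?J \<otimes> tl_id c"
    unfolding tl_tensor_assoc[OF hom_JW tl_hom_id tl_hom_id] tl_tensor_id by simp
  have flipA: "tl_flip ?A = last_cup ?w \<otimes> tl_id c"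
    unfolding tl_flip_tensor[OF hom_last_cap tl_hom_id] flip_last_cap by simp
  have hfA: "tl_flip ?A \<in> tl_hom (?w + c) (?w + 2 + c)" by (rule tl_hom_flip[OF hA])
  have hfC: "tl_flip ?C \<in> tl_hom v (?w + c)" by (rule tl_hom_flip[OF hC])
  have hBJ: "last_cup ?w \<odot> ?J \<in> tl_hom ?w (?w + 2)" by (rule tl_hom_comp[OF hom_last_cup hJ])
  have mid: "tl_flip ?A \<odot> (?J \<otimes> tl_id c) \<odot> ?A = tl_scale (qn (Suc (Suc ?w)) / qn (Suc ?w)) (JW ?w \<otimes> tl_id c)"
    unfolding flipA tl_tensor_comp[OF hom_last_cup hJ tl_hom_id tl_hom_id] tl_comp_id_left[OF tl_hom_id]
      tl_tensor_comp[OF hBJ hom_last_cap tl_hom_id tl_hom_id] JW_partial_trace_1 tl_tensor_scale ..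
  have hAJ: "tl_flip ?A \<odot> (?J \<otimes> tl_id c) \<in> tl_hom (?w + c) (?w + 2 + c)" by (rule tl_hom_comp[OF hfA hJc])
  have "(tl_flip ?C \<odot> tl_flip ?A) \<odot> (?J \<otimes> tl_id c) \<odot> (?A \<odot> ?C) =
      tl_flip ?C \<odot> (tl_flip ?A \<odot> (?J \<otimes> tl_id c)) \<odot> (?A \<odot> ?C)"
    unfolding tl_comp_assoc[OF hfC hfA hJc] ..
  also have "\<dots> = tl_flip ?C \<odot> (tl_flip ?A \<odot> (?J \<otimes> tl_id c)) \<odot> ?A \<odot> ?C"
    by (rule tl_comp_assoc[OF tl_hom_comp[OF hfC hAJ] hA hC, symmetric])
  also have "\<dots> = tl_flip ?C \<odot> (tl_flip ?A \<odot> (?J \<otimes> tl_id c) \<odot> ?A) \<odot> ?C"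
    unfolding tl_comp_assoc[OF hfC hAJ hA] ..
  also have "\<dots> = tl_scale (qn (Suc (Suc ?w)) / qn (Suc ?w)) (tl_flip ?C \<odot> (JW ?w \<otimes> tl_id c) \<odot> ?C)"
    unfolding mid tl_comp_scale ..
  also have "tl_flip ?C = tl_id v \<otimes> tl_flip (tl_cap c)"
    unfolding tl_flip_tensor[OF tl_hom_id tl_hom_cap] by simp
  finally show ?case
    unfolding Suc.IH cap cup J using qn_nonzero[of ?w] by (simp del: qnum.simps add: tl_flip_tensor[OF tl_hom_id tl_hom_cap])
qed

subsection \<open>Digits\<close>

text \<open>Digits for an arbitrary sequence of radices. Dropping the lowest digit turns the radices
  ell, p, p, ... into p, p, ..., so the induction needs this generality; infinite radices are
  allowed.\<close>

definition mixed_digits :: "(nat \<Rightarrow> enat) \<Rightarrow> nat \<Rightarrow> nat list \<Rightarrow> bool" where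
  "mixed_digits b N ds \<longleftrightarrow> ds \<noteq> [] \<and> last ds \<noteq> 0 \<and> (\<forall>i<length ds. enat (ds ! i) < b i) \<and>
     enat N = (\<Sum>i<length ds. enat (ds ! i) * (\<Prod>k<i. b k))"

lemma mixed_digits_single: "mixed_digits b N [d] \<longleftrightarrow> d \<noteq> 0 \<and> enat d < b 0 \<and> N = d"
  by (auto simp: mixed_digits_def one_enat_def)

lemma mixed_digits_Cons_sum:
  "(\<Sum>i<length (d # ds). enat ((d # ds) ! i) * (\<Prod>k<i. b k)) =
     enat d + b 0 * (\<Sum>i<length ds. enat (ds ! i) * (\<Prod>k<i. b (Suc k)))"
  by (simp add: sum.lessThan_Suc_shift prod.lessThan_Suc_shift sum_distrib_left mult_ac
      del: sum.lessThan_Suc prod.lessThan_Suc)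

lemma prod_enat_nonzero: "(\<And>k. b k \<noteq> (0::enat)) \<Longrightarrow> (\<Prod>k<(i::nat). b k) \<noteq> 0"
  by (induction i) (simp_all add: imult_is_0)

lemma mixed_digits_nonzero:
  assumes "mixed_digits b N ds" "\<And>i. 2 \<le> b i"
  shows "N \<noteq> 0"
proof
  assume "N = 0"
  let ?i = "length ds - 1"
  have i: "?i < length ds" "ds ! ?i \<noteq> 0"
    using assms(1) by (auto simp: mixed_digits_def last_conv_nth)
  have "(\<Sum>i<length ds. enat (ds ! i) * (\<Prod>k<i. b k)) = 0"
    using assms(1) \<open>N = 0\<close> by (simp add: mixed_digits_def zero_enat_def)
  then have "enat (ds ! ?i) * (\<Prod>k<?i. b k) = 0" using i(1) by (simp add: sum_eq_0_iff)
  then have "(\<Prod>k<?i. b k) = 0" using i(2) by (simp add: imult_is_0 enat_0_iff)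
  moreover have "b k \<noteq> 0" for k using assms(2)[of k] by (metis not_numeral_le_zero)
  ultimately show False using prod_enat_nonzero by blast
qed

text \<open>The higher digits have positive total value because the last one is nonzero. If the
  lowest radix were infinite, they would contribute an infinite amount; so it is finite, and
  division with remainder separates the digits.\<close>

lemma mixed_digits_Cons:
  assumes b: "\<And>i. 2 \<le> b i" and ds: "ds \<noteq> []"
  shows "mixed_digits b N (d # ds) \<longleftrightarrow> (\<exists>B. b 0 = enat B \<and> d = N mod B \<and> mixed_digits (b \<circ> Suc) (N div B) ds)"
proof
  assume L: "mixed_digits b N (d # ds)"
  define S where "S = (\<Sum>i<length ds. enat (ds ! i) * (\<Prod>k<i. b (Suc k)))"
  have N: "enat N = enat d + b 0 * S"
    using L mixed_digits_Cons_sum[of d ds b] by (simp add: mixed_digits_def S_def)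
  have S0: "S \<noteq> 0"
  proof
    assume "S = 0"
    then have "mixed_digits (b \<circ> Suc) 0 ds"
      using L ds by (auto simp: mixed_digits_def S_def zero_enat_def)
    then show False using mixed_digits_nonzero[of "b \<circ> Suc" 0 ds] b by simp
  qed
  have b0: "b 0 \<noteq> 0" using b[of 0] by (metis not_numeral_le_zero)
  have "b 0 * S \<noteq> \<infinity>" using N by (metis enat.distinct(1) plus_enat_simps(3))
  then have "b 0 \<noteq> \<infinity>" "S \<noteq> \<infinity>" using S0 b0 by (auto simp: imult_is_infinity)
  then obtain B M where B: "b 0 = enat B" and M: "S = enat M" by auto
  have dB: "d < B" using L B by (auto simp: mixed_digits_def)
  have "N = d + B * M" using N unfolding B M by simp
  then have "d = N mod B" "M = N div B" using dB by auto
  moreover have "mixed_digits (b \<circ> Suc) M ds"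
    using L ds M by (auto simp: mixed_digits_def S_def)
  ultimately show "\<exists>B. b 0 = enat B \<and> d = N mod B \<and> mixed_digits (b \<circ> Suc) (N div B) ds" using B by blast
next
  assume "\<exists>B. b 0 = enat B \<and> d = N mod B \<and> mixed_digits (b \<circ> Suc) (N div B) ds"
  then obtain B where B: "b 0 = enat B" "d = N mod B" and m: "mixed_digits (b \<circ> Suc) (N div B) ds" by blast
  have "(2::enat) \<le> enat B" using b[of 0] B by simp
  then have "0 < B" by (cases B) (auto simp: zero_enat_def[symmetric])
  then have dB: "d < B" using B by simp
  have "enat N = enat d + enat B * enat (N div B)" using B by simp
  also have "enat (N div B) = (\<Sum>i<length ds. enat (ds ! i) * (\<Prod>k<i. b (Suc k)))"
    using m by (simp add: mixed_digits_def)
  finally have "enat N = (\<Sum>i<length (d # ds). enat ((d # ds) ! i) * (\<Prod>k<i. b k))"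
    unfolding mixed_digits_Cons_sum B(1) .
  moreover have "enat ((d # ds) ! i) < b i" if "i < length (d # ds)" for i
    using that m dB B(1) by (cases i) (auto simp: mixed_digits_def)
  ultimately show "mixed_digits b N (d # ds)" using m ds by (auto simp: mixed_digits_def)
qed

lemma mixed_digits_ex1:
  assumes "\<And>i. 2 \<le> b i" "N \<noteq> 0"
  shows "\<exists>!ds. mixed_digits b N ds"
  using assms
proof (induction N arbitrary: b rule: less_induct)
  case (less N)
  note Cons = mixed_digits_Cons[of b, OF less.prems(1)]
  show ?case
  proof (cases "enat N < b 0")
    case True
    show ?thesis
    proof (rule ex1I[of _ "[N]"])
      show "mixed_digits b N [N]" using True less.prems by (simp add: mixed_digits_single)
      fix ds assume m: "mixed_digits b N ds"
      then obtain d ds' where ds: "ds = d # ds'" by (cases ds) (auto simp: mixed_digits_def)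
      show "ds = [N]"
      proof (cases "ds' = []")
        case True
        then show ?thesis using m by (simp add: ds mixed_digits_single)
      next
        case False
        then obtain B where B: "b 0 = enat B" "mixed_digits (b \<circ> Suc) (N div B) ds'"
          using Cons[OF False, THEN iffD1, OF m[unfolded ds]] by blast
        then have "N div B \<noteq> 0" using mixed_digits_nonzero[OF B(2)] less.prems(1) by simp
        then show ?thesis using True B(1) by (simp add: div_eq_0_iff)
      qed
    qed
  next
    case False
    then obtain B where B: "b 0 = enat B" by (cases "b 0") auto
    have "(2::enat) \<le> enat B" using less.prems(1)[of 0] B by simp
    then have B2: "2 \<le> B" by (metis enat_ord_simps(1) numeral_eq_enat)
    have NB: "B \<le> N" using False B by simp
    have "N div B < N" "N div B \<noteq> 0" using B2 NB by (simp_all add: div_eq_0_iff)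
    then obtain ds where ds: "mixed_digits (b \<circ> Suc) (N div B) ds"
      and uniq: "\<And>ds'. mixed_digits (b \<circ> Suc) (N div B) ds' \<Longrightarrow> ds' = ds"
      using less.IH[of "N div B" "b \<circ> Suc"] less.prems(1) by (metis comp_apply)
    have ne: "ds \<noteq> []" using ds by (simp add: mixed_digits_def)
    show ?thesis
    proof (rule ex1I[of _ "(N mod B) # ds"])
      show "mixed_digits b N ((N mod B) # ds)" using B ds by (intro Cons[OF ne, THEN iffD2]) simp
      fix ds' assume m: "mixed_digits b N ds'"
      then obtain d ds'' where ds': "ds' = d # ds''" by (cases ds') (auto simp: mixed_digits_def)
      show "ds' = (N mod B) # ds"
      proof (cases "ds'' = []")
        case True
        then show ?thesis using m False by (simp add: ds' mixed_digits_single)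
      next
        case False
        then obtain B' where "b 0 = enat B'" "d = N mod B'" "mixed_digits (b \<circ> Suc) (N div B') ds''"
          using Cons[OF False, THEN iffD1, OF m[unfolded ds']] by blast
        then show ?thesis using B uniq by (simp add: ds')
      qed
    qed
  qed
qed

text \<open>The analogue of 99...9 + 1 = 10...0. In the form with \<open>+ 1\<close> the bound can
  be multiplied by the next radix in the induction.\<close>

lemma mixed_digits_prefix:
  assumes "mixed_digits b N ds" "i \<le> length ds"
  shows "(\<Sum>k<i. enat (ds ! k) * (\<Prod>l<k. b l)) + 1 \<le> (\<Prod>l<i. b l)"
  using assms(2)
proof (induction i)
  case (Suc i)
  have "enat (ds ! i) < b i" using assms(1) Suc.prems by (simp add: mixed_digits_def)
  then have d: "1 + enat (ds ! i) \<le> b i" by (metis ileI1 plus_1_eSuc(1))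
  have "(\<Sum>k<Suc i. enat (ds ! k) * (\<Prod>l<k. b l)) + 1 =
      ((\<Sum>k<i. enat (ds ! k) * (\<Prod>l<k. b l)) + 1) + enat (ds ! i) * (\<Prod>l<i. b l)"
    by (simp add: add_ac)
  also have "\<dots> \<le> (\<Prod>l<i. b l) + enat (ds ! i) * (\<Prod>l<i. b l)"
    using Suc by (intro add_right_mono) simp
  also have "\<dots> = (1 + enat (ds ! i)) * (\<Prod>l<i. b l)" by (simp add: distrib_right)
  also have "\<dots> \<le> b i * (\<Prod>l<i. b l)" by (intro mult_right_mono d) simp
  finally show ?case by (simp add: mult.commute)
qed simp

section \<open>The digits of n + 1 and the support of n\<close>

lemma ell_ge_2: "2 \<le> ell (\<delta>::'a::idom)"
  unfolding ell_def
proof (rule INF_greatest)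
  fix n assume "n \<in> {n. 1 \<le> n \<and> qnum \<delta> n = 0}"
  then have "1 \<le> n" "qnum \<delta> n = 0" by auto
  then have "2 \<le> n" by (cases "n = 1") auto
  then show "2 \<le> enat n" by (simp add: numeral_eq_enat)
qed

lemma pchar_ge_2: "2 \<le> pchar TYPE('a::idom)"
proof (cases "CHAR('a) = 0")
  case False
  then have "prime CHAR('a)" using prime_CHAR_semidom by auto
  then have "2 \<le> CHAR('a)" by (rule prime_ge_2_nat)
  then show ?thesis using False by (simp add: pchar_def numeral_eq_enat)
qed (simp add: pchar_def)

definition radix :: "'a::idom \<Rightarrow> nat \<Rightarrow> enat" where
  "radix \<delta> i = (if i = 0 then ell \<delta> else pchar TYPE('a))"

lemma radix_ge_2: "2 \<le> radix (\<delta>::'a::idom) i"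
  using ell_ge_2[of \<delta>] pchar_ge_2[where 'a = 'a] by (simp add: radix_def)

lemma ppow_prod: "ppow \<delta> i = (\<Prod>k<i. radix \<delta> k)"
proof (cases i)
  case (Suc k)
  have "(\<Prod>l<Suc k. radix \<delta> l) = ell \<delta> * pchar TYPE('a) ^ k"
    unfolding prod.lessThan_Suc_shift by (simp add: radix_def)
  then show ?thesis using Suc by (simp add: ppow_def)
qed (simp add: ppow_def)

lemma digits_mixed: "mixed_digits (radix \<delta>) (n + 1) (digits \<delta> (n + 1))"
proof -
  have "digits \<delta> (n + 1) = (THE ds. mixed_digits (radix \<delta>) (n + 1) ds)"
    unfolding digits_def mixed_digits_def ppow_prod radix_def ..
  moreover have "\<exists>!ds. mixed_digits (radix \<delta>) (n + 1) ds"
    by (rule mixed_digits_ex1[OF radix_ge_2]) simp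
  ultimately show ?thesis by (metis theI')
qed

text \<open>A nonzero digit has a finite place value, since its term is bounded by
  \<open>n + 1\<close>; for a zero digit both sides are 0. Hence \<open>the_enat\<close> in
  \<open>digit_term\<close> loses nothing.\<close>

lemma digit_term_enat:
  assumes "i \<le> top_index \<delta> n"
  shows "enat (digit_term \<delta> n i) = enat (digits \<delta> (n + 1) ! i) * ppow \<delta> i"
proof -
  let ?ds = "digits \<delta> (n + 1)"
  have len: "i < length ?ds" using assms digits_mixed[of \<delta> n]
    by (cases ?ds) (auto simp: top_index_def mixed_digits_def)
  have "enat (?ds ! i) * ppow \<delta> i \<le> (\<Sum>i<length ?ds. enat (?ds ! i) * ppow \<delta> i)"
    using len by (intro member_le_sum) auto
  also have "\<dots> = enat (n + 1)" using digits_mixed[of \<delta> n] by (simp add: mixed_digits_def ppow_prod)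
  finally have fin: "enat (?ds ! i) * ppow \<delta> i \<noteq> \<infinity>" using enat_ile by fastforce
  show ?thesis
  proof (cases "?ds ! i = 0")
    case False
    then have "ppow \<delta> i \<noteq> \<infinity>" using fin by (auto simp: imult_is_infinity enat_0_iff)
    then obtain q where "ppow \<delta> i = enat q" by auto
    then show ?thesis by (simp add: digit_term_def)
  qed (simp add: digit_term_def zero_enat_def[symmetric])
qed

lemma digit_term_prefix:
  assumes "i \<le> Suc (top_index \<delta> n)"
  shows "enat (\<Sum>k<i. digit_term \<delta> n k) = (\<Sum>k<i. enat (digits \<delta> (n + 1) ! k) * ppow \<delta> k)"
  using assms
proof (induction i)
  case (Suc i)
  then have "enat (\<Sum>k<i. digit_term \<delta> n k) + enat (digit_term \<delta> n i) =
      (\<Sum>k<Suc i. enat (digits \<delta> (n + 1) ! k) * ppow \<delta> k)"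
    using digit_term_enat[of i \<delta> n] by simp
  then show ?case by simp
qed (simp add: zero_enat_def)

lemma length_digits: "length (digits \<delta> (n + 1)) = Suc (top_index \<delta> n)"
  using digits_mixed[of \<delta> n] by (cases "digits \<delta> (n + 1)") (auto simp: top_index_def mixed_digits_def)

lemma digit_term_sum: "(\<Sum>i\<le>top_index \<delta> n. digit_term \<delta> n i) = n + 1"
proof -
  have "enat (\<Sum>k<Suc (top_index \<delta> n). digit_term \<delta> n k) = enat (n + 1)"
    using digits_mixed[of \<delta> n] digit_term_prefix[of "Suc (top_index \<delta> n)" \<delta> n]
    by (simp only: mixed_digits_def ppow_prod length_digits order_refl)
  then show ?thesis by (simp add: lessThan_Suc_atMost)
qed

lemma digit_term_eq_0_iff:
  assumes "i \<le> top_index \<delta> n"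
  shows "digit_term \<delta> n i = 0 \<longleftrightarrow> digits \<delta> (n + 1) ! i = 0"
proof -
  have "radix \<delta> k \<noteq> 0" for k using radix_ge_2[of \<delta> k] by (metis not_numeral_le_zero)
  then have "ppow \<delta> i \<noteq> 0" unfolding ppow_prod by (rule prod_enat_nonzero)
  then show ?thesis using digit_term_enat[OF assms] by (metis enat_0_iff(1) imult_is_0)
qed

text \<open>This dominance makes subset sums of the digit terms determine the subset, and keeps the
  signed sums in \<open>supp\<close> and \<open>down_step\<close> from falling below their
  range.\<close>

lemma digit_term_superincreasing:
  assumes "i \<le> top_index \<delta> n" "digit_term \<delta> n i \<noteq> 0"
  shows "(\<Sum>k<i. digit_term \<delta> n k) < digit_term \<delta> n i"
proof -
  have nz: "digits \<delta> (n + 1) ! i \<noteq> 0" using digit_term_eq_0_iff[OF assms(1)] assms(2) by simp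
  have "enat (\<Sum>k<i. digit_term \<delta> n k) + 1 \<le> ppow \<delta> i"
    using mixed_digits_prefix[OF digits_mixed, of i \<delta> n] assms(1)
    by (simp add: digit_term_prefix ppow_prod length_digits[simplified])
  also have "\<dots> = enat 1 * ppow \<delta> i" by (simp only: one_enat_def[symmetric] mult_1_left)
  also have "\<dots> \<le> enat (digits \<delta> (n + 1) ! i) * ppow \<delta> i"
    using nz by (intro mult_right_mono) (auto simp: Suc_le_eq)
  also have "\<dots> = enat (digit_term \<delta> n i)" by (rule digit_term_enat[OF assms(1), symmetric])
  finally show ?thesis by (simp add: one_enat_def)
qed

lemma top_digit_term_nonzero: "digit_term \<delta> n (top_index \<delta> n) \<noteq> 0"
proof -
  have "last (digits \<delta> (n + 1)) \<noteq> 0" using digits_mixed[of \<delta> n] by (simp add: mixed_digits_def)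
  then have "digits \<delta> (n + 1) ! top_index \<delta> n \<noteq> 0"
    using length_digits[of \<delta> n] by (metis diff_Suc_1 last_conv_nth length_0_conv nat.distinct(1))
  then show ?thesis using digit_term_eq_0_iff[of "top_index \<delta> n" \<delta> n] by simp
qed

text \<open>The largest index decides: a subset containing \<open>j\<close> sums to at least
  \<open>c j\<close>, a subset without it to less.\<close>

lemma superincreasing_subset_sum_inject:
  fixes c :: "nat \<Rightarrow> nat"
  assumes "\<And>i. i < j \<Longrightarrow> c i \<noteq> 0 \<Longrightarrow> (\<Sum>k<i. c k) < c i"
    and "S \<subseteq> {i. i < j \<and> c i \<noteq> 0}" "T \<subseteq> {i. i < j \<and> c i \<noteq> 0}" "sum c S = sum c T"
  shows "S = T"
  using assms
proof (induction j arbitrary: S T)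
  case (Suc j)
  have fin: "finite S" "finite T"
    using finite_subset[OF Suc.prems(2)] finite_subset[OF Suc.prems(3)] by auto
  have small: "sum c U < c j" if "U \<subseteq> {i. i < Suc j \<and> c i \<noteq> 0}" "j \<notin> U" "c j \<noteq> 0" for U
  proof -
    have "U \<subseteq> {..<j}" using that by (auto simp: less_Suc_eq)
    then have "sum c U \<le> (\<Sum>k<j. c k)" by (intro sum_mono2) auto
    then show ?thesis using Suc.prems(1)[of j] that by simp
  qed
  have large: "c j \<le> sum c U" if "j \<in> U" "finite U" for U
    using that by (intro member_le_sum) auto
  have jj: "j \<in> S \<longleftrightarrow> j \<in> T"
    using small[OF Suc.prems(2)] small[OF Suc.prems(3)] large[of S] large[of T] fin
      Suc.prems(2-4) by fastforce
  have sub: "S - {j} \<subseteq> {i. i < j \<and> c i \<noteq> 0}" "T - {j} \<subseteq> {i. i < j \<and> c i \<noteq> 0}"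
    using Suc.prems(2,3) by (auto simp: less_Suc_eq)
  have "sum c (S - {j}) = sum c (T - {j})"
    using jj fin Suc.prems(4) by (cases "j \<in> S") (auto simp: sum_diff1_nat)
  then have "S - {j} = T - {j}" using Suc.IH[OF _ sub] Suc.prems(1) by simp
  then show ?case using jj by blast
qed simp

lemma finite_sign_sum:
  fixes c :: "nat \<Rightarrow> nat"
  assumes "S \<subseteq> {..<j}"
  shows "(\<Sum>i<j. (if i \<in> S then - int (c i) else int (c i))) = (\<Sum>i<j. int (c i)) - 2 * (\<Sum>i\<in>S. int (c i))"
proof -
  have "(\<Sum>i\<in>S. int (c i)) = (\<Sum>i<j. if i \<in> S then int (c i) else 0)"
    using assms by (simp add: sum.If_cases Int_absorb1)
  then show ?thesis
    by (simp only: sum_distrib_left sum_subtractf[symmetric]) (intro sum.cong refl, simp)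
qed

lemma top_digit_sum:
  "int (digit_term \<delta> n (top_index \<delta> n)) + (\<Sum>i<top_index \<delta> n. int (digit_term \<delta> n i)) = int n + 1"
  using arg_cong[OF digit_term_sum[of \<delta> n], of int]
  by (simp add: lessThan_Suc_atMost[symmetric] add.commute)

lemma supp_down_set:
  assumes "int m \<in> supp \<delta> n"
  shows "down_set \<delta> n m \<subseteq> {..<top_index \<delta> n}"
    and "int m = int n - 2 * (\<Sum>i\<in>down_set \<delta> n m. int (digit_term \<delta> n i))"
proof -
  let ?j = "top_index \<delta> n" and ?c = "digit_term \<delta> n"
  define Z where "Z = {i. i < ?j \<and> digits \<delta> (n + 1) ! i \<noteq> 0}"
  have "?c i = 0 \<longleftrightarrow> digits \<delta> (n + 1) ! i = 0" if "i < ?j" for i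
    by (rule digit_term_eq_0_iff) (use that in simp)
  then have Z: "Z = {i. i < ?j \<and> ?c i \<noteq> 0}" unfolding Z_def by (intro Collect_cong conj_cong) simp_all
  obtain s where s: "\<forall>i<?j. s i \<in> {1, - 1}"
    and m: "int m = int (?c ?j) + (\<Sum>i<?j. s i * int (?c i)) - 1"
    using assms unfolding supp_def by blast
  \<comment> \<open>A sign at a zero digit does not change the sum, so minus signs are recorded at
    nonzero digits only; this makes the set unique and the \<open>THE\<close> in
    \<open>down_set\<close> meaningful.\<close>
  define S where "S = {i \<in> Z. s i = - 1}"
  have SZ: "S \<subseteq> Z" by (auto simp: S_def)
  have "(\<Sum>i<?j. s i * int (?c i)) = (\<Sum>i<?j. (if i \<in> S then - int (?c i) else int (?c i)))"
    using s by (intro sum.cong refl) (auto simp: S_def Z)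
  also have "\<dots> = (\<Sum>i<?j. int (?c i)) - 2 * (\<Sum>i\<in>S. int (?c i))"
    by (rule finite_sign_sum) (auto simp: S_def Z_def)
  finally have S: "S \<subseteq> Z \<and> int m = int n - 2 * (\<Sum>i\<in>S. int (?c i))"
    using m top_digit_sum[of \<delta> n] SZ by simp
  have "T = S" if T: "T \<subseteq> Z \<and> int m = int n - 2 * (\<Sum>i\<in>T. int (?c i))" for T
  proof (rule superincreasing_subset_sum_inject[of ?j ?c])
    have "int (sum ?c T) = int (sum ?c S)" using T S by simp
    then show "sum ?c T = sum ?c S" by linarith
    show "sum ?c {..<i} < ?c i" if "i < ?j" "?c i \<noteq> 0" for i
      using digit_term_superincreasing[of i \<delta> n] that by simp
  qed (use T S Z in auto)
  then have "down_set \<delta> n m = S"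
    unfolding down_set_def Z_def[symmetric] using S by (intro the_equality) auto
  then show "down_set \<delta> n m \<subseteq> {..<top_index \<delta> n}"
    "int m = int n - 2 * (\<Sum>i\<in>down_set \<delta> n m. int (digit_term \<delta> n i))" using S by (auto simp: Z_def)
qed

lemma supp_bounds:
  assumes "a \<in> supp \<delta> n"
  shows "0 \<le> a" "a \<le> int n" "even (int n - a)"
proof -
  let ?j = "top_index \<delta> n" and ?c = "digit_term \<delta> n"
  obtain s where s: "\<forall>i<?j. s i \<in> {1, - 1}"
    and a: "a = int (?c ?j) + (\<Sum>i<?j. s i * int (?c i)) - 1"
    using assms unfolding supp_def by blast
  have "(\<Sum>i<?j. - int (?c i)) \<le> (\<Sum>i<?j. s i * int (?c i))"
    "(\<Sum>i<?j. s i * int (?c i)) \<le> (\<Sum>i<?j. int (?c i))"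
    by (intro sum_mono; use s in auto)+
  moreover have "int (\<Sum>i<?j. ?c i) < int (?c ?j)"
    unfolding of_nat_less_iff
    by (rule digit_term_superincreasing[OF order_refl top_digit_term_nonzero])
  then have "(\<Sum>i<?j. int (?c i)) < int (?c ?j)" by (simp only: of_nat_sum)
  ultimately show "0 \<le> a" "a \<le> int n"
    using a top_digit_sum[of \<delta> n] by (simp_all add: sum_negf)
  have "int n - a = (\<Sum>i<?j. int (?c i) - s i * int (?c i))"
    using a top_digit_sum[of \<delta> n] by (simp add: sum_subtractf)
  also have "even \<dots>" by (rule dvd_sum) (use s in auto)
  finally show "even (int n - a)" .
qed

lemma supp_nonempty: "int n \<in> supp \<delta> n"
  unfolding supp_def using top_digit_sum[of \<delta> n] by (auto intro!: exI[of _ "\<lambda>_. 1"])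

section \<open>The partial morphisms and their norms\<close>

text \<open>An upward digit keeps the scalar of \<open>tl_flip d \<odot> d\<close>, because the
  larger Jones-Wenzl element absorbs the smaller one. A downward digit multiplies it by the factor
  \<open>qn (Suc w) / qn (Suc v)\<close> of a partial trace. Neither can make it vanish, and its
  inverse becomes \<open>lam\<close>.\<close>

lemma down_step_good:
  assumes big: "(\<Sum>i<j. c i) < c j" and k: "k \<le> j"
  shows "case down_step c j S k of (w, d) \<Rightarrow>
     int w = int (c j) - 1 + (\<Sum>i=j-k..<j. (if i \<in> S then - int (c i) else int (c i))) \<and>
     d \<in> tl_hom (c j - 1 + (\<Sum>i=j-k..<j. c i)) w \<and> d \<odot> JW w = d \<and>
     (\<exists>q. q \<noteq> 0 \<and> tl_flip d \<odot> d = tl_scale q (JW w))"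
  using k
proof (induction k)
  case 0
  have "c j \<noteq> 0" using big by simp
  then show ?case using hom_JW JW_idem by (auto intro!: exI[of _ 1])
next
  case (Suc k)
  obtain w d where wd: "down_step c j S k = (w, d)" by force
  define i where "i = j - Suc k"
  have i: "j - k = Suc i" "j - Suc k = i" "i < j" using Suc.prems by (auto simp: i_def)
  let ?a = "c j - 1 + (\<Sum>i=j-k..<j. c i)"
  let ?g = "\<lambda>i. if i \<in> S then - int (c i) else int (c i)"
  have w: "int w = int (c j) - 1 + (\<Sum>i=j-k..<j. ?g i)" and d: "d \<in> tl_hom ?a w"
    and dJ: "d \<odot> JW w = d" and "\<exists>q. q \<noteq> 0 \<and> tl_flip d \<odot> d = tl_scale q (JW w)"
    using Suc unfolding wd by auto
  then obtain q where q: "q \<noteq> 0" "tl_flip d \<odot> d = tl_scale q (JW w)" by blast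
  have sum_c: "(\<Sum>i=j-Suc k..<j. c i) = c i + (\<Sum>i=j-k..<j. c i)"
    unfolding i using i(3) by (simp add: sum.atLeast_Suc_lessThan)
  have sum_g: "(\<Sum>i=j-Suc k..<j. ?g i) = ?g i + (\<Sum>i=j-k..<j. ?g i)"
    unfolding i using i(3) by (simp add: sum.atLeast_Suc_lessThan)
  have fd: "tl_flip d \<in> tl_hom w ?a" by (rule tl_hom_flip[OF d])
  let ?x = "d \<otimes> tl_id (c i)"
  have x: "?x \<in> tl_hom (?a + c i) (w + c i)" by (rule tl_hom_tensor[OF d tl_hom_id])
  have fx: "tl_flip ?x \<in> tl_hom (w + c i) (?a + c i)" by (rule tl_hom_flip[OF x])
  have fxx: "tl_flip ?x \<odot> ?x = tl_scale q (JW w \<otimes> tl_id (c i))"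
    unfolding tl_flip_tensor[OF d tl_hom_id] tl_flip_id tl_tensor_comp[OF fd d tl_hom_id tl_hom_id]
      q(2) tl_tensor_scale tl_comp_id_id ..
  have hJ: "JW w \<otimes> tl_id (c i) \<in> tl_hom (w + c i) (w + c i)" by (rule tl_hom_tensor[OF hom_JW tl_hom_id])
  show ?case
  proof (cases "i \<in> S")
    case False
    let ?w = "w + c i"
    define d' where "d' = ?x \<odot> JW ?w"
    have step: "down_step c j S (Suc k) = (?w, d')"
      using False by (simp add: wd Let_def i_def d'_def)
    have d': "d' \<in> tl_hom (?a + c i) ?w" unfolding d'_def by (rule tl_hom_comp[OF x hom_JW])
    have "d' \<odot> JW ?w = d'" unfolding d'_def tl_comp_assoc[OF x hom_JW hom_JW] JW_idem ..
    moreover have "tl_flip d' \<odot> d' = tl_scale q (JW ?w)"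
    proof -
      have "tl_flip d' = JW ?w \<odot> tl_flip ?x"
        unfolding d'_def tl_flip_comp[OF x hom_JW] by simp
      then have "tl_flip d' \<odot> d' = JW ?w \<odot> (tl_flip ?x \<odot> d')"
        using tl_comp_assoc[OF hom_JW fx d'] by simp
      also have "tl_flip ?x \<odot> d' = tl_scale q ((JW w \<otimes> tl_id (c i)) \<odot> JW ?w)"
        unfolding d'_def tl_comp_assoc[OF fx x hom_JW, symmetric] fxx tl_comp_scale ..
      finally show ?thesis
        unfolding is_JW_absorb_JW(2)[OF is_JW_JW is_JW_JW] tl_comp_scale JW_idem .
    qed
    moreover have "int ?w = int (c j) - 1 + (\<Sum>i=j-Suc k..<j. ?g i)"
      unfolding sum_g using w False by simp
    ultimately show ?thesis unfolding step using d' q(1) by (auto simp: sum_c add_ac)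
  next
    case True
    \<comment> \<open>Even with all earlier digits subtracted, the leading term exceeds what is left
      to remove. So \<open>c i \<le> w\<close>, and the natural subtraction \<open>w - c i\<close>
      is a true difference.\<close>
    have "(\<Sum>i=j-k..<j. - int (c i)) \<le> (\<Sum>i=j-k..<j. ?g i)" by (intro sum_mono) simp
    then have "int (c j) - 1 - (\<Sum>i=j-k..<j. int (c i)) \<le> int w" using w by (simp add: sum_negf)
    moreover have "(\<Sum>i=j-Suc k..<j. c i) \<le> (\<Sum>i<j. c i)" by (intro sum_mono2) auto
    then have "c i + (\<Sum>i=j-k..<j. c i) < c j" using big sum_c by simp
    then have "int (c i) + (\<Sum>i=j-k..<j. int (c i)) < int (c j)"
      by (metis of_nat_add of_nat_less_iff of_nat_sum)
    ultimately have cw: "c i \<le> w" by linarith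
    define v where "v = w - c i"
    have w_eq: "w = v + c i" using cw by (simp add: v_def)
    let ?C = "tl_id v \<otimes> tl_cap (c i)"
    have C: "?C \<in> tl_hom (w + c i) v"
      using tl_hom_tensor[OF tl_hom_id[of v] tl_hom_cap[of "c i"]] by (simp add: w_eq mult_2 add.assoc)
    have fC: "tl_flip ?C = tl_id v \<otimes> tl_flip (tl_cap (c i))"
      unfolding tl_flip_tensor[OF tl_hom_id tl_hom_cap] by simp
    have hfC: "tl_flip ?C \<in> tl_hom v (w + c i)" by (rule tl_hom_flip[OF C])
    define y where "y = ?x \<odot> ?C"
    have y: "y \<in> tl_hom (?a + c i) v" unfolding y_def by (rule tl_hom_comp[OF x C])
    have fy: "tl_flip y \<in> tl_hom v (?a + c i)" by (rule tl_hom_flip[OF y])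
    define d' where "d' = y \<odot> JW v"
    have step: "down_step c j S (Suc k) = (v, d')"
      using True by (simp add: wd Let_def i_def d'_def y_def v_def)
    have d': "d' \<in> tl_hom (?a + c i) v" unfolding d'_def by (rule tl_hom_comp[OF y hom_JW])
    have "d' \<odot> JW v = d'" unfolding d'_def tl_comp_assoc[OF y hom_JW hom_JW] JW_idem ..
    moreover have "tl_flip d' \<odot> d' = tl_scale (q * (qn (Suc w) / qn (Suc v))) (JW v)"
    proof -
      \<comment> \<open>The inner factor \<open>tl_flip ?x \<odot> ?x\<close> is a multiple of
        \<open>JW w\<close> with \<open>c i\<close> extra strands; the cap and its reflection close
        the last \<open>c i\<close> strands of \<open>JW w\<close> with them.\<close>
      have "tl_flip y \<odot> y = tl_flip ?C \<odot> tl_flip ?x \<odot> (?x \<odot> ?C)"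
        unfolding y_def tl_flip_comp[OF x C] ..
      also have "\<dots> = tl_flip ?C \<odot> (tl_flip ?x \<odot> (?x \<odot> ?C))"
        using tl_comp_assoc[OF hfC fx y] unfolding y_def .
      also have "\<dots> = tl_flip ?C \<odot> (tl_scale q (JW w \<otimes> tl_id (c i)) \<odot> ?C)"
        unfolding tl_comp_assoc[OF fx x C, symmetric] fxx ..
      also have "\<dots> = tl_scale q (tl_flip ?C \<odot> (JW w \<otimes> tl_id (c i)) \<odot> ?C)"
        unfolding tl_comp_scale tl_comp_assoc[OF hfC hJ C] ..
      also have "tl_flip ?C \<odot> (JW w \<otimes> tl_id (c i)) \<odot> ?C = tl_scale (qn (Suc w) / qn (Suc v)) (JW v)"
        using JW_partial_trace[of v "c i"] unfolding fC w_eq[symmetric] .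
      finally have fyy: "tl_flip y \<odot> y = tl_scale (q * (qn (Suc w) / qn (Suc v))) (JW v)"
        by (simp del: qnum.simps)
      have "tl_flip d' = JW v \<odot> tl_flip y"
        unfolding d'_def tl_flip_comp[OF y hom_JW] by simp
      then have "tl_flip d' \<odot> d' = JW v \<odot> (tl_flip y \<odot> d')"
        using tl_comp_assoc[OF hom_JW fy d'] by simp
      also have "tl_flip y \<odot> d' = tl_scale (q * (qn (Suc w) / qn (Suc v))) (JW v)"
        unfolding d'_def tl_comp_assoc[OF fy y hom_JW, symmetric] fyy tl_comp_scale JW_idem ..
      finally show ?thesis unfolding tl_comp_scale JW_idem .
    qed
    moreover have "q * (qn (Suc w) / qn (Suc v)) \<noteq> 0"
      using q(1) qn_nonzero[of w] qn_nonzero[of v] by (simp del: qnum.simps)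
    moreover have "int v = int (c j) - 1 + (\<Sum>i=j-Suc k..<j. ?g i)"
      unfolding sum_g using w True w_eq by simp
    moreover have "d' \<in> tl_hom (c j - 1 + (\<Sum>i=j-Suc k..<j. c i)) v"
      using d' by (simp add: sum_c add_ac)
    ultimately show ?thesis unfolding step prod.case by blast
  qed
qed

lemma dbar_good:
  assumes m: "int m \<in> supp \<delta> n"
  shows "dbar \<delta> n m \<in> tl_hom n m" "dbar \<delta> n m \<odot> JW m = dbar \<delta> n m"
    "lam \<delta> n m \<noteq> 0" "ubar \<delta> n m \<odot> dbar \<delta> n m = tl_scale (inverse (lam \<delta> n m)) (JW m)"
proof -
  let ?j = "top_index \<delta> n" and ?c = "digit_term \<delta> n" and ?S = "down_set \<delta> n m"
  obtain w d where wd: "down_step ?c ?j ?S ?j = (w, d)" by force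
  have big: "(\<Sum>i<?j. ?c i) < ?c ?j"
    using digit_term_superincreasing[of ?j \<delta> n] top_digit_term_nonzero[of \<delta> n] by simp
  have good: "int w = int (?c ?j) - 1 + (\<Sum>i<?j. (if i \<in> ?S then - int (?c i) else int (?c i)))"
     "d \<in> tl_hom (?c ?j - 1 + (\<Sum>i<?j. ?c i)) w" "d \<odot> JW w = d"
     "\<exists>q. q \<noteq> 0 \<and> tl_flip d \<odot> d = tl_scale q (JW w)"
    using down_step_good[OF big order_refl, of ?S] unfolding wd by (auto simp: atLeast0LessThan)
  have "w = m"
    using good(1) supp_down_set[OF m] top_digit_sum[of \<delta> n] finite_sign_sum[of ?S ?j ?c] by simp
  moreover have "int (?c ?j - 1 + (\<Sum>i<?j. ?c i)) = int n" using top_digit_sum[of \<delta> n] big by simp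
  then have "?c ?j - 1 + (\<Sum>i<?j. ?c i) = n" by linarith
  moreover have d: "dbar \<delta> n m = d" unfolding dbar_def wd by simp
  ultimately show "dbar \<delta> n m \<in> tl_hom n m" "dbar \<delta> n m \<odot> JW m = dbar \<delta> n m"
    using good by simp_all
  obtain q where q: "q \<noteq> 0" "ubar \<delta> n m \<odot> dbar \<delta> n m = tl_scale q (JW m)"
    using good(4) \<open>w = m\<close> unfolding ubar_def d by blast
  have "lam \<delta> n m = inverse q"
    unfolding lam_def q(2)
  proof (rule the_equality)
    show "inverse q \<noteq> 0 \<and> tl_scale q (JW m) = tl_scale (inverse (inverse q)) (JW m)" using q(1) by simp
    fix c assume c: "c \<noteq> 0 \<and> tl_scale q (JW m) = tl_scale (inverse c) (JW m)"
    then have "tl_scale (q - inverse c) (JW m) = 0" by (simp add: tl_scale_left_diff)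
    then have "q = inverse c" using JW_nonzero[of m] by simp
    then show "c = inverse q" by simp
  qed
  then show "lam \<delta> n m \<noteq> 0" "ubar \<delta> n m \<odot> dbar \<delta> n m = tl_scale (inverse (lam \<delta> n m)) (JW m)"
    using q by simp_all
qed

subsection \<open>Linear algebra\<close>

text \<open>Independence of families rather than sets: specialisation or embedding may identify
  vectors, and the index set has to survive the passage.\<close>

definition famindep :: "('a::comm_ring_1 \<Rightarrow> 'b::ab_group_add \<Rightarrow> 'b) \<Rightarrow> 'i set \<Rightarrow> ('i \<Rightarrow> 'b) \<Rightarrow> bool" where
  "famindep scale I v \<longleftrightarrow> (\<forall>c. (\<Sum>i\<in>I. scale (c i) (v i)) = 0 \<longrightarrow> (\<forall>i\<in>I. c i = 0))"

lemma (in vector_space) famindep_iff: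
  assumes "finite I"
  shows "famindep scale I v \<longleftrightarrow> inj_on v I \<and> independent (v ` I)"
proof
  assume L: "famindep scale I v"
  have inj: "inj_on v I"
  proof (rule inj_onI, rule ccontr)
    fix i j assume ij: "i \<in> I" "j \<in> I" "v i = v j" "i \<noteq> j"
    define c where "c k = (if k = i then 1 else if k = j then -1 else (0::'a))" for k
    have "(\<Sum>k\<in>I. scale (c k) (v k)) = (\<Sum>k\<in>{i, j}. scale (c k) (v k))"
      by (rule sum.mono_neutral_right[OF assms]) (use ij in \<open>auto simp: c_def\<close>)
    also have "\<dots> = 0" using ij by (simp add: c_def)
    finally have "c i = 0" using L ij(1) unfolding famindep_def by blast
    then show False by (simp add: c_def)
  qed
  have "independent (v ` I)"
  proof
    assume "dependent (v ` I)"
    then obtain u where u: "\<exists>x\<in>v ` I. u x \<noteq> 0" "(\<Sum>x\<in>v ` I. scale (u x) x) = 0"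
      using dependent_finite[of "v ` I"] assms by auto
    have "(\<Sum>i\<in>I. scale (u (v i)) (v i)) = 0" using u(2) by (simp add: sum.reindex[OF inj])
    then have "\<forall>i\<in>I. u (v i) = 0"
      using L[unfolded famindep_def, rule_format, of "\<lambda>i. u (v i)"] by blast
    then show False using u(1) by blast
  qed
  with inj show "inj_on v I \<and> independent (v ` I)" ..
next
  assume R: "inj_on v I \<and> independent (v ` I)"
  show "famindep scale I v"
    unfolding famindep_def
  proof (intro allI impI ballI)
    fix c i assume c: "(\<Sum>i\<in>I. scale (c i) (v i)) = 0" and i: "i \<in> I"
    let ?u = "\<lambda>x. c (the_inv_into I v x)"
    have "(\<Sum>x\<in>v ` I. scale (?u x) x) = (\<Sum>i\<in>I. scale (c i) (v i))"
      unfolding sum.reindex[OF conjunct1[OF R]] comp_def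
      by (intro sum.cong refl) (simp add: the_inv_into_f_f[OF conjunct1[OF R]])
    then have "?u (v i) = 0"
      using c i R assms by (intro independentD[of "v ` I" "v ` I" ?u]) auto
    then show "c i = 0" using the_inv_into_f_f[OF conjunct1[OF R] i] by simp
  qed
qed

text \<open>\<open>T\<close> fixes its image and kills that of \<open>x - T x\<close>, so bases of
  the two are disjoint and jointly independent inside \<open>span B\<close>.\<close>

lemma (in vector_space) idempotent_dims:
  assumes fin: "finite B" and add: "\<And>x y. T (x + y) = T x + T y" and sc: "\<And>c x. T (scale c x) = scale c (T x)"
    and span: "\<And>x. x \<in> B \<Longrightarrow> T x \<in> span B" and idem: "\<And>x. x \<in> B \<Longrightarrow> T (T x) = T x"
  shows "dim (T ` B) + dim ((\<lambda>x. x - T x) ` B) \<le> card B"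
proof -
  have T0: "T 0 = 0" using add[of 0 0] by simp
  have Tdiff: "T (x - y) = T x - T y" for x y using add[of "x - y" y] by (simp add: algebra_simps)
  obtain B1 where B1: "B1 \<subseteq> T ` B" "independent B1" "card B1 = dim (T ` B)" by (rule basis_exists)
  obtain B2 where B2: "B2 \<subseteq> (\<lambda>x. x - T x) ` B" "independent B2" "card B2 = dim ((\<lambda>x. x - T x) ` B)"
    by (rule basis_exists)
  have T1: "T x = x" if "x \<in> span B1" for x using that
  proof (induction rule: span_induct_alt)
    case (step c x y)
    then show ?case using B1(1) idem by (auto simp: add sc)
  qed (rule T0)
  have T2: "T x = 0" if "x \<in> span B2" for x using that
  proof (induction rule: span_induct_alt)
    case (step c x y)
    then show ?case using B2(1) idem by (auto simp: add sc Tdiff)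
  qed (rule T0)
  have fin12: "finite B1" "finite B2"
    using finite_subset[OF B1(1)] finite_subset[OF B2(1)] fin by simp_all
  have disj: "B1 \<inter> B2 = {}"
  proof (rule ccontr)
    assume "B1 \<inter> B2 \<noteq> {}"
    then obtain x where "x \<in> B1" "x \<in> B2" by blast
    then have "x = 0" using T1[of x] T2[of x] by (simp add: span_base)
    then show False using \<open>x \<in> B1\<close> B1(2) dependent_zero by blast
  qed
  have "independent (B1 \<union> B2)"
  proof
    assume "dependent (B1 \<union> B2)"
    then obtain u where u: "\<exists>x\<in>B1 \<union> B2. u x \<noteq> 0" "(\<Sum>x\<in>B1 \<union> B2. scale (u x) x) = 0"
      using dependent_finite[of "B1 \<union> B2"] fin12 by auto
    let ?s1 = "\<Sum>x\<in>B1. scale (u x) x" and ?s2 = "\<Sum>x\<in>B2. scale (u x) x"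
    have s: "?s1 + ?s2 = 0" using u(2) by (simp add: sum.union_disjoint[OF fin12 disj])
    have s1: "?s1 \<in> span B1" and s2: "?s2 \<in> span B2" by (intro span_sum span_scale span_base; assumption)+
    have "T (?s1 + ?s2) = ?s1" by (simp only: add T1[OF s1] T2[OF s2] add_0_right)
    then have "?s1 = 0" using s T0 by simp
    moreover then have "?s2 = 0" using s by simp
    ultimately have "\<forall>x\<in>B1. u x = 0" "\<forall>x\<in>B2. u x = 0"
      using independentD[OF B1(2) fin12(1) order_refl, of u] independentD[OF B2(2) fin12(2) order_refl, of u] by blast+
    then show False using u(1) by blast
  qed
  moreover have "B1 \<union> B2 \<subseteq> span B"
    using B1(1) B2(1) span by (auto intro: span_diff span_base)
  ultimately have "card (B1 \<union> B2) \<le> card B" using independent_span_bound[OF fin] by blast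
  then show ?thesis using B1(3) B2(3) card_Un_disjoint[OF fin12 disj] by simp
qed

interpretation tl: vector_space "tl_scale :: 'f::field \<Rightarrow> 'f morphism \<Rightarrow> 'f morphism"
  by unfold_locales (simp_all add: tl_scale_add tl_scale_left_add)

subsection \<open>The generic idempotent on cell modules\<close>

text \<open>Through strands are counted by their target ends, and every target is such an end
  exactly when no two targets are joined.\<close>

lemma through_degree_eq_iff:
  assumes D: "D \<in> diagrams n m"
  shows "through_degree D = m \<longleftrightarrow> \<not> cupped D"
proof -
  have M: "ncmatch (boundary_pos n m) ({..<n} <+> {..<m}) D" using D by (simp only: diagrams_eq)
  define J where "J = {j. j < m \<and> (\<exists>i. {Inl i, Inr j} \<in> D)}"
  define f where "f j = (THE B. B \<in> D \<and> Inr j \<in> B)" for j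
  have f: "f j = {Inl i, Inr j}" if "{Inl i, Inr j} \<in> D" for i j
    unfolding f_def
  proof (rule the_equality)
    show "{Inl i, Inr j} \<in> D \<and> Inr j \<in> {Inl i, Inr j}" using that by simp
    fix B assume "B \<in> D \<and> Inr j \<in> B"
    then show "B = {Inl i, Inr j}" using ncmatch_unique[OF M _ that, of B "Inr j"] by blast
  qed
  have "bij_betw f J {B \<in> D. \<exists>i j. B = {Inl i, Inr j}}"
    unfolding bij_betw_def
  proof
    show "inj_on f J"
    proof (rule inj_onI)
      fix j j' assume "j \<in> J" "j' \<in> J" and eq: "f j = f j'"
      then obtain i i' where "{Inl i, Inr j} \<in> D" "{Inl i', Inr j'} \<in> D" by (auto simp: J_def)
      then have "{Inl i, Inr j} = {Inl i', Inr j' :: nat + nat}" using f eq by metis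
      then show "j = j'" by (auto simp: doubleton_eq_iff)
    qed
    show "f ` J = {B \<in> D. \<exists>i j. B = {Inl i, Inr j}}"
    proof
      show "f ` J \<subseteq> {B \<in> D. \<exists>i j. B = {Inl i, Inr j}}"
      proof (rule image_subsetI)
        fix j assume "j \<in> J"
        then obtain i where "{Inl i, Inr j} \<in> D" by (auto simp: J_def)
        then have "f j \<in> D" "f j = {Inl i, Inr j}" using f by simp_all
        then show "f j \<in> {B \<in> D. \<exists>i j. B = {Inl i, Inr j}}" by blast
      qed
      show "{B \<in> D. \<exists>i j. B = {Inl i, Inr j}} \<subseteq> f ` J"
      proof
        fix B assume "B \<in> {B \<in> D. \<exists>i j. B = {Inl i, Inr j}}"
        then obtain i j where B: "B \<in> D" "B = {Inl i, Inr j}" by blast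
        then have "j \<in> J" using ncmatch_sub[OF M B(1)] by (auto simp: J_def)
        moreover have "B = f j" using f B by metis
        ultimately show "B \<in> f ` J" by (rule rev_image_eqI)
      qed
    qed
  qed
  then have td: "through_degree D = card J" by (simp add: through_degree_def bij_betw_same_card)
  have "J \<subseteq> {..<m}" by (auto simp: J_def)
  then have "card J = m \<longleftrightarrow> J = {..<m}"
    by (metis card_lessThan card_subset_eq finite_lessThan)
  also have "\<dots> \<longleftrightarrow> \<not> cupped D"
  proof
    assume J: "J = {..<m}"
    show "\<not> cupped D"
    proof
      assume "cupped D"
      then obtain i j where ij: "i \<noteq> j" "{Inr i, Inr j} \<in> D" unfolding cupped_def by blast
      then have "i \<in> J" using ncmatch_sub[OF M ij(2)] J by auto
      then obtain k where "{Inl k, Inr i} \<in> D" unfolding J_def by blast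
      then have "{Inr i, Inl k} \<in> D" by (simp add: insert_commute)
      then show False using ncmatch_partner_unique[OF M ij(2)] by blast
    qed
  next
    assume nc: "\<not> cupped D"
    have "j \<in> J" if j: "j < m" for j
    proof -
      obtain y where y: "{Inr j, y} \<in> D" "Inr j \<noteq> y"
        using ncmatch_cover[OF M, of "Inr j"] j by auto
      show ?thesis
      proof (cases y)
        case (Inl i)
        then have "{Inl i, Inr j} \<in> D" using y(1) by (simp add: insert_commute)
        then show ?thesis using j by (auto simp: J_def)
      next
        case (Inr i)
        then show ?thesis using y nc unfolding cupped_def by blast
      qed
    qed
    then show "J = {..<m}" by (auto simp: J_def)
  qed
  finally show ?thesis using td by simp
qed

lemma monic_diagrams_eq: "monic_diagrams n m = {D \<in> diagrams n m. \<not> cupped D}"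
  unfolding monic_diagrams_def using through_degree_eq_iff by blast

lemma finite_monic_diagrams: "finite (monic_diagrams n m)"
  unfolding monic_diagrams_def using finite_diagrams by simp

definition monic_part :: "nat \<Rightarrow> 'a::idom morphism \<Rightarrow> 'a morphism" where
  "monic_part m x = (\<Sum>D | D \<in> Poly_Mapping.keys x \<and> through_degree D = m.
     Poly_Mapping.single D (Poly_Mapping.lookup x D))"

lemma cell_act_monic_part: "cell_act \<delta> m x v = monic_part m (tl_comp \<delta> x v)"
  by (simp add: cell_act_def monic_part_def)

lemma lookup_monic_part:
  "Poly_Mapping.lookup (monic_part m x) D = (if through_degree D = m then Poly_Mapping.lookup x D else 0)"
proof -
  let ?S = "{D. D \<in> Poly_Mapping.keys x \<and> through_degree D = m}"
  have fin: "finite ?S" by simp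
  have "Poly_Mapping.lookup (monic_part m x) D = (\<Sum>E\<in>?S. if E = D then Poly_Mapping.lookup x D else 0)"
    unfolding monic_part_def lookup_sum by (intro sum.cong refl) (simp add: lookup_single when_def)
  also have "\<dots> = (if D \<in> ?S then Poly_Mapping.lookup x D else 0)" using fin by simp
  finally show ?thesis by (simp add: in_keys_iff)
qed

lemma monic_part_add: "monic_part m (x + y) = monic_part m x + monic_part m y"
  by (rule poly_mapping_eqI) (simp add: lookup_monic_part lookup_add)

lemma monic_part_zero [simp]: "monic_part m 0 = 0"
  by (rule poly_mapping_eqI) (simp add: lookup_monic_part)

lemma monic_part_scale: "monic_part m (tl_scale c x) = tl_scale c (monic_part m x)"
  by (rule poly_mapping_eqI) (simp add: lookup_monic_part tl_scale_lookup)

lemma monic_part_sum: "monic_part m (sum f A) = (\<Sum>i\<in>A. monic_part m (f i))"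
  by (induction A rule: infinite_finite_induct) (simp_all add: monic_part_add)

lemma monic_part_cell_full: "x \<in> tl_hom n m \<Longrightarrow> monic_part m x \<in> cell_full n m"
  by (auto simp: cell_full_def tl_hom_def monic_diagrams_def in_keys_iff lookup_monic_part split: if_splits)

lemma monic_part_id: "x \<in> cell_full n m \<Longrightarrow> monic_part m x = x"
  by (rule poly_mapping_eqI) (auto simp: lookup_monic_part cell_full_def monic_diagrams_def in_keys_iff)

lemma monic_part_comp_cupped:
  assumes x: "x \<in> tl_hom l n" and D: "D \<in> diagrams n m" "cupped D"
  shows "monic_part m (tl_comp \<delta> x (Poly_Mapping.single D c)) = 0"
  using x
proof (induction x rule: tl_hom_induct)
  case (single E e)
  have "diag_comp E D \<in> diagrams l m" "cupped (diag_comp E D)"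
    using diag_comp_diagrams[OF single D(1)] cupped_comp[OF single D] .
  then have "through_degree (diag_comp E D) \<noteq> m" using through_degree_eq_iff by blast
  then show ?case
    unfolding tl_comp_single
    by (intro poly_mapping_eqI) (auto simp: lookup_monic_part lookup_single when_def)
qed (simp_all add: tl_comp_add_left monic_part_add)

text \<open>Arcs among the targets survive composition on the left, so the dropped diagrams stay
  dropped. This is what lets \<open>cell_act\<close> be iterated.\<close>

lemma monic_part_comp_monic_part:
  assumes x: "x \<in> tl_hom l n" and v: "v \<in> tl_hom n m"
  shows "monic_part m (tl_comp \<delta> x (monic_part m v)) = monic_part m (tl_comp \<delta> x v)"
  using v
proof (induction v rule: tl_hom_induct)
  case (single D c)
  show ?case
  proof (cases "cupped D")
    case True
    then have "through_degree D \<noteq> m" using through_degree_eq_iff[OF single] by blast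
    then have "monic_part m (Poly_Mapping.single D c) = 0"
      by (intro poly_mapping_eqI) (auto simp: lookup_monic_part lookup_single when_def)
    then show ?thesis using monic_part_comp_cupped[OF x single True] by simp
  next
    case False
    then have "D \<in> monic_diagrams n m" using single by (simp add: monic_diagrams_eq)
    then have "Poly_Mapping.single D c \<in> cell_full n m" by (simp add: cell_full_def)
    then show ?thesis by (simp add: monic_part_id)
  qed
qed (simp_all add: monic_part_add tl_comp_add_right)

section \<open>Orthogonality of the summands and the generic rank\<close>

text \<open>The monic diagrams not annihilated on the nose by \<open>JW a\<close> acting on the
  first \<open>a\<close> sources; for each \<open>a\<close> in the support they index one part of
  the generic basis.\<close>

definition uncapped_monic :: "nat \<Rightarrow> nat \<Rightarrow> nat \<Rightarrow> diagram set" where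
  "uncapped_monic a n m = {D \<in> monic_diagrams (a + n) m. \<not> capped a D}"

lemma kills_cups_single:
  assumes "kills_caps k n (tl_flip x)" and x: "x \<in> tl_hom n k" and D: "D \<in> diagrams l n" "cupped D"
  shows "Poly_Mapping.single D c \<odot> x = 0"
proof -
  have "tl_flip (Poly_Mapping.single D c \<odot> x) = tl_flip x \<odot> Poly_Mapping.single (diag_flip D) c"
    unfolding tl_flip_comp[OF tl_hom_single[OF D(1)] x] tl_flip_single ..
  also have "\<dots> = 0"
    using kills_caps_capped[OF assms(1), of "diag_flip D" 0 l c] diag_flip_diagrams[OF D(1)]
      D(2) cupped_flip[OF D(1)] by simp
  finally show ?thesis by (metis tl_flip_flip tl_flip_zero)
qed

text \<open>A diagram between different numbers of points has an arc on some side, and the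
  Jones-Wenzl element on that side kills it.\<close>

lemma JW_sandwich:
  assumes "a \<noteq> b" "y \<in> tl_hom b a"
  shows "JW b \<odot> y \<odot> JW a = 0"
  using assms(2)
proof (induction y rule: tl_hom_induct)
  case (single D c)
  note ka = is_JW_kills[OF is_JW_JW[of a]] and kb = is_JW_kills[OF is_JW_JW[of b]]
  from diff_capped_or_cupped[OF single] assms(1) have "capped b D \<or> cupped D" by blast
  then show ?case
  proof
    assume "capped b D"
    then have "JW b \<odot> Poly_Mapping.single D c = 0"
      using kills_caps_capped[OF kb(1), of D 0 a c] single by simp
    then show ?thesis by simp
  next
    assume "cupped D"
    then have "Poly_Mapping.single D c \<odot> JW a = 0" by (rule kills_cups_single[OF ka(2) hom_JW single])
    then show ?thesis unfolding tl_comp_assoc[OF hom_JW tl_hom_single[OF single] hom_JW] by simp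
  qed
qed (simp_all add: tl_comp_add_left tl_comp_add_right)

lemma ubar_dbar_orthogonal:
  assumes a: "int a \<in> supp \<delta> n" and b: "int b \<in> supp \<delta> n" and ab: "a \<noteq> b"
  shows "ubar \<delta> n b \<odot> dbar \<delta> n a = 0"
proof -
  note da = dbar_good[OF a] and db = dbar_good[OF b]
  have ub: "ubar \<delta> n b \<in> tl_hom b n" unfolding ubar_def by (rule tl_hom_flip[OF db(1)])
  have "tl_flip (dbar \<delta> n b \<odot> JW b) = JW b \<odot> ubar \<delta> n b"
    unfolding tl_flip_comp[OF db(1) hom_JW] ubar_def by simp
  then have u: "ubar \<delta> n b = JW b \<odot> ubar \<delta> n b" using db(2) by (simp add: ubar_def)
  have ud: "ubar \<delta> n b \<odot> dbar \<delta> n a \<in> tl_hom b a" by (rule tl_hom_comp[OF ub da(1)])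
  have "ubar \<delta> n b \<odot> dbar \<delta> n a = JW b \<odot> ubar \<delta> n b \<odot> (dbar \<delta> n a \<odot> JW a)"
    using u da(2) by simp
  also have "\<dots> = JW b \<odot> (ubar \<delta> n b \<odot> dbar \<delta> n a) \<odot> JW a"
    unfolding tl_comp_assoc[OF tl_hom_comp[OF hom_JW ub] da(1) hom_JW, symmetric]
      tl_comp_assoc[OF hom_JW ub da(1)] ..
  also have "\<dots> = 0" by (rule JW_sandwich[OF ab ud])
  finally show ?thesis .
qed

lemma hom_generic_ljw: "generic_ljw \<delta> n \<in> tl_hom n n"
  unfolding generic_ljw_def
proof (intro tl_hom_sum tl_hom_scale)
  fix m assume "m \<in> {m. int m \<in> supp \<delta> n}"
  then have "dbar \<delta> n m \<in> tl_hom n m" using dbar_good(1) by simp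
  then show "dbar \<delta> n m \<odot> ubar \<delta> n m \<in> tl_hom n n"
    unfolding ubar_def using tl_hom_comp tl_hom_flip by metis
qed

lemma finite_supp_nat: "finite {m. int m \<in> supp \<delta> n}"
proof (rule finite_subset)
  show "{m. int m \<in> supp \<delta> n} \<subseteq> {..n}"
  proof
    fix m assume "m \<in> {m. int m \<in> supp \<delta> n}"
    then have "int m \<le> int n" using supp_bounds(2) by blast
    then show "m \<in> {..n}" by simp
  qed
qed simp

lemma generic_ljw_dbar:
  assumes a: "int a \<in> supp \<delta> n"
  shows "generic_ljw \<delta> n \<odot> dbar \<delta> n a = dbar \<delta> n a"
proof -
  let ?A = "{m. int m \<in> supp \<delta> n}"
  note da = dbar_good[OF a]
  have summand: "tl_scale (lam \<delta> n m) (dbar \<delta> n m \<odot> ubar \<delta> n m) \<odot> dbar \<delta> n a = (if m = a then dbar \<delta> n a else 0)"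
    if m: "m \<in> ?A" for m
  proof -
    have dm: "dbar \<delta> n m \<in> tl_hom n m" using dbar_good(1) m by simp
    have um: "ubar \<delta> n m \<in> tl_hom m n" unfolding ubar_def by (rule tl_hom_flip[OF dm])
    have "tl_scale (lam \<delta> n m) (dbar \<delta> n m \<odot> ubar \<delta> n m) \<odot> dbar \<delta> n a =
       tl_scale (lam \<delta> n m) (dbar \<delta> n m \<odot> (ubar \<delta> n m \<odot> dbar \<delta> n a))"
      unfolding tl_comp_scale tl_comp_assoc[OF dm um da(1)] ..
    then show ?thesis
      using m ubar_dbar_orthogonal[OF a, of m] da(2-4) by (auto simp: tl_comp_scale)
  qed
  have "generic_ljw \<delta> n \<odot> dbar \<delta> n a = (\<Sum>m\<in>?A. if m = a then dbar \<delta> n a else 0)"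
    unfolding generic_ljw_def tl_comp_sum_left by (intro sum.cong refl summand)
  also have "\<dots> = dbar \<delta> n a" using a finite_supp_nat[of \<delta> n] by simp
  finally show ?thesis .
qed

text \<open>Every diagram of \<open>JW a\<close> other than the identity creates an arc among the
  first \<open>a\<close> sources, so modulo capped diagrams only the identity, with coefficient 1,
  acts.\<close>

lemma lookup_JW_act:
  assumes D: "D \<in> uncapped_monic a n m" and D': "D' \<in> uncapped_monic a n m"
  shows "Poly_Mapping.lookup ((JW a \<otimes> tl_id n) \<odot> Poly_Mapping.single D 1) D' = (if D = D' then 1 else 0)"
proof -
  have Dd: "D \<in> diagrams (a + n) m" and Dd': "D' \<in> diagrams (a + n) m" "\<not> capped a D'"
    using D D' by (auto simp: uncapped_monic_def monic_diagrams_eq)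
  have gen: "Poly_Mapping.lookup ((y \<otimes> tl_id n) \<odot> Poly_Mapping.single D 1) D' =
      Poly_Mapping.lookup y (diag_id a) * (if D = D' then 1 else 0)" if "y \<in> tl_hom a a" for y
    using that
  proof (induction y rule: tl_hom_induct)
    case (single G e)
    show ?case
    proof (cases "G = diag_id a")
      case True
      then show ?thesis
        by (simp add: tl_id_def tl_tensor_single tl_comp_single diag_tensor_id
            diag_comp_id_left[OF pdiag_diagrams[OF Dd]] lookup_single when_def)
    next
      case False
      have "capped a (diag_tensor G (diag_id n))"
        using capped_tensor[OF single nonid_capped_cupped(1)[OF single False]] .
      then have "capped a (diag_comp (diag_tensor G (diag_id n)) D)"
        using capped_comp[OF diag_tensor_diagrams[OF single diag_id_diagrams] Dd] by blast
      then have "diag_comp (diag_tensor G (diag_id n)) D \<noteq> D'" using Dd'(2) by blast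
      then show ?thesis using False
        by (simp add: tl_id_def tl_tensor_single tl_comp_single lookup_single when_def)
    qed
  next
    case (add x y)
    then show ?case by (simp add: tl_tensor_add_left tl_comp_add_left lookup_add algebra_simps)
  qed simp
  show ?thesis using gen[OF hom_JW] is_JW_coeff[OF is_JW_JW] by simp
qed

lemma cell_full_expand:
  assumes "x \<in> cell_full n m"
  shows "x = (\<Sum>D\<in>monic_diagrams n m. tl_scale (Poly_Mapping.lookup x D) (Poly_Mapping.single D 1))"
proof -
  have "x = (\<Sum>D\<in>Poly_Mapping.keys x. Poly_Mapping.single D (Poly_Mapping.lookup x D))"
    by (rule morphism_expand)
  also have "\<dots> = (\<Sum>D\<in>monic_diagrams n m. Poly_Mapping.single D (Poly_Mapping.lookup x D))"
    using assms finite_monic_diagrams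
    by (intro sum.mono_neutral_left) (auto simp: cell_full_def in_keys_iff)
  finally show ?thesis by (simp add: tl_scale_single)
qed

text \<open>The family \<open>b\<close> is a basis of the image: it spans because the idempotent is
  the sum of the \<open>d a \<odot> u a\<close> with weights \<open>lam\<close>, and the
  \<open>u a\<close> provide the coordinates. The second claim follows because the action fixes this
  basis.\<close>

lemma generic_rank:
  fixes \<delta> :: "'a::idom" and k n m :: nat
  defines "E \<equiv> generic_ljw \<delta> k \<otimes> tl_id n"
  defines "r \<equiv> \<Sum>a | int a \<in> supp \<delta> k. card (uncapped_monic a n m)"
  defines "v \<equiv> \<lambda>D. cell_act loopX m E (Poly_Mapping.single D 1)"
  shows "tl.dim (v ` monic_diagrams (k + n) m) = r"
    and "tl.dim ((\<lambda>D. Poly_Mapping.single D 1 - v D) ` monic_diagrams (k + n) m) + r \<le>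
           card (monic_diagrams (k + n) m)"
proof -
  define A where "A = {a. int a \<in> supp \<delta> k}"
  define I where "I = Sigma A (\<lambda>a. uncapped_monic a n m)"
  let ?M = "monic_diagrams (k + n) m"
  define d where "d a = dbar \<delta> k a \<otimes> tl_id n" for a
  define u where "u a = ubar \<delta> k a \<otimes> tl_id n" for a
  define b where "b = (\<lambda>(a, D). monic_part m (d a \<odot> Poly_Mapping.single D 1))"
  define T where "T x = cell_act loopX m E x" for x
  have finA: "finite A" unfolding A_def by (rule finite_supp_nat)
  have finU: "finite (uncapped_monic a n m)" for a
    unfolding uncapped_monic_def using finite_monic_diagrams by simp
  have finI: "finite I" unfolding I_def using finA finU by blast
  have cardI: "card I = r" unfolding I_def r_def A_def[symmetric] using finA finU by (intro card_SigmaI) auto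
  have hE: "E \<in> tl_hom (k + n) (k + n)" unfolding E_def by (rule tl_hom_tensor[OF hom_generic_ljw tl_hom_id])
  have hdb: "dbar \<delta> k a \<in> tl_hom k a" and hub: "ubar \<delta> k a \<in> tl_hom a k" if "a \<in> A" for a
    using dbar_good(1) that tl_hom_flip unfolding A_def ubar_def by blast+
  have hd: "d a \<in> tl_hom (k + n) (a + n)" and hu: "u a \<in> tl_hom (a + n) (k + n)" if "a \<in> A" for a
    unfolding d_def u_def using tl_hom_tensor[OF hdb[OF that] tl_hom_id] tl_hom_tensor[OF hub[OF that] tl_hom_id] by blast+
  have Uhom: "Poly_Mapping.single D c \<in> tl_hom (a + n) m" if "D \<in> uncapped_monic a n m" for a D c
    using that by (intro tl_hom_single) (simp add: uncapped_monic_def monic_diagrams_eq)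
  have Mhom: "Poly_Mapping.single D c \<in> tl_hom (k + n) m" if "D \<in> ?M" for D c
    using that by (intro tl_hom_single) (simp add: monic_diagrams_eq)
  have T_add: "T (x + y) = T x + T y" for x y
    unfolding T_def cell_act_monic_part tl_comp_add_right monic_part_add ..
  have T_scale: "T (tl_scale c x) = tl_scale c (T x)" for c x
    unfolding T_def cell_act_monic_part tl_comp_scale monic_part_scale ..
  have T_sum: "T (sum f S) = (\<Sum>i\<in>S. T (f i))" for f :: "diagram \<Rightarrow> ratfun morphism" and S
    unfolding T_def cell_act_monic_part tl_comp_sum_right monic_part_sum ..
  have vT: "v D = T (Poly_Mapping.single D 1)" for D by (simp add: v_def T_def)
  have b_full: "b i \<in> cell_full (k + n) m" if i: "i \<in> I" for i
  proof -
    obtain a D where aD: "i = (a, D)" "a \<in> A" "D \<in> uncapped_monic a n m" using i by (auto simp: I_def)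
    show ?thesis unfolding b_def aD(1) prod.case
      by (rule monic_part_cell_full[OF tl_hom_comp[OF hd[OF aD(2)] Uhom[OF aD(3)]]])
  qed
  have Ed: "E \<odot> d a = d a" if "a \<in> A" for a
    unfolding E_def d_def tl_tensor_comp[OF hom_generic_ljw hdb[OF that] tl_hom_id tl_hom_id]
    using generic_ljw_dbar[of a \<delta> k] that by (simp add: A_def)
  have Tb: "T (b i) = b i" if i: "i \<in> I" for i
  proof -
    obtain a D where aD: "i = (a, D)" "a \<in> A" "D \<in> uncapped_monic a n m" using i by (auto simp: I_def)
    note hD = Uhom[OF aD(3)]
    have "T (b i) = monic_part m (E \<odot> (d a \<odot> Poly_Mapping.single D 1))"
      unfolding T_def b_def aD(1) prod.case cell_act_monic_part
      by (rule monic_part_comp_monic_part[OF hE tl_hom_comp[OF hd[OF aD(2)] hD]])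
    also have "\<dots> = b i"
      unfolding tl_comp_assoc[OF hE hd[OF aD(2)] hD, symmetric] Ed[OF aD(2)] b_def aD(1) by simp
    finally show ?thesis .
  qed
  \<comment> \<open>\<open>d a\<close> ends in \<open>JW a\<close> on the first \<open>a\<close>
    strands and so kills capped diagrams, while cupped ones vanish in the monic part; the uncapped
    monic diagrams remain.\<close>
  have d_span: "monic_part m (d a \<odot> y) \<in> tl.span (b ` I)" if a: "a \<in> A" and y: "y \<in> tl_hom (a + n) m" for a y
    using y
  proof (induction y rule: tl_hom_induct)
    case (single D c)
    show ?case
    proof (cases "cupped D \<or> capped a D")
      case False
      then have "D \<in> uncapped_monic a n m" using single by (simp add: uncapped_monic_def monic_diagrams_eq)
      then have "(a, D) \<in> I" using a by (simp add: I_def)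
      moreover have "monic_part m (d a \<odot> Poly_Mapping.single D c) = tl_scale c (b (a, D))"
        unfolding b_def prod.case monic_part_scale[symmetric] tl_comp_scale(2)[symmetric] tl_scale_single by simp
      ultimately show ?thesis using tl.span_scale[OF tl.span_base[of "b (a, D)" "b ` I"], of c] by simp
    next
      case True
      have "monic_part m (d a \<odot> Poly_Mapping.single D c) = 0"
      proof (cases "cupped D")
        case True
        then show ?thesis by (rule monic_part_comp_cupped[OF hd[OF a] single])
      next
        case False
        have "kills_caps k a (dbar \<delta> k a)"
          using kills_caps_comp[OF hdb[OF a] is_JW_kills(1)[OF is_JW_JW]] dbar_good(2)[of a \<delta> k] a
          by (simp add: A_def)
        then have "d a \<odot> Poly_Mapping.single D c = 0"
          unfolding d_def using kills_caps_capped single True False by blast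
        then show ?thesis by simp
      qed
      then show ?thesis by (simp add: tl.span_zero)
    qed
  qed (simp_all add: tl_comp_add_right monic_part_add tl.span_add tl.span_zero)
  have T_span: "T x \<in> tl.span (b ` I)" if x: "x \<in> tl_hom (k + n) m" for x
  proof -
    have Eeq: "E = (\<Sum>a\<in>A. tl_scale (lam \<delta> k a) (d a \<odot> u a))"
      unfolding E_def generic_ljw_def A_def[symmetric] tl_tensor_sum_left
    proof (intro sum.cong refl)
      fix a assume a: "a \<in> A"
      show "tl_scale (lam \<delta> k a) (dbar \<delta> k a \<odot> ubar \<delta> k a) \<otimes> tl_id n = tl_scale (lam \<delta> k a) (d a \<odot> u a)"
        unfolding d_def u_def tl_tensor_comp[OF hdb[OF a] hub[OF a] tl_hom_id tl_hom_id] tl_comp_id_id tl_tensor_scale ..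
    qed
    have "T x = (\<Sum>a\<in>A. tl_scale (lam \<delta> k a) (monic_part m (d a \<odot> (u a \<odot> x))))"
      unfolding T_def cell_act_monic_part Eeq tl_comp_sum_left monic_part_sum
      by (intro sum.cong refl)
        (simp add: tl_comp_scale monic_part_scale tl_comp_assoc[OF hd hu x])
    also have "\<dots> \<in> tl.span (b ` I)"
      by (intro tl.span_sum tl.span_scale d_span tl_hom_comp[OF hu x])
    finally show ?thesis .
  qed
  have indep: "famindep tl_scale I b"
    unfolding famindep_def
  proof (intro allI impI ballI)
    fix c i assume c0: "(\<Sum>i\<in>I. tl_scale (c i) (b i)) = 0" and i: "i \<in> I"
    obtain a D where aD: "i = (a, D)" "a \<in> A" "D \<in> uncapped_monic a n m" using i by (auto simp: I_def)
    \<comment> \<open>\<open>u a\<close> separates the summands: it annihilates the vectors of every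
      other \<open>a'\<close> and turns those of \<open>a\<close> into the action of
      \<open>JW a\<close>, whose coefficient at \<open>D\<close> isolates \<open>D\<close>.\<close>
    have ub: "monic_part m (u a \<odot> b (a', D')) =
        (if a' = a then tl_scale (inverse (lam \<delta> k a)) (monic_part m ((JW a \<otimes> tl_id n) \<odot> Poly_Mapping.single D' 1)) else 0)"
      if a': "a' \<in> A" and D': "D' \<in> uncapped_monic a' n m" for a' D'
    proof -
      note hD' = Uhom[OF D']
      have "monic_part m (u a \<odot> b (a', D')) = monic_part m (u a \<odot> (d a' \<odot> Poly_Mapping.single D' 1))"
        unfolding b_def prod.case
        by (rule monic_part_comp_monic_part[OF hu[OF aD(2)] tl_hom_comp[OF hd[OF a'] hD']])
      also have "\<dots> = monic_part m (((ubar \<delta> k a \<odot> dbar \<delta> k a') \<otimes> tl_id n) \<odot> Poly_Mapping.single D' 1)"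
        unfolding tl_comp_assoc[OF hu[OF aD(2)] hd[OF a'] hD', symmetric]
        unfolding u_def d_def tl_tensor_comp[OF hub[OF aD(2)] hdb[OF a'] tl_hom_id tl_hom_id] tl_comp_id_id ..
      also have "\<dots> = (if a' = a then tl_scale (inverse (lam \<delta> k a)) (monic_part m ((JW a \<otimes> tl_id n) \<odot> Poly_Mapping.single D' 1)) else 0)"
        using ubar_dbar_orthogonal[of a' \<delta> k a] dbar_good(4)[of a \<delta> k] aD(2) a'
        by (auto simp: A_def tl_tensor_scale tl_comp_scale monic_part_scale)
      finally show ?thesis .
    qed
    have "0 = Poly_Mapping.lookup (monic_part m (u a \<odot> (\<Sum>i\<in>I. tl_scale (c i) (b i)))) D"
      unfolding c0 by simp
    also have "\<dots> = (\<Sum>i\<in>I. c i * Poly_Mapping.lookup (monic_part m (u a \<odot> b i)) D)"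
      by (simp add: tl_comp_sum_right monic_part_sum tl_comp_scale monic_part_scale lookup_sum tl_scale_lookup)
    also have "\<dots> = (\<Sum>i\<in>I. if i = (a, D) then c (a, D) * inverse (lam \<delta> k a) else 0)"
    proof (intro sum.cong refl)
      fix i assume "i \<in> I"
      then obtain a' D' where i': "i = (a', D')" "a' \<in> A" "D' \<in> uncapped_monic a' n m" by (auto simp: I_def)
      have td: "through_degree D = m" using aD(3) by (simp add: uncapped_monic_def monic_diagrams_def)
      show "c i * Poly_Mapping.lookup (monic_part m (u a \<odot> b i)) D =
          (if i = (a, D) then c (a, D) * inverse (lam \<delta> k a) else 0)"
      proof (cases "a' = a")
        case True
        then have "Poly_Mapping.lookup (monic_part m (u a \<odot> b i)) D =
            inverse (lam \<delta> k a) * (if D' = D then 1 else 0)"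
          unfolding i'(1) ub[OF i'(2,3)] using lookup_JW_act[of D' a n m D] i'(3) aD(3) td
          by (simp add: tl_scale_lookup lookup_monic_part)
        then show ?thesis using True i'(1) by simp
      next
        case False
        then show ?thesis unfolding i'(1) ub[OF i'(2,3)] by simp
      qed
    qed
    also have "\<dots> = c i * inverse (lam \<delta> k a)" using i finI by (simp add: aD(1))
    finally show "c i = 0" using dbar_good(3)[of a \<delta> k] aD(2) by (simp add: A_def)
  qed
  have inj: "inj_on b I" and ind: "tl.independent (b ` I)" using indep tl.famindep_iff[OF finI] by auto
  have "tl.span (b ` I) = tl.span (v ` ?M)"
  proof
    show "tl.span (v ` ?M) \<subseteq> tl.span (b ` I)"
      by (intro tl.span_minimal tl.subspace_span image_subsetI) (simp add: vT T_span[OF Mhom])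
    show "tl.span (b ` I) \<subseteq> tl.span (v ` ?M)"
    proof (intro tl.span_minimal tl.subspace_span image_subsetI)
      fix i assume i: "i \<in> I"
      have "b i = T (\<Sum>D\<in>?M. tl_scale (Poly_Mapping.lookup (b i) D) (Poly_Mapping.single D 1))"
        using cell_full_expand[OF b_full[OF i]] Tb[OF i] by simp
      also have "\<dots> = (\<Sum>D\<in>?M. tl_scale (Poly_Mapping.lookup (b i) D) (v D))"
        by (simp add: T_sum T_scale vT)
      also have "\<dots> \<in> tl.span (v ` ?M)"
        by (intro tl.span_sum tl.span_scale tl.span_base imageI)
      finally show "b i \<in> tl.span (v ` ?M)" .
    qed
  qed
  then have "tl.dim (v ` ?M) = card (b ` I)" using ind by (rule tl.dim_eq_card)
  then show dim_v: "tl.dim (v ` ?M) = r" using card_image[OF inj] cardI by simp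
  let ?B = "(\<lambda>D. Poly_Mapping.single D 1 :: ratfun morphism) ` ?M"
  have finM: "finite ?M" by (rule finite_monic_diagrams)
  \<comment> \<open>\<open>T\<close> is the identity on the span of \<open>b\<close>, which contains
    its image; so \<open>T\<close> is idempotent on the cell module.\<close>
  have fixb: "T x = x" if "x \<in> tl.span (b ` I)" for x
    using that
  proof (induction rule: tl.span_induct_alt)
    case base
    then show ?case using T_scale[of 0 0] by simp
  next
    case (step c x y)
    then show ?case using Tb by (auto simp: T_add T_scale)
  qed
  have "tl.dim (T ` ?B) + tl.dim ((\<lambda>x. x - T x) ` ?B) \<le> card ?B"
  proof (rule tl.idempotent_dims[OF _ T_add T_scale])
    show "finite ?B" using finM by simp
    fix x assume "x \<in> ?B"
    then obtain D where D: "D \<in> ?M" "x = Poly_Mapping.single D 1" by blast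
    have "T x \<in> cell_full (k + n) m"
      unfolding T_def cell_act_monic_part D(2) by (intro monic_part_cell_full tl_hom_comp[OF hE Mhom[OF D(1)]])
    then have "T x = (\<Sum>D\<in>?M. tl_scale (Poly_Mapping.lookup (T x) D) (Poly_Mapping.single D 1))"
      by (rule cell_full_expand)
    also have "\<dots> \<in> tl.span ?B" by (intro tl.span_sum tl.span_scale tl.span_base imageI)
    finally show "T x \<in> tl.span ?B" .
    show "T (T x) = T x" using fixb[OF T_span[OF Mhom[OF D(1)]]] D(2) by simp
  qed
  moreover have "T ` ?B = v ` ?M" "(\<lambda>x. x - T x) ` ?B = (\<lambda>D. Poly_Mapping.single D 1 - v D) ` ?M"
    by (simp_all add: image_image vT)
  moreover have "card ?B \<le> card ?M" by (rule card_image_le[OF finM])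
  ultimately show "tl.dim ((\<lambda>D. Poly_Mapping.single D 1 - v D) ` ?M) + r \<le> card ?M"
    using dim_v by simp
qed

subsection \<open>Counting monic diagrams\<close>

lemma ncmatch_image:
  assumes M: "ncmatch f A M" and h: "bij_betw h A B" and f': "\<And>x. x \<in> A \<Longrightarrow> f' (h x) = f x"
  shows "ncmatch f' B ((`) h ` M)"
proof (rule ncmatchI)
  have inj: "inj_on h A" and img: "h ` A = B" using h by (auto simp: bij_betw_def)
  have strand: "\<exists>x y. {a, b} = {h x, h y} \<and> a = h x \<and> b = h y \<and> {x, y} \<in> M \<and> x \<in> A \<and> y \<in> A"
    if ab: "{a, b} \<in> (`) h ` M" for a b
  proof -
    obtain C where C: "C \<in> M" "{a, b} = h ` C" using ab by blast
    have "a \<in> h ` C" "b \<in> h ` C" using C(2) by blast+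
    then obtain x y where xy: "x \<in> C" "a = h x" "y \<in> C" "b = h y" by blast
    have CA: "C \<subseteq> A" by (rule ncmatch_sub[OF M C(1)])
    have "h ` C = h ` {x, y}" using C(2) xy by simp
    then have "C = {x, y}" using inj CA xy by (intro inj_on_image_eq_iff[THEN iffD1, OF inj]) auto
    then show ?thesis using C(1) xy CA by blast
  qed
  show "\<exists>x y. C = {x, y} \<and> x \<noteq> y \<and> x \<in> B \<and> y \<in> B" if C: "C \<in> (`) h ` M" for C
  proof -
    obtain C' where C': "C' \<in> M" "C = h ` C'" using C by blast
    obtain x where "x \<in> C'" using ncmatch_nonempty[OF M C'(1)] by blast
    then obtain y where y: "C' = {x, y}" "x \<noteq> y" "x \<in> A" "y \<in> A" by (rule ncmatch_strand[OF M C'(1)])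
    then have "h x \<noteq> h y" using inj by (auto simp: inj_on_def)
    then show ?thesis using y C' img by (intro exI[of _ "h x"] exI[of _ "h y"]) auto
  qed
  show "\<exists>C\<in>(`) h ` M. x \<in> C" if x: "x \<in> B" for x
  proof -
    obtain z where z: "z \<in> A" "x = h z" using x img by blast
    obtain w where "{z, w} \<in> M" using ncmatch_cover[OF M z(1)] by blast
    then have "h ` {z, w} \<in> (`) h ` M" by (rule imageI)
    then show ?thesis using z(2) by (intro bexI) auto
  qed
  show "C = C'" if C: "C \<in> (`) h ` M" "C' \<in> (`) h ` M" "x \<in> C" "x \<in> C'" for C C' x
  proof -
    obtain E E' where E: "E \<in> M" "C = h ` E" "E' \<in> M" "C' = h ` E'" using C by blast
    obtain z z' where z: "z \<in> E" "x = h z" "z' \<in> E'" "x = h z'" using C(3,4) E(2,4) by blast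
    then have "z = z'" using inj ncmatch_sub[OF M E(1)] ncmatch_sub[OF M E(3)] by (auto simp: inj_on_def)
    then have "E = E'" using ncmatch_unique[OF M E(1,3)] z by blast
    then show ?thesis using E by simp
  qed
  fix a b c d
  assume *: "{a, b} \<in> (`) h ` M" "{c, d} \<in> (`) h ` M" "f' a < f' c" "f' c < f' b" "f' b < f' d"
  obtain x y where xy: "a = h x" "b = h y" "{x, y} \<in> M" "x \<in> A" "y \<in> A" using strand[OF *(1)] by blast
  obtain z w where zw: "c = h z" "d = h w" "{z, w} \<in> M" "z \<in> A" "w \<in> A" using strand[OF *(2)] by blast
  show False using ncmatch_noncrossing[OF M xy(3) zw(3)] *(3-5) f' xy zw by simp
qed

text \<open>The boundary of the rectangle unrolled to a line. A matching on
  \<open>{..<n + m}\<close> no longer knows which points are sources, so the last source can be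
  declared a target.\<close>

definition flat :: "nat \<Rightarrow> nat \<Rightarrow> diagram \<Rightarrow> nat set set" where
  "flat n m D = (`) (boundary_pos n m) ` D"

lemma flat_bij: "bij_betw (flat n m) (diagrams n m) {M. ncmatch id {..<n + m} M}"
proof -
  let ?A = "{..<n} <+> {..<m}" and ?f = "boundary_pos n m"
  let ?g = "inv_into ?A ?f"
  have bij: "bij_betw ?f ?A {..<n + m}" by (rule boundary_pos_bij)
  have gbij: "bij_betw ?g {..<n + m} ?A" by (rule bij_betw_inv_into[OF bij])
  have gf: "?g (?f x) = x" if "x \<in> ?A" for x using bij that by (simp add: bij_betw_inv_into_left)
  have fg: "?f (?g x) = x" if "x \<in> {..<n + m}" for x using bij_betw_inv_into_right[OF bij that] .
  show ?thesis
  proof (rule bij_betw_byWitness[where f' = "\<lambda>M. (`) ?g ` M"])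
    show "\<forall>D\<in>diagrams n m. (`) ?g ` flat n m D = D"
    proof
      fix D assume D: "D \<in> diagrams n m"
      have "?g ` ?f ` B = B" if B: "B \<in> D" for B
      proof -
        have "B \<subseteq> ?A" using pdiag_sub[OF pdiag_diagrams[OF D] B] .
        then show ?thesis unfolding image_image using gf by (simp add: subset_iff)
      qed
      then show "(`) ?g ` flat n m D = D" unfolding flat_def image_image[of "(`) ?g"] by simp
    qed
    show "\<forall>M\<in>{M. ncmatch id {..<n + m} M}. flat n m ((`) ?g ` M) = M"
    proof
      fix M assume "M \<in> {M. ncmatch id {..<n + m} M}"
      then have M: "ncmatch id {..<n + m} M" by simp
      have "?f ` ?g ` B = B" if B: "B \<in> M" for B
      proof -
        have "B \<subseteq> {..<n + m}" using ncmatch_sub[OF M B] .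
        then show ?thesis unfolding image_image using fg by (simp add: subset_iff)
      qed
      then show "flat n m ((`) ?g ` M) = M" unfolding flat_def image_image[of "(`) ?f"] by simp
    qed
    show "flat n m ` diagrams n m \<subseteq> {M. ncmatch id {..<n + m} M}"
    proof (rule image_subsetI)
      fix D assume "D \<in> diagrams n m"
      then have "ncmatch ?f ?A D" by (simp only: diagrams_eq)
      then show "flat n m D \<in> {M. ncmatch id {..<n + m} M}"
        unfolding flat_def mem_Collect_eq by (rule ncmatch_image[OF _ bij]) simp
    qed
    show "(\<lambda>M. (`) ?g ` M) ` {M. ncmatch id {..<n + m} M} \<subseteq> diagrams n m"
    proof (rule image_subsetI)
      fix M assume "M \<in> {M. ncmatch id {..<n + m} M}"
      then have "ncmatch id {..<n + m} M" by simp
      then show "(`) ?g ` M \<in> diagrams n m"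
        unfolding diagrams_eq by (rule ncmatch_image[OF _ gbij]) (simp add: fg)
    qed
  qed
qed

lemma flat_mem:
  assumes D: "D \<in> diagrams n m" and xy: "x \<in> {..<n} <+> {..<m}" "y \<in> {..<n} <+> {..<m}"
  shows "{boundary_pos n m x, boundary_pos n m y} \<in> flat n m D \<longleftrightarrow> {x, y} \<in> D"
proof
  let ?f = "boundary_pos n m"
  assume "{?f x, ?f y} \<in> flat n m D"
  then obtain B where B: "B \<in> D" "?f ` {x, y} = ?f ` B" unfolding flat_def by auto
  have "B \<subseteq> {..<n} <+> {..<m}" using pdiag_sub[OF pdiag_diagrams[OF D] B(1)] .
  moreover have "{x, y} \<subseteq> {..<n} <+> {..<m}" using xy by simp
  ultimately have "{x, y} = B"
    using inj_on_image_eq_iff[OF bij_betw_imp_inj_on[OF boundary_pos_bij], of "{x, y}" n m B] B(2) by simp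
  then show "{x, y} \<in> D" using B(1) by simp
next
  assume "{x, y} \<in> D"
  then have "boundary_pos n m ` {x, y} \<in> flat n m D" unfolding flat_def by (rule imageI)
  then show "{boundary_pos n m x, boundary_pos n m y} \<in> flat n m D" by simp
qed

text \<open>On the line, \<open>p\<close> is the border between sources and targets: no arc among
  the first \<open>a\<close> points and none beyond the border. Lowering \<open>p\<close> by one
  bends the last source to the target side.\<close>

definition free_ends :: "nat \<Rightarrow> nat \<Rightarrow> nat set set \<Rightarrow> bool" where
  "free_ends a p M \<longleftrightarrow> (\<forall>x y. {x, y} \<in> M \<longrightarrow> x \<noteq> y \<longrightarrow> \<not> (x < a \<and> y < a) \<and> \<not> (p \<le> x \<and> p \<le> y))"

definition flat_monic :: "nat \<Rightarrow> nat \<Rightarrow> nat \<Rightarrow> nat set set set" where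
  "flat_monic L a p = {M. ncmatch id {..<L} M \<and> free_ends a p M}"

lemma free_ends_flat:
  assumes D: "D \<in> diagrams n m" and a: "a \<le> n"
  shows "free_ends a n (flat n m D) \<longleftrightarrow> \<not> capped a D \<and> \<not> cupped D"
proof -
  let ?f = "boundary_pos n m"
  have M: "ncmatch id {..<n + m} (flat n m D)"
    using bij_betw_imp_surj_on[OF flat_bij] D by blast
  have caps: "capped a D \<longleftrightarrow> (\<exists>x y. {x, y} \<in> flat n m D \<and> x \<noteq> y \<and> x < a \<and> y < a)"
  proof
    assume "capped a D"
    then obtain i j where ij: "i < a" "j < a" "i \<noteq> j" "{Inl i, Inl j} \<in> D" unfolding capped_def by blast
    then have "{i, j} \<in> flat n m D" using flat_mem[OF D, of "Inl i" "Inl j"] a by simp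
    then show "\<exists>x y. {x, y} \<in> flat n m D \<and> x \<noteq> y \<and> x < a \<and> y < a" using ij by blast
  next
    assume "\<exists>x y. {x, y} \<in> flat n m D \<and> x \<noteq> y \<and> x < a \<and> y < a"
    then obtain x y where xy: "{x, y} \<in> flat n m D" "x \<noteq> y" "x < a" "y < a" by blast
    then have "{Inl x, Inl y} \<in> D" using flat_mem[OF D, of "Inl x" "Inl y"] a by simp
    then show "capped a D" using xy unfolding capped_def by blast
  qed
  have cups: "cupped D \<longleftrightarrow> (\<exists>x y. {x, y} \<in> flat n m D \<and> x \<noteq> y \<and> n \<le> x \<and> n \<le> y)"
  proof
    assume "cupped D"
    then obtain i j where ij: "i \<noteq> j" "{Inr i, Inr j} \<in> D" unfolding cupped_def by blast
    then have lt: "i < m" "j < m" using pdiag_sub[OF pdiag_diagrams[OF D] ij(2)] by auto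
    then have "{?f (Inr i), ?f (Inr j)} \<in> flat n m D" using flat_mem[OF D, of "Inr i" "Inr j"] ij(2) by simp
    moreover have "?f (Inr i) \<noteq> ?f (Inr j)" "n \<le> ?f (Inr i)" "n \<le> ?f (Inr j)" using ij(1) lt by auto
    ultimately show "\<exists>x y. {x, y} \<in> flat n m D \<and> x \<noteq> y \<and> n \<le> x \<and> n \<le> y" by blast
  next
    assume "\<exists>x y. {x, y} \<in> flat n m D \<and> x \<noteq> y \<and> n \<le> x \<and> n \<le> y"
    then obtain x y where xy: "{x, y} \<in> flat n m D" "x \<noteq> y" "n \<le> x" "n \<le> y" by blast
    have lt: "x < n + m" "y < n + m" using ncmatch_sub[OF M xy(1)] by auto
    define i j where "i = n + m - 1 - x" and "j = n + m - 1 - y"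
    have ij: "i < m" "j < m" "?f (Inr i) = x" "?f (Inr j) = y" "i \<noteq> j"
      using lt xy(2-4) by (auto simp: i_def j_def)
    then have "{Inr i, Inr j} \<in> D" using flat_mem[OF D, of "Inr i" "Inr j"] xy(1) by simp
    then show "cupped D" using ij(5) unfolding cupped_def by blast
  qed
  show ?thesis unfolding free_ends_def caps cups by blast
qed

lemma card_uncapped_monic_flat:
  "card (uncapped_monic a n m) = card (flat_monic (a + n + m) a (a + n))"
proof (rule bij_betw_same_card)
  have sub: "uncapped_monic a n m \<subseteq> diagrams (a + n) m" by (auto simp: uncapped_monic_def monic_diagrams_eq)
  have iff: "D \<in> uncapped_monic a n m \<longleftrightarrow> free_ends a (a + n) (flat (a + n) m D)"
    if "D \<in> diagrams (a + n) m" for D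
    using free_ends_flat[OF that, of a] that by (auto simp: uncapped_monic_def monic_diagrams_eq)
  show "bij_betw (flat (a + n) m) (uncapped_monic a n m) (flat_monic (a + n + m) a (a + n))"
    unfolding bij_betw_def
  proof
    show "inj_on (flat (a + n) m) (uncapped_monic a n m)"
      using bij_betw_imp_inj_on[OF flat_bij] sub by (rule inj_on_subset)
    show "flat (a + n) m ` uncapped_monic a n m = flat_monic (a + n + m) a (a + n)"
    proof
      show "flat (a + n) m ` uncapped_monic a n m \<subseteq> flat_monic (a + n + m) a (a + n)"
        using iff sub bij_betw_imp_surj_on[OF flat_bij[of "a + n" m]] unfolding flat_monic_def by blast
      show "flat_monic (a + n + m) a (a + n) \<subseteq> flat (a + n) m ` uncapped_monic a n m"
      proof
        fix M assume "M \<in> flat_monic (a + n + m) a (a + n)"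
        then have M: "ncmatch id {..<a + n + m} M" "free_ends a (a + n) M" by (simp_all add: flat_monic_def)
        then obtain D where "D \<in> diagrams (a + n) m" "M = flat (a + n) m D"
          using bij_betw_imp_surj_on[OF flat_bij[of "a + n" m]] by blast
        then show "M \<in> flat (a + n) m ` uncapped_monic a n m" using iff M(2) by blast
      qed
    qed
  qed
qed

lemma finite_flat_monic: "finite (flat_monic L a p)"
proof (rule finite_subset)
  show "flat_monic L a p \<subseteq> Pow (Pow {..<L})"
    unfolding flat_monic_def using ncmatch_sub by blast
qed simp

lemma adjacent_pair_nat:
  assumes "p \<le> L"
  shows "adjacent_pair id {..<L} id {..<L + 2} (skip p) p (Suc p) p"
proof
  show "inj (skip p)" by (auto simp: inj_def skip_def split: if_splits)
  show "skip p x \<in> {..<L + 2} \<longleftrightarrow> x \<in> {..<L}" for x using assms by (auto simp: skip_def)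
  show "{..<L + 2} - {p, Suc p} \<subseteq> range (skip p)"
  proof
    fix x assume "x \<in> {..<L + 2} - {p, Suc p}"
    then have "skip p (if x < p then x else x - 2) = x" by (auto simp: skip_def)
    then show "x \<in> range (skip p)" by (metis rangeI)
  qed
  show "p \<notin> range (skip p)" "Suc p \<notin> range (skip p)" using skip_not_pair by (metis imageE)+
qed (use assms in auto)

text \<open>A strand \<open>{p, Suc p}\<close> joins the last source to the target next to it in
  boundary order. Deleting it takes away one point on each side of the border and affects no other
  condition.\<close>

lemma flat_monic_insert:
  assumes a: "a \<le> p" and p: "p \<le> L"
  shows "bij_betw (adjacent_pair.ins (skip p) p (Suc p)) (flat_monic L a p)
    {M \<in> flat_monic (L + 2) a (Suc p). {p, Suc p} \<in> M}"
proof -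
  interpret adjacent_pair id "{..<L}" id "{..<L + 2}" "skip p" p "Suc p" p
    by (rule adjacent_pair_nat[OF p])
  have strands: "{x, y} \<in> ins M \<longleftrightarrow> {x, y} = {p, Suc p} \<or> (\<exists>x' y'. x = skip p x' \<and> y = skip p y' \<and> {x', y'} \<in> M)"
    if M: "ncmatch id {..<L} M" for M x y
  proof
    assume "{x, y} \<in> ins M"
    then consider "{x, y} = {p, Suc p}" | B where "B \<in> M" "{x, y} = skip p ` B" unfolding ins_def by blast
    then show "{x, y} = {p, Suc p} \<or> (\<exists>x' y'. x = skip p x' \<and> y = skip p y' \<and> {x', y'} \<in> M)"
    proof cases
      case 2
      have "x \<in> skip p ` B" "y \<in> skip p ` B" using 2(2) by blast+
      then obtain x' y' where xy: "x' \<in> B" "x = skip p x'" "y' \<in> B" "y = skip p y'" by blast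
      have "skip p ` B = skip p ` {x', y'}" using 2(2) xy by simp
      then have "B = {x', y'}" using inj by (simp only: inj_image_eq_iff)
      then show ?thesis using 2(1) xy by blast
    qed simp
  next
    assume "{x, y} = {p, Suc p} \<or> (\<exists>x' y'. x = skip p x' \<and> y = skip p y' \<and> {x', y'} \<in> M)"
    then show "{x, y} \<in> ins M"
    proof (elim disjE exE conjE)
      fix x' y' assume "x = skip p x'" "y = skip p y'" "{x', y'} \<in> M"
      then have "skip p ` {x', y'} \<in> ins M" unfolding ins_def by (intro insertI2 imageI)
      then show ?thesis using \<open>x = skip p x'\<close> \<open>y = skip p y'\<close> by simp
    qed (simp add: ins_def)
  qed
  have skip_lt: "skip p x < a \<longleftrightarrow> x < a" "Suc p \<le> skip p x \<longleftrightarrow> p \<le> x" "skip p x = skip p y \<longleftrightarrow> x = y" for x y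
    using a by (auto simp: skip_def)
  have free: "free_ends a (Suc p) (ins M) \<longleftrightarrow> free_ends a p M" if M: "ncmatch id {..<L} M" for M
  proof
    assume L: "free_ends a (Suc p) (ins M)"
    show "free_ends a p M" unfolding free_ends_def
    proof (intro allI impI)
      fix x y assume "{x, y} \<in> M" "x \<noteq> y"
      then have "{skip p x, skip p y} \<in> ins M" "skip p x \<noteq> skip p y" using strands[OF M] skip_lt(3) by blast+
      then show "\<not> (x < a \<and> y < a) \<and> \<not> (p \<le> x \<and> p \<le> y)"
        using L unfolding free_ends_def using skip_lt by metis
    qed
  next
    assume R: "free_ends a p M"
    show "free_ends a (Suc p) (ins M)" unfolding free_ends_def
    proof (intro allI impI)
      fix x y assume "{x, y} \<in> ins M" "x \<noteq> y"
      then consider "{x, y} = {p, Suc p}" | x' y' where "x = skip p x'" "y = skip p y'" "{x', y'} \<in> M"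
        using strands[OF M, of x y] by blast
      then show "\<not> (x < a \<and> y < a) \<and> \<not> (Suc p \<le> x \<and> Suc p \<le> y)"
      proof cases
        case 1
        then show ?thesis using a by (auto simp: doubleton_eq_iff)
      next
        case 2
        then have "x' \<noteq> y'" using \<open>x \<noteq> y\<close> by blast
        then show ?thesis using R 2 unfolding free_ends_def 2(1,2) skip_lt by blast
      qed
    qed
  qed
  show ?thesis unfolding bij_betw_def
  proof
    show "inj_on ins (flat_monic L a p)"
    proof (rule inj_onI)
      fix M M' assume eq: "ins M = ins M'"
      have notin: "{p, Suc p} \<notin> (`) (skip p) ` M" for M using PQ(1) by blast
      have "(`) (skip p) ` M = (`) (skip p) ` M'"
        using eq notin[of M] notin[of M'] unfolding ins_def by (simp add: insert_eq_iff)
      moreover have "inj ((`) (skip p))" by (rule injI) (simp only: inj_image_eq_iff[OF inj])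
      ultimately show "M = M'" by (simp only: inj_image_eq_iff)
    qed
    show "ins ` flat_monic L a p = {M \<in> flat_monic (L + 2) a (Suc p). {p, Suc p} \<in> M}"
    proof
      show "ins ` flat_monic L a p \<subseteq> {M \<in> flat_monic (L + 2) a (Suc p). {p, Suc p} \<in> M}"
      proof (rule image_subsetI)
        fix M assume "M \<in> flat_monic L a p"
        then have M: "ncmatch id {..<L} M" "free_ends a p M" by (simp_all add: flat_monic_def)
        then show "ins M \<in> {M \<in> flat_monic (L + 2) a (Suc p). {p, Suc p} \<in> M}"
          using ncmatch_ins[OF M(1)] free[OF M(1)] by (simp add: flat_monic_def) (simp add: ins_def)
      qed
      show "{M \<in> flat_monic (L + 2) a (Suc p). {p, Suc p} \<in> M} \<subseteq> ins ` flat_monic L a p"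
      proof
        fix M assume "M \<in> {M \<in> flat_monic (L + 2) a (Suc p). {p, Suc p} \<in> M}"
        then have M: "ncmatch id {..<L + 2} M" "free_ends a (Suc p) M" "{p, Suc p} \<in> M" by (simp_all add: flat_monic_def)
        have c: "ncmatch id {..<L} (contr M)" by (rule ncmatch_contr[OF M(1)])
        have i: "ins (contr M) = M" by (rule ins_contr[OF M(1,3)])
        have "contr M \<in> flat_monic L a p" using c free[OF c] i M(2) by (simp add: flat_monic_def)
        then show "M \<in> ins ` flat_monic L a p" using i by (metis imageI)
      qed
    qed
  qed
qed

text \<open>If lowering the border to \<open>p\<close> produces an arc beyond it, take an innermost
  one. It cannot lie beyond \<open>Suc p\<close>, so it starts at \<open>p\<close> and is
  \<open>{p, Suc p}\<close>.\<close>

lemma flat_monic_split: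
  assumes p: "p < L"
  shows "flat_monic L a (Suc p) = flat_monic L a p \<union> {M \<in> flat_monic L a (Suc p). {p, Suc p} \<in> M}"
    and "flat_monic L a p \<inter> {M \<in> flat_monic L a (Suc p). {p, Suc p} \<in> M} = {}"
proof -
  have mono: "free_ends a p M \<Longrightarrow> free_ends a (Suc p) M" for M
    unfolding free_ends_def by (meson Suc_leD)
  have "{p, Suc p} \<in> M" if M: "ncmatch id {..<L} M" "free_ends a (Suc p) M" "\<not> free_ends a p M" for M
  proof -
    obtain x y where xy: "{x, y} \<in> M" "x \<noteq> y" "p \<le> x" "p \<le> y" "x < y"
    proof -
      obtain x y where "{x, y} \<in> M" "x \<noteq> y" "p \<le> x" "p \<le> y"
        using M(2,3) unfolding free_ends_def by blast
      then show ?thesis using that[of x y] that[of y x] by (metis insert_commute linorder_neqE_nat)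
    qed
    have bij: "bij_betw id {..<L} {..<L}" by simp
    obtain u v where uv: "{u, v} \<in> M" "v = Suc u" "x \<le> u"
      using ncmatch_adjacent_strand[OF M(1) bij xy(1)] xy(5) by auto
    then have "\<not> Suc p \<le> u" using M(2) unfolding free_ends_def by fastforce
    then have "u = p" using uv(3) xy(3) by simp
    then show ?thesis using uv by simp
  qed
  then show "flat_monic L a (Suc p) = flat_monic L a p \<union> {M \<in> flat_monic L a (Suc p). {p, Suc p} \<in> M}"
    unfolding flat_monic_def using mono by blast
  have "\<not> free_ends a p M" if "{p, Suc p} \<in> M" for M
    using that unfolding free_ends_def by (metis n_not_Suc_n le_refl le_SucI)
  then show "flat_monic L a p \<inter> {M \<in> flat_monic L a (Suc p). {p, Suc p} \<in> M} = {}"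
    unfolding flat_monic_def by blast
qed

section \<open>Lattice paths and the reflection principle\<close>

text \<open>Walks of \<open>n\<close> steps up or down by one from \<open>a\<close> to
  \<open>m\<close> that never become negative, split according to the last step.\<close>

fun paths :: "nat \<Rightarrow> nat \<Rightarrow> nat \<Rightarrow> nat" where
  "paths a 0 m = (if a = m then 1 else 0)"
| "paths a (Suc n) 0 = paths a n 1"
| "paths a (Suc n) (Suc m) = paths a n (Suc (Suc m)) + paths a n m"

text \<open>The last source point is either a through strand, or can be bent to the target side.\<close>

lemma card_uncapped_monic: "card (uncapped_monic a n m) = paths a n m"
proof (induction n arbitrary: m)
  case 0
  have "uncapped_monic a 0 m = (if a = m then {diag_id a} else {})"
  proof (rule set_eqI)
    fix D
    have "\<not> capped a (diag_id a)" "\<not> cupped (diag_id a)"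
      unfolding capped_def cupped_def diag_id_def by (auto simp: doubleton_eq_iff)
    then show "D \<in> uncapped_monic a 0 m \<longleftrightarrow> D \<in> (if a = m then {diag_id a} else {})"
      using uncapped_uncupped_id[of D a m] diag_id_diagrams[of a]
      by (auto simp: uncapped_monic_def monic_diagrams_eq)
  qed
  then show ?case by simp
next
  case (Suc n)
  let ?L = "a + Suc n + m" and ?p = "a + n"
  let ?S = "{M \<in> flat_monic ?L a (Suc ?p). {?p, Suc ?p} \<in> M}"
  have split: "card (flat_monic ?L a (Suc ?p)) = card (flat_monic ?L a ?p) + card ?S"
    by (subst flat_monic_split(1), simp, subst card_Un_disjoint)
      (use finite_flat_monic flat_monic_split(2)[of ?p ?L a] in simp_all)
  \<comment> \<open>The same points read with one source fewer and one target more: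
    \<open>?L = a + n + Suc m\<close>.\<close>
  have "card (flat_monic ?L a ?p) = paths a n (Suc m)"
    using Suc.IH[of "Suc m"] card_uncapped_monic_flat[of a n "Suc m"] by simp
  moreover have "card ?S = (case m of 0 \<Rightarrow> 0 | Suc m' \<Rightarrow> paths a n m')"
  proof (cases m)
    case 0
    have "{?p, Suc ?p} \<notin> M" if "M \<in> flat_monic ?L a (Suc ?p)" for M
    proof
      assume "{?p, Suc ?p} \<in> M"
      moreover have "ncmatch id {..<?L} M" using that by (simp add: flat_monic_def)
      ultimately have "{?p, Suc ?p} \<subseteq> {..<?L}" using ncmatch_sub by blast
      then show False using 0 by simp
    qed
    then have S: "?S = {}" by blast
    show ?thesis unfolding S by (simp add: 0)
  next
    case (Suc m')
    have "card (flat_monic (?p + m') a ?p) = card {M \<in> flat_monic (?p + m' + 2) a (Suc ?p). {?p, Suc ?p} \<in> M}"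
      by (rule bij_betw_same_card[OF flat_monic_insert]) simp_all
    moreover have "?p + m' + 2 = ?L" using Suc by simp
    ultimately show ?thesis
      using Suc Suc.IH[of m'] card_uncapped_monic_flat[of a n m'] by simp
  qed
  ultimately show ?case
    using card_uncapped_monic_flat[of a "Suc n" m] split by (cases m) simp_all
qed

text \<open>Indexing by twice the lower entry keeps the argument an integer for either
  parity.\<close>

definition half_choose :: "nat \<Rightarrow> int \<Rightarrow> int" where
  "half_choose n k = int (binom n (of_int k / 2))"

lemma half_choose_eq:
  "half_choose n k = (if even k \<and> 0 \<le> k \<and> k \<le> 2 * int n then int (n choose nat (k div 2)) else 0)"
proof (cases "even k")
  case True
  then obtain j where j: "k = 2 * j" by blast
  have "(of_int k / 2 :: rat) = of_int j" by (simp add: j)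
  then have "binom n (of_int k / 2) = (if 0 \<le> j \<and> j \<le> int n then n choose nat j else 0)"
  proof -
    have "of_int j \<le> (of_nat n :: rat) \<longleftrightarrow> j \<le> int n" by (metis of_int_of_nat_eq of_int_le_iff)
    then show ?thesis using \<open>of_int k / 2 = of_int j\<close> unfolding binom_def by simp
  qed
  then show ?thesis by (simp add: half_choose_def j)
next
  case False
  have "(of_int k / 2 :: rat) \<notin> \<int>"
  proof
    assume "(of_int k / 2 :: rat) \<in> \<int>"
    then obtain j where "(of_int k / 2 :: rat) = of_int j" by (auto elim: Ints_cases)
    then have "(of_int k :: rat) = of_int (2 * j)" by (simp add: field_simps)
    then have "k = 2 * j" by (simp only: of_int_eq_iff)
    then show False using False by simp
  qed
  then show ?thesis using False by (simp add: half_choose_def binom_def)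
qed

lemma half_choose_double: "half_choose n (2 * int q) = int (n choose q)"
  by (auto simp: half_choose_eq)

text \<open>Pascal's rule, valid for every integer \<open>k\<close> because \<open>binom\<close> is
  zero outside its range and at half-integers.\<close>

lemma half_choose_Suc: "half_choose (Suc n) k = half_choose n k + half_choose n (k - 2)"
proof (cases "even k \<and> 0 \<le> k \<and> k \<le> 2 * int (Suc n)")
  case True
  then obtain j where j: "k = 2 * int j" "j \<le> Suc n" by (metis evenE nonneg_int_cases mult_le_cancel_left_pos
        of_nat_le_iff zero_less_numeral zero_le_mult_iff not_numeral_le_zero mult_2 numeral_Bit0)
  show ?thesis
  proof (cases j)
    case 0
    then show ?thesis using half_choose_double[of n 0] half_choose_double[of "Suc n" 0]
      by (simp add: j(1) half_choose_eq[of n "-2"])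
  next
    case (Suc i)
    have k: "k - 2 = 2 * int i" by (simp add: j(1) Suc)
    show ?thesis unfolding k unfolding j(1) half_choose_double Suc by simp
  qed
next
  case False
  then have "half_choose n k = 0" "half_choose n (k - 2) = 0" by (auto simp: half_choose_eq)
  then show ?thesis using False by (simp only: half_choose_eq) simp
qed

lemma half_choose_symmetric: "half_choose n (2 * int n - k) = half_choose n k"
proof (cases "even k \<and> 0 \<le> k \<and> k \<le> 2 * int n")
  case True
  then obtain j where j: "k = 2 * j" by blast
  then have "0 \<le> j" "j \<le> int n" using True by auto
  then obtain i where i: "j = int i" "i \<le> n" by (metis nonneg_int_cases of_nat_le_iff)
  have "2 * int n - k = 2 * int (n - i)" using i j by (simp add: of_nat_diff)
  then show ?thesis using binomial_symmetric[OF i(2)] unfolding j i(1) by (simp only: half_choose_double)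
next
  case False
  then show ?thesis by (auto simp: half_choose_eq)
qed

text \<open>Reflection principle: the first term counts all walks from \<open>a\<close> to
  \<open>m\<close>, the second all walks from -a - 2, the mirror image of \<open>a\<close> in
  -1.\<close>

lemma paths_formula:
  "int (paths a n m) = half_choose n (int n + int a - int m) - half_choose n (int n - int a - int m - 2)"
proof (induction a n m rule: paths.induct)
  case (1 a m)
  then show ?case by (auto simp: half_choose_eq)
next
  case (2 a n)
  \<comment> \<open>At \<open>m = 0\<close> the recursion has no walk through -1; the two terms
    cancel there because \<open>a\<close> and its mirror image are equally far from -1.\<close>
  have "half_choose n (int n + int a + 1) = half_choose n (2 * int n - (int n + int a + 1))"
    by (rule half_choose_symmetric[symmetric])
  then show ?case using 2 half_choose_Suc[of n "int (Suc n) + int a"] half_choose_Suc[of n "int (Suc n) - int a - 2"]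
    by (simp add: algebra_simps)
next
  case (3 a n m)
  then show ?case using half_choose_Suc[of n "int (Suc n) + int a - int (Suc m)"]
      half_choose_Suc[of n "int (Suc n) - int a - int (Suc m) - 2"]
    by (simp add: algebra_simps)
qed

text \<open>\<open>t\<close> counts the upward steps. Taking them first and descending afterwards to
  the natural number \<open>m\<close> never leaves the half-line, so parity and distance are the
  only constraints.\<close>

lemma paths_pos_iff: "paths a n m > 0 \<longleftrightarrow> (\<exists>t\<le>n. int m = int a - int n + 2 * int t)"
proof (induction a n m rule: paths.induct)
  case (1 a m)
  then show ?case by auto
next
  case (2 a n)
  have "(\<exists>t\<le>n. int 1 = int a - int n + 2 * int t) \<longleftrightarrow>
      (\<exists>t\<le>Suc n. int 0 = int a - int (Suc n) + 2 * int t)"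
  proof
    assume "\<exists>t\<le>n. int 1 = int a - int n + 2 * int t"
    then obtain t where "t \<le> n" "int 1 = int a - int n + 2 * int t" by blast
    then show "\<exists>t\<le>Suc n. int 0 = int a - int (Suc n) + 2 * int t" by (intro exI[of _ t]) auto
  next
    assume "\<exists>t\<le>Suc n. int 0 = int a - int (Suc n) + 2 * int t"
    then obtain t where t: "t \<le> Suc n" "int 0 = int a - int (Suc n) + 2 * int t" by blast
    then have "t \<le> n" by linarith
    then show "\<exists>t\<le>n. int 1 = int a - int n + 2 * int t" using t by (intro exI[of _ t]) auto
  qed
  then show ?case using 2 by simp
next
  case (3 a n m)
  have "(\<exists>t\<le>Suc n. int (Suc m) = int a - int (Suc n) + 2 * int t) \<longleftrightarrow>
     (\<exists>t\<le>n. int (Suc (Suc m)) = int a - int n + 2 * int t) \<or> (\<exists>t\<le>n. int m = int a - int n + 2 * int t)"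
    (is "?L \<longleftrightarrow> ?R1 \<or> ?R2")
  proof
    assume ?L
    then obtain t where t: "t \<le> Suc n" "int (Suc m) = int a - int (Suc n) + 2 * int t" by blast
    show "?R1 \<or> ?R2"
    proof (cases "t \<le> n")
      case True
      then have ?R1 using t by (intro exI[of _ t]) auto
      then show ?thesis ..
    next
      case False
      then have ?R2 using t by (intro exI[of _ n]) auto
      then show ?thesis ..
    qed
  next
    assume "?R1 \<or> ?R2"
    then show ?L
    proof
      assume ?R1
      then obtain t where "t \<le> n" "int (Suc (Suc m)) = int a - int n + 2 * int t" by blast
      then show ?L by (intro exI[of _ t]) auto
    next
      assume ?R2
      then obtain t where "t \<le> n" "int m = int a - int n + 2 * int t" by blast
      then show ?L by (intro exI[of _ "Suc t"]) auto
    qed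
  qed
  then show ?case using 3 by auto
qed

subsection \<open>Specialisation\<close>

lemma eval_int_poly_0 [simp]: "eval_int_poly \<delta> 0 = 0"
  by (simp add: eval_int_poly_def)

lemma eval_int_poly_pCons: "eval_int_poly \<delta> (pCons a f) = of_int a + \<delta> * eval_int_poly \<delta> f"
  by (simp add: eval_int_poly_def map_poly_pCons)

lemma eval_int_poly_add: "eval_int_poly \<delta> (f + g) = eval_int_poly \<delta> f + eval_int_poly \<delta> g"
proof -
  have "map_poly of_int (f + g) = map_poly of_int f + (map_poly of_int g :: 'a poly)"
    by (rule poly_eqI) (simp add: coeff_map_poly)
  then show ?thesis by (simp add: eval_int_poly_def)
qed

lemma eval_int_poly_smult: "eval_int_poly \<delta> (smult a f) = of_int a * eval_int_poly \<delta> f"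
  by (induction f) (simp_all add: eval_int_poly_pCons algebra_simps)

lemma eval_int_poly_mult: "eval_int_poly \<delta> (f * g) = eval_int_poly \<delta> f * eval_int_poly \<delta> g"
  by (induction f)
    (simp_all add: eval_int_poly_pCons eval_int_poly_add eval_int_poly_smult algebra_simps)

lemma eval_int_poly_uminus: "eval_int_poly \<delta> (- f) = - eval_int_poly \<delta> f"
  using eval_int_poly_smult[of \<delta> "-1" f] by simp

lemma eval_int_poly_1 [simp]: "eval_int_poly \<delta> 1 = 1"
  by (simp add: one_pCons eval_int_poly_pCons)

text \<open>The graph of the residue homomorphism from \<open>\<int>[X]\<close> localised at the
  kernel of X \<mapsto> \<delta>. Values lie in the fraction field of \<open>K\<close>, so that
  nonzero ones can be inverted during elimination.\<close>

definition spec :: "'a::idom \<Rightarrow> ratfun \<Rightarrow> 'a fract \<Rightarrow> bool" where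
  "spec \<delta> q a \<longleftrightarrow> (\<exists>f g. q = Fract f g \<and> eval_int_poly \<delta> g \<noteq> 0 \<and>
     a = Fract (eval_int_poly \<delta> f) (eval_int_poly \<delta> g))"

lemma specI: "eval_int_poly \<delta> g \<noteq> 0 \<Longrightarrow> spec \<delta> (Fract f g) (Fract (eval_int_poly \<delta> f) (eval_int_poly \<delta> g))"
  unfolding spec_def by blast

lemma specE:
  assumes "spec \<delta> q a"
  obtains f g where "q = Fract f g" "g \<noteq> 0" "eval_int_poly \<delta> g \<noteq> 0"
    "a = Fract (eval_int_poly \<delta> f) (eval_int_poly \<delta> g)"
  using assms unfolding spec_def by (metis eval_int_poly_0)

lemma specialises_to_spec: "specialises_to \<delta> q a \<Longrightarrow> spec \<delta> q (to_fract a)"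
proof -
  assume "specialises_to \<delta> q a"
  then obtain f g where fg: "q = Fract f g" "eval_int_poly \<delta> g \<noteq> 0"
    "eval_int_poly \<delta> f = a * eval_int_poly \<delta> g" unfolding specialises_to_def by blast
  then have "to_fract a = Fract (eval_int_poly \<delta> f) (eval_int_poly \<delta> g)"
    by (simp add: to_fract_def eq_fract)
  then show ?thesis using specI[OF fg(2), of f] fg(1) by simp
qed

lemma spec_unique:
  assumes "spec \<delta> q a" "spec \<delta> q b"
  shows "a = b"
proof -
  from assms(1) obtain f g where 1: "q = Fract f g" "g \<noteq> 0" "eval_int_poly \<delta> g \<noteq> 0"
    "a = Fract (eval_int_poly \<delta> f) (eval_int_poly \<delta> g)" by (rule specE)
  from assms(2) obtain f' g' where 2: "q = Fract f' g'" "g' \<noteq> 0" "eval_int_poly \<delta> g' \<noteq> 0"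
    "b = Fract (eval_int_poly \<delta> f') (eval_int_poly \<delta> g')" by (rule specE)
  have "f * g' = f' * g" using 1 2 by (simp add: eq_fract)
  then have "eval_int_poly \<delta> (f * g') = eval_int_poly \<delta> (f' * g)" by simp
  then show ?thesis using 1 2 by (simp add: eq_fract eval_int_poly_mult)
qed

lemma spec_add:
  assumes "spec \<delta> q a" "spec \<delta> r b"
  shows "spec \<delta> (q + r) (a + b)"
proof -
  from assms(1) obtain f g where 1: "q = Fract f g" "g \<noteq> 0" "eval_int_poly \<delta> g \<noteq> 0"
    "a = Fract (eval_int_poly \<delta> f) (eval_int_poly \<delta> g)" by (rule specE)
  from assms(2) obtain f' g' where 2: "r = Fract f' g'" "g' \<noteq> 0" "eval_int_poly \<delta> g' \<noteq> 0"
    "b = Fract (eval_int_poly \<delta> f') (eval_int_poly \<delta> g')" by (rule specE)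
  show ?thesis
    using specI[of \<delta> "g * g'" "f * g' + f' * g"] 1 2
    by (simp add: eval_int_poly_mult eval_int_poly_add)
qed

lemma spec_mult:
  assumes "spec \<delta> q a" "spec \<delta> r b"
  shows "spec \<delta> (q * r) (a * b)"
proof -
  from assms(1) obtain f g where 1: "q = Fract f g" "g \<noteq> 0" "eval_int_poly \<delta> g \<noteq> 0"
    "a = Fract (eval_int_poly \<delta> f) (eval_int_poly \<delta> g)" by (rule specE)
  from assms(2) obtain f' g' where 2: "r = Fract f' g'" "g' \<noteq> 0" "eval_int_poly \<delta> g' \<noteq> 0"
    "b = Fract (eval_int_poly \<delta> f') (eval_int_poly \<delta> g')" by (rule specE)
  show ?thesis
    using specI[of \<delta> "g * g'" "f * f'"] 1 2 by (simp add: eval_int_poly_mult)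
qed

lemma spec_uminus:
  assumes "spec \<delta> q a"
  shows "spec \<delta> (- q) (- a)"
proof -
  from assms obtain f g where 1: "q = Fract f g" "g \<noteq> 0" "eval_int_poly \<delta> g \<noteq> 0"
    "a = Fract (eval_int_poly \<delta> f) (eval_int_poly \<delta> g)" by (rule specE)
  show ?thesis using specI[of \<delta> g "- f"] 1 by (simp add: eval_int_poly_uminus)
qed

lemma spec_diff: "spec \<delta> q a \<Longrightarrow> spec \<delta> r b \<Longrightarrow> spec \<delta> (q - r) (a - b)"
  using spec_add[OF _ spec_uminus] by fastforce

lemma spec_0: "spec \<delta> 0 0"
  using specI[of \<delta> 1 0] by (simp add: Zero_fract_def)

lemma spec_1: "spec \<delta> 1 1"
  using specI[of \<delta> 1 1] by (simp add: One_fract_def)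

text \<open>In this local ring an element with nonzero residue is a unit.\<close>

lemma spec_inverse:
  assumes "spec \<delta> q a" "a \<noteq> 0"
  shows "q \<noteq> 0" "spec \<delta> (inverse q) (inverse a)"
proof -
  show "q \<noteq> 0" using assms spec_unique[OF spec_0] by blast
  from assms obtain f g where 1: "q = Fract f g" "g \<noteq> 0" "eval_int_poly \<delta> g \<noteq> 0"
    "a = Fract (eval_int_poly \<delta> f) (eval_int_poly \<delta> g)" by (blast elim: specE)
  then have "eval_int_poly \<delta> f \<noteq> 0" using assms(2) by (auto simp: fract_collapse)
  then show "spec \<delta> (inverse q) (inverse a)" using specI[of \<delta> f g] 1 by simp
qed

lemma spec_loopX: "spec \<delta> loopX (to_fract \<delta>)"
  using specI[of \<delta> 1 "[:0, 1:]"] by (simp add: loopX_def to_fract_def eval_int_poly_pCons)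

lemma spec_power: "spec \<delta> q a \<Longrightarrow> spec \<delta> (q ^ n) (a ^ n)"
  by (induction n) (simp_all add: spec_1 spec_mult)

lemma spec_sum: "(\<And>i. i \<in> A \<Longrightarrow> spec \<delta> (f i) (g i)) \<Longrightarrow> spec \<delta> (sum f A) (sum g A)"
  by (induction A rule: infinite_finite_induct) (simp_all add: spec_0 spec_add)

lemma to_fract_sum: "to_fract (sum f A) = (\<Sum>i\<in>A. to_fract (f i))"
  by (induction A rule: infinite_finite_induct) simp_all

lemma to_fract_power: "to_fract (x ^ n) = to_fract x ^ n"
  by (induction n) simp_all

text \<open>Gaussian elimination with a pivot that does not vanish under specialisation: independence
  can only get lost, not gained, by specialising.\<close>

lemma famindep_spec:
  fixes vG :: "'i \<Rightarrow> ratfun morphism" and vF :: "'i \<Rightarrow> 'a::idom fract morphism"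
  assumes "finite S" "famindep tl_scale S vF"
    and "\<And>i D. i \<in> S \<Longrightarrow> spec \<delta> (Poly_Mapping.lookup (vG i) D) (Poly_Mapping.lookup (vF i) D)"
  shows "famindep tl_scale S vG"
  using assms
proof (induction S arbitrary: vG vF rule: finite_induct)
  case empty
  then show ?case by (simp add: famindep_def)
next
  case (insert i0 S)
  have "vF i0 \<noteq> 0"
  proof
    assume "vF i0 = 0"
    then have "(\<Sum>i\<in>insert i0 S. tl_scale (if i = i0 then 1 else 0) (vF i)) = 0"
      using insert.hyps by (intro sum.neutral) auto
    from insert.prems(1)[unfolded famindep_def, rule_format, OF this, of i0] show False by simp
  qed
  then obtain D0 where "Poly_Mapping.lookup (vF i0) D0 \<noteq> 0" by (metis lookup_zero poly_mapping_eqI)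
  define aF where "aF = Poly_Mapping.lookup (vF i0) D0"
  define aG where "aG = Poly_Mapping.lookup (vG i0) D0"
  have a: "aF \<noteq> 0" "spec \<delta> aG aF"
    using insert.prems(2)[of i0 D0] \<open>Poly_Mapping.lookup (vF i0) D0 \<noteq> 0\<close> by (simp_all add: aF_def aG_def)
  note inv = spec_inverse[OF a(2,1)]
  \<comment> \<open>The multipliers that clear the coordinate \<open>D0\<close>. The pivot is chosen
    nonzero after specialisation, so its generic counterpart is a unit and \<open>bG\<close>
    specialises to \<open>bF\<close>.\<close>
  define bF where "bF i = Poly_Mapping.lookup (vF i) D0 * inverse aF" for i
  define bG where "bG i = Poly_Mapping.lookup (vG i) D0 * inverse aG" for i
  define wF where "wF i = vF i - tl_scale (bF i) (vF i0)" for i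
  define wG where "wG i = vG i - tl_scale (bG i) (vG i0)" for i
  have combF: "(\<Sum>i\<in>S. tl_scale (c i) (wF i)) = (\<Sum>i\<in>S. tl_scale (c i) (vF i)) - tl_scale (\<Sum>i\<in>S. c i * bF i) (vF i0)" for c
    by (rule poly_mapping_eqI)
      (simp add: wF_def lookup_sum tl_scale_lookup lookup_minus sum_distrib_left sum_distrib_right sum_subtractf algebra_simps)
  have combG: "(\<Sum>i\<in>S. tl_scale (c i) (wG i)) = (\<Sum>i\<in>S. tl_scale (c i) (vG i)) - tl_scale (\<Sum>i\<in>S. c i * bG i) (vG i0)" for c
    by (rule poly_mapping_eqI)
      (simp add: wG_def lookup_sum tl_scale_lookup lookup_minus sum_distrib_left sum_distrib_right sum_subtractf algebra_simps)
  have "famindep tl_scale S wF"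
    unfolding famindep_def
  proof (intro allI impI)
    fix c assume c: "(\<Sum>i\<in>S. tl_scale (c i) (wF i)) = 0"
    let ?c = "\<lambda>i. if i = i0 then - (\<Sum>i\<in>S. c i * bF i) else c i"
    have "(\<Sum>i\<in>S. tl_scale (?c i) (vF i)) = (\<Sum>i\<in>S. tl_scale (c i) (vF i))"
      using insert.hyps by (intro sum.cong refl) auto
    moreover have "tl_scale (- (\<Sum>i\<in>S. c i * bF i)) (vF i0) = - tl_scale (\<Sum>i\<in>S. c i * bF i) (vF i0)"
      by (rule poly_mapping_eqI) (simp add: tl_scale_lookup)
    ultimately have "(\<Sum>i\<in>insert i0 S. tl_scale (?c i) (vF i)) = 0"
      using c insert.hyps by (simp add: combF)
    then have "\<forall>i\<in>insert i0 S. ?c i = 0"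
      by (rule insert.prems(1)[unfolded famindep_def, THEN HOL.spec, THEN mp])
    then show "\<forall>i\<in>S. c i = 0" using insert.hyps by (metis insertCI)
  qed
  moreover have "spec \<delta> (Poly_Mapping.lookup (wG i) D) (Poly_Mapping.lookup (wF i) D)" if "i \<in> S" for i D
    unfolding wG_def wF_def bG_def bF_def lookup_minus tl_scale_lookup
    by (intro spec_diff spec_mult inv insert.prems(2)) (use that in auto)
  ultimately have wG: "famindep tl_scale S wG" by (rule insert.IH)
  show ?case
    unfolding famindep_def
  proof (intro allI impI)
    fix c assume "(\<Sum>i\<in>insert i0 S. tl_scale (c i) (vG i)) = 0"
    then have c: "tl_scale (c i0) (vG i0) + (\<Sum>i\<in>S. tl_scale (c i) (vG i)) = 0" using insert.hyps by simp
    have "c i0 * aG + (\<Sum>i\<in>S. c i * Poly_Mapping.lookup (vG i) D0) = 0"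
      using arg_cong[OF c, of "\<lambda>x. Poly_Mapping.lookup x D0"]
      by (simp add: lookup_add lookup_sum tl_scale_lookup aG_def)
    then have "(c i0 * aG + (\<Sum>i\<in>S. c i * Poly_Mapping.lookup (vG i) D0)) * inverse aG = 0" by simp
    then have c0: "c i0 = - (\<Sum>i\<in>S. c i * bG i)"
      using inv(1) by (simp add: bG_def distrib_right sum_distrib_right mult.assoc eq_neg_iff_add_eq_0)
    have "tl_scale (c i0) (vG i0) = - tl_scale (\<Sum>i\<in>S. c i * bG i) (vG i0)"
      unfolding c0 by (rule poly_mapping_eqI) (simp add: tl_scale_lookup)
    then have "(\<Sum>i\<in>S. tl_scale (c i) (wG i)) = 0" using c by (simp add: combG)
    then have "\<forall>i\<in>S. c i = 0" using wG unfolding famindep_def by blast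
    then show "\<forall>i\<in>insert i0 S. c i = 0" using c0 by simp
  qed
qed

section \<open>Ranks under specialisation and over the fraction field\<close>

lemma (in vector_space) card_le_dim:
  assumes "finite V" "independent B" "B \<subseteq> span V"
  shows "card B \<le> dim V"
proof -
  obtain C where C: "C \<subseteq> V" "V \<subseteq> span C" "card C = dim V" by (rule basis_exists)
  have "span V \<subseteq> span C" by (rule span_minimal[OF C(2) subspace_span])
  then have "B \<subseteq> span C" using assms(3) by blast
  then show ?thesis using independent_span_bound[OF finite_subset[OF C(1) assms(1)] assms(2)] C(3) by simp
qed

lemma (in vector_space) basis_family:
  assumes "finite I"
  obtains S where "S \<subseteq> I" "card S = dim (v ` I)" "inj_on v S" "famindep scale S v"
proof -
  obtain B where B: "B \<subseteq> v ` I" "independent B" "card B = dim (v ` I)" by (rule basis_exists)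
  then obtain S where S: "S \<subseteq> I" "inj_on v S" "B = v ` S" by (auto simp: subset_image_inj)
  have "famindep scale S v"
    using famindep_iff[OF finite_subset[OF S(1) assms], of v] S(2,3) B(2) by simp
  then show ?thesis using that S B(3) card_image[OF S(2)] by simp
qed

lemma dim_spec_le:
  fixes vG :: "'i \<Rightarrow> ratfun morphism" and vF :: "'i \<Rightarrow> 'a::idom fract morphism"
  assumes "finite I"
    and spec: "\<And>i D. i \<in> I \<Longrightarrow> spec \<delta> (Poly_Mapping.lookup (vG i) D) (Poly_Mapping.lookup (vF i) D)"
  shows "tl.dim (vF ` I) \<le> tl.dim (vG ` I)"
proof -
  obtain S where S: "S \<subseteq> I" "card S = tl.dim (vF ` I)" "famindep tl_scale S vF"
    by (rule tl.basis_family[OF assms(1), of vF])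
  have fin: "finite S" by (rule finite_subset[OF S(1) assms(1)])
  have "famindep tl_scale S vG"
    by (rule famindep_spec[OF fin S(3)]) (use spec S(1) in blast)
  then have ind: "inj_on vG S" "tl.independent (vG ` S)" using tl.famindep_iff[OF fin, of vG] by auto
  have "card (vG ` S) \<le> tl.dim (vG ` I)"
    using S(1) assms(1) by (intro tl.card_le_dim ind) (auto intro: tl.span_base)
  then show ?thesis using S(2) card_image[OF ind(1)] by simp
qed

definition embed :: "'a::idom morphism \<Rightarrow> 'a fract morphism" where
  "embed x = Poly_Mapping.map to_fract x"

lemma lookup_embed: "Poly_Mapping.lookup (embed x) D = to_fract (Poly_Mapping.lookup x D)"
  by (simp add: embed_def Poly_Mapping.map.rep_eq when_def)

lemma embed_zero [simp]: "embed 0 = 0"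
  by (rule poly_mapping_eqI) (simp add: lookup_embed)

lemma embed_eq_iff [simp]: "embed x = embed y \<longleftrightarrow> x = y"
  by (metis lookup_embed poly_mapping_eqI to_fract_eq_iff)

lemma embed_sum: "embed (sum f A) = (\<Sum>i\<in>A. embed (f i))"
  by (rule poly_mapping_eqI) (simp add: lookup_embed lookup_sum to_fract_sum)

lemma embed_scale: "embed (tl_scale c x) = tl_scale (to_fract c) (embed x)"
  by (rule poly_mapping_eqI) (simp add: lookup_embed tl_scale_lookup)

lemma common_denominator:
  fixes c :: "'i \<Rightarrow> 'a::idom fract"
  assumes "finite S"
  obtains q b where "q \<noteq> 0" "\<And>i. i \<in> S \<Longrightarrow> to_fract q * c i = to_fract (b i)"
proof -
  have "\<exists>q b. q \<noteq> 0 \<and> (\<forall>i\<in>S. to_fract q * c i = to_fract (b i))"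
    using assms
  proof (induction S rule: finite_induct)
    case empty
    show ?case by (intro exI[of _ 1]) simp
  next
    case (insert i S)
    then obtain q b where qb: "q \<noteq> 0" "\<forall>i\<in>S. to_fract q * c i = to_fract (b i)" by blast
    obtain x y where xy: "c i = Fract x y" "y \<noteq> 0" by (cases "c i")
    have yc: "to_fract y * c i = to_fract x" using xy by (simp add: to_fract_def eq_fract)
    have "to_fract (q * y) * c k = to_fract (if k = i then q * x else y * b k)" if "k \<in> insert i S" for k
    proof (cases "k = i")
      case True
      then show ?thesis using yc by (simp add: mult.assoc)
    next
      case False
      then have "to_fract q * c k = to_fract (b k)" using that qb by blast
      then show ?thesis using False by (simp add: mult_ac)
    qed
    then show ?case using qb(1) xy(2)
      by (intro exI[of _ "q * y"] exI[of _ "\<lambda>k. if k = i then q * x else y * b k"]) simp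
  qed
  then show ?thesis using that by blast
qed

text \<open>A relation over the fraction field becomes one over \<open>K\<close> after clearing
  denominators, so ranks over the domain can be computed over the field.\<close>

lemma famindep_embed_iff:
  assumes fin: "finite S"
  shows "famindep tl_scale S (\<lambda>i. embed (v i)) \<longleftrightarrow> famindep tl_scale S v"
proof
  assume L: "famindep tl_scale S (\<lambda>i. embed (v i))"
  show "famindep tl_scale S v"
    unfolding famindep_def
  proof (intro allI impI)
    fix c assume "(\<Sum>i\<in>S. tl_scale (c i) (v i)) = 0"
    then have "embed (\<Sum>i\<in>S. tl_scale (c i) (v i)) = 0" by simp
    then have "(\<Sum>i\<in>S. tl_scale (to_fract (c i)) (embed (v i))) = 0"
      by (simp add: embed_sum embed_scale)
    then have "\<forall>i\<in>S. to_fract (c i) = 0"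
      using L[unfolded famindep_def, rule_format, of "\<lambda>i. to_fract (c i)"] by blast
    then show "\<forall>i\<in>S. c i = 0" by simp
  qed
next
  assume R: "famindep tl_scale S v"
  show "famindep tl_scale S (\<lambda>i. embed (v i))"
    unfolding famindep_def
  proof (intro allI impI)
    fix c assume c: "(\<Sum>i\<in>S. tl_scale (c i) (embed (v i))) = 0"
    obtain q b where q: "q \<noteq> 0" and b: "\<And>i. i \<in> S \<Longrightarrow> to_fract q * c i = to_fract (b i)"
      by (rule common_denominator[OF fin, of c]) blast
    have "embed (\<Sum>i\<in>S. tl_scale (b i) (v i)) = (\<Sum>i\<in>S. tl_scale (to_fract q * c i) (embed (v i)))"
      unfolding embed_sum embed_scale by (intro sum.cong refl) (simp add: b)
    also have "\<dots> = tl_scale (to_fract q) (\<Sum>i\<in>S. tl_scale (c i) (embed (v i)))"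
      by (simp add: tl_scale_sum)
    also have "\<dots> = embed 0" by (simp add: c)
    finally have "(\<Sum>i\<in>S. tl_scale (b i) (v i)) = 0" unfolding embed_eq_iff .
    then have b0: "\<forall>i\<in>S. b i = 0" using R unfolding famindep_def by blast
    show "\<forall>i\<in>S. c i = 0"
    proof
      fix i assume "i \<in> S"
      then have "to_fract q * c i = 0" using b b0 by simp
      then show "c i = 0" using q by simp
    qed
  qed
qed

subsection \<open>The idempotent \<open>e\<^sup>\<mu>\<close>\<close>

lemma is_ljw_unique: "is_ljw \<delta> n x \<Longrightarrow> is_ljw \<delta> n y \<Longrightarrow> x = y"
  unfolding is_ljw_def by (metis poly_mapping_eqI spec_unique specialises_to_spec to_fract_eq_iff)

lemma is_ljw_ljw:
  assumes "ljw_defined \<delta> n"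
  shows "is_ljw \<delta> n (ljw \<delta> n)"
  unfolding ljw_def
proof (rule theI')
  show "\<exists>!x. is_ljw \<delta> n x" using assms is_ljw_unique unfolding ljw_defined_def by blast
qed

lemma spec_ljw:
  assumes "ljw_defined \<delta> n"
  shows "spec \<delta> (Poly_Mapping.lookup (generic_ljw \<delta> n) D) (to_fract (Poly_Mapping.lookup (ljw \<delta> n) D))"
  using is_ljw_ljw[OF assms] specialises_to_spec unfolding is_ljw_def by blast

lemma hom_ljw:
  assumes "ljw_defined \<delta> n"
  shows "ljw \<delta> n \<in> tl_hom n n"
proof -
  have "Poly_Mapping.lookup (ljw \<delta> n) D = 0" if "D \<notin> diagrams n n" for D
    using spec_ljw[OF assms, of D] tl_hom_lookup[OF hom_generic_ljw that] spec_unique[OF spec_0]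
    by (metis to_fract_0 to_fract_eq_iff)
  then show ?thesis unfolding tl_hom_def by (auto simp: in_keys_iff)
qed

lemma hom_1_1:
  assumes "x \<in> tl_hom 1 1"
  shows "x = tl_scale (Poly_Mapping.lookup x (diag_id 1)) (tl_id 1)"
proof (rule poly_mapping_eqI)
  fix D
  have "D \<notin> diagrams 1 1" if "D \<noteq> diag_id 1"
    using nonid_capped_cupped(1)[of D 1] that by (auto simp: capped_def)
  then show "Poly_Mapping.lookup x D =
      Poly_Mapping.lookup (tl_scale (Poly_Mapping.lookup x (diag_id 1)) (tl_id 1)) D"
    using tl_hom_lookup[OF assms, of D] by (auto simp: tl_scale_lookup tl_id_def lookup_single when_def)
qed

text \<open>Parity and size leave only \<open>m = 1\<close> in the support. Then \<open>dbar\<close>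
  is a scalar c times the identity, and \<open>lam\<close> is by definition the inverse of c^2. This
  makes the trailing ones of the composition act as identity strands.\<close>

lemma generic_ljw_1: "generic_ljw \<delta> 1 = tl_id 1"
proof -
  have one: "int 1 \<in> supp \<delta> 1" by (rule supp_nonempty)
  have "m = 1" if "int m \<in> supp \<delta> 1" for m
  proof -
    have "int m \<le> 1" "even (1 - int m)" using supp_bounds[OF that] by simp_all
    then show ?thesis by (cases "m = 0") auto
  qed
  then have supp: "{m. int m \<in> supp \<delta> 1} = {1}" using one by blast
  note d = dbar_good[OF one]
  obtain c where c: "dbar \<delta> 1 1 = tl_scale c (tl_id 1)" using hom_1_1[OF d(1)] by blast
  have u: "ubar \<delta> 1 1 = tl_scale c (tl_id 1)" unfolding ubar_def c tl_flip_scale by simp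
  have "JW 1 = tl_id 1" unfolding JW_eq by simp
  then have "tl_scale (c * c) (tl_id 1) = tl_scale (inverse (lam \<delta> 1 1)) (tl_id 1 :: ratfun morphism)"
    using d(4) unfolding u unfolding c by (simp add: tl_comp_scale)
  then have "tl_scale (c * c - inverse (lam \<delta> 1 1)) (tl_id 1 :: ratfun morphism) = 0"
    by (simp add: tl_scale_left_diff)
  then have "lam \<delta> 1 1 * (c * c) = 1" using d(3) by simp
  moreover have "generic_ljw \<delta> 1 = tl_scale (lam \<delta> 1 1) (dbar \<delta> 1 1 \<odot> ubar \<delta> 1 1)"
    unfolding generic_ljw_def supp by simp
  ultimately show ?thesis unfolding u unfolding c by (simp add: tl_comp_scale)
qed

lemma ljw_1: "ljw \<delta> 1 = tl_id 1"
proof -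
  have "specialises_to \<delta> 1 1"
    unfolding specialises_to_def by (intro exI[of _ 1]) (simp add: One_fract_def)
  moreover have "specialises_to \<delta> 0 0"
    unfolding specialises_to_def by (intro exI[of _ 0] exI[of _ 1]) (simp add: Zero_fract_def)
  ultimately have "is_ljw \<delta> 1 (tl_id 1)"
    unfolding is_ljw_def generic_ljw_1 by (simp add: tl_id_def lookup_single when_def)
  then show ?thesis unfolding ljw_def using is_ljw_unique by blast
qed

lemma ljw_tensor_eq: "ljw_tensor \<delta> (k # replicate n 1) = ljw \<delta> k \<otimes> tl_id n"
proof -
  have "foldr (\<lambda>k x. ljw \<delta> k \<otimes> x) (replicate n 1) (tl_id 0) = tl_id n"
    by (induction n) (simp_all add: ljw_1[simplified] tl_tensor_id)
  then show ?thesis by (simp add: ljw_tensor_def)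
qed

text \<open>Matrix entries as sums over all diagrams instead of the support of \<open>x\<close>: the
  supports of the generic and of the specialised element may differ, but over a common index set the
  entries specialise term by term.\<close>

lemma lookup_cell_act:
  assumes x: "x \<in> tl_hom k k"
  shows "Poly_Mapping.lookup (cell_act \<delta> m (x \<otimes> tl_id n) (Poly_Mapping.single D 1)) D' =
    (if through_degree D' = m then
      \<Sum>G\<in>diagrams k k. (if diag_comp (diag_tensor G (diag_id n)) D = D' then
        Poly_Mapping.lookup x G * \<delta> ^ diag_loops (diag_tensor G (diag_id n)) D else 0) else 0)"
proof -
  have "x = (\<Sum>G\<in>Poly_Mapping.keys x. Poly_Mapping.single G (Poly_Mapping.lookup x G))"
    by (rule morphism_expand)
  also have "\<dots> = (\<Sum>G\<in>diagrams k k. Poly_Mapping.single G (Poly_Mapping.lookup x G))"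
    using x finite_diagrams by (intro sum.mono_neutral_left) (auto simp: tl_hom_def in_keys_iff)
  finally have "x = (\<Sum>G\<in>diagrams k k. Poly_Mapping.single G (Poly_Mapping.lookup x G))" .
  then have "tl_comp \<delta> (x \<otimes> tl_id n) (Poly_Mapping.single D 1) =
      tl_comp \<delta> ((\<Sum>G\<in>diagrams k k. Poly_Mapping.single G (Poly_Mapping.lookup x G)) \<otimes> tl_id n) (Poly_Mapping.single D 1)"
    by simp
  also have "\<dots> = (\<Sum>G\<in>diagrams k k. Poly_Mapping.single (diag_comp (diag_tensor G (diag_id n)) D)
      (Poly_Mapping.lookup x G * \<delta> ^ diag_loops (diag_tensor G (diag_id n)) D))"
    by (simp add: tl_tensor_sum_left tl_comp_sum_left tl_id_def tl_tensor_single tl_comp_single)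
  finally show ?thesis
    by (simp add: cell_act_monic_part lookup_monic_part lookup_sum lookup_single when_def)
qed

lemma spec_cell_act:
  assumes "ljw_defined \<delta> k"
  shows "spec \<delta> (Poly_Mapping.lookup (cell_act loopX m (generic_ljw \<delta> k \<otimes> tl_id n) (Poly_Mapping.single D 1)) D')
     (Poly_Mapping.lookup (embed (cell_act \<delta> m (ljw \<delta> k \<otimes> tl_id n) (Poly_Mapping.single D 1))) D')"
  unfolding lookup_embed lookup_cell_act[OF hom_generic_ljw] lookup_cell_act[OF hom_ljw[OF assms]]
proof (cases "through_degree D' = m")
  case True
  have "spec \<delta> (\<Sum>G\<in>diagrams k k. (if diag_comp (diag_tensor G (diag_id n)) D = D' then
        Poly_Mapping.lookup (generic_ljw \<delta> k) G * loopX ^ diag_loops (diag_tensor G (diag_id n)) D else 0))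
      (\<Sum>G\<in>diagrams k k. to_fract (if diag_comp (diag_tensor G (diag_id n)) D = D' then
        Poly_Mapping.lookup (ljw \<delta> k) G * \<delta> ^ diag_loops (diag_tensor G (diag_id n)) D else 0))"
  proof (rule spec_sum)
    fix G
    show "spec \<delta> (if diag_comp (diag_tensor G (diag_id n)) D = D' then
        Poly_Mapping.lookup (generic_ljw \<delta> k) G * loopX ^ diag_loops (diag_tensor G (diag_id n)) D else 0)
      (to_fract (if diag_comp (diag_tensor G (diag_id n)) D = D' then
        Poly_Mapping.lookup (ljw \<delta> k) G * \<delta> ^ diag_loops (diag_tensor G (diag_id n)) D else 0))"
      using spec_mult[OF spec_ljw[OF assms] spec_power[OF spec_loopX]]
      by (simp add: to_fract_power spec_0)
  qed
  then show "spec \<delta>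
     (if through_degree D' = m then \<Sum>G\<in>diagrams k k. (if diag_comp (diag_tensor G (diag_id n)) D = D' then
        Poly_Mapping.lookup (generic_ljw \<delta> k) G * loopX ^ diag_loops (diag_tensor G (diag_id n)) D else 0) else 0)
     (to_fract (if through_degree D' = m then \<Sum>G\<in>diagrams k k. (if diag_comp (diag_tensor G (diag_id n)) D = D' then
        Poly_Mapping.lookup (ljw \<delta> k) G * \<delta> ^ diag_loops (diag_tensor G (diag_id n)) D else 0) else 0))"
    unfolding if_P[OF True] to_fract_sum .
qed (simp add: spec_0)

section \<open>The ranks of the cell modules\<close>

lemma specialised_rank:
  fixes \<delta> :: "'a::idom" and k n m :: nat
  assumes "ljw_defined \<delta> k"
  defines "v \<equiv> \<lambda>D. embed (cell_act \<delta> m (ljw \<delta> k \<otimes> tl_id n) (Poly_Mapping.single D 1))"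
  shows "tl.dim (v ` monic_diagrams (k + n) m) = (\<Sum>a | int a \<in> supp \<delta> k. paths a n m)"
proof -
  let ?M = "monic_diagrams (k + n) m"
  define r where "r = (\<Sum>a | int a \<in> supp \<delta> k. paths a n m)"
  define vG where "vG D = cell_act loopX m (generic_ljw \<delta> k \<otimes> tl_id n) (Poly_Mapping.single D 1)" for D
  define s :: "diagram \<Rightarrow> 'a fract morphism" where "s D = Poly_Mapping.single D 1" for D
  have fin: "finite ?M" by (rule finite_monic_diagrams)
  have rank: "tl.dim (vG ` ?M) = r" "tl.dim ((\<lambda>D. Poly_Mapping.single D 1 - vG D) ` ?M) + r \<le> card ?M"
    using generic_rank[of m \<delta> k n] unfolding card_uncapped_monic r_def vG_def by simp_all
  have spec: "spec \<delta> (Poly_Mapping.lookup (vG D) D') (Poly_Mapping.lookup (v D) D')" for D D'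
    unfolding vG_def v_def by (rule spec_cell_act[OF assms(1)])
  have 1: "tl.dim (v ` ?M) \<le> r"
    using dim_spec_le[OF fin, of \<delta> vG v] spec rank(1) by simp
  have "tl.dim ((\<lambda>D. s D - v D) ` ?M) \<le> tl.dim ((\<lambda>D. Poly_Mapping.single D 1 - vG D) ` ?M)"
  proof (rule dim_spec_le[OF fin])
    fix D D'
    have "spec \<delta> (Poly_Mapping.lookup (Poly_Mapping.single D 1) D') (Poly_Mapping.lookup (s D) D')"
      by (simp add: s_def lookup_single when_def spec_0 spec_1)
    then show "spec \<delta> (Poly_Mapping.lookup (Poly_Mapping.single D 1 - vG D) D') (Poly_Mapping.lookup (s D - v D) D')"
      unfolding lookup_minus using spec by (rule spec_diff)
  qed
  then have 2: "tl.dim ((\<lambda>D. s D - v D) ` ?M) + r \<le> card ?M" using rank(2) by simp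
  obtain B1 where B1: "B1 \<subseteq> v ` ?M" "v ` ?M \<subseteq> tl.span B1" "card B1 = tl.dim (v ` ?M)"
    by (rule tl.basis_exists)
  obtain B2 where B2: "B2 \<subseteq> (\<lambda>D. s D - v D) ` ?M" "(\<lambda>D. s D - v D) ` ?M \<subseteq> tl.span B2"
    "card B2 = tl.dim ((\<lambda>D. s D - v D) ` ?M)" by (rule tl.basis_exists)
  have finB: "finite B1" "finite B2"
    using finite_subset[OF B1(1)] finite_subset[OF B2(1)] fin by simp_all
  have "famindep tl_scale ?M s"
    unfolding famindep_def
  proof (intro allI impI ballI)
    fix c D assume "(\<Sum>i\<in>?M. tl_scale (c i) (s i)) = 0" and D: "D \<in> ?M"
    then have "0 = Poly_Mapping.lookup (\<Sum>i\<in>?M. tl_scale (c i) (s i)) D" by simp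
    also have "\<dots> = (\<Sum>i\<in>?M. if i = D then c D else 0)"
      unfolding lookup_sum by (intro sum.cong refl) (simp add: s_def tl_scale_lookup lookup_single when_def)
    also have "\<dots> = c D" using D fin by simp
    finally show "c D = 0" by simp
  qed
  then have ind: "inj_on s ?M" "tl.independent (s ` ?M)" using tl.famindep_iff[OF fin, of s] by auto
  \<comment> \<open>Each basis vector is \<open>v D + (s D - v D)\<close>, so the two specialised
    ranks add up to at least \<open>card ?M\<close>. Against the upper bounds \<open>1\<close> and
    \<open>2\<close> this leaves no slack.\<close>
  have "s ` ?M \<subseteq> tl.span (B1 \<union> B2)"
  proof (rule image_subsetI)
    fix D assume "D \<in> ?M"
    then have "v D \<in> tl.span (B1 \<union> B2)" "s D - v D \<in> tl.span (B1 \<union> B2)"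
      using B1(2) B2(2) tl.span_mono[of B1 "B1 \<union> B2"] tl.span_mono[of B2 "B1 \<union> B2"] by blast+
    then have "v D + (s D - v D) \<in> tl.span (B1 \<union> B2)" by (rule tl.span_add)
    then show "s D \<in> tl.span (B1 \<union> B2)" by simp
  qed
  then have "card (s ` ?M) \<le> card (B1 \<union> B2)"
    using tl.independent_span_bound[OF _ ind(2)] finB by simp
  also have "\<dots> \<le> card B1 + card B2" by (rule card_Un_le)
  finally have "card ?M \<le> tl.dim (v ` ?M) + tl.dim ((\<lambda>D. s D - v D) ` ?M)"
    using B1(3) B2(3) card_image[OF ind(1)] by simp
  then show ?thesis using 1 2 by (simp add: r_def)
qed

lemma independent_iff_famindep:
  fixes B :: "'a::idom morphism set"
  assumes "finite B"
  shows "\<not> module.dependent tl_scale B \<longleftrightarrow> famindep tl_scale B (\<lambda>x. x)"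
  unfolding module.dependent_finite[OF module_tl_scale assms] famindep_def by blast

lemma rank_cell_module:
  fixes \<delta> :: "'a::idom" and k n m :: nat
  assumes "ljw_defined \<delta> k"
  defines "r \<equiv> \<Sum>a | int a \<in> supp \<delta> k. paths a n m"
  defines "V \<equiv> cell_module \<delta> (k # replicate n 1) m"
  shows "tl_rank V = r" and "V \<noteq> {0} \<longleftrightarrow> 0 < r"
proof -
  let ?M = "monic_diagrams (k + n) m"
  define e where "e = ljw \<delta> k \<otimes> tl_id n"
  define w where "w D = cell_act \<delta> m e (Poly_Mapping.single D 1)" for D
  define v where "v D = embed (w D)" for D
  have fin: "finite ?M" by (rule finite_monic_diagrams)
  have dim: "tl.dim (v ` ?M) = r"
    using specialised_rank[OF assms(1), of m n] by (simp add: v_def w_def e_def r_def)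
  have len: "sum_list (k # replicate n 1) = k + n" by (simp add: sum_list_replicate)
  have V: "V = cell_act \<delta> m e ` cell_full (k + n) m"
    unfolding V_def cell_module_def ljw_tensor_eq len e_def ..
  have wV: "w D \<in> V" if "D \<in> ?M" for D
    unfolding V w_def using that by (intro imageI) (simp add: cell_full_def)
  have span: "embed x \<in> tl.span (v ` ?M)" if x: "x \<in> V" for x
  proof -
    obtain y where y: "y \<in> cell_full (k + n) m" "x = cell_act \<delta> m e y" using x V by blast
    have "x = cell_act \<delta> m e (\<Sum>D\<in>?M. tl_scale (Poly_Mapping.lookup y D) (Poly_Mapping.single D 1))"
      using cell_full_expand[OF y(1)] y(2) by simp
    also have "\<dots> = (\<Sum>D\<in>?M. tl_scale (Poly_Mapping.lookup y D) (w D))"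
      by (simp add: w_def cell_act_monic_part tl_comp_sum_right tl_comp_scale monic_part_sum monic_part_scale)
    finally have "embed x = (\<Sum>D\<in>?M. tl_scale (to_fract (Poly_Mapping.lookup y D)) (v D))"
      by (simp add: embed_sum embed_scale v_def)
    also have "\<dots> \<in> tl.span (v ` ?M)" by (intro tl.span_sum tl.span_scale tl.span_base imageI)
    finally show ?thesis .
  qed
  \<comment> \<open>\<open>tl_rank\<close> is a \<open>GREATEST\<close> of this predicate, so a
    witness for \<open>r\<close> and a bound on all witnesses are both required. Independence over
    \<open>K\<close> is carried to the fraction field in one direction and back in the
    other.\<close>
  define P where "P q \<longleftrightarrow> (\<exists>B. B \<subseteq> V \<and> finite B \<and> card B = q \<and> \<not> module.dependent tl_scale B)" for q
  have upper: "q \<le> r" if "P q" for q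
  proof -
    obtain B where B: "B \<subseteq> V" "finite B" "card B = q" "famindep tl_scale B (\<lambda>x. x)"
      using \<open>P q\<close> independent_iff_famindep unfolding P_def by blast
    have "famindep tl_scale B embed" using famindep_embed_iff[OF B(2), of "\<lambda>x. x"] B(4) by simp
    then have "inj_on embed B" "tl.independent (embed ` B)" using tl.famindep_iff[OF B(2), of embed] by auto
    then have "card B \<le> tl.dim (v ` ?M)"
      using tl.card_le_dim[of "v ` ?M" "embed ` B"] fin span B(1) card_image[of embed B] by auto
    then show ?thesis using B(3) dim by simp
  qed
  have Pr: "P r"
  proof -
    obtain S where S: "S \<subseteq> ?M" "card S = tl.dim (v ` ?M)" "inj_on v S" "famindep tl_scale S v"
      by (rule tl.basis_family[OF fin, of v])
    have finS: "finite S" by (rule finite_subset[OF S(1) fin])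
    have inj: "inj_on w S" using S(3) by (simp add: inj_on_def v_def)
    have fw: "famindep tl_scale S w" using S(4) famindep_embed_iff[OF finS, of w] by (simp add: v_def[abs_def])
    have "famindep tl_scale (w ` S) (\<lambda>x. x)"
      unfolding famindep_def
    proof (intro allI impI)
      fix c assume "(\<Sum>x\<in>w ` S. tl_scale (c x) x) = 0"
      then have "(\<Sum>i\<in>S. tl_scale (c (w i)) (w i)) = 0" by (simp add: sum.reindex[OF inj])
      then show "\<forall>x\<in>w ` S. c x = 0"
        using fw[unfolded famindep_def, rule_format, of "\<lambda>i. c (w i)"] by blast
    qed
    then have "\<not> module.dependent tl_scale (w ` S)" using independent_iff_famindep[of "w ` S"] finS by simp
    then show ?thesis
      unfolding P_def using S(1,2) finS wV dim card_image[OF inj] by (intro exI[of _ "w ` S"]) auto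
  qed
  show "tl_rank V = r"
    unfolding tl_rank_def P_def[symmetric] using Pr upper by (rule Greatest_equality)
  have V0: "0 \<in> V"
  proof -
    have "cell_act \<delta> m e 0 = 0" by (simp add: cell_act_monic_part)
    moreover have "0 \<in> cell_full (k + n) m" by (simp add: cell_full_def)
    ultimately show ?thesis unfolding V by (metis imageI)
  qed
  show "V \<noteq> {0} \<longleftrightarrow> 0 < r"
  proof
    assume "V \<noteq> {0}"
    then obtain x where x: "x \<in> V" "x \<noteq> 0" using V0 by blast
    \<comment> \<open>Over a domain a nonzero element has no torsion, so a nonzero submodule has
      positive rank.\<close>
    have "famindep tl_scale {x} (\<lambda>x. x)" using x(2) by (simp add: famindep_def)
    then have "P 1" unfolding P_def using x(1) independent_iff_famindep[of "{x}"]
      by (intro exI[of _ "{x}"]) simp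
    then show "0 < r" using upper by fastforce
  next
    assume r: "0 < r"
    obtain B where B: "B \<subseteq> V" "finite B" "card B = r" "famindep tl_scale B (\<lambda>x. x)"
      using Pr independent_iff_famindep unfolding P_def by blast
    have "0 \<notin> B"
    proof
      assume "0 \<in> B"
      moreover have "(\<Sum>x\<in>B. tl_scale (if x = 0 then 1 else 0) x) = 0" by (rule sum.neutral) simp
      ultimately have "(if (0::'a morphism) = 0 then 1 else 0) = (0::'a)"
        using B(4)[unfolded famindep_def, rule_format, of "\<lambda>x. if x = 0 then 1 else 0" 0] by blast
      then show False by simp
    qed
    moreover have "B \<noteq> {}" using B(3) r by auto
    ultimately show "V \<noteq> {0}" using B(1) by blast
  qed
qed

theorem proposition7p3:
  fixes \<delta> :: "'a::idom" and k0 n :: nat and \<mu> :: "nat list"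
  assumes "ljw_defined \<delta> k0"
    and "\<mu> = k0 # replicate n 1"
  shows "int ` cell_index \<delta> \<mu> =
           (\<Union>a\<in>supp \<delta> k0. {a - int n + 2 * int t | t. t \<le> n}) \<inter> \<nat>
       \<and> (\<forall>m \<in> cell_index \<delta> \<mu>.
           int (tl_rank (cell_module \<delta> \<mu> m)) =
             (\<Sum>a\<in>supp \<delta> k0.
                int (binom n (of_int (int n + a - int m) / 2))
                - int (binom n (of_int (int n - a - int m - 2) / 2))))"
proof (intro conjI ballI)
  let ?A = "{a. int a \<in> supp \<delta> k0}"
  note rank = rank_cell_module[OF assms(1), of n, folded assms(2)]
  \<comment> \<open>The support has no negative members, so sums over \<open>supp\<close> can be
    reindexed by natural numbers.\<close>
  have supp: "supp \<delta> k0 = int ` ?A"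
  proof (intro set_eqI iffI)
    fix a assume a: "a \<in> supp \<delta> k0"
    then have "a = int (nat a)" using supp_bounds(1)[OF a] by simp
    then show "a \<in> int ` ?A" using a by (metis (mono_tags) imageI mem_Collect_eq)
  qed auto
  have index: "m \<in> cell_index \<delta> \<mu> \<longleftrightarrow> (\<exists>a\<in>?A. \<exists>t\<le>n. int m = int a - int n + 2 * int t)" for m
  proof -
    have "m \<in> cell_index \<delta> \<mu> \<longleftrightarrow> (\<Sum>a\<in>?A. paths a n m) \<noteq> 0"
      unfolding cell_index_def mem_Collect_eq rank(2) by simp
    also have "\<dots> \<longleftrightarrow> (\<exists>a\<in>?A. 0 < paths a n m)" using finite_supp_nat[of \<delta> k0] by auto
    finally show ?thesis unfolding paths_pos_iff .
  qed
  show "int ` cell_index \<delta> \<mu> = (\<Union>a\<in>supp \<delta> k0. {a - int n + 2 * int t | t. t \<le> n}) \<inter> \<nat>"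
  proof (intro set_eqI iffI)
    fix x assume "x \<in> int ` cell_index \<delta> \<mu>"
    then obtain m a t where m: "x = int m" and "int a \<in> supp \<delta> k0" "t \<le> n" "x = int a - int n + 2 * int t"
      using index by blast
    then have "x \<in> (\<Union>a\<in>supp \<delta> k0. {a - int n + 2 * int t | t. t \<le> n})" by blast
    then show "x \<in> (\<Union>a\<in>supp \<delta> k0. {a - int n + 2 * int t | t. t \<le> n}) \<inter> \<nat>" using m by simp
  next
    fix x assume x: "x \<in> (\<Union>a\<in>supp \<delta> k0. {a - int n + 2 * int t | t. t \<le> n}) \<inter> \<nat>"
    then obtain m where m: "x = int m" by (auto elim: Nats_cases)
    from x obtain a t where a: "a \<in> supp \<delta> k0" and t: "x = a - int n + 2 * int t" "t \<le> n" by blast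
    then obtain b where "a = int b" "b \<in> ?A" using supp by blast
    then have "m \<in> cell_index \<delta> \<mu>" unfolding index using m t
      by (intro bexI[of _ b] exI[of _ t]) simp_all
    then show "x \<in> int ` cell_index \<delta> \<mu>" using m by blast
  qed
  fix m
  have "int (tl_rank (cell_module \<delta> \<mu> m)) = (\<Sum>a\<in>?A. int (paths a n m))"
    unfolding rank(1) by simp
  also have "\<dots> = (\<Sum>a\<in>supp \<delta> k0. half_choose n (int n + a - int m) - half_choose n (int n - a - int m - 2))"
    unfolding paths_formula by (subst supp, subst sum.reindex) simp_all
  finally show "int (tl_rank (cell_module \<delta> \<mu> m)) = (\<Sum>a\<in>supp \<delta> k0.
      int (binom n (of_int (int n + a - int m) / 2)) - int (binom n (of_int (int n - a - int m - 2) / 2)))"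
    unfolding half_choose_def .
qed

end
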